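(* Let $(\Phi,U)$ be an indecomposable $W_F$-semisimple Deligne $\overline{\mathbb{F}_\ell}$-representation. (1) There exist an irreducible $\overline{\mathbb{F}_\ell}$-representation $\Psi$ of $W_F$ and a positive integer $r$ such that either (a) $(\Phi,U)\simeq [0,r-1]\otimes \Psi$, or (b) there exists an isomorphism $I$ from $\nu^{o(\Psi)}\Psi$ to $\Psi$ such that $(\Phi,U)\simeq [0,r-1]\otimes C(\Psi,I)$. (2) With the notation of (1), $(\Phi,U)$ is irreducible (as a Deligne representation) if and only if $r=1$. (3) In case (a), the isomorphism class of $(\Phi,U)$ coincides with its equivalence class, and it determines the isomorphism class of $\Psi$ and the integer $r$ uniquely. (4) In case (b), the equivalence class $[\Phi,U]$ of $[0,r-1]\otimes C(\Psi,I)$ depends only on $r$ and $\mathbb{Z}_\Psi$, and the datum $(r,\mathbb{Z}_\Psi)$ is uniquely determined by $[\Phi,U]$.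
   Context: $F$ is a non-archimedean local field with residue field of characteristic $p$ and cardinality $q$; $\ell\ne p$ is a prime. $W_F$ is the Weil group of $F$, $I_F$ its inertia subgroup. All representations are smooth. $\nu:W_F\to\overline{\mathbb{F}_\ell}^\times$ is the character trivial on $I_F$ sending a geometric Frobenius element to $q^{-1}$. A Deligne $\overline{\mathbb{F}_\ell}$-representation is a pair $(\Phi,U)$ with $\Phi$ a finite-dimensional representation of $W_F$ and $U\in\mathrm{Hom}_{W_F}(\nu\Phi,\Phi)$. It is $W_F$-semisimple if $\Phi$ is a semisimple representation of $W_F$. A morphism $(\Phi,U)\to(\Phi',U')$ is $f\in\mathrm{Hom}_{W_F}(\Phi,\Phi')$ with $fU=U'f$. Direct sums are $(\Phi\oplus\Phi',U\oplus U')$; indecomposable means nonzero and not a direct sum of two nonzero Deligne representations; irreducible means nonzero with no proper nonzero $W_F$- and $U$-stable subspace. The tensor product is $(\Phi,U)\otimes(\Phi',U')=(\Phi\otimes\Phi',U\otimes\mathrm{Id}+\mathrm{Id}\otimes U')$. A representation $\Psi$ of $W_F$ is identified with $(\Psi,0)$. Two indecomposable $W_F$-semisimple Deligne representations $(\Phi,U),(\Phi',U')$ are equivalent if $(\Phi',U')\simeq(\Phi,\lambda U)$ for some $\lambda\in\overline{\mathbb{F}_\ell}^\times$; $[\Phi,U]$ denotes the equivalence class. For $\Psi$ an irreducible $\overline{\mathbb{F}_\ell}$-representation of $W_F$: $\mathbb{Z}_\Psi=\{\nu^k\Psi: k\in\mathbb{Z}\}$ (set of isomorphism classes), which is finite,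 and $o(\Psi)=|\mathbb{Z}_\Psi|$, the least positive integer with $\nu^{o(\Psi)}\Psi\simeq\Psi$. For an isomorphism $I:\nu^{o(\Psi)}\Psi\to\Psi$, $C(\Psi,I)=(\Phi(\Psi),C_I)$ where $\Phi(\Psi)=\bigoplus_{k=0}^{o(\Psi)-1}\nu^k\Psi$ and $C_I(x_0,\dots,x_{o(\Psi)-1})=(I(x_{o(\Psi)-1}),x_0,\dots,x_{o(\Psi)-2})$. For $r\ge1$, $[0,r-1]=(\Phi(r),N(r))$ with $\Phi(r)=\bigoplus_{k=0}^{r-1}\nu^k$ and $N(r)(x_0,\dots,x_{r-1})=(0,x_0,\dots,x_{r-2})$. *)

theory Defs
  imports
    "HOL-Algebra.Algebraic_Closure_Type"
    "HOL-Algebra.Bij"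
    "HOL-Algebra.Coset"
    "HOL-Analysis.Abstract_Topology"
    "HOL-Library.Function_Algebras"
    "HOL-Library.Product_Plus"
    "Berlekamp_Zassenhaus.Finite_Field"
begin

section \<open>Non-archimedean local fields\<close>

text \<open>
  A non-archimedean local field is a field that is complete for a normalised discrete valuation
  and has finite residue field. The value \<open>v 0\<close> is irrelevant: it stands for infinity.
\<close>

definition val_ge :: "('f::field \<Rightarrow> int) \<Rightarrow> int \<Rightarrow> 'f \<Rightarrow> bool" where
  "val_ge v n x \<longleftrightarrow> x = 0 \<or> n \<le> v x"

definition int_ring :: "('f::field \<Rightarrow> int) \<Rightarrow> 'f set" where
  "int_ring v = {x. val_ge v 0 x}"

definition max_ideal :: "('f::field \<Rightarrow> int) \<Rightarrow> 'f set" where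
  "max_ideal v = {x. val_ge v 1 x}"

definition residue_field :: "('f::field \<Rightarrow> int) \<Rightarrow> 'f set set" where
  "residue_field v = int_ring v // {(x, y). x \<in> int_ring v \<and> y \<in> int_ring v \<and> x - y \<in> max_ideal v}"

definition residue_card :: "('f::field \<Rightarrow> int) \<Rightarrow> nat" where
  "residue_card v = card (residue_field v)"

definition residue_char :: "('f::field \<Rightarrow> int) \<Rightarrow> nat" where
  "residue_char v = (LEAST n. 0 < n \<and> of_nat n \<in> max_ideal v)"

locale nonarch_local_field =
  fixes v :: "'f::field \<Rightarrow> int"
  assumes val_mult: "\<lbrakk>x \<noteq> 0; y \<noteq> 0\<rbrakk> \<Longrightarrow> v (x * y) = v x + v y"
    and val_add: "\<lbrakk>val_ge v n x; val_ge v n y\<rbrakk> \<Longrightarrow> val_ge v n (x + y)"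
    and uniformizer: "\<exists>x. x \<noteq> 0 \<and> v x = 1"
    and finite_residue_field: "finite (residue_field v)"
    and complete:
      "(\<And>n. \<exists>M::nat. \<forall>i\<ge>M. \<forall>j\<ge>M. val_ge v n (s i - s j)) \<Longrightarrow>
         \<exists>L. \<forall>n. \<exists>M::nat. \<forall>i\<ge>M. val_ge v n (s i - L)"


section \<open>The Weil group\<close>

definition sep_closure :: "'f::field alg_closure set" where
  "sep_closure = {x. \<exists>P :: 'f poly. coprime P (pderiv P) \<and> poly (map_poly to_ac P) x = 0}"

text \<open>The integral closure of the ring of integers, and its unique maximal ideal (the non-units).\<close>

definition sep_int_ring :: "('f::field \<Rightarrow> int) \<Rightarrow> 'f alg_closure set" where
  "sep_int_ring v = {x \<in> sep_closure. \<exists>P :: 'f poly. lead_coeff P = 1 \<and>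
     (\<forall>i. coeff P i \<in> int_ring v) \<and> poly (map_poly to_ac P) x = 0}"

definition sep_max_ideal :: "('f::field \<Rightarrow> int) \<Rightarrow> 'f alg_closure set" where
  "sep_max_ideal v = {x \<in> sep_int_ring v. x = 0 \<or> inverse x \<notin> sep_int_ring v}"

type_synonym 'f gal = "'f alg_closure \<Rightarrow> 'f alg_closure"

definition absolute_galois :: "'f::field gal set" where
  "absolute_galois = {\<sigma> \<in> Bij sep_closure.
     (\<forall>x\<in>sep_closure. \<forall>y\<in>sep_closure. \<sigma> (x + y) = \<sigma> x + \<sigma> y \<and> \<sigma> (x * y) = \<sigma> x * \<sigma> y) \<and>
     (\<forall>a. \<sigma> (to_ac a) = to_ac a)}"

definition inertia :: "('f::field \<Rightarrow> int) \<Rightarrow> 'f gal set" where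
  "inertia v = {\<sigma> \<in> absolute_galois. \<forall>x\<in>sep_int_ring v. \<sigma> x - x \<in> sep_max_ideal v}"

text \<open>
  \<open>frob_power v \<sigma> n\<close> says that \<open>\<sigma>\<close> acts on the residue field of the separable closure as the
  \<open>n\<close>-th power (\<open>n\<close> an integer) of the arithmetic Frobenius \<open>x \<mapsto> x ^ q\<close>; at most one of the two
  exponents below differs from \<open>q ^ 0 = 1\<close>. A geometric Frobenius element is one with \<open>n = -1\<close>.
\<close>

definition frob_power :: "('f::field \<Rightarrow> int) \<Rightarrow> 'f gal \<Rightarrow> int \<Rightarrow> bool" where
  "frob_power v \<sigma> n \<longleftrightarrow> (\<forall>x\<in>sep_int_ring v.
     \<sigma> x ^ (residue_card v ^ nat (- n)) - x ^ (residue_card v ^ nat n) \<in> sep_max_ideal v)"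

definition weil_group :: "('f::field \<Rightarrow> int) \<Rightarrow> 'f gal monoid" where
  "weil_group v = (BijGroup sep_closure)
     \<lparr>carrier := {\<sigma> \<in> absolute_galois. \<exists>n. frob_power v \<sigma> n}\<rparr>"

text \<open>
  The topology in which inertia is open and carries the Krull topology: a basis consists of the
  left cosets of the pointwise stabilisers in inertia of finite subsets of the separable closure.
\<close>

definition weil_topology :: "('f::field \<Rightarrow> int) \<Rightarrow> 'f gal topology" where
  "weil_topology v = topology_generated_by
     {\<sigma> <#\<^bsub>weil_group v\<^esub> {\<tau> \<in> inertia v. \<forall>a\<in>A. \<tau> a = a} | \<sigma> A.
        \<sigma> \<in> carrier (weil_group v) \<and> finite A \<and> A \<subseteq> sep_closure}"

text \<open>The character that is trivial on inertia and maps a geometric Frobenius element to \<open>q\<inverse>\<close>.\<close>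

definition nu :: "('f::field \<Rightarrow> int) \<Rightarrow> 'f gal \<Rightarrow> 'k::field" where
  "nu v \<sigma> = of_nat (residue_card v) powi (THE n. frob_power v \<sigma> n)"


section \<open>Representations\<close>

text \<open>
  The space of a representation is a subspace \<open>vecs\<close> of an ambient type, on all of which
  \<open>smul\<close> is a scalar multiplication; the values of \<open>act\<close> outside \<open>vecs\<close> are irrelevant.
\<close>

record ('g, 'k, 'v) rep =
  vecs :: "'v set"
  smul :: "'k \<Rightarrow> 'v \<Rightarrow> 'v"
  act :: "'g \<Rightarrow> 'v \<Rightarrow> 'v"

type_synonym ('f, 'k, 'v) weil_rep = "('f gal, 'k, 'v) rep"

definition lin_maps ::
  "('g, 'k, 'v::ab_group_add) rep \<Rightarrow> ('g, 'k, 'w::ab_group_add) rep \<Rightarrow> ('v \<Rightarrow> 'w) set" where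
  "lin_maps \<Phi> \<Phi>' = {f \<in> vecs \<Phi> \<rightarrow> vecs \<Phi>'.
     (\<forall>x\<in>vecs \<Phi>. \<forall>y\<in>vecs \<Phi>. f (x + y) = f x + f y) \<and>
     (\<forall>c. \<forall>x\<in>vecs \<Phi>. f (smul \<Phi> c x) = smul \<Phi>' c (f x))}"

text \<open>Smooth finite-dimensional representations of the Weil group.\<close>

definition weil_rep :: "('f::field \<Rightarrow> int) \<Rightarrow> ('f, 'k::field, 'v::ab_group_add) weil_rep \<Rightarrow> bool" where
  "weil_rep v \<Phi> \<longleftrightarrow>
     vector_space (smul \<Phi>) \<and>
     module.subspace (smul \<Phi>) (vecs \<Phi>) \<and>
     (\<exists>B. finite B \<and> vecs \<Phi> = module.span (smul \<Phi>) B) \<and>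
     (\<forall>\<sigma>\<in>carrier (weil_group v). act \<Phi> \<sigma> \<in> lin_maps \<Phi> \<Phi>) \<and>
     (\<forall>x\<in>vecs \<Phi>. act \<Phi> \<one>\<^bsub>weil_group v\<^esub> x = x) \<and>
     (\<forall>\<sigma>\<in>carrier (weil_group v). \<forall>\<tau>\<in>carrier (weil_group v). \<forall>x\<in>vecs \<Phi>.
        act \<Phi> (\<sigma> \<otimes>\<^bsub>weil_group v\<^esub> \<tau>) x = act \<Phi> \<sigma> (act \<Phi> \<tau> x)) \<and>
     (\<forall>x\<in>vecs \<Phi>. openin (weil_topology v) {\<sigma> \<in> carrier (weil_group v). act \<Phi> \<sigma> x = x})"

definition rep_hom :: "('f::field \<Rightarrow> int) \<Rightarrow>
    ('f, 'k, 'v::ab_group_add) weil_rep \<Rightarrow> ('f, 'k, 'w::ab_group_add) weil_rep \<Rightarrow> ('v \<Rightarrow> 'w) set" where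
  "rep_hom v \<Phi> \<Phi>' = {f \<in> lin_maps \<Phi> \<Phi>'.
     \<forall>\<sigma>\<in>carrier (weil_group v). \<forall>x\<in>vecs \<Phi>. f (act \<Phi> \<sigma> x) = act \<Phi>' \<sigma> (f x)}"

definition rep_isos :: "('f::field \<Rightarrow> int) \<Rightarrow>
    ('f, 'k, 'v::ab_group_add) weil_rep \<Rightarrow> ('f, 'k, 'w::ab_group_add) weil_rep \<Rightarrow> ('v \<Rightarrow> 'w) set" where
  "rep_isos v \<Phi> \<Phi>' = {f \<in> rep_hom v \<Phi> \<Phi>'. bij_betw f (vecs \<Phi>) (vecs \<Phi>')}"

definition rep_iso :: "('f::field \<Rightarrow> int) \<Rightarrow>
    ('f, 'k, 'v::ab_group_add) weil_rep \<Rightarrow> ('f, 'k, 'w::ab_group_add) weil_rep \<Rightarrow> bool" where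
  "rep_iso v \<Phi> \<Phi>' \<longleftrightarrow> rep_isos v \<Phi> \<Phi>' \<noteq> {}"

definition stable_subspace ::
  "('f::field \<Rightarrow> int) \<Rightarrow> ('f, 'k::field, 'v::ab_group_add) weil_rep \<Rightarrow> 'v set \<Rightarrow> bool" where
  "stable_subspace v \<Phi> S \<longleftrightarrow> module.subspace (smul \<Phi>) S \<and> S \<subseteq> vecs \<Phi> \<and>
     (\<forall>\<sigma>\<in>carrier (weil_group v). act \<Phi> \<sigma> ` S \<subseteq> S)"

definition irreducible_rep ::
  "('f::field \<Rightarrow> int) \<Rightarrow> ('f, 'k::field, 'v::ab_group_add) weil_rep \<Rightarrow> bool" where
  "irreducible_rep v \<Phi> \<longleftrightarrow> weil_rep v \<Phi> \<and> vecs \<Phi> \<noteq> {0} \<and>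
     (\<forall>S. stable_subspace v \<Phi> S \<longrightarrow> S = {0} \<or> S = vecs \<Phi>)"

text \<open>Semisimple: the internal direct sum of a set of irreducible subrepresentations.\<close>

definition semisimple_rep ::
  "('f::field \<Rightarrow> int) \<Rightarrow> ('f, 'k::field, 'v::ab_group_add) weil_rep \<Rightarrow> bool" where
  "semisimple_rep v \<Phi> \<longleftrightarrow> weil_rep v \<Phi> \<and>
     (\<exists>\<S>. (\<forall>S\<in>\<S>. stable_subspace v \<Phi> S \<and> irreducible_rep v (\<Phi>\<lparr>vecs := S\<rparr>)) \<and>
       module.span (smul \<Phi>) (\<Union>\<S>) = vecs \<Phi> \<and>
       (\<forall>S\<in>\<S>. S \<inter> module.span (smul \<Phi>) (\<Union>(\<S> - {S})) = {0}))"

definition rep_sum ::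
  "('g, 'k, 'v) rep \<Rightarrow> ('g, 'k, 'w) rep \<Rightarrow> ('g, 'k, 'v \<times> 'w) rep" where
  "rep_sum \<Phi> \<Phi>' =
     \<lparr>vecs = vecs \<Phi> \<times> vecs \<Phi>',
      smul = (\<lambda>c. map_prod (smul \<Phi> c) (smul \<Phi>' c)),
      act = (\<lambda>\<sigma>. map_prod (act \<Phi> \<sigma>) (act \<Phi>' \<sigma>))\<rparr>"

text \<open>The direct sum of \<open>R 0, \<dots>, R (n - 1)\<close>, on tuples padded with zeros.\<close>

definition rep_Sum ::
  "nat \<Rightarrow> (nat \<Rightarrow> ('g, 'k, 'v::zero) rep) \<Rightarrow> ('g, 'k, nat \<Rightarrow> 'v) rep" where
  "rep_Sum n R =
     \<lparr>vecs = {x. (\<forall>i<n. x i \<in> vecs (R i)) \<and> (\<forall>i\<ge>n. x i = 0)},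
      smul = (\<lambda>c x i. smul (R i) c (x i)),
      act = (\<lambda>\<sigma> x i. act (R i) \<sigma> (x i))\<rparr>"

text \<open>The twist \<open>\<nu>\<^sup>k \<Phi>\<close> and the one-dimensional representation \<open>\<nu>\<^sup>k\<close>, for an integer \<open>k\<close>.\<close>

definition twist :: "('f::field \<Rightarrow> int) \<Rightarrow> int \<Rightarrow>
    ('f, 'k::field, 'v) weil_rep \<Rightarrow> ('f, 'k, 'v) weil_rep" where
  "twist v k \<Phi> = \<Phi>\<lparr>act := \<lambda>\<sigma> x. smul \<Phi> (nu v \<sigma> powi k) (act \<Phi> \<sigma> x)\<rparr>"

definition nu_rep :: "('f::field \<Rightarrow> int) \<Rightarrow> int \<Rightarrow> ('f, 'k::field, 'k) weil_rep" where
  "nu_rep v k = \<lparr>vecs = UNIV, smul = (*), act = \<lambda>\<sigma> x. nu v \<sigma> powi k * x\<rparr>"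


subsection \<open>Tensor products\<close>

text \<open>
  Since bilinear forms separate the elements of a tensor product of vector spaces, \<open>V \<otimes> W\<close> embeds
  canonically into the dual of the space of bilinear forms on \<open>V \<times> W\<close>, the tensor \<open>x \<otimes> y\<close> being
  evaluation at \<open>(x, y)\<close>. We take the span of these evaluations as the tensor product.
\<close>

definition bilinear_forms ::
  "('g, 'k::field, 'v::ab_group_add) rep \<Rightarrow> ('g, 'k, 'w::ab_group_add) rep \<Rightarrow> ('v \<Rightarrow> 'w \<Rightarrow> 'k) set" where
  "bilinear_forms \<Phi> \<Phi>' = {B.
     (\<forall>x\<in>vecs \<Phi>. \<forall>y\<in>vecs \<Phi>'. \<forall>y'\<in>vecs \<Phi>'. B x (y + y') = B x y + B x y') \<and>
     (\<forall>c. \<forall>x\<in>vecs \<Phi>. \<forall>y\<in>vecs \<Phi>'. B x (smul \<Phi>' c y) = c * B x y) \<and>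
     (\<forall>x\<in>vecs \<Phi>. \<forall>x'\<in>vecs \<Phi>. \<forall>y\<in>vecs \<Phi>'. B (x + x') y = B x y + B x' y) \<and>
     (\<forall>c. \<forall>x\<in>vecs \<Phi>. \<forall>y\<in>vecs \<Phi>'. B (smul \<Phi> c x) y = c * B x y)}"

type_synonym ('k, 'v, 'w) tensor = "('v \<Rightarrow> 'w \<Rightarrow> 'k) \<Rightarrow> 'k"

definition pure_tensor ::
  "('g, 'k::field, 'v::ab_group_add) rep \<Rightarrow> ('g, 'k, 'w::ab_group_add) rep \<Rightarrow>
     'v \<Rightarrow> 'w \<Rightarrow> ('k, 'v, 'w) tensor" where
  "pure_tensor \<Phi> \<Phi>' x y = (\<lambda>B. if B \<in> bilinear_forms \<Phi> \<Phi>' then B x y else 0)"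

text \<open>The map \<open>f \<otimes> g\<close> induced by endomorphisms \<open>f\<close> and \<open>g\<close> of the two spaces.\<close>

definition tensor_map ::
  "('g, 'k::field, 'v::ab_group_add) rep \<Rightarrow> ('g, 'k, 'w::ab_group_add) rep \<Rightarrow>
     ('v \<Rightarrow> 'v) \<Rightarrow> ('w \<Rightarrow> 'w) \<Rightarrow> ('k, 'v, 'w) tensor \<Rightarrow> ('k, 'v, 'w) tensor" where
  "tensor_map \<Phi> \<Phi>' f g t =
     (\<lambda>B. if B \<in> bilinear_forms \<Phi> \<Phi>' then t (\<lambda>x y. B (f x) (g y)) else 0)"

lemma tensor_map_pure_tensor:
  assumes "f \<in> lin_maps \<Phi> \<Phi>" "g \<in> lin_maps \<Phi>' \<Phi>'"
  shows "tensor_map \<Phi> \<Phi>' f g (pure_tensor \<Phi> \<Phi>' x y) = pure_tensor \<Phi> \<Phi>' (f x) (g y)"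
proof -
  have "(\<lambda>x y. B (f x) (g y)) \<in> bilinear_forms \<Phi> \<Phi>'" if "B \<in> bilinear_forms \<Phi> \<Phi>'" for B
    using that assms by (simp add: bilinear_forms_def lin_maps_def Pi_iff)
  then show ?thesis
    by (auto simp: tensor_map_def pure_tensor_def)
qed

definition tensor_rep ::
  "('g, 'k::field, 'v::ab_group_add) rep \<Rightarrow> ('g, 'k, 'w::ab_group_add) rep \<Rightarrow>
     ('g, 'k, ('k, 'v, 'w) tensor) rep" where
  "tensor_rep \<Phi> \<Phi>' =
     \<lparr>vecs = module.span (\<lambda>c t B. c * t B)
        {pure_tensor \<Phi> \<Phi>' x y | x y. x \<in> vecs \<Phi> \<and> y \<in> vecs \<Phi>'},
      smul = (\<lambda>c t B. c * t B),
      act = (\<lambda>\<sigma>. tensor_map \<Phi> \<Phi>' (act \<Phi> \<sigma>) (act \<Phi>' \<sigma>))\<rparr>"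


section \<open>Deligne representations\<close>

type_synonym ('f, 'k, 'v) deligne = "('f, 'k, 'v) weil_rep \<times> ('v \<Rightarrow> 'v)"

fun deligne_rep ::
  "('f::field \<Rightarrow> int) \<Rightarrow> ('f, 'k::field, 'v::ab_group_add) deligne \<Rightarrow> bool" where
  "deligne_rep v (\<Phi>, U) \<longleftrightarrow> weil_rep v \<Phi> \<and> U \<in> rep_hom v (twist v 1 \<Phi>) \<Phi>"

fun nonzero :: "('f, 'k, 'v::zero) deligne \<Rightarrow> bool" where
  "nonzero (\<Phi>, U) \<longleftrightarrow> vecs \<Phi> \<noteq> {0}"

fun weil_semisimple ::
  "('f::field \<Rightarrow> int) \<Rightarrow> ('f, 'k::field, 'v::ab_group_add) deligne \<Rightarrow> bool" where
  "weil_semisimple v (\<Phi>, U) \<longleftrightarrow> semisimple_rep v \<Phi>"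

fun deligne_iso :: "('f::field \<Rightarrow> int) \<Rightarrow>
    ('f, 'k, 'v::ab_group_add) deligne \<Rightarrow> ('f, 'k, 'w::ab_group_add) deligne \<Rightarrow> bool" where
  "deligne_iso v (\<Phi>, U) (\<Phi>', U') \<longleftrightarrow> (\<exists>f\<in>rep_isos v \<Phi> \<Phi>'. \<forall>x\<in>vecs \<Phi>. f (U x) = U' (f x))"

fun deligne_sum ::
  "('f, 'k, 'v) deligne \<Rightarrow> ('f, 'k, 'w) deligne \<Rightarrow> ('f, 'k, 'v \<times> 'w) deligne" where
  "deligne_sum (\<Phi>, U) (\<Phi>', U') = (rep_sum \<Phi> \<Phi>', map_prod U U')"

text \<open>
  The summands may be required to live in the same ambient type, because a summand of \<open>D\<close> is
  isomorphic to one carried by a subspace of the space of \<open>D\<close>.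
\<close>

definition indecomposable ::
  "('f::field \<Rightarrow> int) \<Rightarrow> ('f, 'k::field, 'v::ab_group_add) deligne \<Rightarrow> bool" where
  "indecomposable v D \<longleftrightarrow> deligne_rep v D \<and> nonzero D \<and>
     \<not> (\<exists>(D\<^sub>1 :: ('f, 'k, 'v) deligne) (D\<^sub>2 :: ('f, 'k, 'v) deligne). deligne_rep v D\<^sub>1 \<and> nonzero D\<^sub>1 \<and>
          deligne_rep v D\<^sub>2 \<and> nonzero D\<^sub>2 \<and> deligne_iso v D (deligne_sum D\<^sub>1 D\<^sub>2))"

fun deligne_irreducible ::
  "('f::field \<Rightarrow> int) \<Rightarrow> ('f, 'k::field, 'v::ab_group_add) deligne \<Rightarrow> bool" where
  "deligne_irreducible v (\<Phi>, U) \<longleftrightarrow> deligne_rep v (\<Phi>, U) \<and> nonzero (\<Phi>, U) \<and>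
     (\<forall>S. stable_subspace v \<Phi> S \<and> U ` S \<subseteq> S \<longrightarrow> S = {0} \<or> S = vecs \<Phi>)"

fun deligne_tensor :: "('f, 'k::field, 'v::ab_group_add) deligne \<Rightarrow>
    ('f, 'k, 'w::ab_group_add) deligne \<Rightarrow> ('f, 'k, ('k, 'v, 'w) tensor) deligne" where
  "deligne_tensor (\<Phi>, U) (\<Phi>', U') =
     (tensor_rep \<Phi> \<Phi>', \<lambda>t. tensor_map \<Phi> \<Phi>' U id t + tensor_map \<Phi> \<Phi>' id U' t)"

definition of_rep :: "('f, 'k, 'v::zero) weil_rep \<Rightarrow> ('f, 'k, 'v) deligne" where
  "of_rep \<Psi> = (\<Psi>, \<lambda>x. 0)"

fun deligne_equiv :: "('f::field \<Rightarrow> int) \<Rightarrow>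
    ('f, 'k::field, 'v::ab_group_add) deligne \<Rightarrow> ('f, 'k, 'w::ab_group_add) deligne \<Rightarrow> bool" where
  "deligne_equiv v (\<Phi>, U) (\<Phi>', U') \<longleftrightarrow>
     indecomposable v (\<Phi>, U) \<and> weil_semisimple v (\<Phi>, U) \<and>
     indecomposable v (\<Phi>', U') \<and> weil_semisimple v (\<Phi>', U') \<and>
     (\<exists>c. c \<noteq> 0 \<and> deligne_iso v (\<Phi>', U') (\<Phi>, \<lambda>x. smul \<Phi> c (U x)))"

text \<open>
  The isomorphism class and the equivalence class of \<open>D\<close>, as sets of Deligne representations
  carried by a second ambient type, which need not be that of \<open>D\<close>.
\<close>

definition iso_class :: "('f::field \<Rightarrow> int) \<Rightarrow>
    ('f, 'k::field, 'v::ab_group_add) deligne \<Rightarrow> ('f, 'k, 'w::ab_group_add) deligne set" where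
  "iso_class v D = {D'. deligne_rep v D' \<and> deligne_iso v D D'}"

definition equiv_class :: "('f::field \<Rightarrow> int) \<Rightarrow>
    ('f, 'k::field, 'v::ab_group_add) deligne \<Rightarrow> ('f, 'k, 'w::ab_group_add) deligne set" where
  "equiv_class v D = {D'. deligne_equiv v D D'}"


subsection \<open>The standard examples\<close>

definition rep_class ::
  "('f::field \<Rightarrow> int) \<Rightarrow> ('f, 'k::field, 'v::ab_group_add) weil_rep \<Rightarrow> ('f, 'k, 'v) weil_rep set" where
  "rep_class v \<Psi> = {\<Psi>'. weil_rep v \<Psi>' \<and> rep_iso v \<Psi> \<Psi>'}"

definition nu_orbit ::
  "('f::field \<Rightarrow> int) \<Rightarrow> ('f, 'k::field, 'v::ab_group_add) weil_rep \<Rightarrow> ('f, 'k, 'v) weil_rep set set" where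
  "nu_orbit v \<Psi> = range (\<lambda>k :: int. rep_class v (twist v k \<Psi>))"

definition orbit_card :: "('f::field \<Rightarrow> int) \<Rightarrow> ('f, 'k::field, 'v::ab_group_add) weil_rep \<Rightarrow> nat" where
  "orbit_card v \<Psi> = card (nu_orbit v \<Psi>)"

definition cycle :: "('f::field \<Rightarrow> int) \<Rightarrow> ('f, 'k::field, 'v::ab_group_add) weil_rep \<Rightarrow>
    ('v \<Rightarrow> 'v) \<Rightarrow> ('f, 'k, nat \<Rightarrow> 'v) deligne" where
  "cycle v \<Psi> I =
     (rep_Sum (orbit_card v \<Psi>) (\<lambda>k. twist v (int k) \<Psi>),
      \<lambda>x i. if i = 0 then I (x (orbit_card v \<Psi> - 1))
            else if i < orbit_card v \<Psi> then x (i - 1) else 0)"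

text \<open>\<open>segment v r\<close> is \<open>[0, r - 1]\<close>.\<close>

definition segment :: "('f::field \<Rightarrow> int) \<Rightarrow> nat \<Rightarrow> ('f, 'k::field, nat \<Rightarrow> 'k) deligne" where
  "segment v r =
     (rep_Sum r (\<lambda>k. nu_rep v (int k)),
      \<lambda>x i. if i = 0 then 0 else if i < r then x (i - 1) else 0)"

definition nilpotent_type :: "('f::field \<Rightarrow> int) \<Rightarrow> ('f, 'k::field, 'v::ab_group_add) weil_rep \<Rightarrow>
    nat \<Rightarrow> ('f, 'k, 'w::ab_group_add) deligne \<Rightarrow> bool" where
  "nilpotent_type v \<Psi> r D \<longleftrightarrow> irreducible_rep v \<Psi> \<and> 1 \<le> r \<and>
     deligne_iso v D (deligne_tensor (segment v r) (of_rep \<Psi>))"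

definition cyclic_type :: "('f::field \<Rightarrow> int) \<Rightarrow> ('f, 'k::field, 'v::ab_group_add) weil_rep \<Rightarrow>
    nat \<Rightarrow> ('v \<Rightarrow> 'v) \<Rightarrow> ('f, 'k, 'w::ab_group_add) deligne \<Rightarrow> bool" where
  "cyclic_type v \<Psi> r I D \<longleftrightarrow> irreducible_rep v \<Psi> \<and> 1 \<le> r \<and>
     I \<in> rep_isos v (twist v (int (orbit_card v \<Psi>)) \<Psi>) \<Psi> \<and>
     deligne_iso v D (deligne_tensor (segment v r) (cycle v \<Psi> I))"

end

theory Submission
  imports Defs "Jordan_Normal_Form.Char_Poly" "HOL-Algebra.Sylow"
begin

text \<open>
  The character \<open>\<nu>\<close> takes values in \<open>\<F>\<^sub>l\<close>, so a suitable \<open>C = \<kappa> U ^ (l ^ e)\<close> satisfies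
  the same commutation rule with the Weil group as \<open>U\<close>. If \<open>U\<close> is not nilpotent, indecomposability
  leaves a single eigenvalue of \<open>U ^ (l - 1)\<close>, and for large \<open>e\<close> one gets the
  Jordan decomposition \<open>U = C + N\<close> with \<open>N\<close> nilpotent and \<open>C ^ (l - 1)\<close> scalar; otherwise \<open>C = 0\<close>.
  As \<open>l - 1\<close> is prime to \<open>l\<close>, averaging over the powers of \<open>C\<close> keeps the space semisimple under
  the Weil group together with \<open>C\<close>, so that the indecomposable space is \<open>S \<oplus> N S \<oplus> \<dots> \<oplus> N ^ (r - 1) S\<close> for a subspace
  \<open>S\<close> that is simple under both. If \<open>C \<noteq> 0\<close> on \<open>S\<close>, an eigenvector argument in \<open>Hom(\<Psi>, S)\<close>
  identifies \<open>(S, C)\<close> with a cycle.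
\<close>

section \<open>Integral elements of the separable closure\<close>

text \<open>\<open>U\<close> commutes with the Weil group only up to the scalars \<nu>(\<sigma>), so
  its generalised eigenspaces need not be stable, and a polynomial in \<open>U\<close> is admissible
  only if it picks up the same scalar. Monomials whose exponent is 1 modulo l - 1 always do. Among
  them the exponents l ^ e are chosen because raising to such a power is additive on polynomials in
  \<open>U\<close>: nilpotency of \<open>U - C\<close> becomes an identity between two powers of
  \<open>U\<close>. Complete reducibility under \<open>C\<close> as well is what allows the chains
  under \<open>N\<close> to be split off by subspaces stable under \<open>C\<close>.

  The arithmetic is forced by the definition of \<nu> through the Frobenius exponent of an element.
  That this exponent is unique and additive requires the non-units of the integral closure to form
  an ideal. By completeness an idempotent modulo the uniformizer lifts, and this decides whether
  some power of an integral element is divisible by the uniformizer or is 1 modulo it; no valuation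
  is extended to the closure.

  For uniqueness, Schur's lemma recovers \<Psi>, up to a twist in the cyclic case, and dimensions
  recover r.\<close>

interpretation to_ac: field_hom "to_ac :: 'f::field \<Rightarrow> 'f alg_closure"
  by unfold_locales simp_all

interpretation to_ac_poly: map_poly_comm_ring_hom "to_ac :: 'f::field \<Rightarrow> 'f alg_closure" ..

abbreviation ac_poly :: "'f::field poly \<Rightarrow> 'f alg_closure poly" where
  "ac_poly \<equiv> map_poly to_ac"

lemma ac_poly_simps:
  "ac_poly (p + q) = ac_poly p + ac_poly q" "ac_poly (p * q) = ac_poly p * ac_poly q"
  "ac_poly (smult c p) = smult (to_ac c) (ac_poly p)" "ac_poly (pCons c p) = pCons (to_ac c) (ac_poly p)"
  "ac_poly (p ^ n) = ac_poly p ^ n" "ac_poly (monom c n) = monom (to_ac c) n"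
  "ac_poly (pderiv p) = pderiv (ac_poly p)" "ac_poly (- p) = - ac_poly p" "ac_poly (p - q) = ac_poly p - ac_poly q"
  by (simp_all add: hom_distribs to_ac_poly.hom_mult to_ac_poly.hom_power to_ac_poly.hom_uminus to_ac_poly.hom_minus)

section \<open>Separable polynomials and their roots\<close>

lemma poly_bezout:
  fixes p q :: "'a::field poly"
  assumes "coprime p q"
  shows "\<exists>u w. u * p + w * q = 1"
proof -
  define J where "J = {u * p + w * q | u w. True}"
  have J_mult: "k * f \<in> J" if "f \<in> J" for k f
  proof -
    from that obtain u w where "f = u * p + w * q" unfolding J_def by auto
    then have "k * f = (k * u) * p + (k * w) * q" by (simp add: algebra_simps)
    then show ?thesis unfolding J_def by blast
  qed
  have J_diff: "f - g \<in> J" if "f \<in> J" "g \<in> J" for f g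
  proof -
    from that obtain u w u' w' where "f = u * p + w * q" "g = u' * p + w' * q"
      unfolding J_def by auto
    then have "f - g = (u - u') * p + (w - w') * q" by (simp add: algebra_simps)
    then show ?thesis unfolding J_def by blast
  qed
  have "p = 1 * p + 0 * q" "q = 0 * p + 1 * q" by simp_all
  then have p: "p \<in> J" and q: "q \<in> J" unfolding J_def by blast+
  have "p \<noteq> 0 \<or> q \<noteq> 0" using assms by auto
  then have "\<exists>d. d \<in> J \<and> d \<noteq> 0" using p q by blast
  then obtain d where d: "d \<in> J" "d \<noteq> 0" and dmin: "\<And>f. f \<in> J \<Longrightarrow> f \<noteq> 0 \<Longrightarrow> degree d \<le> degree f"
    using ex_has_least_nat[of "\<lambda>d. d \<in> J \<and> d \<noteq> 0" _ degree] by metis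
  have dvd: "d dvd f" if "f \<in> J" for f
  proof (rule ccontr)
    assume n: "\<not> d dvd f"
    then have "f mod d \<noteq> 0" by (simp add: dvd_eq_mod_eq_0)
    moreover have "f mod d \<in> J"
      using J_diff[OF that J_mult[OF d(1), of "f div d"]] by (simp add: minus_div_mult_eq_mod)
    ultimately show False using dmin degree_mod_less'[of d f] d(2) by fastforce
  qed
  have "is_unit d" using assms dvd[OF p] dvd[OF q] by (rule coprime_common_divisor)
  then obtain k where "1 = d * k" by (rule dvdE)
  then have "1 \<in> J" using J_mult[OF d(1), of k] by (simp add: mult.commute)
  then obtain u w where "1 = u * p + w * q" unfolding J_def by blast
  then show ?thesis by metis
qed

definition simple_roots :: "'a::field poly \<Rightarrow> bool" where
  "simple_roots p \<longleftrightarrow> (\<forall>x. poly p x = 0 \<longrightarrow> poly (pderiv p) x \<noteq> 0)"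

lemma simple_roots_nonzero: "simple_roots p \<Longrightarrow> p \<noteq> 0"
  by (auto simp: simple_roots_def)

text \<open>A Bezout identity survives the embedding into the algebraic closure; conversely a common
  factor of positive degree acquires a root there. This turns separability into a statement about
  roots, the form in which it is used below.\<close>

lemma coprime_pderiv_iff_simple_roots:
  fixes P :: "'f::field poly"
  shows "coprime P (pderiv P) \<longleftrightarrow> simple_roots (ac_poly P)"
proof
  assume "coprime P (pderiv P)"
  then obtain u w where "u * P + w * pderiv P = 1" using poly_bezout by blast
  then have "ac_poly (u * P + w * pderiv P) = 1" by simp
  then have "ac_poly u * ac_poly P + ac_poly w * pderiv (ac_poly P) = 1"
    by (simp add: ac_poly_simps)
  then have "poly (ac_poly u) x * poly (ac_poly P) x + poly (ac_poly w) x * poly (pderiv (ac_poly P)) x = 1"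
    for x by (metis poly_1 poly_add poly_mult)
  then show "simple_roots (ac_poly P)" unfolding simple_roots_def
    by (metis add.right_neutral mult_zero_right zero_neq_one)
next
  assume s: "simple_roots (ac_poly P)"
  have P0: "P \<noteq> 0" using simple_roots_nonzero[OF s] by auto
  show "coprime P (pderiv P)"
  proof (rule coprimeI)
    fix d assume d: "d dvd P" "d dvd pderiv P"
    have "degree d = 0"
    proof (rule ccontr)
      assume "degree d \<noteq> 0"
      then have "degree (ac_poly d) > 0" by simp
      then obtain x where x: "poly (ac_poly d) x = 0" using alg_closed_imp_poly_has_root by blast
      have "ac_poly d dvd ac_poly P" "ac_poly d dvd pderiv (ac_poly P)"
        using d unfolding dvd_def by (auto simp: ac_poly_simps simp flip: ac_poly_simps(7))
      then show False using x s unfolding simple_roots_def by (metis dvd_trans poly_eq_0_iff_dvd)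
    qed
    moreover have "d \<noteq> 0" using d P0 by auto
    ultimately show "is_unit d" by (simp add: is_unit_iff_degree)
  qed
qed

section \<open>The separable elements form a field\<close>

lemma sep_closure_iff:
  "x \<in> sep_closure \<longleftrightarrow> (\<exists>P. simple_roots (ac_poly P) \<and> poly (ac_poly P) x = 0)"
  by (simp add: sep_closure_def coprime_pderiv_iff_simple_roots)

lemma simple_roots_linear_factor:
  assumes "simple_roots ([:-a, 1:] * q)"
  shows "poly q a \<noteq> 0" "simple_roots q"
  using assms unfolding simple_roots_def
  by (auto simp del: mult_pCons_left simp: pderiv_mult pderiv_pCons)

lemma card_simple_roots:
  fixes p :: "'a::alg_closed_field poly"
  assumes "simple_roots p"
  shows "card {x. poly p x = 0} = degree p"
  using assms
proof (induction "degree p" arbitrary: p)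
  case 0
  then obtain c where "p = [:c:]" by (auto elim: degree_eq_zeroE)
  then show ?case using simple_roots_nonzero[OF 0(2)] by auto
next
  case (Suc n)
  then obtain a where a: "poly p a = 0" using alg_closed_imp_poly_has_root[of p] by auto
  then obtain q where q: "p = [:-a, 1:] * q" by (metis dvdE poly_eq_0_iff_dvd)
  have s: "poly q a \<noteq> 0" "simple_roots q" using simple_roots_linear_factor Suc.prems q by blast+
  have q0: "q \<noteq> 0" using simple_roots_nonzero s(2) by blast
  have dq: "degree p = Suc (degree q)" unfolding q using q0 by (subst degree_mult_eq) auto
  have "{x. poly p x = 0} = insert a {x. poly q x = 0}" unfolding q by (auto simp del: mult_pCons_left)
  moreover have "finite {x. poly q x = 0}" using poly_roots_finite q0 by blast
  ultimately show ?case using s dq Suc by simp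
qed

text \<open>Linear independence of the powers 1, ..., \<open>x ^ (n - 1)\<close> as functions on
  \<open>n\<close> points. It allows coefficients to be compared on a grid of roots.\<close>

lemma poly_vanishing_coeffs:
  fixes h :: "nat \<Rightarrow> 'a::field"
  assumes "finite R" "card R = n" "\<And>x. x \<in> R \<Longrightarrow> (\<Sum>i<n. h i * x ^ i) = 0" "i < n"
  shows "h i = 0"
proof -
  define p where "p = (\<Sum>i<n. monom (h i) i)"
  have c: "coeff p j = (if j < n then h j else 0)" for j
    unfolding p_def coeff_sum coeff_monom by (simp add: sum.delta)
  have v: "poly p x = 0" if "x \<in> R" for x
    using assms(3)[OF that] unfolding p_def by (simp add: poly_sum poly_monom)
  have "p = 0"
  proof (rule ccontr)
    assume p0: "p \<noteq> 0"
    have "degree p < n"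
      using c p0 by (metis leading_coeff_0_iff)
    moreover have "card R \<le> card {x. poly p x = 0}"
      using v poly_roots_finite[OF p0] by (intro card_mono) auto
    moreover have "card {x. poly p x = 0} \<le> degree p" using card_poly_roots_bound[OF p0] .
    ultimately show False using assms(2) by simp
  qed
  then show ?thesis using c[of i] assms(4) by simp
qed

text \<open>An F-linear retraction of the closure onto F, obtained by extension from the line
  through 1. It pushes solutions of linear systems over F from the closure down to F, in place of an
  argument with fixed fields.\<close>

lemma F_linear_functional:
  obtains \<phi> :: "'f::field alg_closure \<Rightarrow> 'f" where "\<And>x y. \<phi> (x + y) = \<phi> x + \<phi> y"
    "\<And>c x. \<phi> (to_ac c * x) = c * \<phi> x" "\<phi> 1 = 1"
proof -
  interpret V: vector_space "\<lambda>(c::'f) x. to_ac c * x"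
    by unfold_locales (simp_all add: algebra_simps)
  interpret W: vector_space "\<lambda>(c::'f) x. c * x"
    by unfold_locales (simp_all add: algebra_simps)
  interpret VW: vector_space_pair "\<lambda>(c::'f) x. to_ac c * x" "\<lambda>(c::'f) x. c * x" ..
  have "V.independent {1}" by simp
  then obtain g where g: "Vector_Spaces.linear (\<lambda>(c::'f) x. to_ac c * x) (\<lambda>(c::'f) x. c * x) g" "g 1 = 1"
    using VW.linear_independent_extend[of "{1}" "\<lambda>_. 1"] by auto
  then show ?thesis by (intro that[of g]) (auto simp: Vector_Spaces.linear_iff)
qed

text \<open>In effect F[X, Y] / (P(X), Q(Y)), seen through the values of its elements at pairs of
  roots; values off the grid are left free.\<close>

definition grid_span :: "'f::field poly \<Rightarrow> 'f poly \<Rightarrow> ('f alg_closure \<Rightarrow> 'f alg_closure \<Rightarrow> 'f alg_closure) set" where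
  "grid_span P Q = {g. \<exists>c. \<forall>x y. poly (ac_poly P) x = 0 \<longrightarrow> poly (ac_poly Q) y = 0 \<longrightarrow>
     g x y = (\<Sum>i<degree P. \<Sum>j<degree Q. to_ac (c i j) * (x ^ i * y ^ j))}"

lemma grid_span_add: "f \<in> grid_span P Q \<Longrightarrow> g \<in> grid_span P Q \<Longrightarrow> (\<lambda>x y. f x y + g x y) \<in> grid_span P Q"
  unfolding grid_span_def
proof safe
  fix c d
  assume "\<forall>x y. poly (ac_poly P) x = 0 \<longrightarrow> poly (ac_poly Q) y = 0 \<longrightarrow>
     f x y = (\<Sum>i<degree P. \<Sum>j<degree Q. to_ac (c i j) * (x ^ i * y ^ j))"
   "\<forall>x y. poly (ac_poly P) x = 0 \<longrightarrow> poly (ac_poly Q) y = 0 \<longrightarrow>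
     g x y = (\<Sum>i<degree P. \<Sum>j<degree Q. to_ac (d i j) * (x ^ i * y ^ j))"
  then show "\<exists>c. \<forall>x y. poly (ac_poly P) x = 0 \<longrightarrow> poly (ac_poly Q) y = 0 \<longrightarrow>
     f x y + g x y = (\<Sum>i<degree P. \<Sum>j<degree Q. to_ac (c i j) * (x ^ i * y ^ j))"
    by (intro exI[of _ "\<lambda>i j. c i j + d i j"]) (simp add: sum.distrib distrib_right)
qed

lemma grid_span_scale: "f \<in> grid_span P Q \<Longrightarrow> (\<lambda>x y. to_ac a * f x y) \<in> grid_span P Q"
  unfolding grid_span_def
proof safe
  fix c
  assume "\<forall>x y. poly (ac_poly P) x = 0 \<longrightarrow> poly (ac_poly Q) y = 0 \<longrightarrow>
     f x y = (\<Sum>i<degree P. \<Sum>j<degree Q. to_ac (c i j) * (x ^ i * y ^ j))"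
  then show "\<exists>c. \<forall>x y. poly (ac_poly P) x = 0 \<longrightarrow> poly (ac_poly Q) y = 0 \<longrightarrow>
     to_ac a * f x y = (\<Sum>i<degree P. \<Sum>j<degree Q. to_ac (c i j) * (x ^ i * y ^ j))"
    by (intro exI[of _ "\<lambda>i j. a * c i j"]) (simp add: sum_distrib_left mult.assoc)
qed

lemma grid_span_zero: "(\<lambda>x y. 0) \<in> grid_span P Q"
  unfolding grid_span_def by (auto intro!: exI[of _ "\<lambda>_ _. 0"])

lemma grid_span_sum:
  "(\<And>i. i \<in> A \<Longrightarrow> f i \<in> grid_span P Q) \<Longrightarrow> (\<lambda>x y. \<Sum>i\<in>A. f i x y) \<in> grid_span P Q"
  by (induction A rule: infinite_finite_induct) (auto intro: grid_span_add grid_span_zero)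

lemma poly_mod_at_root:
  assumes "poly (ac_poly P) x = 0"
  shows "poly (ac_poly (f mod P)) x = poly (ac_poly f) x"
proof -
  have "ac_poly f = ac_poly (f div P) * ac_poly P + ac_poly (f mod P)"
    by (simp flip: ac_poly_simps(1,2))
  then show ?thesis using assms by simp
qed

lemma poly_mod_expand:
  assumes "poly (ac_poly P) x = 0" "degree P > 0"
  shows "poly (ac_poly f) x = (\<Sum>i<degree P. to_ac (coeff (f mod P) i) * x ^ i)"
proof -
  have "degree (f mod P) < degree P" using assms(2) degree_mod_less[of P f] by (cases "P = 0") auto
  then have "(\<Sum>i\<le>degree (f mod P). to_ac (coeff (f mod P) i) * x ^ i) = (\<Sum>i<degree P. to_ac (coeff (f mod P) i) * x ^ i)"
    by (intro sum.mono_neutral_left) (auto simp: coeff_eq_0)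
  then show ?thesis using poly_mod_at_root[OF assms(1), of f] by (simp add: poly_altdef)
qed

lemma grid_span_poly_mult:
  fixes P Q :: "'f::field poly"
  assumes "degree P > 0" "degree Q > 0"
  shows "(\<lambda>x y. poly (ac_poly f) x * poly (ac_poly g) y) \<in> grid_span P Q"
  unfolding grid_span_def
  by (rule CollectI, rule exI[of _ "\<lambda>i j. coeff (f mod P) i * coeff (g mod Q) j"])
     (simp add: poly_mod_expand[OF _ assms(1), of _ f] poly_mod_expand[OF _ assms(2), of _ g] sum_product mult_ac)

text \<open>The product \<open>R\<close> of the linear factors at the distinct values of
  \<open>z\<close> has simple roots by construction; the point is that its coefficients lie in F.
  They solve a linear system over F, given by the expansions of the powers of \<open>z\<close>.
  Applying the functional coefficientwise yields another monic solution of the same degree,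
  vanishing at the same points, hence the same polynomial.\<close>

lemma sep_closure_grid_value:
  fixes P Q :: "'f::field poly"
  assumes P: "simple_roots (ac_poly P)" and Q: "simple_roots (ac_poly Q)"
    and pow: "\<And>k. (\<lambda>x y. z x y ^ k) \<in> grid_span P Q"
    and a: "poly (ac_poly P) a = 0" and b: "poly (ac_poly Q) b = 0"
  shows "z a b \<in> sep_closure"
proof -
  define n m where "n = degree P" and "m = degree Q"
  define RX RY where "RX = {x. poly (ac_poly P) x = 0}" and "RY = {x. poly (ac_poly Q) x = 0}"
  have RX: "finite RX" "card RX = n" and RY: "finite RY" "card RY = m"
    using poly_roots_finite[OF simple_roots_nonzero[OF P]] poly_roots_finite[OF simple_roots_nonzero[OF Q]]
      card_simple_roots[OF P] card_simple_roots[OF Q]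
    unfolding RX_def RY_def n_def m_def by simp_all
  define S where "S = (\<lambda>(x, y). z x y) ` (RX \<times> RY)"
  have S: "finite S" unfolding S_def using RX RY by auto
  define R where "R = (\<Prod>\<gamma>\<in>S. [:-\<gamma>, 1:])"
  have R0: "poly R w = 0 \<longleftrightarrow> w \<in> S" for w unfolding R_def poly_prod using S by auto
  have dR: "degree R = card S" unfolding R_def by (subst degree_prod_eq_sum_degree) auto
  have lR: "lead_coeff R = 1" unfolding R_def by (simp add: lead_coeff_prod)
  obtain \<phi> :: "'f alg_closure \<Rightarrow> 'f" where \<phi>: "\<And>x y. \<phi> (x + y) = \<phi> x + \<phi> y"
    "\<And>c x. \<phi> (to_ac c * x) = c * \<phi> x" "\<phi> 1 = 1" using F_linear_functional by blast
  have \<phi>0: "\<phi> 0 = 0" using \<phi>(2)[of 0 0] by simp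
  have \<phi>s: "\<phi> (sum f A) = (\<Sum>k\<in>A. \<phi> (f k))" for f A
    by (induction A rule: infinite_finite_induct) (auto simp: \<phi> \<phi>0)
  define R' where "R' = map_poly \<phi> R"
  have cR': "coeff R' k = \<phi> (coeff R k)" for k unfolding R'_def using \<phi>0 by (simp add: coeff_map_poly)
  have dR': "degree R' \<le> card S" using dR unfolding R'_def by (metis degree_map_poly_le)
  from pow have "\<forall>k. \<exists>c. \<forall>x\<in>RX. \<forall>y\<in>RY. z x y ^ k = (\<Sum>i<n. \<Sum>j<m. to_ac (c i j) * (x ^ i * y ^ j))"
    unfolding grid_span_def RX_def RY_def n_def m_def by blast
  from choice[OF this] obtain c where c: "\<And>k x y. x \<in> RX \<Longrightarrow> y \<in> RY \<Longrightarrow>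
      z x y ^ k = (\<Sum>i<n. \<Sum>j<m. to_ac (c k i j) * (x ^ i * y ^ j))" by blast
  have expand: "(\<Sum>k\<le>card S. u k * z x y ^ k) =
      (\<Sum>i<n. (\<Sum>j<m. (\<Sum>k\<le>card S. u k * to_ac (c k i j)) * y ^ j) * x ^ i)"
    if "x \<in> RX" "y \<in> RY" for x y u
  proof -
    have "(\<Sum>k\<le>card S. u k * z x y ^ k) =
        (\<Sum>k\<le>card S. \<Sum>i<n. \<Sum>j<m. u k * to_ac (c k i j) * y ^ j * x ^ i)"
      unfolding c[OF that] sum_distrib_left by (intro sum.cong refl) (simp only: mult_ac)
    also have "\<dots> = (\<Sum>i<n. \<Sum>k\<le>card S. \<Sum>j<m. u k * to_ac (c k i j) * y ^ j * x ^ i)"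
      by (rule sum.swap)
    also have "\<dots> = (\<Sum>i<n. \<Sum>j<m. \<Sum>k\<le>card S. u k * to_ac (c k i j) * y ^ j * x ^ i)"
      by (intro sum.cong refl sum.swap)
    finally show ?thesis unfolding sum_distrib_right .
  qed
  have "(\<Sum>k\<le>card S. coeff R k * to_ac (c k i j)) = 0" if "i < n" "j < m" for i j
  proof (rule poly_vanishing_coeffs[OF RY _ \<open>j < m\<close>])
    fix y assume y: "y \<in> RY"
    show "(\<Sum>j<m. (\<Sum>k\<le>card S. coeff R k * to_ac (c k i j)) * y ^ j) = 0"
    proof (rule poly_vanishing_coeffs[OF RX _ \<open>i < n\<close>])
      fix x assume x: "x \<in> RX"
      have "poly R (z x y) = 0" using x y R0 unfolding S_def by blast
      then show "(\<Sum>i<n. (\<Sum>j<m. (\<Sum>k\<le>card S. coeff R k * to_ac (c k i j)) * y ^ j) * x ^ i) = 0"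
        using expand[OF x y, of "coeff R"] by (simp add: poly_altdef dR)
    qed
  qed
  \<comment> \<open>The numbers \<open>c k i j\<close> lie in F, so \<phi> can be moved onto
    \<open>coeff R k\<close>: the image of \<open>R\<close> solves the same linear system.\<close>
  then have "\<phi> (\<Sum>k\<le>card S. to_ac (c k i j) * coeff R k) = 0" if "i < n" "j < m" for i j
    using that \<phi>0 by (simp add: mult.commute)
  then have v: "(\<Sum>k\<le>card S. coeff R' k * c k i j) = 0" if "i < n" "j < m" for i j
    using that unfolding \<phi>s \<phi> cR' by (simp add: mult.commute)
  then have v': "(\<Sum>k\<le>card S. to_ac (coeff R' k) * to_ac (c k i j)) = 0" if "i < n" "j < m" for i j
    using that by (simp flip: to_ac_mult to_ac_sum)
  have root': "poly (ac_poly R') w = 0" if w: "w \<in> S" for w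
  proof -
    obtain x y where xy: "x \<in> RX" "y \<in> RY" "w = z x y" using w unfolding S_def by auto
    have "poly (ac_poly R') w = (\<Sum>k\<le>card S. to_ac (coeff R' k) * w ^ k)"
      unfolding poly_altdef using dR' by (intro sum.mono_neutral_cong_left) (auto simp: coeff_eq_0)
    then show ?thesis using expand[OF xy(1,2), of "\<lambda>k. to_ac (coeff R' k)"] xy v' by simp
  qed
  \<comment> \<open>The normalisation \<open>\<phi> 1 = 1\<close> keeps the polynomial monic of the
    same degree.\<close>
  have c1: "coeff (ac_poly R') (card S) = 1" using cR' \<phi>(3) lR dR by simp
  have "ac_poly R' = R"
  proof (rule poly_eqI_degree_lead_coeff[where n = "card S" and A = S])
    show "card S \<le> card S" ..
    show "degree (ac_poly R') \<le> card S" "degree R \<le> card S" using dR' dR by simp_all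
    show "coeff (ac_poly R') (card S) = coeff R (card S)" using c1 lR dR by simp
    show "poly (ac_poly R') w = poly R w" if "w \<in> S" for w using root'[OF that] R0 that by simp
  qed
  moreover have "simple_roots R" unfolding simple_roots_def
  proof safe
    fix w assume "poly R w = 0" "poly (pderiv R) w = 0"
    then have w: "w \<in> S" using R0 by simp
    then have R: "R = [:-w, 1:] * (\<Prod>\<gamma>\<in>S - {w}. [:-\<gamma>, 1:])"
      unfolding R_def using S by (subst prod.remove) auto
    have "poly (pderiv R) w = poly (\<Prod>\<gamma>\<in>S - {w}. [:-\<gamma>, 1:]) w"
      unfolding R by (simp del: mult_pCons_left add: pderiv_mult pderiv_pCons)
    moreover have "poly (\<Prod>\<gamma>\<in>S - {w}. [:-\<gamma>, 1:]) w \<noteq> 0"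
      unfolding poly_prod using S by auto
    ultimately show False using \<open>poly (pderiv R) w = 0\<close> by simp
  qed
  moreover have "z a b \<in> S" unfolding S_def RX_def RY_def using a b by auto
  ultimately show ?thesis unfolding sep_closure_iff using root' by metis
qed

lemma simple_roots_degree_pos:
  assumes "simple_roots (ac_poly P)" "poly (ac_poly P) x = 0"
  shows "degree P > 0"
proof (rule ccontr)
  assume "\<not> degree P > 0"
  then obtain c where "P = [:c:]" by (auto elim: degree_eq_zeroE)
  then show False using assms simple_roots_nonzero by fastforce
qed

lemma sep_closure_to_ac [simp]: "to_ac a \<in> sep_closure"
  unfolding sep_closure_iff
  by (rule exI[of _ "[:-a, 1:]"]) (simp add: simple_roots_def pderiv_pCons)

lemma sep_closure_add:
  assumes "a \<in> sep_closure" "b \<in> sep_closure"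
  shows "a + b \<in> sep_closure"
proof -
  obtain P Q where PQ: "simple_roots (ac_poly P)" "poly (ac_poly P) a = 0"
      "simple_roots (ac_poly Q)" "poly (ac_poly Q) b = 0" using assms unfolding sep_closure_iff by blast
  note pos = simple_roots_degree_pos[OF PQ(1,2)] simple_roots_degree_pos[OF PQ(3,4)]
  have "(\<lambda>x y. (x + y) ^ k) \<in> grid_span P Q" for k
  proof -
    have "(\<lambda>x y. \<Sum>i\<le>k. to_ac (of_nat (k choose i)) *
        (poly (ac_poly (monom 1 i)) x * poly (ac_poly (monom 1 (k - i))) y)) \<in> grid_span P Q"
      by (intro grid_span_sum grid_span_scale grid_span_poly_mult pos)
    then show ?thesis by (simp add: binomial_ring poly_monom mult.assoc ac_poly_simps)
  qed
  then show ?thesis using sep_closure_grid_value[OF PQ(1,3) _ PQ(2,4), of "\<lambda>x y. x + y"] by blast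
qed

lemma sep_closure_mult:
  assumes "a \<in> sep_closure" "b \<in> sep_closure"
  shows "a * b \<in> sep_closure"
proof -
  obtain P Q where PQ: "simple_roots (ac_poly P)" "poly (ac_poly P) a = 0"
      "simple_roots (ac_poly Q)" "poly (ac_poly Q) b = 0" using assms unfolding sep_closure_iff by blast
  note pos = simple_roots_degree_pos[OF PQ(1,2)] simple_roots_degree_pos[OF PQ(3,4)]
  have "(\<lambda>x y. (x * y) ^ k) \<in> grid_span P Q" for k
    using grid_span_poly_mult[OF pos, of "monom 1 k" "monom 1 k"]
    by (simp add: poly_monom power_mult_distrib ac_poly_simps)
  then show ?thesis using sep_closure_grid_value[OF PQ(1,3) _ PQ(2,4), of "\<lambda>x y. x * y"] by blast
qed

text \<open>On the roots of a polynomial with nonzero constant term, inversion agrees with a single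
  polynomial over F, so the grid argument applies with one variable idle.\<close>

lemma sep_closure_inverse:
  assumes "a \<in> sep_closure"
  shows "inverse a \<in> sep_closure"
proof (cases "a = 0")
  case True
  then show ?thesis using sep_closure_to_ac[of 0] by simp
next
  case a0: False
  obtain P where P: "simple_roots (ac_poly P)" "poly (ac_poly P) a = 0"
    using assms unfolding sep_closure_iff by blast
  \<comment> \<open>If the constant term vanishes, the factor X is split off. As \<open>a\<close> is
    not zero it remains a root, and the simple root 0 cannot occur twice.\<close>
  obtain Q where Q: "simple_roots (ac_poly Q)" "poly (ac_poly Q) a = 0" "coeff Q 0 \<noteq> 0"
  proof (cases "coeff P 0 = 0")
    case True
    then obtain Q where Q: "P = [:0, 1:] * Q" by (cases P) auto
    then have aP: "ac_poly P = [:-0, 1:] * ac_poly Q" by (simp add: ac_poly_simps)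
    note s = simple_roots_linear_factor[OF P(1)[unfolded aP]]
    have "coeff Q 0 \<noteq> 0" using s(1) by (simp add: poly_0_coeff_0)
    then show ?thesis using that[of Q] s P(2) a0 unfolding aP by auto
  qed (use P that in blast)
  obtain h c where h: "Q = pCons c h" "c \<noteq> 0" using Q(3) by (cases Q) auto
  define g where "g = smult (- inverse c) h"
  have inv: "inverse x = poly (ac_poly g) x" if "poly (ac_poly Q) x = 0" for x
  proof -
    have e: "to_ac c + x * poly (ac_poly h) x = 0" using that unfolding h by (simp add: ac_poly_simps)
    then have "x \<noteq> 0" using h(2) by auto
    have "to_ac c = - (x * poly (ac_poly h) x)" using e by (simp add: eq_neg_iff_add_eq_0)
    moreover have "to_ac c * (x * poly (ac_poly g) x) = - (x * poly (ac_poly h) x)"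
      unfolding g_def using h(2) by (simp add: ac_poly_simps)
    ultimately have "to_ac c * (x * poly (ac_poly g) x) = to_ac c" by metis
    then have "x * poly (ac_poly g) x = 1" using h(2) by simp
    then show ?thesis by (simp add: inverse_unique)
  qed
  have pos: "degree Q > 0" using simple_roots_degree_pos[OF Q(1,2)] .
  have "(\<lambda>x y. poly (ac_poly g) x ^ k) \<in> grid_span Q Q" for k
    using grid_span_poly_mult[OF pos pos, of "g ^ k" 1] by (simp add: ac_poly_simps)
  then have "poly (ac_poly g) a \<in> sep_closure"
    using sep_closure_grid_value[OF Q(1,1) _ Q(2,2), of "\<lambda>x y. poly (ac_poly g) x"] by blast
  then show ?thesis using inv Q by simp
qed

lemma sep_closure_0 [simp]: "0 \<in> sep_closure" and sep_closure_1 [simp]: "1 \<in> sep_closure"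
  using sep_closure_to_ac[of 0] sep_closure_to_ac[of 1] by simp_all

lemma sep_closure_minus: "a \<in> sep_closure \<Longrightarrow> - a \<in> sep_closure"
  using sep_closure_mult[OF sep_closure_to_ac[of "-1"], of a] by simp

lemma sep_closure_diff: "a \<in> sep_closure \<Longrightarrow> b \<in> sep_closure \<Longrightarrow> a - b \<in> sep_closure"
  using sep_closure_add[of a "- b"] sep_closure_minus[of b] by simp

lemma sep_closure_power: "a \<in> sep_closure \<Longrightarrow> a ^ n \<in> sep_closure"
  by (induction n) (auto intro: sep_closure_mult)

section \<open>Elements integral over the ring of integers\<close>

context nonarch_local_field
begin

lemma v_one [simp]: "v 1 = 0"
  using val_mult[of 1 1] by simp

lemma val_ge_mono: "val_ge v n x \<Longrightarrow> m \<le> n \<Longrightarrow> val_ge v m x"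
  by (auto simp: val_ge_def)

lemma val_ge_mult: "val_ge v n x \<Longrightarrow> val_ge v m y \<Longrightarrow> val_ge v (n + m) (x * y)"
  using val_mult[of x y] by (cases "x = 0 \<or> y = 0") (auto simp: val_ge_def)

lemma v_minus_one: "v (- 1) = 0"
  using val_mult[of "- 1" "- 1"] by simp

lemma val_ge_minus: "val_ge v n x \<Longrightarrow> val_ge v n (- x)"
  using val_ge_mult[of 0 "- 1" n x] v_minus_one by (simp add: val_ge_def)

lemma val_ge_diff: "val_ge v n x \<Longrightarrow> val_ge v n y \<Longrightarrow> val_ge v n (x - y)"
  using val_add[of n x "- y"] val_ge_minus by simp

lemma v_inverse: "x \<noteq> 0 \<Longrightarrow> v (inverse x) = - v x"
  using val_mult[of x "inverse x"] by simp

lemma int_ring_0 [simp]: "0 \<in> int_ring v" and int_ring_1 [simp]: "1 \<in> int_ring v"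
  by (simp_all add: int_ring_def val_ge_def)

lemma int_ring_add: "x \<in> int_ring v \<Longrightarrow> y \<in> int_ring v \<Longrightarrow> x + y \<in> int_ring v"
  and int_ring_mult: "x \<in> int_ring v \<Longrightarrow> y \<in> int_ring v \<Longrightarrow> x * y \<in> int_ring v"
  and int_ring_minus: "x \<in> int_ring v \<Longrightarrow> - x \<in> int_ring v"
  and int_ring_diff: "x \<in> int_ring v \<Longrightarrow> y \<in> int_ring v \<Longrightarrow> x - y \<in> int_ring v"
  using val_add[of 0 x y] val_ge_mult[of 0 x 0 y] val_ge_minus[of 0 x] val_ge_diff[of 0 x y]
  by (simp_all add: int_ring_def)

lemma int_ring_power: "x \<in> int_ring v \<Longrightarrow> x ^ n \<in> int_ring v"
  by (induction n) (auto intro: int_ring_mult)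

lemma int_ring_sum: "(\<And>i. i \<in> S \<Longrightarrow> f i \<in> int_ring v) \<Longrightarrow> sum f S \<in> int_ring v"
  by (induction S rule: infinite_finite_induct) (auto intro: int_ring_add)

lemma int_ring_of_nat: "of_nat n \<in> int_ring v"
  by (induction n) (auto intro: int_ring_add)

definition unif :: 'f where "unif = (SOME x. x \<noteq> 0 \<and> v x = 1)"

lemma unif: "unif \<noteq> 0" "v unif = 1"
  using someI_ex[OF uniformizer] unfolding unif_def by auto

lemma v_unif_power: "v (unif ^ n) = int n"
  by (induction n) (use unif in \<open>auto simp: val_mult\<close>)

lemma val_ge_iff: "val_ge v (int n) x \<longleftrightarrow> (\<exists>y\<in>int_ring v. x = unif ^ n * y)"
proof
  assume x: "val_ge v (int n) x"
  have "val_ge v (- int n + int n) (inverse (unif ^ n) * x)"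
    by (rule val_ge_mult[OF _ x]) (use unif v_unif_power v_inverse[of "unif ^ n"] in \<open>simp add: val_ge_def\<close>)
  then show "\<exists>y\<in>int_ring v. x = unif ^ n * y"
    using unif by (intro bexI[of _ "inverse (unif ^ n) * x"]) (auto simp: int_ring_def)
next
  assume "\<exists>y\<in>int_ring v. x = unif ^ n * y"
  then obtain y where y: "val_ge v 0 y" "x = unif ^ n * y" by (auto simp: int_ring_def)
  have "val_ge v (int n) (unif ^ n)" using v_unif_power by (simp add: val_ge_def)
  from val_ge_mult[OF this y(1)] show "val_ge v (int n) x" using y(2) by simp
qed

lemma max_ideal_iff: "x \<in> max_ideal v \<longleftrightarrow> (\<exists>y\<in>int_ring v. x = unif * y)"
  using val_ge_iff[of 1 x] by (simp add: max_ideal_def)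

lemma max_ideal_int_ring: "x \<in> max_ideal v \<Longrightarrow> x \<in> int_ring v"
  using val_ge_mono[of 1 x 0] by (simp add: max_ideal_def int_ring_def)

lemma one_notin_max_ideal: "1 \<notin> max_ideal v"
  by (simp add: max_ideal_def val_ge_def)

lemma unif_int_ring: "unif \<in> int_ring v"
  using unif by (simp add: int_ring_def val_ge_def)

lemma unit_int_ring:
  assumes "x \<in> int_ring v" "x \<notin> max_ideal v"
  shows "x \<noteq> 0" "v x = 0" "inverse x \<in> int_ring v"
  using assms v_inverse[of x] by (auto simp: int_ring_def max_ideal_def val_ge_def)

definition int_poly :: "'f poly \<Rightarrow> bool" where
  "int_poly p \<longleftrightarrow> (\<forall>i. coeff p i \<in> int_ring v)"

lemma int_poly_coeff: "int_poly p \<Longrightarrow> coeff p i \<in> int_ring v"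
  by (simp add: int_poly_def)

lemma int_poly_0 [simp]: "int_poly 0" and int_poly_1 [simp]: "int_poly 1"
  by (simp_all add: int_poly_def coeff_1)

lemma int_poly_add: "int_poly p \<Longrightarrow> int_poly q \<Longrightarrow> int_poly (p + q)"
  and int_poly_diff: "int_poly p \<Longrightarrow> int_poly q \<Longrightarrow> int_poly (p - q)"
  and int_poly_minus: "int_poly p \<Longrightarrow> int_poly (- p)"
  and int_poly_smult: "c \<in> int_ring v \<Longrightarrow> int_poly p \<Longrightarrow> int_poly (smult c p)"
  and int_poly_monom: "c \<in> int_ring v \<Longrightarrow> int_poly (monom c n)"
  by (auto simp: int_poly_def int_ring_add int_ring_diff int_ring_minus int_ring_mult)

lemma int_poly_mult: "int_poly p \<Longrightarrow> int_poly q \<Longrightarrow> int_poly (p * q)"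
  by (auto simp: int_poly_def coeff_mult intro!: int_ring_sum int_ring_mult)

lemma int_poly_power: "int_poly p \<Longrightarrow> int_poly (p ^ n)"
  by (induction n) (auto intro: int_poly_mult)

lemma int_poly_sum: "(\<And>i. i \<in> S \<Longrightarrow> int_poly (f i)) \<Longrightarrow> int_poly (sum f S)"
  by (induction S rule: infinite_finite_induct) (auto intro: int_poly_add)

lemma int_poly_prod: "(\<And>i. i \<in> S \<Longrightarrow> int_poly (f i)) \<Longrightarrow> int_poly (prod f S)"
  by (induction S rule: infinite_finite_induct) (auto intro: int_poly_mult)

lemma int_poly_pCons [simp]: "int_poly (pCons c p) \<longleftrightarrow> c \<in> int_ring v \<and> int_poly p"
  by (auto simp: int_poly_def coeff_pCons split: nat.splits)

lemma int_poly_pcompose: "int_poly p \<Longrightarrow> int_poly q \<Longrightarrow> int_poly (pcompose p q)"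
  by (induction p) (auto simp: pcompose_pCons intro: int_poly_add int_poly_mult)

lemma int_poly_poly: "int_poly p \<Longrightarrow> x \<in> int_ring v \<Longrightarrow> poly p x \<in> int_ring v"
  by (induction p) (auto intro: int_ring_add int_ring_mult)

text \<open>Division by a monic polynomial never inverts a coefficient: each Horner step subtracts
  an integral multiple of \<open>P\<close>.\<close>

lemma int_poly_mod:
  assumes "int_poly f" "int_poly P" "lead_coeff P = 1"
  shows "int_poly (f mod P)"
  using assms(1)
proof (induction f)
  case (pCons a f)
  have "P \<noteq> 0" using assms(3) by auto
  define w where "w = pCons a (f mod P)"
  have w: "int_poly w" unfolding w_def using pCons by simp
  have "pCons a f mod P = w - smult (coeff w (degree P)) P"
    using mod_pCons[OF \<open>P \<noteq> 0\<close>, of a f] assms(3) unfolding w_def by (simp add: Let_def)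
  then show ?case using w assms by (auto intro!: int_poly_diff int_poly_smult int_poly_coeff)
qed simp

definition integral :: "'f alg_closure \<Rightarrow> bool" where
  "integral x \<longleftrightarrow> (\<exists>P. lead_coeff P = 1 \<and> int_poly P \<and> poly (ac_poly P) x = 0)"

lemma sep_int_ring_iff: "x \<in> sep_int_ring v \<longleftrightarrow> x \<in> sep_closure \<and> integral x"
  by (simp add: sep_int_ring_def integral_def int_poly_def)

lemma integral_to_ac: "a \<in> int_ring v \<Longrightarrow> integral (to_ac a)"
  unfolding integral_def
  by (rule exI[of _ "[:-a, 1:]"]) (simp add: int_ring_minus)

lemma int_poly_char_poly:
  assumes "B \<in> carrier_mat n n" "\<And>i j. i < n \<Longrightarrow> j < n \<Longrightarrow> B $$ (i, j) \<in> int_ring v"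
  shows "int_poly (char_poly B)"
proof -
  have c: "char_poly_matrix B \<in> carrier_mat n n" using assms by simp
  have e: "int_poly (char_poly_matrix B $$ (i, j))" if "i < n" "j < n" for i j
    using assms that by (auto simp: char_poly_matrix_def intro: int_ring_minus)
  show ?thesis unfolding char_poly_def det_def'[OF c]
  proof (intro int_poly_sum int_poly_mult int_poly_prod)
    fix p assume "p \<in> {p. p permutes {0..<n}}"
    then have "p permutes {0..<n}" by simp
    then show "int_poly (char_poly_matrix B $$ (i, p i))" if "i \<in> {0..<n}" for i
      using e that permutes_in_image by fastforce
    show "int_poly (signof p)" by (auto simp: sign_def intro: int_poly_minus)
  qed
qed

text \<open>The determinant trick: \<open>z\<close> acts on the span of the \<open>g k\<close>
  through an integral matrix, so it is a root of the characteristic polynomial, which is monic and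
  integral.\<close>

lemma integral_eigenvalue:
  fixes g :: "'i \<Rightarrow> 'f alg_closure"
  assumes "finite J" and M: "\<And>k l. k \<in> J \<Longrightarrow> l \<in> J \<Longrightarrow> M k l \<in> int_ring v"
    and z: "\<And>k. k \<in> J \<Longrightarrow> z * g k = (\<Sum>l\<in>J. to_ac (M k l) * g l)"
    and nz: "\<exists>k\<in>J. g k \<noteq> 0"
  shows "integral z"
proof -
  define n where "n = card J"
  obtain h where h: "bij_betw h {0..<n} J"
    using ex_bij_betw_nat_finite[OF \<open>finite J\<close>] unfolding n_def by blast
  define B where "B = mat n n (\<lambda>(i, j). M (h i) (h j))"
  define w where "w = vec n (\<lambda>i. g (h i))"
  have B: "B \<in> carrier_mat n n" unfolding B_def by simp
  have hJ: "h i \<in> J" if "i < n" for i using h that by (auto simp: bij_betw_def)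
  have "eigenvector (map_mat to_ac B) w z"
    unfolding eigenvector_def
  proof (intro conjI)
    show "w \<in> carrier_vec (dim_row (map_mat to_ac B))" unfolding w_def B_def by simp
    obtain k where "k \<in> J" "g k \<noteq> 0" using nz by blast
    then obtain i where "i < n" "g (h i) \<noteq> 0" using h by (auto simp: bij_betw_def)
    then show "w \<noteq> 0\<^sub>v (dim_row (map_mat to_ac B))" unfolding w_def B_def
      by (metis index_vec index_zero_vec(1) dim_row_mat(1) index_map_mat(2))
    show "map_mat to_ac B *\<^sub>v w = z \<cdot>\<^sub>v w"
    proof (rule eq_vecI)
      show "dim_vec (map_mat to_ac B *\<^sub>v w) = dim_vec (z \<cdot>\<^sub>v w)" unfolding w_def B_def by simp
      fix i assume "i < dim_vec (z \<cdot>\<^sub>v w)"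
      then have i: "i < n" unfolding w_def by simp
      have "(map_mat to_ac B *\<^sub>v w) $ i = (\<Sum>j\<in>{0..<n}. to_ac (M (h i) (h j)) * g (h j))"
        using i unfolding B_def w_def by (simp add: scalar_prod_def)
      also have "\<dots> = (\<Sum>l\<in>J. to_ac (M (h i) l) * g l)"
        by (rule sum.reindex_bij_betw[OF h])
      also have "\<dots> = (z \<cdot>\<^sub>v w) $ i" using z[OF hJ[OF i]] i unfolding w_def by simp
      finally show "(map_mat to_ac B *\<^sub>v w) $ i = (z \<cdot>\<^sub>v w) $ i" .
    qed
  qed
  then have "eigenvalue (map_mat to_ac B) z" unfolding eigenvalue_def by blast
  then have "poly (char_poly (map_mat to_ac B)) z = 0"
    using eigenvalue_root_char_poly[of "map_mat to_ac B" n z] B by simp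
  then have "poly (ac_poly (char_poly B)) z = 0" using comm_ring_hom.char_poly_hom[OF to_ac.comm_ring_hom_axioms B] by simp
  moreover have "lead_coeff (char_poly B) = 1" using degree_monic_char_poly[OF B] by simp
  moreover have "int_poly (char_poly B)"
    by (rule int_poly_char_poly[OF B]) (auto simp: B_def hJ M)
  ultimately show ?thesis unfolding integral_def by blast
qed

lemma integral_degree_pos:
  "lead_coeff P = 1 \<Longrightarrow> poly (ac_poly P) x = 0 \<Longrightarrow> degree P > 0"
  by (rule ccontr) (auto elim!: degree_eq_zeroE)

text \<open>Exponents are reduced modulo \<open>P\<close> and \<open>Q\<close> separately. Hence the
  lattice spanned by the monomials below the degrees is stable under both \<open>x\<close> and
  \<open>y\<close>, as the determinant trick requires for their sum and product.\<close>

lemma integral_power_lattice: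
  assumes P: "lead_coeff P = 1" "int_poly P" "poly (ac_poly P) x = 0"
    and Q: "lead_coeff Q = 1" "int_poly Q" "poly (ac_poly Q) y = 0"
  shows "\<exists>c. (\<forall>l. c l \<in> int_ring v) \<and>
    x ^ i * y ^ j = (\<Sum>l\<in>{..<degree P} \<times> {..<degree Q}. to_ac (c l) * (x ^ fst l * y ^ snd l))"
proof -
  define f g where "f = monom 1 i mod P" and "g = monom 1 j mod Q"
  have fg: "int_poly f" "int_poly g" unfolding f_def g_def
    using P Q by (auto intro!: int_poly_mod int_poly_monom)
  have "x ^ i * y ^ j = poly (ac_poly (monom 1 i)) x * poly (ac_poly (monom 1 j)) y"
    by (simp add: poly_monom)
  also have "\<dots> = (\<Sum>k<degree P. to_ac (coeff f k) * x ^ k) * (\<Sum>l<degree Q. to_ac (coeff g l) * y ^ l)"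
    unfolding f_def g_def
    by (simp only: poly_mod_expand[OF P(3) integral_degree_pos[OF P(1,3)], of "monom 1 i"]
        poly_mod_expand[OF Q(3) integral_degree_pos[OF Q(1,3)], of "monom 1 j"])
  also have "\<dots> = (\<Sum>l\<in>{..<degree P} \<times> {..<degree Q}. to_ac (coeff f (fst l) * coeff g (snd l)) * (x ^ fst l * y ^ snd l))"
    unfolding sum_product sum.cartesian_product by (intro sum.cong) (auto simp: mult_ac)
  finally show ?thesis
    using fg by (intro exI[of _ "\<lambda>l. coeff f (fst l) * coeff g (snd l)"]) (auto intro: int_ring_mult int_poly_coeff)
qed

lemma integral_add_mult:
  assumes "integral x" "integral y"
  shows "integral (x + y)" "integral (x * y)"
proof -
  obtain P Q where P: "lead_coeff P = 1" "int_poly P" "poly (ac_poly P) x = 0"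
    and Q: "lead_coeff Q = 1" "int_poly Q" "poly (ac_poly Q) y = 0"
    using assms unfolding integral_def by blast
  define J where "J = {..<degree P} \<times> {..<degree Q}"
  define g where "g = (\<lambda>l. x ^ fst l * y ^ snd l)"
  have J: "finite J" unfolding J_def by simp
  have nz: "\<exists>k\<in>J. g k \<noteq> 0"
    using integral_degree_pos[OF P(1,3)] integral_degree_pos[OF Q(1,3)]
    unfolding J_def g_def by (intro bexI[of _ "(0, 0)"]) auto
  have "\<exists>c. (\<forall>l. c l \<in> int_ring v) \<and> x ^ i * y ^ j = (\<Sum>l\<in>J. to_ac (c l) * g l)" for i j
    unfolding J_def g_def by (rule integral_power_lattice[OF P Q])
  then obtain c where c: "c i j l \<in> int_ring v" "x ^ i * y ^ j = (\<Sum>l\<in>J. to_ac (c i j l) * g l)" for i j l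
    by metis
  show "integral (x + y)"
  proof (rule integral_eigenvalue[OF J _ _ nz])
    show "c (Suc (fst k)) (snd k) l + c (fst k) (Suc (snd k)) l \<in> int_ring v" for k l
      using c int_ring_add by blast
    have "(x + y) * g k = x ^ Suc (fst k) * y ^ snd k + x ^ fst k * y ^ Suc (snd k)" for k
      unfolding g_def by (simp add: algebra_simps)
    then show "(x + y) * g k = (\<Sum>l\<in>J. to_ac (c (Suc (fst k)) (snd k) l + c (fst k) (Suc (snd k)) l) * g l)" for k
      by (simp only: c(2) to_ac_add distrib_right sum.distrib)
  qed
  show "integral (x * y)"
  proof (rule integral_eigenvalue[OF J _ _ nz])
    show "c (Suc (fst k)) (Suc (snd k)) l \<in> int_ring v" for k l
      using c by blast
    have "(x * y) * g k = x ^ Suc (fst k) * y ^ Suc (snd k)" for k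
      unfolding g_def by (simp add: algebra_simps)
    then show "(x * y) * g k = (\<Sum>l\<in>J. to_ac (c (Suc (fst k)) (Suc (snd k)) l) * g l)" for k
      by (simp only: c(2))
  qed
qed

lemma integral_0 [simp]: "integral 0" and integral_1 [simp]: "integral 1"
  using integral_to_ac[of 0] integral_to_ac[of 1] by simp_all

lemma integral_minus: "integral x \<Longrightarrow> integral (- x)"
  using integral_add_mult(2)[OF integral_to_ac[of "- 1"], of x] by (simp add: int_ring_minus)

lemma integral_diff: "integral x \<Longrightarrow> integral y \<Longrightarrow> integral (x - y)"
  using integral_add_mult(1)[of x "- y"] integral_minus[of y] by simp

lemma integral_power: "integral x \<Longrightarrow> integral (x ^ n)"
  by (induction n) (auto intro: integral_add_mult)

lemma integral_sum: "(\<And>i. i \<in> S \<Longrightarrow> integral (f i)) \<Longrightarrow> integral (sum f S)"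
  by (induction S rule: infinite_finite_induct) (auto intro: integral_add_mult)

lemma integral_of_nat: "integral (of_nat n)"
  using integral_to_ac[OF int_ring_of_nat, of n] by simp

lemma integral_poly: "int_poly f \<Longrightarrow> integral x \<Longrightarrow> integral (poly (ac_poly f) x)"
  by (induction f) (auto simp: ac_poly_simps intro: integral_add_mult integral_to_ac)

text \<open>Scaling the root by \<open>unif\<close> multiplies the coefficient of degree i < d by
  \<open>unif ^ (d - i)\<close>. All lower coefficients become divisible by \<open>unif\<close>, and
  \<open>T\<close> collects the quotients.\<close>

lemma integral_scaled_poly:
  assumes "lead_coeff P = 1" "int_poly P" "poly (ac_poly P) x = 0"
  shows "\<exists>T. int_poly T \<and> (to_ac unif * x) ^ degree P + to_ac unif * poly (ac_poly T) (to_ac unif * x) = 0"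
proof -
  define d where "d = degree P"
  define T where "T = (\<Sum>i<d. monom (coeff P i * unif ^ (d - 1 - i)) i)"
  have "int_poly T" unfolding T_def using assms(2)
    by (intro int_poly_sum int_poly_monom int_ring_mult int_poly_coeff int_ring_power unif_int_ring)
  let ?u = "to_ac unif"
  have "?u * poly (ac_poly T) (?u * x) = (\<Sum>i<d. ?u * (to_ac (coeff P i) * ?u ^ (d - 1 - i) * (?u * x) ^ i))"
    unfolding T_def by (simp add: to_ac_poly.hom_sum poly_sum poly_monom sum_distrib_left)
  also have "\<dots> = (\<Sum>i<d. ?u ^ d * (to_ac (coeff P i) * x ^ i))"
  proof (rule sum.cong[OF refl])
    fix i assume "i \<in> {..<d}"
    then have "?u ^ d = ?u * ?u ^ (d - 1 - i) * ?u ^ i"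
      by (simp flip: power_add power_Suc)
    then show "?u * (to_ac (coeff P i) * ?u ^ (d - 1 - i) * (?u * x) ^ i) = ?u ^ d * (to_ac (coeff P i) * x ^ i)"
      by (simp add: power_mult_distrib mult_ac)
  qed
  finally have T: "?u * poly (ac_poly T) (?u * x) = ?u ^ d * (\<Sum>i<d. to_ac (coeff P i) * x ^ i)"
    by (simp add: sum_distrib_left)
  have "0 = (\<Sum>i\<le>d. to_ac (coeff P i) * x ^ i)" using assms(3) by (simp add: poly_altdef d_def)
  also have "\<dots> = (\<Sum>i<d. to_ac (coeff P i) * x ^ i) + x ^ d"
    using assms(1) by (simp flip: lessThan_Suc_atMost add: d_def)
  finally have "(?u * x) ^ d + ?u ^ d * (\<Sum>i<d. to_ac (coeff P i) * x ^ i) = 0"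
    by (simp add: power_mult_distrib flip: distrib_left) (metis add.commute)
  then show ?thesis using T \<open>int_poly T\<close> unfolding d_def by auto
qed

lemma not_max_ideal_one_plus:
  assumes "y \<in> int_ring v"
  shows "(-1) ^ d + unif * y \<notin> max_ideal v"
proof
  assume "(-1) ^ d + unif * y \<in> max_ideal v"
  moreover have "unif * y \<in> max_ideal v" using assms max_ideal_iff by blast
  ultimately have "(-1) ^ d \<in> max_ideal v" unfolding max_ideal_def
    using val_ge_diff[of 1 "(-1) ^ d + unif * y" "unif * y"] by simp
  then have "(-1) ^ d * (-1) ^ d \<in> max_ideal v" unfolding max_ideal_def
    using val_ge_mult[of 1 "(-1) ^ d" 0 "(-1) ^ d"] int_ring_power[OF int_ring_minus[OF int_ring_1], of d]
    by (simp add: int_ring_def)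
  then show False using one_notin_max_ideal by (simp flip: power_mult_distrib)
qed

text \<open>A monic equation for the inverse of \<open>unif\<close>, scaled by \<open>unif\<close>,
  becomes \<open>1 + unif * T(1) = 0\<close>, which is impossible modulo the maximal ideal. So the
  uniformizer stays a non-unit in the integral closure.\<close>

lemma inverse_unif_not_integral: "\<not> integral (inverse (to_ac unif))"
proof
  assume "integral (inverse (to_ac unif))"
  then obtain P where P: "lead_coeff P = 1" "int_poly P" "poly (ac_poly P) (inverse (to_ac unif)) = 0"
    unfolding integral_def by blast
  from integral_scaled_poly[OF P] obtain T where T: "int_poly T" "1 + to_ac unif * poly (ac_poly T) 1 = 0"
    using unif by auto
  have "poly (ac_poly T) 1 = to_ac (poly T 1)" using to_ac.poly_map_poly[of T 1] by simp
  with T have "to_ac (1 + unif * poly T 1) = 0" by simp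
  then have "(-1) ^ 0 + unif * poly T 1 = 0" by (simp del: to_ac_add)
  moreover have "0 \<in> max_ideal v" by (simp add: max_ideal_def val_ge_def)
  ultimately show False using not_max_ideal_one_plus[of "poly T 1" 0] T(1) int_poly_poly by simp
qed

text \<open>The reversed polynomial, divided by the unit constant term of \<open>Q\<close>, is a
  monic integral equation for the inverse.\<close>

lemma integral_inverse:
  assumes Q: "int_poly Q" "poly (ac_poly Q) b = 0" "coeff Q 0 \<notin> max_ideal v"
  shows "b \<noteq> 0" "integral (inverse b)"
proof -
  define c where "c = coeff Q 0"
  have c: "c \<noteq> 0" "inverse c \<in> int_ring v"
    using unit_int_ring[of c] Q int_poly_coeff unfolding c_def by auto
  show b: "b \<noteq> 0" using Q(2) c(1) by (auto simp: poly_0_coeff_0 c_def)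
  define S where "S = smult (inverse c) (reflect_poly Q)"
  have r: "ac_poly (reflect_poly Q) = reflect_poly (ac_poly Q)"
    by (rule poly_eqI) (simp add: coeff_reflect_poly)
  have "degree S = degree Q" unfolding S_def using c by (simp add: c_def)
  then have "lead_coeff S = inverse c * coeff Q 0"
    unfolding S_def by (simp add: coeff_reflect_poly)
  then have "lead_coeff S = 1" using c by (simp add: c_def)
  moreover have "int_poly S" unfolding S_def
    using c(2) Q(1) by (intro int_poly_smult) (auto simp: int_poly_def coeff_reflect_poly)
  moreover have "poly (ac_poly S) (inverse b) = 0"
    unfolding S_def using b Q(2) by (simp add: ac_poly_simps r poly_reflect_poly_nz)
  ultimately show "integral (inverse b)" unfolding integral_def by blast
qed

text \<open>The scaled equation of \<open>unif * a\<close>, shifted by 1, has a constant term that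
  is a sign modulo \<open>unif\<close>, hence a unit.\<close>

lemma integral_one_plus_unif:
  assumes "integral a"
  shows "1 + to_ac unif * a \<noteq> 0" "integral (inverse (1 + to_ac unif * a))"
proof -
  obtain P where P: "lead_coeff P = 1" "int_poly P" "poly (ac_poly P) a = 0"
    using assms unfolding integral_def by blast
  obtain T where T: "int_poly T" "(to_ac unif * a) ^ degree P + to_ac unif * poly (ac_poly T) (to_ac unif * a) = 0"
    using integral_scaled_poly[OF P] by blast
  define Q where "Q = [:-1, 1:] ^ degree P + smult unif (pcompose T [:-1, 1:])"
  have iQ: "int_poly Q" unfolding Q_def
    by (intro int_poly_add int_poly_power int_poly_smult unif_int_ring int_poly_pcompose T(1))
       (auto intro: int_ring_minus)
  have pc: "ac_poly (pcompose T [:-1, 1:]) = pcompose (ac_poly T) [:-1, 1:]"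
    by (induction T) (auto simp: pcompose_pCons ac_poly_simps)
  have "poly (ac_poly Q) (1 + to_ac unif * a) = 0"
    unfolding Q_def using T(2) by (simp add: ac_poly_simps pc poly_pcompose)
  moreover have "coeff Q 0 \<notin> max_ideal v"
  proof -
    have "coeff Q 0 = (-1) ^ degree P + unif * poly T (-1)"
      unfolding poly_0_coeff_0[symmetric] Q_def by (simp add: poly_pcompose)
    then show ?thesis
      using not_max_ideal_one_plus[OF int_poly_poly[OF T(1)], of "-1" "degree P"] by (simp add: int_ring_minus)
  qed
  ultimately show "1 + to_ac unif * a \<noteq> 0" "integral (inverse (1 + to_ac unif * a))"
    using integral_inverse[OF iQ] by blast+
qed

end

text \<open>The map e \<mapsto> 3 e^2 - 2 e^3 is Newton's step for X^2 - X with 1 / (2 e - 1)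
  replaced by 2 e - 1, which is legitimate since (2 e - 1)^2 is 1 modulo the defect e^2 - e. No
  division occurs, and the defect gets squared.\<close>

lemma newton_idempotent:
  fixes e :: "'a::comm_ring_1"
  shows "(e * e - e) * (e * e - e) * (4 * e ^ 2 - 4 * e - 3) =
    (3 * e ^ 2 - 2 * e ^ 3) * (3 * e ^ 2 - 2 * e ^ 3) - (3 * e ^ 2 - 2 * e ^ 3)"
  by (simp add: power2_eq_square power3_eq_cube algebra_simps)

section \<open>Idempotents modulo a monic polynomial, and locality of the integral closure\<close>

context nonarch_local_field
begin

lemma smult_unif_power_exists:
  assumes "\<And>i. val_ge v (int k) (coeff f i)"
  shows "\<exists>g. int_poly g \<and> f = smult (unif ^ k) g"
proof -
  define g where "g = smult (inverse (unif ^ k)) f"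
  have "coeff g i \<in> int_ring v" for i
    using assms[of i] unif unfolding val_ge_iff g_def by (auto simp flip: mult.assoc)
  then have "int_poly g" by (simp add: int_poly_def)
  moreover have "f = smult (unif ^ k) g" unfolding g_def using unif by simp
  ultimately show ?thesis by blast
qed

lemma val_ge_coeff_smult_unif:
  "int_poly g \<Longrightarrow> val_ge v (int k) (coeff (smult (unif ^ k) g) i)"
  unfolding val_ge_iff by (auto intro: int_poly_coeff)

text \<open>Smallness in F[X] / (P), measured by powers of \<open>unif\<close>. The cofactor
  \<open>h\<close> may be any polynomial, so for monic integral \<open>P\<close> only the remainder
  counts, see \<open>cong_mod_iff\<close>.\<close>

definition cong_mod :: "'f poly \<Rightarrow> nat \<Rightarrow> 'f poly \<Rightarrow> bool" where
  "cong_mod P k f \<longleftrightarrow> (\<exists>g h. int_poly g \<and> f = smult (unif ^ k) g + P * h)"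

lemma cong_mod_add: "cong_mod P k f \<Longrightarrow> cong_mod P k g \<Longrightarrow> cong_mod P k (f + g)"
proof -
  assume "cong_mod P k f" "cong_mod P k g"
  then obtain a b c d where "int_poly a" "f = smult (unif ^ k) a + P * b"
    "int_poly c" "g = smult (unif ^ k) c + P * d" unfolding cong_mod_def by blast
  then show ?thesis unfolding cong_mod_def
    by (intro exI[of _ "a + c"] exI[of _ "b + d"]) (auto intro: int_poly_add simp: smult_add_right algebra_simps)
qed

lemma cong_mod_mult: "cong_mod P k f \<Longrightarrow> cong_mod P l g \<Longrightarrow> cong_mod P (k + l) (f * g)"
proof -
  assume "cong_mod P k f" "cong_mod P l g"
  then obtain a b c d where "int_poly a" and f: "f = smult (unif ^ k) a + P * b"
    and "int_poly c" and g: "g = smult (unif ^ l) c + P * d" unfolding cong_mod_def by blast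
  moreover have "f * g = smult (unif ^ (k + l)) (a * c) + P * (b * g + smult (unif ^ k) a * d)"
    unfolding f g by (simp add: algebra_simps power_add)
  ultimately show ?thesis unfolding cong_mod_def using int_poly_mult by blast
qed

lemma cong_mod_0: "int_poly f \<Longrightarrow> cong_mod P 0 f"
  unfolding cong_mod_def by (intro exI[of _ f] exI[of _ 0]) simp

lemma cong_mod_mono: "cong_mod P k f \<Longrightarrow> l \<le> k \<Longrightarrow> cong_mod P l f"
proof -
  assume "cong_mod P k f" "l \<le> k"
  then obtain a b where a: "int_poly a" "f = smult (unif ^ k) a + P * b" unfolding cong_mod_def by blast
  have "unif ^ k = unif ^ l * unif ^ (k - l)" using \<open>l \<le> k\<close> by (simp flip: power_add)
  then show ?thesis unfolding cong_mod_def using a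
    by (intro exI[of _ "smult (unif ^ (k - l)) a"] exI[of _ b]) (auto intro: int_poly_smult int_ring_power unif_int_ring)
qed

lemma cong_mod_iff:
  assumes P: "int_poly P" "lead_coeff P = 1"
  shows "cong_mod P k f \<longleftrightarrow> (\<forall>i. val_ge v (int k) (coeff (f mod P) i))"
proof
  assume "cong_mod P k f"
  then obtain g h where g: "int_poly g" "f = smult (unif ^ k) g + P * h" unfolding cong_mod_def by blast
  then have "f mod P = smult (unif ^ k) (g mod P)" by (simp add: poly_mod_add_left mod_smult_left)
  then show "\<forall>i. val_ge v (int k) (coeff (f mod P) i)"
    using val_ge_coeff_smult_unif[OF int_poly_mod[OF g(1) P]] by simp
next
  assume "\<forall>i. val_ge v (int k) (coeff (f mod P) i)"
  then obtain g where "int_poly g" "f mod P = smult (unif ^ k) g" using smult_unif_power_exists by blast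
  then show "cong_mod P k f" unfolding cong_mod_def
    by (intro exI[of _ g] exI[of _ "f div P"]) (simp flip: \<open>f mod P = smult (unif ^ k) g\<close>)
qed

lemma residue_class_eq:
  assumes "x \<in> int_ring v" "y \<in> int_ring v"
    "{(x, y). x \<in> int_ring v \<and> y \<in> int_ring v \<and> x - y \<in> max_ideal v} `` {x} =
     {(x, y). x \<in> int_ring v \<and> y \<in> int_ring v \<and> x - y \<in> max_ideal v} `` {y}"
  shows "x - y \<in> max_ideal v"
proof -
  have "y \<in> {(x, y). x \<in> int_ring v \<and> y \<in> int_ring v \<and> x - y \<in> max_ideal v} `` {y}"
    using assms(2) by (auto simp: max_ideal_def val_ge_def)
  then show ?thesis using assms(3) by auto
qed

text \<open>Pigeonhole: the residue field is finite, so there are finitely many tuples of residue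
  classes for the coefficients of a remainder, but infinitely many powers of X.\<close>

lemma power_congruent_power:
  assumes P: "int_poly P" "lead_coeff P = 1"
  shows "\<exists>i j. i < j \<and> cong_mod P 1 (monom 1 j - monom 1 i)"
proof -
  define cls where "cls x = {(x, y). x \<in> int_ring v \<and> y \<in> int_ring v \<and> x - y \<in> max_ideal v} `` {x}" for x
  define F where "F n = (\<lambda>i\<in>{..<degree P}. cls (coeff (monom 1 n mod P) i))" for n
  have ir: "int_poly (monom 1 n mod P)" for n by (intro int_poly_mod int_poly_monom P) simp
  have "F n \<in> {..<degree P} \<rightarrow>\<^sub>E residue_field v" for n
    unfolding F_def cls_def residue_field_def using ir int_poly_coeff by (auto simp: quotient_def)
  moreover have "finite ({..<degree P} \<rightarrow>\<^sub>E residue_field v)"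
    using finite_residue_field by (intro finite_PiE) auto
  ultimately have "finite (range F)" by (meson finite_subset image_subsetI)
  then have "\<not> inj F" using finite_imageD infinite_UNIV_nat by blast
  then obtain i j where ij: "F i = F j" "i < j"
    unfolding inj_def by (metis linorder_neqE_nat)
  have "val_ge v (int 1) (coeff ((monom 1 j - monom 1 i) mod P) l)" for l
  proof (cases "l < degree P")
    case True
    then have "cls (coeff (monom 1 j mod P) l) = cls (coeff (monom 1 i mod P) l)"
      using fun_cong[OF ij(1), of l] unfolding F_def by simp
    then have "coeff (monom 1 j mod P) l - coeff (monom 1 i mod P) l \<in> max_ideal v"
      unfolding cls_def by (intro residue_class_eq int_poly_coeff ir)
    then show ?thesis by (simp add: max_ideal_def poly_mod_diff_left)
  next
    case False
    have "degree P > 0 \<or> P = 1" using P(2) by (cases "degree P = 0") (auto elim: degree_eq_zeroE)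
    then show ?thesis
    proof
      assume "degree P > 0"
      then have "P \<noteq> 0" by auto
      then have "degree ((monom 1 j - monom 1 i) mod P) < degree P \<or> (monom 1 j - monom 1 i) mod P = 0"
        using degree_mod_less[of P] by blast
      then show ?thesis using False by (auto simp: coeff_eq_0 val_ge_def)
    qed (simp add: val_ge_def)
  qed
  then show ?thesis using ij(2) cong_mod_iff[OF P] by blast
qed

text \<open>An element of a finite semigroup has an idempotent power. From exponent \<open>i\<close>
  on, the powers of X are periodic with period \<open>t = j - i\<close>, so any multiple of
  \<open>t\<close> that is at least \<open>i\<close> serves as exponent; \<open>(i + 1) * t\<close>
  is one.\<close>

lemma idempotent_power_mod:
  assumes P: "int_poly P" "lead_coeff P = 1"
  shows "\<exists>N>0. cong_mod P 1 (monom 1 N * monom 1 N - monom 1 N)"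
proof -
  obtain i j where ij: "i < j" "cong_mod P 1 (monom 1 j - monom 1 i)"
    using power_congruent_power[OF P] by blast
  define t where "t = j - i"
  have shift: "cong_mod P 1 (monom 1 (n + s * t) - monom 1 n)" if "n \<ge> i" for n s
  proof (induction s)
    case 0
    then show ?case using cong_mod_mono[OF cong_mod_0[OF int_poly_0]]
      by (auto simp: cong_mod_def intro!: exI[of _ 0])
  next
    case (Suc s)
    have "cong_mod P (0 + 1) (monom 1 (n + s * t - i) * (monom 1 j - monom 1 i))"
      by (intro cong_mod_mult cong_mod_0 ij int_poly_monom) simp
    moreover have "n + s * t - i + j = n + Suc s * t" "n + s * t - i + i = n + s * t"
      using that ij(1) by (simp_all add: t_def)
    then have "monom 1 (n + s * t - i) * (monom 1 j - monom 1 i) = monom 1 (n + Suc s * t) - monom (1::'f) (n + s * t)"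
      by (simp add: right_diff_distrib mult_monom)
    ultimately show ?case using cong_mod_add[OF Suc, of "monom 1 (n + Suc s * t) - monom 1 (n + s * t)"] by simp
  qed
  have t: "t \<ge> 1" using ij(1) unfolding t_def by simp
  then have "(i + 1) * t \<ge> i + 1" by (metis mult.right_neutral mult_le_mono2)
  then show ?thesis using shift[of "(i + 1) * t" "i + 1"]
    by (intro exI[of _ "(i + 1) * t"]) (auto simp: mult_monom)
qed

text \<open>Newton's iteration for idempotents: with \<open>e' = 3 e^2 - 2 e^3\<close> one has
  \<open>e'^2 - e' = (e^2 - e)^2 (4 e^2 - 4 e - 3)\<close>.\<close>

lemma idempotent_lift:
  assumes P: "int_poly P" "lead_coeff P = 1" and e: "int_poly e" "cong_mod P 1 (e * e - e)"
  shows "\<exists>L. int_poly L \<and> cong_mod P 1 (L - e) \<and> P dvd L * L - L"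
proof -
  define E where "E = rec_nat e (\<lambda>_ f. 3 * f ^ 2 - 2 * f ^ 3)"
  have E0: "E 0 = e" and ES: "E (Suc k) = 3 * E k ^ 2 - 2 * E k ^ 3" for k unfolding E_def by simp_all
  have num: "int_poly (of_nat n)" for n by (induction n) (auto intro: int_poly_add)
  have num': "int_poly (numeral n)" for n using num[of "numeral n"] by simp
  have iE: "int_poly (E k)" for k
    by (induction k) (auto simp: E0 ES e intro!: int_poly_diff int_poly_mult int_poly_power num')
  have sq: "cong_mod P (Suc k) (E k * E k - E k)" for k
  proof (induction k)
    case (Suc k)
    have "cong_mod P (Suc k + Suc k + 0) ((E k * E k - E k) * (E k * E k - E k) * (4 * E k ^ 2 - 4 * E k - 3))"
      by (intro cong_mod_mult cong_mod_0 Suc int_poly_diff int_poly_mult int_poly_power num' iE)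
    moreover have "(E k * E k - E k) * (E k * E k - E k) * (4 * E k ^ 2 - 4 * E k - 3) =
        E (Suc k) * E (Suc k) - E (Suc k)"
      unfolding ES by (rule newton_idempotent)
    ultimately show ?case using cong_mod_mono by (metis add_Suc add.right_neutral le_add1 add_Suc_right)
  qed (use e(2) in \<open>simp add: E0\<close>)
  have step: "cong_mod P (Suc k) (E (Suc k) - E k)" for k
  proof -
    have "cong_mod P (Suc k + 0) ((E k * E k - E k) * (1 - 2 * E k))"
      by (intro cong_mod_mult cong_mod_0 sq int_poly_diff int_poly_mult num' iE) simp
    moreover have "(E k * E k - E k) * (1 - 2 * E k) = E (Suc k) - E k" unfolding ES
      by (simp add: algebra_simps power2_eq_square power3_eq_cube flip: mult_2)
    ultimately show ?thesis by simp
  qed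
  \<comment> \<open>Convergence is tested on remainders modulo \<open>P\<close>: their degrees are
    bounded, so a limit can be taken coefficient by coefficient.\<close>
  define r where "r k = E k mod P" for k
  have ir: "int_poly (r k)" for k unfolding r_def by (intro int_poly_mod iE P)
  have rstep: "val_ge v (int (Suc k)) (coeff (r (Suc k)) i - coeff (r k) i)" for k i
    using step[of k] unfolding cong_mod_iff[OF P] r_def by (simp add: poly_mod_diff_left)
  have rdiff: "val_ge v (int (Suc k)) (coeff (r (k + n)) i - coeff (r k) i)" for k n i
  proof (induction n)
    case (Suc n)
    have "val_ge v (int (Suc k)) (coeff (r (Suc (k + n))) i - coeff (r (k + n)) i)"
      using val_ge_mono[OF rstep[of "k + n" i]] by simp
    from val_add[OF this Suc] show ?case by simp
  qed (simp add: val_ge_def)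
  have cauchy: "\<exists>M. \<forall>a\<ge>M. \<forall>b\<ge>M. val_ge v n (coeff (r a) i - coeff (r b) i)" for n i
  proof (intro exI allI impI)
    fix a b assume "nat n \<le> a" "nat n \<le> b"
    then have "val_ge v n (coeff (r a) i - coeff (r (nat n)) i)" "val_ge v n (coeff (r b) i - coeff (r (nat n)) i)"
      using val_ge_mono[OF rdiff[of "nat n" "a - nat n" i]] val_ge_mono[OF rdiff[of "nat n" "b - nat n" i]] by auto
    from val_ge_diff[OF this] show "val_ge v n (coeff (r a) i - coeff (r b) i)" by simp
  qed
  \<comment> \<open>Completeness of F enters here.\<close>
  have "\<forall>i. \<exists>L. \<forall>n. \<exists>M::nat. \<forall>k\<ge>M. val_ge v n (coeff (r k) i - L)"
    using complete[OF cauchy] by blast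
  from choice[OF this] obtain l where l: "\<And>i n. \<exists>M::nat. \<forall>k\<ge>M. val_ge v n (coeff (r k) i - l i)" by blast
  have close: "val_ge v (int (Suc k)) (l i - coeff (r k) i)" for i k
  proof -
    obtain M where "val_ge v (int (Suc k)) (coeff (r (k + M)) i - l i)" using l[of "int (Suc k)" i] le_add2 by blast
    from val_ge_diff[OF rdiff[of k M i] this] show ?thesis by simp
  qed
  have rsmall: "coeff (r k) i = 0" if "degree P \<le> i" for k i
  proof (cases "r k = 0")
    case False
    have "P \<noteq> 0" using P(2) by auto
    then have "degree (r k) < degree P" using degree_mod_less[of P "E k"] False unfolding r_def by auto
    then show ?thesis using that by (simp add: coeff_eq_0)
  qed simp
  define L where "L = (\<Sum>i<degree P. monom (l i) i)"
  have cL: "coeff L i = (if i < degree P then l i else 0)" for i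
    unfolding L_def coeff_sum coeff_monom by (simp add: sum.delta)
  have Lr: "val_ge v (int (Suc k)) (coeff (L - r k) i)" for k i
    using close[of k i] rsmall[of i k] by (auto simp: cL val_ge_def)
  then have "\<forall>k. \<exists>g. int_poly g \<and> L - r k = smult (unif ^ Suc k) g" using smult_unif_power_exists by blast
  then obtain g where g: "\<And>k. int_poly (g k)" "\<And>k. L - r k = smult (unif ^ Suc k) (g k)" by metis
  have iL: "int_poly L"
  proof -
    have "L = r 0 + smult (unif ^ Suc 0) (g 0)" using g(2)[of 0] by (simp add: algebra_simps)
    then show ?thesis using ir g unif_int_ring by (auto intro!: int_poly_add int_poly_smult)
  qed
  have LE: "cong_mod P (Suc k) (L - E k)" for k
    unfolding cong_mod_def
  proof (intro exI conjI)
    show "int_poly (g k)" by (rule g)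
    have "E k = P * (E k div P) + r k" unfolding r_def by simp
    then show "L - E k = smult (unif ^ Suc k) (g k) + P * (- (E k div P))"
      using g(2)[of k] by (simp add: algebra_simps)
  qed
  have "cong_mod P (Suc k) (L * L - L)" for k
  proof -
    have "cong_mod P (Suc k + 0) ((L - E k) * (L + E k - 1))"
      by (intro cong_mod_mult cong_mod_0 LE int_poly_add int_poly_diff iL iE) simp
    from cong_mod_add[OF this[simplified] sq[of k]] show ?thesis by (simp add: algebra_simps)
  qed
  then have v: "val_ge v (int (Suc k)) (coeff ((L * L - L) mod P) i)" for i k
    unfolding cong_mod_iff[OF P] by blast
  \<comment> \<open>A nonzero coefficient would have valuation at least \<open>Suc k\<close> for
    every \<open>k\<close>; taking for \<open>k\<close> its own valuation is a
    contradiction.\<close>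
  have "coeff ((L * L - L) mod P) i = 0" for i
    using v[where k = "nat (v (coeff ((L * L - L) mod P) i))" and i = i]
    by (auto simp: val_ge_def split: if_splits)
  then have "P dvd L * L - L" by (simp add: dvd_eq_mod_eq_0 poly_eq_iff)
  then show ?thesis using iL LE[of 0] by (auto simp: E0)
qed

text \<open>An idempotent of F[X] / (P) takes the value 0 or 1 at a root of \<open>P\<close>.
  Lifting the idempotent power of X therefore decides which residue \<open>x ^ N\<close> has modulo
  \<open>unif\<close>. This stands in for an extension of the valuation.\<close>

lemma integral_dichotomy:
  assumes "integral x"
  shows "\<exists>N>0. \<exists>a. integral a \<and> (x ^ N = to_ac unif * a \<or> x ^ N = 1 + to_ac unif * a)"
proof -
  obtain P where P: "lead_coeff P = 1" "int_poly P" "poly (ac_poly P) x = 0"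
    using assms unfolding integral_def by blast
  obtain N where N: "N > 0" "cong_mod P 1 (monom 1 N * monom 1 N - monom 1 N)"
    using idempotent_power_mod[OF P(2,1)] by blast
  obtain L where L: "cong_mod P 1 (L - monom 1 N)" "P dvd L * L - L"
    using idempotent_lift[OF P(2,1) int_poly_monom N(2)] by auto
  obtain g h where g: "int_poly g" "L - monom 1 N = smult (unif ^ 1) g + P * h"
    using L(1) unfolding cong_mod_def by blast
  have "poly (ac_poly (L - monom 1 N)) x = to_ac unif * poly (ac_poly g) x"
    unfolding g(2) using P(3) by (simp add: ac_poly_simps)
  then have e: "x ^ N = poly (ac_poly L) x + to_ac unif * (- poly (ac_poly g) x)"
    by (simp add: ac_poly_simps poly_monom algebra_simps)
  obtain k where "L * L - L = P * k" using L(2) by (rule dvdE)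
  then have "poly (ac_poly (L * L - L)) x = 0" using P(3) by (simp add: ac_poly_simps)
  then have "poly (ac_poly L) x * (poly (ac_poly L) x - 1) = 0" by (simp add: ac_poly_simps algebra_simps)
  then have "poly (ac_poly L) x = 0 \<or> poly (ac_poly L) x = 1" by simp
  moreover have "integral (- poly (ac_poly g) x)" using integral_minus integral_poly[OF g(1) assms] by blast
  ultimately show ?thesis using e N(1) by (intro exI[of _ N]) auto
qed

text \<open>The radical of the ideal generated by \<open>unif\<close> in the integral closure. In
  this form closure under addition is a binomial computation; \<open>top_nilpotent_iff\<close>
  identifies it with the set of non-units.\<close>

definition top_nilpotent :: "'f alg_closure \<Rightarrow> bool" where
  "top_nilpotent x \<longleftrightarrow> integral x \<and> (\<exists>N>0. \<exists>a. integral a \<and> x ^ N = to_ac unif * a)"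

text \<open>If \<open>unif\<close> divides \<open>x ^ N\<close>, an integral inverse of
  \<open>x\<close> would make the inverse of \<open>unif\<close> integral. Otherwise the dichotomy
  gives \<open>x ^ N = 1 + unif * a\<close>, a unit, and then \<open>x\<close> is a unit as
  well.\<close>

lemma top_nilpotent_iff:
  "top_nilpotent x \<longleftrightarrow> integral x \<and> (x = 0 \<or> \<not> integral (inverse x))"
proof
  assume "top_nilpotent x"
  then obtain N a where N: "integral x" "N > 0" "integral a" "x ^ N = to_ac unif * a"
    unfolding top_nilpotent_def by blast
  have False if "x \<noteq> 0" "integral (inverse x)"
  proof -
    have "x ^ N * inverse x ^ N = 1" using that(1) by (simp flip: power_mult_distrib)
    then have "to_ac unif * (a * inverse x ^ N) = 1" using N(4) by (simp add: mult.assoc)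
    then have "inverse (to_ac unif) = a * inverse x ^ N" by (rule inverse_unique)
    then show False using inverse_unif_not_integral integral_add_mult(2)[OF N(3) integral_power[OF that(2)]] by simp
  qed
  then show "integral x \<and> (x = 0 \<or> \<not> integral (inverse x))" using N by blast
next
  assume x: "integral x \<and> (x = 0 \<or> \<not> integral (inverse x))"
  obtain N a where N: "N > 0" "integral a" "x ^ N = to_ac unif * a \<or> x ^ N = 1 + to_ac unif * a"
    using integral_dichotomy x by blast
  have False if e: "x ^ N = 1 + to_ac unif * a"
  proof -
    have "x \<noteq> 0" using integral_one_plus_unif(1)[OF N(2)] e N(1) by (metis zero_power)
    have "x ^ N = x ^ (N - 1) * x" using N(1) by (metis Suc_diff_1 power_Suc2)
    then have "inverse x = x ^ (N - 1) * inverse (x ^ N)" using \<open>x \<noteq> 0\<close> by (simp add: field_simps)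
    then have "integral (inverse x)" unfolding e
      using integral_one_plus_unif(2)[OF N(2)] integral_power[of x] x integral_add_mult(2) by metis
    then show False using x \<open>x \<noteq> 0\<close> by blast
  qed
  then show "top_nilpotent x" unfolding top_nilpotent_def using x N by blast
qed

lemma sep_max_ideal_iff: "x \<in> sep_max_ideal v \<longleftrightarrow> x \<in> sep_closure \<and> top_nilpotent x"
  using sep_closure_inverse[of x]
  by (auto simp: sep_max_ideal_def sep_int_ring_iff top_nilpotent_iff)

lemma top_nilpotent_0 [simp]: "top_nilpotent 0"
  by (simp add: top_nilpotent_iff)

lemma top_nilpotent_mult: "top_nilpotent x \<Longrightarrow> integral y \<Longrightarrow> top_nilpotent (x * y)"
  unfolding top_nilpotent_def
proof (elim conjE exE, intro conjI)
  fix N a assume *: "integral x" "integral y" "0 < N" "integral a" "x ^ N = to_ac unif * a"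
  then show "integral (x * y)" by (intro integral_add_mult)
  show "\<exists>N>0. \<exists>a. integral a \<and> (x * y) ^ N = to_ac unif * a"
    using * by (intro exI[of _ N] conjI exI[of _ "a * y ^ N"])
      (auto simp: power_mult_distrib mult.assoc intro: integral_add_mult integral_power)
qed

lemma top_nilpotent_minus: "top_nilpotent x \<Longrightarrow> top_nilpotent (- x)"
  using top_nilpotent_mult[of x "-1"] integral_minus[OF integral_1] by simp

text \<open>Every binomial term of \<open>(x + y) ^ (M + N)\<close> contains \<open>x ^ M\<close> or
  \<open>y ^ N\<close>. Together with \<open>top_nilpotent_iff\<close> this says that the integral
  closure is a local ring.\<close>

lemma top_nilpotent_add:
  assumes "top_nilpotent x" "top_nilpotent y"
  shows "top_nilpotent (x + y)"
proof -
  obtain M N a b where x: "integral x" "M > 0" "integral a" "x ^ M = to_ac unif * a"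
    and y: "integral y" "N > 0" "integral b" "y ^ N = to_ac unif * b"
    using assms unfolding top_nilpotent_def by blast
  have "\<exists>c. integral c \<and> of_nat ((M + N) choose i) * x ^ i * y ^ (M + N - i) = to_ac unif * c" for i
  proof (cases "i \<ge> M")
    case True
    then have "x ^ i = to_ac unif * a * x ^ (i - M)" using x(4) by (metis le_add_diff_inverse power_add)
    then show ?thesis
      by (intro exI[of _ "of_nat ((M + N) choose i) * a * x ^ (i - M) * y ^ (M + N - i)"])
         (auto simp: mult_ac intro!: integral_add_mult integral_power integral_of_nat x y)
  next
    case False
    then have "N \<le> M + N - i" by simp
    then have "y ^ (M + N - i) = to_ac unif * b * y ^ (M + N - i - N)"
      using y(4) by (metis le_add_diff_inverse power_add)
    then show ?thesis
      by (intro exI[of _ "of_nat ((M + N) choose i) * x ^ i * b * y ^ (M + N - i - N)"])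
         (auto simp: mult_ac intro!: integral_add_mult integral_power integral_of_nat x y)
  qed
  then obtain c where c: "integral (c i)" "of_nat ((M + N) choose i) * x ^ i * y ^ (M + N - i) = to_ac unif * c i" for i
    by metis
  have "(x + y) ^ (M + N) = to_ac unif * (\<Sum>i\<le>M + N. c i)"
    unfolding binomial_ring c(2) sum_distrib_left ..
  moreover have "integral (\<Sum>i\<le>M + N. c i)" using c(1) by (rule integral_sum)
  ultimately show ?thesis unfolding top_nilpotent_def
    using x y integral_add_mult(1)[of x y] by (metis add_gr_0)
qed

lemma top_nilpotent_power_cancel: "integral x \<Longrightarrow> top_nilpotent (x ^ n) \<Longrightarrow> top_nilpotent x"
proof -
  assume x: "integral x" "top_nilpotent (x ^ n)"
  then obtain N a where N: "N > 0" "integral a" "(x ^ n) ^ N = to_ac unif * a" unfolding top_nilpotent_def by blast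
  have "n \<noteq> 0" using x(2) by (metis top_nilpotent_iff integral_1 inverse_1 power_0 zero_neq_one)
  then show ?thesis unfolding top_nilpotent_def using x(1) N
    by (intro conjI exI[of _ "n * N"] exI[of _ a]) (simp_all add: power_mult)
qed

lemma top_nilpotent_to_ac_iff:
  assumes "a \<in> int_ring v"
  shows "top_nilpotent (to_ac a) \<longleftrightarrow> a \<in> max_ideal v"
proof
  assume "a \<in> max_ideal v"
  then obtain y where "y \<in> int_ring v" "a = unif * y" using max_ideal_iff by blast
  then show "top_nilpotent (to_ac a)" unfolding top_nilpotent_def
    using integral_to_ac[OF assms] integral_to_ac[of y]
    by (intro conjI exI[of _ 1] exI[of _ "to_ac y"]) auto
next
  assume t: "top_nilpotent (to_ac a)"
  show "a \<in> max_ideal v"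
  proof (rule ccontr)
    assume "a \<notin> max_ideal v"
    from unit_int_ring[OF assms this] show False
      using t integral_to_ac[of "inverse a"] by (simp add: top_nilpotent_iff)
  qed
qed

end

section \<open>The residue field and the Weil group\<close>

context nonarch_local_field
begin

text \<open>The order of the residue field is studied through its additive group, so that the
  theorems of Lagrange and Sylow apply.\<close>

definition add_grp :: "'f monoid" where
  "add_grp = \<lparr>carrier = int_ring v, monoid.mult = (+), one = 0\<rparr>"

lemma carrier_add_grp: "carrier add_grp = int_ring v"
  by (simp add: add_grp_def)

lemma comm_group_add_grp: "comm_group add_grp"
proof (rule comm_groupI)
  fix x assume "x \<in> carrier add_grp"
  then show "\<exists>y\<in>carrier add_grp. y \<otimes>\<^bsub>add_grp\<^esub> x = \<one>\<^bsub>add_grp\<^esub>"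
    by (intro bexI[of _ "- x"]) (auto simp: add_grp_def int_ring_minus)
qed (auto simp: add_grp_def int_ring_add)

sublocale add_grp: comm_group add_grp
  by (rule comm_group_add_grp)

lemma max_ideal_normal: "normal (max_ideal v) add_grp"
proof (rule add_grp.subgroup_imp_normal, rule add_grp.subgroupI)
  show "max_ideal v \<subseteq> carrier add_grp" using max_ideal_int_ring by (auto simp: add_grp_def)
  show "max_ideal v \<noteq> {}" by (auto simp: max_ideal_def val_ge_def)
  fix x y assume xy: "x \<in> max_ideal v" "y \<in> max_ideal v"
  then show "x \<otimes>\<^bsub>add_grp\<^esub> y \<in> max_ideal v" using val_add by (simp add: max_ideal_def add_grp_def)
  have "inv\<^bsub>add_grp\<^esub> x = - x"
    by (rule add_grp.inv_equality) (use max_ideal_int_ring[OF xy(1)] int_ring_minus in \<open>auto simp: add_grp_def\<close>)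
  then show "inv\<^bsub>add_grp\<^esub> x \<in> max_ideal v" using val_ge_minus xy(1) by (simp add: max_ideal_def)
qed

lemma r_coset_max_ideal: "max_ideal v #>\<^bsub>add_grp\<^esub> x = {y. y - x \<in> max_ideal v}"
  unfolding r_coset_def add_grp_def by (auto intro!: bexI[of _ "_ - x"])

lemma residue_field_eq: "residue_field v = carrier (add_grp Mod max_ideal v)"
proof -
  have "{(x, y). x \<in> int_ring v \<and> y \<in> int_ring v \<and> x - y \<in> max_ideal v} `` {x} = {y. y - x \<in> max_ideal v}"
    if "x \<in> int_ring v" for x
  proof -
    have "x - y \<in> max_ideal v \<longleftrightarrow> y - x \<in> max_ideal v" for y
      using val_ge_minus[of 1 "x - y"] val_ge_minus[of 1 "y - x"] by (auto simp: max_ideal_def)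
    moreover have "y \<in> int_ring v" if "y - x \<in> max_ideal v" for y
      using int_ring_add[OF max_ideal_int_ring[OF that] \<open>x \<in> int_ring v\<close>] by simp
    ultimately show ?thesis using that by auto
  qed
  then show ?thesis
    unfolding residue_field_def quotient_def FactGroup_def RCOSETS_def r_coset_max_ideal
    by (auto simp: add_grp_def)
qed

lemma group_residue: "group (add_grp Mod max_ideal v)"
  by (rule normal.factorgroup_is_group[OF max_ideal_normal])

lemma order_residue: "Coset.order (add_grp Mod max_ideal v) = residue_card v"
  by (simp add: Coset.order_def residue_card_def residue_field_eq)

lemma finite_residue: "finite (carrier (add_grp Mod max_ideal v))"
  using finite_residue_field residue_field_eq by simp

lemma add_grp_pow: "x [^]\<^bsub>add_grp\<^esub> (n::nat) = of_nat n * x"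
  by (induction n) (auto simp: add_grp_def algebra_simps)

lemma residue_pow:
  assumes "x \<in> int_ring v"
  shows "(max_ideal v #>\<^bsub>add_grp\<^esub> x) [^]\<^bsub>add_grp Mod max_ideal v\<^esub> (n::nat) = max_ideal v #>\<^bsub>add_grp\<^esub> (of_nat n * x)"
proof -
  interpret H: group_hom add_grp "add_grp Mod max_ideal v" "\<lambda>x. max_ideal v #>\<^bsub>add_grp\<^esub> x"
    using normal.r_coset_hom_Mod[OF max_ideal_normal] group_residue add_grp.is_group
    by (simp add: group_hom_def group_hom_axioms_def)
  show ?thesis using H.hom_nat_pow[of x n] assms by (simp add: add_grp_pow carrier_add_grp)
qed

lemma residue_coset_one_iff:
  "max_ideal v #>\<^bsub>add_grp\<^esub> x = \<one>\<^bsub>add_grp Mod max_ideal v\<^esub> \<longleftrightarrow> x \<in> max_ideal v"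
proof -
  have "{y. y - x \<in> max_ideal v} = max_ideal v \<longleftrightarrow> x \<in> max_ideal v"
  proof
    assume "{y. y - x \<in> max_ideal v} = max_ideal v"
    moreover have "x - x \<in> max_ideal v" by (simp add: max_ideal_def val_ge_def)
    ultimately show "x \<in> max_ideal v" by blast
  next
    assume x: "x \<in> max_ideal v"
    show "{y. y - x \<in> max_ideal v} = max_ideal v"
      using val_add[of 1 _ x] val_ge_diff[of 1 _ x] x unfolding max_ideal_def by fastforce
  qed
  then show ?thesis by (simp add: FactGroup_def r_coset_max_ideal)
qed

text \<open>Lagrange's theorem for the coset of 1.\<close>

lemma residue_card_in_max_ideal: "of_nat (residue_card v) \<in> max_ideal v"
proof -
  have "(max_ideal v #>\<^bsub>add_grp\<^esub> 1) [^]\<^bsub>add_grp Mod max_ideal v\<^esub> residue_card v = \<one>\<^bsub>add_grp Mod max_ideal v\<^esub>"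
  proof -
    have "max_ideal v #>\<^bsub>add_grp\<^esub> 1 \<in> carrier (add_grp Mod max_ideal v)"
      by (auto simp: FactGroup_def RCOSETS_def carrier_add_grp)
    then show ?thesis
      using group.pow_order_eq_1[OF group_residue, of "max_ideal v #>\<^bsub>add_grp\<^esub> 1"] order_residue by simp
  qed
  then show ?thesis using residue_pow[of 1] residue_coset_one_iff by simp
qed

lemma residue_card_pos: "residue_card v > 0"
  using finite_residue order_residue group.is_monoid[OF group_residue]
  by (metis Coset.order_def card_gt_0_iff empty_iff monoid.one_closed)

lemma residue_char: "residue_char v > 0" "of_nat (residue_char v) \<in> max_ideal v"
  using LeastI[of "\<lambda>n. 0 < n \<and> of_nat n \<in> max_ideal v" "residue_card v"]
    residue_card_pos residue_card_in_max_ideal unfolding residue_char_def by auto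

lemma max_ideal_multD:
  assumes "x \<in> int_ring v" "y \<in> int_ring v" "x * y \<in> max_ideal v"
  shows "x \<in> max_ideal v \<or> y \<in> max_ideal v"
proof (rule ccontr)
  assume "\<not> ?thesis"
  then have "x \<noteq> 0" "v x = 0" "y \<noteq> 0" "v y = 0" using unit_int_ring assms by auto
  then show False using val_mult[of x y] assms(3) by (simp add: max_ideal_def val_ge_def)
qed

lemma prime_residue_char: "prime (residue_char v)"
  unfolding prime_nat_iff
proof (intro conjI allI impI)
  have "residue_char v \<noteq> 1" using residue_char one_notin_max_ideal by auto
  then show "1 < residue_char v" using residue_char(1) by linarith
next
  fix m assume "m dvd residue_char v"
  then obtain k where k: "residue_char v = m * k" by (rule dvdE)
  have least: "residue_char v \<le> n" if "0 < n" "of_nat n \<in> max_ideal v" for n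
    unfolding residue_char_def using that by (intro Least_le) simp
  have "of_nat m * of_nat k \<in> max_ideal v" using residue_char(2) k by simp
  then have "of_nat m \<in> max_ideal v \<or> of_nat k \<in> max_ideal v"
    using max_ideal_multD int_ring_of_nat by blast
  moreover have pos: "m > 0" "k > 0" using residue_char(1) k by auto
  ultimately have "residue_char v \<le> m \<or> residue_char v \<le> k" using least by blast
  moreover have "m \<le> residue_char v" "k \<le> residue_char v" using pos k by simp_all
  ultimately have "m = residue_char v \<or> k = m * k" using k by linarith
  then show "m = 1 \<or> m = residue_char v" using pos by auto
qed

text \<open>Sylow gives a subgroup of order \<open>r\<close>. A nontrivial element of it is killed
  by \<open>r\<close> and, like every residue class, by the residue characteristic; two distinct
  primes would make it trivial.\<close>

lemma prime_dvd_residue_card: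
  assumes "prime r" "r dvd residue_card v"
  shows "r = residue_char v"
proof (rule ccontr)
  assume ne: "r \<noteq> residue_char v"
  let ?G = "add_grp Mod max_ideal v"
  interpret G: group ?G by (rule group_residue)
  obtain m where m: "residue_card v = r * m" using assms(2) by (rule dvdE)
  obtain H where H: "subgroup H ?G" "card H = r ^ 1"
    using sylow_thm[OF assms(1) group_residue _ finite_residue, of 1 m] order_residue m by auto
  have "card H > 1" using H assms(1) prime_gt_1_nat by simp
  have "\<exists>h\<in>H. h \<noteq> \<one>\<^bsub>?G\<^esub>"
  proof (rule ccontr)
    assume "\<not> ?thesis"
    then have "H \<subseteq> {\<one>\<^bsub>?G\<^esub>}" by blast
    then have "card H \<le> card {\<one>\<^bsub>?G\<^esub>}" by (intro card_mono) auto
    then show False using \<open>card H > 1\<close> by simp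
  qed
  then obtain h where h: "h \<in> H" "h \<noteq> \<one>\<^bsub>?G\<^esub>" by blast
  have hG: "h \<in> carrier ?G" using subgroup.mem_carrier[OF H(1) h(1)] .
  have "h [^]\<^bsub>?G\<lparr>carrier := H\<rparr>\<^esub> card H = \<one>\<^bsub>?G\<^esub>"
    using group.pow_order_eq_1[OF subgroup.subgroup_is_group[OF H(1) group_residue], of h] h(1) by (simp add: Coset.order_def)
  then have "h [^]\<^bsub>?G\<^esub> r = \<one>\<^bsub>?G\<^esub>" using H(2) by (simp add: nat_pow_def)
  then have "G.ord h dvd r" using G.pow_eq_id[OF hG] by blast
  moreover obtain x where x: "x \<in> int_ring v" "h = max_ideal v #>\<^bsub>add_grp\<^esub> x"
    using hG by (auto simp: FactGroup_def RCOSETS_def add_grp_def)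
  have "h [^]\<^bsub>?G\<^esub> residue_char v = \<one>\<^bsub>?G\<^esub>"
    unfolding x(2) residue_pow[OF x(1)] residue_coset_one_iff
    using residue_char(2) val_ge_mult[of 1 "of_nat (residue_char v)" 0 x] x(1)
    by (simp add: max_ideal_def int_ring_def)
  then have "G.ord h dvd residue_char v" using G.pow_eq_id[OF hG] by blast
  ultimately have "G.ord h = 1"
    using ne assms(1) prime_residue_char by (metis primes_dvd_imp_eq prime_nat_iff)
  then show False using G.ord_eq_1[OF hG] h(2) by blast
qed

lemma residue_card_prime_power: "\<exists>k>0. residue_card v = residue_char v ^ k"
proof -
  let ?p = "residue_char v"
  obtain m where m: "residue_card v = ?p ^ multiplicity ?p (residue_card v) * m" "\<not> ?p dvd m"
    using multiplicity_decompose'[of "residue_card v" ?p] residue_card_pos prime_residue_char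
    by (metis not_gr0 not_prime_unit)
  have "m = 1"
  proof (rule ccontr)
    assume "m \<noteq> 1"
    then obtain r where r: "prime r" "r dvd m" using prime_factor_nat by blast
    then have "r dvd residue_card v" using m(1) by (metis dvd_mult)
    from prime_dvd_residue_card[OF r(1) this] r(2) m(2) show False by simp
  qed
  then have e: "residue_card v = ?p ^ multiplicity ?p (residue_card v)" using m(1) by simp
  have "residue_card v \<noteq> 1" using residue_card_in_max_ideal one_notin_max_ideal by auto
  then have "multiplicity ?p (residue_card v) > 0" using e by (metis gr0I power_0)
  then show ?thesis using e by blast
qed

lemma residue_card_ge_2: "residue_card v \<ge> 2"
proof -
  have "residue_card v \<noteq> 1" using residue_card_in_max_ideal one_notin_max_ideal by auto
  then show ?thesis using residue_card_pos by linarith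
qed

section \<open>Congruence modulo the maximal ideal of the integral closure\<close>

definition res_eq :: "'f alg_closure \<Rightarrow> 'f alg_closure \<Rightarrow> bool" where
  "res_eq x y \<longleftrightarrow> integral x \<and> integral y \<and> top_nilpotent (x - y)"

lemma res_eq_sym: "res_eq x y \<Longrightarrow> res_eq y x"
  using top_nilpotent_minus[of "x - y"] by (auto simp: res_eq_def)

lemma res_eq_trans: "res_eq x y \<Longrightarrow> res_eq y z \<Longrightarrow> res_eq x z"
  using top_nilpotent_add[of "x - y" "y - z"] by (auto simp: res_eq_def)

lemma res_eq_power: "res_eq x y \<Longrightarrow> res_eq (x ^ n) (y ^ n)"
proof (induction n)
  case (Suc n)
  have "x ^ Suc n - y ^ Suc n = (x - y) * x ^ n + (x ^ n - y ^ n) * y" by (simp add: algebra_simps)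
  then show ?case using Suc unfolding res_eq_def
    by (metis integral_power top_nilpotent_add top_nilpotent_mult)
qed (simp add: res_eq_def)

lemma top_nilpotent_of_nat_iff: "top_nilpotent (of_nat n) \<longleftrightarrow> of_nat n \<in> max_ideal v"
  using top_nilpotent_to_ac_iff[OF int_ring_of_nat, of n] by simp

text \<open>The Frobenius map is additive modulo the maximal ideal: the inner binomial coefficients
  are multiples of the residue characteristic, which lies in that ideal.\<close>

lemma top_nilpotent_char_power:
  assumes "integral x" "integral y"
  shows "top_nilpotent ((x - y) ^ (residue_char v ^ k) - (x ^ (residue_char v ^ k) - y ^ (residue_char v ^ k)))"
proof -
  let ?p = "residue_char v"
  have p: "prime ?p" by (rule prime_residue_char)
  have one: "top_nilpotent ((x - y) ^ ?p - (x ^ ?p - y ^ ?p))" if xy: "integral x" "integral y" for x y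
  proof -
    have "(x - y) ^ ?p = (y + (x - y) - y) ^ ?p" by simp
    \<comment> \<open>Expanding \<open>x\<close> as \<open>y + (x - y)\<close> avoids the sign of
      \<open>(- y) ^ p\<close>, so that p = 2 is no special case.\<close>
    have e: "x ^ ?p = (\<Sum>i\<le>?p. of_nat (?p choose i) * y ^ i * (x - y) ^ (?p - i))"
      using binomial_ring[of y "x - y" ?p] by simp
    have "{..?p} = insert 0 (insert ?p {0<..<?p})" using residue_char(1) by auto
    then have "x ^ ?p = (x - y) ^ ?p + y ^ ?p + (\<Sum>i\<in>{0<..<?p}. of_nat (?p choose i) * y ^ i * (x - y) ^ (?p - i))"
      unfolding e using residue_char(1) by (simp add: algebra_simps)
    then have "(x - y) ^ ?p - (x ^ ?p - y ^ ?p) = - (\<Sum>i\<in>{0<..<?p}. of_nat (?p choose i) * y ^ i * (x - y) ^ (?p - i))"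
      by simp
    moreover have "top_nilpotent (\<Sum>i\<in>S. of_nat (?p choose i) * y ^ i * (x - y) ^ (?p - i))"
      if "finite S" "S \<subseteq> {0<..<?p}" for S
      using that
    proof (induction S)
      case (insert i S)
      then have "?p dvd (?p choose i)" by (intro dvd_choose_prime) (use p in auto)
      then obtain c where c: "?p choose i = ?p * c" by (rule dvdE)
      have "top_nilpotent (of_nat ?p * (of_nat c * y ^ i * (x - y) ^ (?p - i)))"
        using xy by (intro top_nilpotent_mult integral_add_mult integral_of_nat integral_power integral_diff)
          (simp_all add: top_nilpotent_of_nat_iff residue_char)
      then show ?case using insert c by (auto intro!: top_nilpotent_add simp: mult_ac)
    qed simp
    ultimately show ?thesis using top_nilpotent_minus by simp
  qed
  show ?thesis
  proof (induction k)
    case (Suc k)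
    let ?q = "?p ^ k"
    have i: "integral ((x - y) ^ ?q)" "integral (x ^ ?q)" "integral (y ^ ?q)"
      using assms by (auto intro: integral_power integral_diff)
    have "res_eq ((x - y) ^ ?q) (x ^ ?q - y ^ ?q)" unfolding res_eq_def using Suc i integral_diff by blast
    from res_eq_power[OF this, of ?p] one[OF i(2,3)]
    have "top_nilpotent ((((x - y) ^ ?q) ^ ?p - (x ^ ?q - y ^ ?q) ^ ?p) + ((x ^ ?q - y ^ ?q) ^ ?p - ((x ^ ?q) ^ ?p - (y ^ ?q) ^ ?p)))"
      unfolding res_eq_def by (intro top_nilpotent_add) auto
    then show ?case by (simp add: mult.commute algebra_simps flip: power_mult)
  qed simp
qed

text \<open>Frobenius is injective on the residue field of the closure, being additive with trivial
  kernel. Composing elements with Frobenius exponents of opposite signs leaves a surplus power on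
  both sides, which this removes.\<close>

lemma res_eq_cancel:
  assumes "integral x" "integral y" "res_eq (x ^ (residue_card v ^ n)) (y ^ (residue_card v ^ n))"
  shows "res_eq x y"
proof -
  obtain k where k: "residue_card v = residue_char v ^ k" using residue_card_prime_power by blast
  have "top_nilpotent ((x - y) ^ (residue_char v ^ (k * n)))"
    using top_nilpotent_add[OF top_nilpotent_char_power[OF assms(1,2), of "k * n"],
        of "x ^ residue_char v ^ (k * n) - y ^ residue_char v ^ (k * n)"] assms(3)
    unfolding res_eq_def k by (simp add: power_mult)
  then show ?thesis unfolding res_eq_def
    using top_nilpotent_power_cancel integral_diff assms by blast
qed

end

section \<open>Galois automorphisms and their Frobenius exponents\<close>

lemma galois_bij: "\<sigma> \<in> absolute_galois \<Longrightarrow> \<sigma> \<in> Bij sep_closure"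
  and galois_add: "\<sigma> \<in> absolute_galois \<Longrightarrow> x \<in> sep_closure \<Longrightarrow> y \<in> sep_closure \<Longrightarrow> \<sigma> (x + y) = \<sigma> x + \<sigma> y"
  and galois_mult: "\<sigma> \<in> absolute_galois \<Longrightarrow> x \<in> sep_closure \<Longrightarrow> y \<in> sep_closure \<Longrightarrow> \<sigma> (x * y) = \<sigma> x * \<sigma> y"
  and galois_to_ac: "\<sigma> \<in> absolute_galois \<Longrightarrow> \<sigma> (to_ac a) = to_ac a"
  by (simp_all add: absolute_galois_def)

lemma galois_closed: "\<sigma> \<in> absolute_galois \<Longrightarrow> x \<in> sep_closure \<Longrightarrow> \<sigma> x \<in> sep_closure"
  using Bij_imp_funcset[OF galois_bij] by blast

lemma galois_0: "\<sigma> \<in> absolute_galois \<Longrightarrow> \<sigma> 0 = 0"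
  using galois_to_ac[of \<sigma> 0] galois_to_ac[of \<sigma> 1] by simp_all

lemma poly_sep_closure: "x \<in> sep_closure \<Longrightarrow> poly (ac_poly P) x \<in> sep_closure"
  by (induction P) (auto simp: ac_poly_simps intro: sep_closure_add sep_closure_mult)

lemma galois_poly:
  assumes "\<sigma> \<in> absolute_galois" "x \<in> sep_closure"
  shows "poly (ac_poly P) (\<sigma> x) = \<sigma> (poly (ac_poly P) x)"
  by (induction P)
     (simp_all add: assms ac_poly_simps galois_0 galois_add galois_mult galois_to_ac poly_sep_closure sep_closure_mult)

lemma galois_one: "(\<lambda>x\<in>sep_closure. x) \<in> absolute_galois"
  using id_Bij[of sep_closure] by (simp add: absolute_galois_def sep_closure_add sep_closure_mult)

lemma galois_compose:
  assumes "\<sigma> \<in> absolute_galois" "\<tau> \<in> absolute_galois"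
  shows "compose sep_closure \<sigma> \<tau> \<in> absolute_galois"
  using assms compose_Bij[OF galois_bij galois_bij, of \<sigma> \<tau>] galois_closed[OF assms(2)]
  by (simp add: absolute_galois_def compose_eq sep_closure_add sep_closure_mult)

lemma galois_inv_into:
  assumes "\<sigma> \<in> absolute_galois"
  shows "restrict (inv_into sep_closure \<sigma>) sep_closure \<in> absolute_galois"
proof -
  have b: "bij_betw \<sigma> sep_closure sep_closure" using galois_bij[OF assms] by (simp add: Bij_def)
  let ?t = "inv_into sep_closure \<sigma>"
  have t: "?t x \<in> sep_closure" "\<sigma> (?t x) = x" if "x \<in> sep_closure" for x
    using bij_betw_inv_into[OF b] that bij_betw_inv_into_right[OF b] by (auto simp: bij_betw_def)
  have inj: "x = y" if "x \<in> sep_closure" "y \<in> sep_closure" "\<sigma> x = \<sigma> y" for x y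
    using b that by (auto simp: bij_betw_def inj_on_def)
  have "?t (x + y) = ?t x + ?t y" "?t (x * y) = ?t x * ?t y" if xy: "x \<in> sep_closure" "y \<in> sep_closure" for x y
  proof -
    note c = t(1)[OF xy(1)] t(1)[OF xy(2)]
    show "?t (x + y) = ?t x + ?t y"
      by (rule inj) (simp_all add: t xy c sep_closure_add galois_add[OF assms])
    show "?t (x * y) = ?t x * ?t y"
      by (rule inj) (simp_all add: t xy c sep_closure_mult galois_mult[OF assms])
  qed
  moreover have "?t (to_ac a) = to_ac a" for a
    by (rule inj) (simp_all add: t galois_to_ac[OF assms])
  ultimately show ?thesis
    using restrict_inv_into_Bij[OF galois_bij[OF assms]]
    by (simp add: absolute_galois_def sep_closure_add sep_closure_mult)
qed

lemma weil_carrier: "\<sigma> \<in> carrier (weil_group v) \<longleftrightarrow> \<sigma> \<in> absolute_galois \<and> (\<exists>n. frob_power v \<sigma> n)"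
  by (simp add: weil_group_def)

lemma weil_mult:
  "\<sigma> \<in> absolute_galois \<Longrightarrow> \<tau> \<in> absolute_galois \<Longrightarrow> \<sigma> \<otimes>\<^bsub>weil_group v\<^esub> \<tau> = compose sep_closure \<sigma> \<tau>"
  by (simp add: weil_group_def BijGroup_def galois_bij)

context nonarch_local_field
begin

lemma galois_integral: "\<sigma> \<in> absolute_galois \<Longrightarrow> x \<in> sep_closure \<Longrightarrow> integral x \<Longrightarrow> integral (\<sigma> x)"
  unfolding integral_def using galois_poly galois_0 by metis

lemma frob_power_iff:
  assumes "\<sigma> \<in> absolute_galois"
  shows "frob_power v \<sigma> n \<longleftrightarrow> (\<forall>x. x \<in> sep_closure \<and> integral x \<longrightarrow>
    res_eq (\<sigma> x ^ (residue_card v ^ nat (- n))) (x ^ (residue_card v ^ nat n)))"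
  by (auto simp: frob_power_def sep_int_ring_iff sep_max_ideal_iff res_eq_def
      intro!: integral_power sep_closure_diff sep_closure_power galois_integral[OF assms] galois_closed[OF assms])

lemma frob_power_compose:
  assumes "\<sigma> \<in> absolute_galois" "\<tau> \<in> absolute_galois" "frob_power v \<sigma> a" "frob_power v \<tau> b"
  shows "frob_power v (compose sep_closure \<sigma> \<tau>) (a + b)"
  unfolding frob_power_iff[OF galois_compose[OF assms(1,2)]]
proof (intro allI impI)
  fix x assume x: "x \<in> sep_closure \<and> integral x"
  let ?q = "residue_card v"
  have \<tau>x: "\<tau> x \<in> sep_closure" "integral (\<tau> x)"
    using x galois_closed[OF assms(2)] galois_integral[OF assms(2)] by auto
  have \<sigma>\<tau>x: "integral (\<sigma> (\<tau> x))" using \<tau>x galois_integral[OF assms(1)] by auto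
  have "res_eq ((\<sigma> (\<tau> x) ^ (?q ^ nat (- a))) ^ (?q ^ nat (- b))) ((\<tau> x ^ (?q ^ nat a)) ^ (?q ^ nat (- b)))"
    using assms(3) \<tau>x unfolding frob_power_iff[OF assms(1)] by (intro res_eq_power) blast
  also have "(\<tau> x ^ (?q ^ nat a)) ^ (?q ^ nat (- b)) = (\<tau> x ^ (?q ^ nat (- b))) ^ (?q ^ nat a)"
    by (simp add: mult.commute flip: power_mult)
  also have "res_eq \<dots> ((x ^ (?q ^ nat b)) ^ (?q ^ nat a))"
    using assms(4) x unfolding frob_power_iff[OF assms(2)] by (intro res_eq_power) blast
  finally (res_eq_trans) have e: "res_eq (\<sigma> (\<tau> x) ^ (?q ^ (nat (- a) + nat (- b)))) (x ^ (?q ^ (nat b + nat a)))"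
    by (simp add: power_add power_mult)
  \<comment> \<open>For exponents of opposite signs the positive and the negative parts both exceed
    those of \<open>a + b\<close>, and by the same amount \<open>t\<close>. This common Frobenius
    power is cancelled.\<close>
  define t where "t = nat (- a) + nat (- b) - nat (- (a + b))"
  have t: "nat (- a) + nat (- b) = nat (- (a + b)) + t" "nat b + nat a = nat (a + b) + t"
    unfolding t_def by linarith+
  have "res_eq ((\<sigma> (\<tau> x) ^ (?q ^ nat (- (a + b)))) ^ (?q ^ t)) ((x ^ (?q ^ nat (a + b))) ^ (?q ^ t))"
    using e unfolding t power_add power_mult .
  then have "res_eq (\<sigma> (\<tau> x) ^ (?q ^ nat (- (a + b)))) (x ^ (?q ^ nat (a + b)))"
    by (rule res_eq_cancel[OF integral_power[OF \<sigma>\<tau>x] integral_power[OF conjunct2[OF x]]])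
  then show "res_eq (compose sep_closure \<sigma> \<tau> x ^ (?q ^ nat (- (a + b)))) (x ^ (?q ^ nat (a + b)))"
    using x by (simp add: compose_eq)
qed

lemma frob_power_inv_into:
  assumes "\<sigma> \<in> absolute_galois" "frob_power v \<sigma> a"
  shows "frob_power v (restrict (inv_into sep_closure \<sigma>) sep_closure) (- a)"
  unfolding frob_power_iff[OF galois_inv_into[OF assms(1)]]
proof (intro allI impI)
  fix x assume x: "x \<in> sep_closure \<and> integral x"
  define y where "y = restrict (inv_into sep_closure \<sigma>) sep_closure x"
  have y: "y \<in> sep_closure" "integral y"
    using galois_closed[OF galois_inv_into[OF assms(1)]] galois_integral[OF galois_inv_into[OF assms(1)]] x
    unfolding y_def by auto
  have "\<sigma> y = x" unfolding y_def using x galois_bij[OF assms(1)]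
    by (auto simp: Bij_def intro: bij_betw_inv_into_right)
  then have "res_eq (x ^ (residue_card v ^ nat (- a))) (y ^ (residue_card v ^ nat a))"
    using assms(2) y unfolding frob_power_iff[OF assms(1)] by metis
  then show "res_eq (restrict (inv_into sep_closure \<sigma>) sep_closure x ^ (residue_card v ^ nat (- (- a))))
      (x ^ (residue_card v ^ nat (- a)))"
    unfolding y_def[symmetric] using res_eq_sym by simp
qed

lemma frob_power_one: "frob_power v (\<lambda>x\<in>sep_closure. x) 0"
  unfolding frob_power_iff[OF galois_one] by (simp add: res_eq_def)

lemma weil_subgroup: "subgroup (carrier (weil_group v)) (BijGroup sep_closure)"
proof (rule group.subgroupI[OF group_BijGroup])
  show "carrier (weil_group v) \<subseteq> carrier (BijGroup sep_closure)"
    using galois_bij by (auto simp: weil_carrier BijGroup_def)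
  show "carrier (weil_group v) \<noteq> {}"
    using galois_one frob_power_one weil_carrier by blast
  fix \<sigma> assume \<sigma>: "\<sigma> \<in> carrier (weil_group v)"
  then show "inv\<^bsub>BijGroup sep_closure\<^esub> \<sigma> \<in> carrier (weil_group v)"
    unfolding weil_carrier using inv_BijGroup[OF galois_bij, of \<sigma>] galois_inv_into frob_power_inv_into by metis
  fix \<tau> assume "\<tau> \<in> carrier (weil_group v)"
  then have "compose sep_closure \<sigma> \<tau> \<in> carrier (weil_group v)"
    using \<sigma> galois_compose frob_power_compose unfolding weil_carrier by blast
  then show "\<sigma> \<otimes>\<^bsub>BijGroup sep_closure\<^esub> \<tau> \<in> carrier (weil_group v)"
    using \<sigma> \<open>\<tau> \<in> carrier (weil_group v)\<close> by (simp add: BijGroup_def weil_carrier galois_bij)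
qed

lemma group_weil_group: "group (weil_group v)"
  using subgroup.subgroup_is_group[OF weil_subgroup group_BijGroup] by (simp add: weil_group_def)

text \<open>Two distinct exponents would make \<open>x ^ (q ^ s)\<close> and
  \<open>x ^ (q ^ t)\<close> congruent for all integral separable \<open>x\<close>. For roots of
  unity of order prime to p, congruence implies equality, and there are more of them than the degree
  of the resulting polynomial allows. The definite description in \<open>nu\<close> is thereby
  justified.\<close>

lemma frob_power_unique:
  assumes \<sigma>: "\<sigma> \<in> absolute_galois" and "frob_power v \<sigma> a" "frob_power v \<sigma> b"
  shows "a = b"
proof (rule ccontr)
  assume "a \<noteq> b"
  let ?q = "residue_card v"
  define s t where "s = nat a + nat (- b)" and "t = nat b + nat (- a)"
  have st: "s \<noteq> t" using \<open>a \<noteq> b\<close> unfolding s_def t_def by linarith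
  have eq: "res_eq (x ^ (?q ^ s)) (x ^ (?q ^ t))" if x: "x \<in> sep_closure" "integral x" for x
  proof -
    have 1: "res_eq ((\<sigma> x ^ (?q ^ nat (- a))) ^ (?q ^ nat (- b))) ((x ^ (?q ^ nat a)) ^ (?q ^ nat (- b)))"
      using assms(2) x unfolding frob_power_iff[OF \<sigma>] by (intro res_eq_power) blast
    have 2: "res_eq ((\<sigma> x ^ (?q ^ nat (- b))) ^ (?q ^ nat (- a))) ((x ^ (?q ^ nat b)) ^ (?q ^ nat (- a)))"
      using assms(3) x unfolding frob_power_iff[OF \<sigma>] by (intro res_eq_power) blast
    have 3: "(\<sigma> x ^ (?q ^ nat (- b))) ^ (?q ^ nat (- a)) = (\<sigma> x ^ (?q ^ nat (- a))) ^ (?q ^ nat (- b))"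
      by (simp add: mult.commute flip: power_mult)
    show ?thesis using res_eq_trans[OF res_eq_sym[OF 1] 2[unfolded 3]]
      by (simp add: s_def t_def power_add power_mult)
  qed
  \<comment> \<open>\<open>N\<close> is 1 modulo the maximal ideal, so X^N - 1 is separable, and
    \<open>N\<close> exceeds by one the bound \<open>q ^ (s + t)\<close> for the degree of
    \<open>Y\<close> below.\<close>
  define N where "N = ?q ^ (s + t) + 1"
  have "s + t > 0" using st by linarith
  then have "of_nat (?q ^ (s + t)) \<in> max_ideal v"
    using val_ge_mult[of 1 "of_nat ?q" 0 "of_nat ?q ^ (s + t - 1)"] residue_card_in_max_ideal
      int_ring_power[OF int_ring_of_nat[of ?q], of "s + t - 1"]
    by (cases "s + t") (auto simp: max_ideal_def int_ring_def)
  then have N: "of_nat N \<notin> max_ideal v"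
    using one_notin_max_ideal val_ge_diff[of 1 "of_nat N" "of_nat (?q ^ (s + t))"]
    unfolding N_def max_ideal_def by auto
  then have N0: "of_nat N \<noteq> (0 :: 'f)" by (auto simp: max_ideal_def val_ge_def)
  have "N > 0" unfolding N_def by simp
  define Z where "Z = monom (1::'f) N - 1"
  define R where "R = {x. poly (ac_poly Z) x = 0}"
  have R: "x \<in> R \<longleftrightarrow> x ^ N = 1" for x unfolding R_def Z_def by (simp add: ac_poly_simps poly_monom)
  have dZ: "pderiv Z = monom (of_nat N) (N - 1)" unfolding Z_def
    by (simp add: pderiv_diff pderiv_monom)
  have simple: "simple_roots (ac_poly Z)" unfolding simple_roots_def
  proof (intro allI impI)
    fix x assume "poly (ac_poly Z) x = 0"
    then have "x ^ N = 1" using R R_def by blast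
    then have "x \<noteq> 0" using \<open>N > 0\<close> by (cases N) auto
    then show "poly (pderiv (ac_poly Z)) x \<noteq> 0"
      using N0 by (simp flip: ac_poly_simps(7) to_ac_of_nat add: dZ ac_poly_simps poly_monom)
  qed
  have "degree Z = N"
  proof (rule antisym)
    show "degree Z \<le> N" unfolding Z_def by (intro degree_diff_le) (auto simp: degree_monom_le)
    show "N \<le> degree Z" using \<open>N > 0\<close> by (intro le_degree) (simp add: Z_def coeff_1)
  qed
  then have cR: "card R = N" unfolding R_def using card_simple_roots[OF simple] by simp
  have exact: "x ^ (?q ^ s) = x ^ (?q ^ t)" if "x \<in> R" for x
  proof (rule ccontr)
    assume ne: "x ^ (?q ^ s) \<noteq> x ^ (?q ^ t)"
    have "x ^ N = 1" using that R by blast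
    moreover from this have "x \<noteq> 0" using \<open>N > 0\<close> by (cases N) auto
    ultimately have x: "x ^ N = 1" "x \<noteq> 0" by simp_all
    have "x \<in> sep_closure" using that simple unfolding R_def sep_closure_iff by blast
    moreover have ix: "integral x" unfolding integral_def
      by (rule exI[of _ Z]) (use that \<open>degree Z = N\<close> \<open>N > 0\<close> in
        \<open>auto simp: Z_def R_def coeff_1 intro!: int_poly_diff int_poly_monom\<close>)
    ultimately have tn: "top_nilpotent (x ^ (?q ^ s) - x ^ (?q ^ t))" using eq by (simp add: res_eq_def)
    \<comment> \<open>\<open>w\<close> is the quotient of \<open>x ^ (q ^ s)\<close> by
      \<open>x ^ (q ^ t)\<close>; the inverse is written as a positive power by means of
      \<open>x ^ N = 1\<close>.\<close>
    define w where "w = x ^ (?q ^ s) * x ^ ((N - 1) * ?q ^ t)"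
    have inv: "x ^ (?q ^ t) * x ^ ((N - 1) * ?q ^ t) = 1"
    proof -
      have "?q ^ t + (N - 1) * ?q ^ t = N * ?q ^ t" using \<open>N > 0\<close> by (simp add: algebra_simps)
      then have "x ^ (?q ^ t) * x ^ ((N - 1) * ?q ^ t) = (x ^ N) ^ (?q ^ t)"
        by (simp only: flip: power_add power_mult)
      then show ?thesis using x(1) by simp
    qed
    have "w - 1 = (x ^ (?q ^ s) - x ^ (?q ^ t)) * x ^ ((N - 1) * ?q ^ t)"
      unfolding w_def using inv by (simp add: algebra_simps)
    then have tw: "top_nilpotent (w - 1)" using top_nilpotent_mult[OF tn integral_power[OF ix]] by simp
    have "w \<noteq> 1"
    proof
      assume "w = 1"
      then have "x ^ (?q ^ s) * x ^ ((N - 1) * ?q ^ t) = x ^ (?q ^ t) * x ^ ((N - 1) * ?q ^ t)"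
        using inv unfolding w_def by simp
      then show False using ne x(2) by simp
    qed
    have "w = x ^ (?q ^ s + (N - 1) * ?q ^ t)" unfolding w_def by (simp only: power_add)
    then have "w ^ N = (x ^ N) ^ (?q ^ s + (N - 1) * ?q ^ t)" by (simp only: mult.commute flip: power_mult)
    then have "w ^ N = 1" using x(1) by simp
    have iw: "integral w" unfolding w_def using ix by (intro integral_add_mult integral_power)
    \<comment> \<open>A root of unity \<open>w\<close> other than 1 makes the sum of its first
      \<open>N\<close> powers vanish, while \<open>w\<close> congruent to 1 makes that sum congruent
      to \<open>N\<close>, a unit.\<close>
    have "(w - 1) * (\<Sum>i<N. w ^ i) = 0" using \<open>w ^ N = 1\<close> power_diff_1_eq[of w N] by simp
    then have "(\<Sum>i<N. w ^ i) = 0" using \<open>w \<noteq> 1\<close> by simp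
    then have "of_nat N = - (\<Sum>i<N. w ^ i - 1)" by (simp add: sum_subtractf)
    moreover have "top_nilpotent (\<Sum>i<M. w ^ i - 1)" for M
    proof (induction M)
      case (Suc M)
      have "top_nilpotent ((w - 1) * (\<Sum>i<M. w ^ i))"
        using tw iw by (intro top_nilpotent_mult integral_sum integral_power)
      then show ?case using Suc top_nilpotent_add by (simp add: power_diff_1_eq)
    qed simp
    ultimately have "top_nilpotent (of_nat N)" using top_nilpotent_minus by metis
    then show False using N top_nilpotent_of_nat_iff by blast
  qed
  define Y where "Y = monom (1::'f alg_closure) (?q ^ s) - monom 1 (?q ^ t)"
  have "?q ^ s \<noteq> ?q ^ t" using st residue_card_ge_2 power_inject_exp by auto
  then have "coeff Y (?q ^ s) \<noteq> 0" unfolding Y_def by simp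
  then have "Y \<noteq> 0" by auto
  have "R \<subseteq> {x. poly Y x = 0}" using exact unfolding Y_def by (auto simp: poly_monom)
  then have "card R \<le> card {x. poly Y x = 0}" using poly_roots_finite[OF \<open>Y \<noteq> 0\<close>] by (intro card_mono)
  also have "\<dots> \<le> degree Y" using card_poly_roots_bound[OF \<open>Y \<noteq> 0\<close>] .
  also have "\<dots> \<le> ?q ^ (s + t)" unfolding Y_def
    using residue_card_ge_2 by (intro degree_diff_le order.trans[OF degree_monom_le] power_increasing) auto
  finally show False using cR unfolding N_def by simp
qed

section \<open>The character \<nu>\<close>

lemma nu_eq:
  assumes "\<sigma> \<in> absolute_galois" "frob_power v \<sigma> n"
  shows "nu v \<sigma> = (of_nat (residue_card v) powi n :: 'k::field)"
proof -
  have "(THE n. frob_power v \<sigma> n) = n" using assms frob_power_unique by (intro the_equality) auto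
  then show ?thesis by (simp add: nu_def)
qed

lemma nu_mult:
  assumes "\<sigma> \<in> carrier (weil_group v)" "\<tau> \<in> carrier (weil_group v)"
    and "of_nat (residue_card v) \<noteq> (0 :: 'k::field)"
  shows "nu v (\<sigma> \<otimes>\<^bsub>weil_group v\<^esub> \<tau>) = (nu v \<sigma> * nu v \<tau> :: 'k)"
proof -
  obtain a b where ab: "\<sigma> \<in> absolute_galois" "\<tau> \<in> absolute_galois" "frob_power v \<sigma> a" "frob_power v \<tau> b"
    using assms(1,2) weil_carrier by blast
  have "nu v (\<sigma> \<otimes>\<^bsub>weil_group v\<^esub> \<tau>) = (of_nat (residue_card v) :: 'k) powi (a + b)"
    using weil_mult[OF ab(1,2)] nu_eq[OF galois_compose[OF ab(1,2)] frob_power_compose[OF ab]] by simp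
  then show ?thesis using assms(3) by (simp add: power_int_add nu_eq[OF ab(1,3)] nu_eq[OF ab(2,4)])
qed

lemma nu_nonzero:
  assumes "\<sigma> \<in> carrier (weil_group v)" "of_nat (residue_card v) \<noteq> (0 :: 'k::field)"
  shows "nu v \<sigma> \<noteq> (0 :: 'k)"
proof -
  obtain a where "\<sigma> \<in> absolute_galois" "frob_power v \<sigma> a" using assms(1) weil_carrier by blast
  then show ?thesis using assms(2) by (simp add: nu_eq)
qed

lemma of_nat_prime_char_power:
  assumes "prime CHAR('k::field)"
  shows "(of_nat n :: 'k) ^ CHAR('k) = of_nat n"
proof (induction n)
  case 0
  then show ?case using assms prime_gt_0_nat by (simp add: zero_power)
next
  case (Suc n)
  have "(of_nat n + 1 :: 'k) ^ CHAR('k) = of_nat n ^ CHAR('k) + 1 ^ CHAR('k)"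
    by (rule freshmans_dream) (use assms in auto)
  then show ?case using Suc by (simp add: add.commute)
qed

text \<open>The values of \<nu> are powers of the integer q, so they lie in the prime field and are
  fixed by the l-th power map. The Jordan decomposition of \<open>U\<close> up to scalars rests on
  this.\<close>

lemma nu_power_char:
  assumes "\<sigma> \<in> carrier (weil_group v)" "prime CHAR('k::field)"
  shows "(nu v \<sigma> :: 'k) ^ CHAR('k) = nu v \<sigma>"
proof -
  obtain a where a: "\<sigma> \<in> absolute_galois" "frob_power v \<sigma> a" using assms(1) weil_carrier by blast
  have "((of_nat (residue_card v) :: 'k) powi a) ^ CHAR('k) = (of_nat (residue_card v) ^ CHAR('k)) powi a"
    by (metis mult.commute power_int_mult power_int_of_nat)
  then show ?thesis by (simp add: nu_eq[OF a] of_nat_prime_char_power[OF assms(2)])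
qed

text \<open>The residue characteristic is the only prime dividing q, so q is invertible in a field
  of any other prime characteristic.\<close>

lemma residue_card_nonzero:
  assumes "prime CHAR('k::field)" "CHAR('k) \<noteq> residue_char v"
  shows "of_nat (residue_card v) \<noteq> (0 :: 'k)"
  using prime_dvd_residue_card[OF assms(1)] assms(2) by (auto simp: of_nat_eq_0_iff_char_dvd)

lemma nu_one: "nu v \<one>\<^bsub>weil_group v\<^esub> = (1 :: 'k::field)"
  using nu_eq[OF galois_one frob_power_one] by (simp add: weil_group_def BijGroup_def)

lemma inertia_frob_power: "\<tau> \<in> inertia v \<Longrightarrow> frob_power v \<tau> 0"
  by (simp add: inertia_def frob_power_def)

lemma inertia_weil: "\<tau> \<in> inertia v \<Longrightarrow> \<tau> \<in> carrier (weil_group v)"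
  using inertia_frob_power by (auto simp: weil_carrier inertia_def)

lemma nu_inertia: "\<tau> \<in> inertia v \<Longrightarrow> nu v \<tau> = (1 :: 'k::field)"
  using nu_eq[of \<tau> 0] inertia_frob_power by (simp add: inertia_def)

lemma inertia_compose:
  assumes "\<sigma> \<in> inertia v" "\<tau> \<in> inertia v"
  shows "compose sep_closure \<sigma> \<tau> \<in> inertia v"
proof -
  have g: "\<sigma> \<in> absolute_galois" "\<tau> \<in> absolute_galois" using assms by (auto simp: inertia_def)
  have "compose sep_closure \<sigma> \<tau> x - x \<in> sep_max_ideal v" if x: "x \<in> sep_int_ring v" for x
  proof -
    have xs: "x \<in> sep_closure" "integral x" using x by (auto simp: sep_int_ring_iff)
    have "\<tau> x \<in> sep_int_ring v" using xs galois_closed[OF g(2)] galois_integral[OF g(2)] by (simp add: sep_int_ring_iff)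
    then have "\<sigma> (\<tau> x) - \<tau> x \<in> sep_max_ideal v" "\<tau> x - x \<in> sep_max_ideal v"
      using assms x by (auto simp: inertia_def)
    then have "(\<sigma> (\<tau> x) - \<tau> x) + (\<tau> x - x) \<in> sep_max_ideal v"
      unfolding sep_max_ideal_iff using sep_closure_add top_nilpotent_add by blast
    then show ?thesis using xs by (simp add: compose_eq)
  qed
  then show ?thesis using galois_compose[OF g] by (simp add: inertia_def)
qed

section \<open>The Weil topology\<close>

definition fixer :: "'f alg_closure set \<Rightarrow> 'f gal set" where
  "fixer A = {\<tau> \<in> inertia v. \<forall>a\<in>A. \<tau> a = a}"

text \<open>The pointwise stabilisers are closed under composition, so a left coset may be recentred
  at any of its elements.\<close>

lemma weil_coset_subset:
  assumes "\<sigma> \<in> carrier (weil_group v)" "\<tau> \<in> \<sigma> <#\<^bsub>weil_group v\<^esub> fixer A" "A \<subseteq> sep_closure"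
  shows "\<tau> <#\<^bsub>weil_group v\<^esub> fixer A \<subseteq> \<sigma> <#\<^bsub>weil_group v\<^esub> fixer A"
proof
  interpret W: group "weil_group v" by (rule group_weil_group)
  fix x assume "x \<in> \<tau> <#\<^bsub>weil_group v\<^esub> fixer A"
  then obtain h where h: "h \<in> fixer A" "x = \<tau> \<otimes>\<^bsub>weil_group v\<^esub> h" by (auto simp: l_coset_def)
  obtain k where k: "k \<in> fixer A" "\<tau> = \<sigma> \<otimes>\<^bsub>weil_group v\<^esub> k" using assms(2) by (auto simp: l_coset_def)
  have hk: "h \<in> inertia v" "k \<in> inertia v" using h k by (auto simp: fixer_def)
  have e: "k \<otimes>\<^bsub>weil_group v\<^esub> h = compose sep_closure k h"
    using hk by (intro weil_mult) (auto simp: inertia_def)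
  have "compose sep_closure k h \<in> fixer A"
    using inertia_compose[OF hk(2,1)] h(1) k(1) assms(3) by (auto simp: fixer_def compose_eq subset_iff)
  moreover have "x = \<sigma> \<otimes>\<^bsub>weil_group v\<^esub> (k \<otimes>\<^bsub>weil_group v\<^esub> h)"
    using h k hk inertia_weil assms(1) by (simp add: W.m_assoc)
  ultimately show "x \<in> \<sigma> <#\<^bsub>weil_group v\<^esub> fixer A" unfolding e by (auto simp: l_coset_def)
qed

lemma one_in_fixer: "A \<subseteq> sep_closure \<Longrightarrow> \<one>\<^bsub>weil_group v\<^esub> \<in> fixer A"
  using galois_one by (auto simp: fixer_def inertia_def weil_group_def BijGroup_def sep_int_ring_iff sep_max_ideal_iff subset_iff)

lemma mem_weil_coset:
  assumes "\<sigma> \<in> carrier (weil_group v)" "A \<subseteq> sep_closure"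
  shows "\<sigma> \<in> \<sigma> <#\<^bsub>weil_group v\<^esub> fixer A"
proof -
  interpret W: group "weil_group v" by (rule group_weil_group)
  show ?thesis using one_in_fixer[OF assms(2)] assms(1) by (force simp: l_coset_def)
qed

text \<open>The generating cosets form a basis: two of them through a point are refined by uniting
  the finite sets to be fixed. Openness thus becomes a condition on small left cosets at each
  point.\<close>

lemma openin_weil_iff:
  assumes "V \<subseteq> carrier (weil_group v)"
  shows "openin (weil_topology v) V \<longleftrightarrow>
    (\<forall>\<sigma>\<in>V. \<exists>A. finite A \<and> A \<subseteq> sep_closure \<and> \<sigma> <#\<^bsub>weil_group v\<^esub> fixer A \<subseteq> V)"
proof
  let ?B = "{\<sigma> <#\<^bsub>weil_group v\<^esub> {\<tau> \<in> inertia v. \<forall>a\<in>A. \<tau> a = a} | \<sigma> A.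
        \<sigma> \<in> carrier (weil_group v) \<and> finite A \<and> A \<subseteq> sep_closure}"
  assume "openin (weil_topology v) V"
  then have "generate_topology_on ?B V"
    by (simp add: weil_topology_def openin_topology_generated_by_iff)
  then show "\<forall>\<sigma>\<in>V. \<exists>A. finite A \<and> A \<subseteq> sep_closure \<and> \<sigma> <#\<^bsub>weil_group v\<^esub> fixer A \<subseteq> V"
  proof induction
    case (Int a b)
    show ?case
    proof
      fix \<sigma> assume "\<sigma> \<in> a \<inter> b"
      then have \<sigma>: "\<sigma> \<in> a" "\<sigma> \<in> b" by auto
      obtain A where A: "finite A" "A \<subseteq> sep_closure" "\<sigma> <#\<^bsub>weil_group v\<^esub> fixer A \<subseteq> a"
        using Int.IH(1) \<sigma>(1) by auto
      obtain B where B: "finite B" "B \<subseteq> sep_closure" "\<sigma> <#\<^bsub>weil_group v\<^esub> fixer B \<subseteq> b"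
        using Int.IH(2) \<sigma>(2) by auto
      have "\<sigma> <#\<^bsub>weil_group v\<^esub> fixer (A \<union> B) \<subseteq> (\<sigma> <#\<^bsub>weil_group v\<^esub> fixer A) \<inter> (\<sigma> <#\<^bsub>weil_group v\<^esub> fixer B)"
        by (auto simp: l_coset_def fixer_def)
      then show "\<exists>A. finite A \<and> A \<subseteq> sep_closure \<and> \<sigma> <#\<^bsub>weil_group v\<^esub> fixer A \<subseteq> a \<inter> b"
        using A B by (intro exI[of _ "A \<union> B"]) auto
    qed
  next
    case (UN K)
    show ?case
    proof
      fix \<sigma> assume "\<sigma> \<in> \<Union>K"
      then obtain k where k: "k \<in> K" "\<sigma> \<in> k" by blast
      with UN.IH[OF k(1)] obtain A where "finite A" "A \<subseteq> sep_closure" "\<sigma> <#\<^bsub>weil_group v\<^esub> fixer A \<subseteq> k"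
        by auto
      then show "\<exists>A. finite A \<and> A \<subseteq> sep_closure \<and> \<sigma> <#\<^bsub>weil_group v\<^esub> fixer A \<subseteq> \<Union>K"
        using k(1) by (intro exI[of _ A]) auto
    qed
  next
    case (Basis s)
    then obtain \<sigma> A where "s = \<sigma> <#\<^bsub>weil_group v\<^esub> fixer A" "\<sigma> \<in> carrier (weil_group v)" "finite A" "A \<subseteq> sep_closure"
      unfolding fixer_def by blast
    then show ?case using weil_coset_subset[of \<sigma> _ A] by auto
  qed simp
next
  assume *: "\<forall>\<sigma>\<in>V. \<exists>A. finite A \<and> A \<subseteq> sep_closure \<and> \<sigma> <#\<^bsub>weil_group v\<^esub> fixer A \<subseteq> V"
  define \<C> where "\<C> = {\<sigma> <#\<^bsub>weil_group v\<^esub> fixer A | \<sigma> A. \<sigma> \<in> V \<and> finite A \<and> A \<subseteq> sep_closure \<and> \<sigma> <#\<^bsub>weil_group v\<^esub> fixer A \<subseteq> V}"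
  have "V = \<Union>\<C>"
  proof
    show "V \<subseteq> \<Union>\<C>"
    proof
      fix \<sigma> assume \<sigma>: "\<sigma> \<in> V"
      then obtain A where "finite A" "A \<subseteq> sep_closure" "\<sigma> <#\<^bsub>weil_group v\<^esub> fixer A \<subseteq> V" using * by blast
      then show "\<sigma> \<in> \<Union>\<C>" unfolding \<C>_def using \<sigma> mem_weil_coset[of \<sigma> A] assms by blast
    qed
  qed (auto simp: \<C>_def)
  moreover have "openin (weil_topology v) C" if "C \<in> \<C>" for C
    using that assms unfolding \<C>_def weil_topology_def
    by (intro topology_generated_by_Basis) (auto simp: fixer_def)
  ultimately show "openin (weil_topology v) V" by (metis openin_Union)
qed

text \<open>An open stabiliser contains some \<open>fixer A\<close>, and any condition invariant
  under right translation by it is open. The application is to twists, which do not change the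
  action of inertia because \<nu> is trivial there.\<close>

lemma openin_twisted_stabilizer:
  fixes act' :: "'f gal \<Rightarrow> 'b"
  assumes op: "openin (weil_topology v) {\<sigma> \<in> carrier (weil_group v). h \<sigma> = x}"
    and one: "h \<one>\<^bsub>weil_group v\<^esub> = x"
    and coset: "\<And>\<sigma> \<tau>. \<sigma> \<in> carrier (weil_group v) \<Longrightarrow> P \<sigma> \<Longrightarrow> \<tau> \<in> inertia v \<Longrightarrow> h \<tau> = x \<Longrightarrow>
      P (\<sigma> \<otimes>\<^bsub>weil_group v\<^esub> \<tau>)"
  shows "openin (weil_topology v) {\<sigma> \<in> carrier (weil_group v). P \<sigma>}"
proof -
  interpret W: group "weil_group v" by (rule group_weil_group)
  obtain A where A: "finite A" "A \<subseteq> sep_closure"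
    "\<one>\<^bsub>weil_group v\<^esub> <#\<^bsub>weil_group v\<^esub> fixer A \<subseteq> {\<sigma> \<in> carrier (weil_group v). h \<sigma> = x}"
    using op one openin_weil_iff[of "{\<sigma> \<in> carrier (weil_group v). h \<sigma> = x}"] W.one_closed by blast
  have "h \<tau> = x" if "\<tau> \<in> fixer A" for \<tau>
    using A(3) that inertia_weil by (force simp: l_coset_def fixer_def)
  then have "\<sigma> <#\<^bsub>weil_group v\<^esub> fixer A \<subseteq> {\<sigma> \<in> carrier (weil_group v). P \<sigma>}"
    if "\<sigma> \<in> carrier (weil_group v)" "P \<sigma>" for \<sigma>
    using that coset inertia_weil W.m_closed by (auto simp: l_coset_def fixer_def)
  then show ?thesis using A(1,2) by (subst openin_weil_iff) auto
qed

end

section \<open>Linear algebra with operators\<close>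

locale linear_space = vector_space scale
  for scale :: "'k::field \<Rightarrow> 'b::ab_group_add \<Rightarrow> 'b"
begin

abbreviation lsub :: "'b set \<Rightarrow> bool" where "lsub \<equiv> module.subspace scale"

text \<open>Linearity is demanded on \<open>V\<close> only, to match representations carried by a
  subspace of an ambient type.\<close>

definition endo :: "'b set \<Rightarrow> ('b \<Rightarrow> 'b) \<Rightarrow> bool" where
  "endo V f \<longleftrightarrow> (\<forall>x\<in>V. f x \<in> V) \<and> (\<forall>x\<in>V. \<forall>y\<in>V. f (x + y) = f x + f y) \<and>
     (\<forall>c. \<forall>x\<in>V. f (scale c x) = scale c (f x))"

lemma endo_closed: "endo V f \<Longrightarrow> x \<in> V \<Longrightarrow> f x \<in> V"
  and endo_add: "endo V f \<Longrightarrow> x \<in> V \<Longrightarrow> y \<in> V \<Longrightarrow> f (x + y) = f x + f y"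
  and endo_scale: "endo V f \<Longrightarrow> x \<in> V \<Longrightarrow> f (scale c x) = scale c (f x)"
  by (simp_all add: endo_def)

lemma endo_0: "endo V f \<Longrightarrow> lsub V \<Longrightarrow> f 0 = 0"
  using endo_scale[of V f 0 0] subspace_0[of V] by simp

lemma endo_minus: "endo V f \<Longrightarrow> lsub V \<Longrightarrow> x \<in> V \<Longrightarrow> f (- x) = - f x"
  using endo_scale[of V f x "- 1"] by simp

lemma endo_diff: "endo V f \<Longrightarrow> lsub V \<Longrightarrow> x \<in> V \<Longrightarrow> y \<in> V \<Longrightarrow> f (x - y) = f x - f y"
  using endo_add[of V f x "- y"] endo_minus[of V f y] subspace_neg[of V y] by simp

lemma endo_sum:
  assumes "endo V f" "lsub V" "\<And>i. i \<in> A \<Longrightarrow> x i \<in> V"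
  shows "f (\<Sum>i\<in>A. x i) = (\<Sum>i\<in>A. f (x i))"
  using assms(3)
  by (induction A rule: infinite_finite_induct)
     (auto simp: endo_0[OF assms(1,2)] endo_add[OF assms(1)] subspace_sum[OF assms(2)])

lemma endo_funpow: "endo V f \<Longrightarrow> endo V (f ^^ n)"
  by (induction n) (auto simp: endo_def)

lemma endo_funpow_closed: "endo V f \<Longrightarrow> x \<in> V \<Longrightarrow> (f ^^ n) x \<in> V"
  using endo_closed endo_funpow by blast

lemma funpow_eq_0_mono:
  assumes "endo V f" "lsub V" "(f ^^ m) x = 0" "m \<le> n"
  shows "(f ^^ n) x = 0"
proof -
  have "(f ^^ n) x = (f ^^ (n - m)) ((f ^^ m) x)"
    using assms(4) by (simp flip: funpow_add[THEN fun_cong, unfolded comp_def])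
  then show ?thesis using assms endo_0[OF endo_funpow] by simp
qed

text \<open>Each factor \<open>N\<close> moved past \<open>g\<close> contributes one scalar. For a
  nonzero scalar \<open>c\<close> in the prime field, the power l - 1 therefore commutes with
  \<open>g\<close>, and the power l ^ e again picks up \<open>c\<close>.\<close>

lemma funpow_quasi_commute:
  assumes "endo V g" "endo V N" "\<And>x. x \<in> V \<Longrightarrow> g (N x) = scale c (N (g x))" "x \<in> V"
  shows "g ((N ^^ n) x) = scale (c ^ n) ((N ^^ n) (g x))"
proof (induction n)
  case (Suc n)
  have "g ((N ^^ Suc n) x) = scale c (N (g ((N ^^ n) x)))"
    using assms(3)[OF endo_funpow_closed[OF assms(2,4)]] by simp
  also have "\<dots> = scale c (N (scale (c ^ n) ((N ^^ n) (g x))))" by (simp add: Suc)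
  also have "\<dots> = scale (c ^ Suc n) ((N ^^ Suc n) (g x))"
    using endo_scale[OF assms(2) endo_funpow_closed[OF assms(2) endo_closed[OF assms(1,4)]]] by simp
  finally show ?case .
qed simp

section \<open>Subspaces stable under a set of operators\<close>

definition closed_under :: "('b \<Rightarrow> 'b) set \<Rightarrow> 'b set \<Rightarrow> 'b set \<Rightarrow> bool" where
  "closed_under \<Gamma> V S \<longleftrightarrow> lsub S \<and> S \<subseteq> V \<and> (\<forall>g\<in>\<Gamma>. \<forall>x\<in>S. g x \<in> S)"

definition complements :: "'b set \<Rightarrow> 'b set \<Rightarrow> 'b set \<Rightarrow> bool" where
  "complements V S T \<longleftrightarrow> S \<inter> T = {0} \<and> (\<forall>x\<in>V. \<exists>s\<in>S. \<exists>t\<in>T. x = s + t)"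

definition completely_reducible :: "('b \<Rightarrow> 'b) set \<Rightarrow> 'b set \<Rightarrow> bool" where
  "completely_reducible \<Gamma> V \<longleftrightarrow> (\<forall>S. closed_under \<Gamma> V S \<longrightarrow> (\<exists>T. closed_under \<Gamma> V T \<and> complements V S T))"

definition irred :: "('b \<Rightarrow> 'b) set \<Rightarrow> 'b set \<Rightarrow> bool" where
  "irred \<Gamma> S \<longleftrightarrow> S \<noteq> {0} \<and> (\<forall>T. closed_under \<Gamma> S T \<longrightarrow> T = {0} \<or> T = S)"

definition indecomp :: "('b \<Rightarrow> 'b) set \<Rightarrow> 'b set \<Rightarrow> bool" where
  "indecomp \<Gamma> V \<longleftrightarrow> V \<noteq> {0} \<and>
     (\<forall>S T. closed_under \<Gamma> V S \<longrightarrow> closed_under \<Gamma> V T \<longrightarrow> complements V S T \<longrightarrow> S = {0} \<or> T = {0})"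

lemma closed_under_subspace: "closed_under \<Gamma> V S \<Longrightarrow> lsub S"
  and closed_under_subset: "closed_under \<Gamma> V S \<Longrightarrow> S \<subseteq> V"
  and closed_under_closed: "closed_under \<Gamma> V S \<Longrightarrow> g \<in> \<Gamma> \<Longrightarrow> x \<in> S \<Longrightarrow> g x \<in> S"
  by (auto simp: closed_under_def)

lemma closed_under_trans: "closed_under \<Gamma> V S \<Longrightarrow> closed_under \<Gamma> S T \<Longrightarrow> closed_under \<Gamma> V T"
  by (auto simp: closed_under_def)

lemma closed_under_plus:
  assumes "\<And>g. g \<in> \<Gamma> \<Longrightarrow> endo V g" "lsub V" "closed_under \<Gamma> V S" "closed_under \<Gamma> V T"
  shows "closed_under \<Gamma> V {s + t | s t. s \<in> S \<and> t \<in> T}"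
  unfolding closed_under_def
proof (intro conjI ballI)
  show "lsub {s + t | s t. s \<in> S \<and> t \<in> T}"
    using assms(3,4) by (intro subspace_sums) (auto simp: closed_under_def)
  show "{s + t | s t. s \<in> S \<and> t \<in> T} \<subseteq> V"
    using assms(3,4) subspace_add[OF assms(2)] by (auto simp: closed_under_def subset_iff)
  fix g x assume g: "g \<in> \<Gamma>" "x \<in> {s + t | s t. s \<in> S \<and> t \<in> T}"
  then obtain s t where st: "x = s + t" "s \<in> S" "t \<in> T" by blast
  have "s \<in> V" "t \<in> V" using st assms(3,4) by (auto simp: closed_under_def)
  then have "g x = g s + g t" using st endo_add[OF assms(1)[OF g(1)]] by simp
  then show "g x \<in> {s + t | s t. s \<in> S \<and> t \<in> T}" using st g assms(3,4) closed_under_closed by blast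
qed

lemma closed_under_chain_Union:
  assumes "C \<noteq> {}" "\<And>M. M \<in> C \<Longrightarrow> closed_under \<Gamma> V M" "\<And>M N. M \<in> C \<Longrightarrow> N \<in> C \<Longrightarrow> M \<subseteq> N \<or> N \<subseteq> M"
  shows "closed_under \<Gamma> V (\<Union>C)"
  unfolding closed_under_def
proof (intro conjI ballI)
  show "lsub (\<Union>C)"
  proof (rule subspaceI)
    show "0 \<in> \<Union>C" using assms(1,2) subspace_0 closed_under_subspace by blast
    fix x y assume "x \<in> \<Union>C" "y \<in> \<Union>C"
    then obtain M N where "x \<in> M" "M \<in> C" "y \<in> N" "N \<in> C" by blast
    then show "x + y \<in> \<Union>C" using assms(2,3) closed_under_subspace subspace_add by (metis UnionI subsetD)
  next
    fix c x assume "x \<in> \<Union>C"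
    then show "scale c x \<in> \<Union>C" using assms(2) closed_under_subspace subspace_scale by blast
  qed
next
  show "\<Union>C \<subseteq> V" using assms(2) closed_under_subset by blast
  fix g x assume "g \<in> \<Gamma>" "x \<in> \<Union>C"
  then show "g x \<in> \<Union>C" using assms(2) closed_under_closed by blast
qed

text \<open>Zorn's lemma: unions of chains of stable subspaces are stable, so only the side
  condition \<open>P\<close> has to be shown to survive unions.\<close>

lemma maximal_closed_under:
  assumes "closed_under \<Gamma> V K" "P K"
    and chain: "\<And>C. C \<noteq> {} \<Longrightarrow> (\<And>M. M \<in> C \<Longrightarrow> closed_under \<Gamma> V M \<and> K \<subseteq> M \<and> P M) \<Longrightarrow> P (\<Union>C)"
  shows "\<exists>M. closed_under \<Gamma> V M \<and> K \<subseteq> M \<and> P M \<and> (\<forall>M'. closed_under \<Gamma> V M' \<longrightarrow> M \<subseteq> M' \<longrightarrow> P M' \<longrightarrow> M' = M)"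
proof -
  define \<A> where "\<A> = {M. closed_under \<Gamma> V M \<and> K \<subseteq> M \<and> P M}"
  have "\<exists>M\<in>\<A>. \<forall>M'\<in>\<A>. M \<subseteq> M' \<longrightarrow> M' = M"
  proof (rule subset_Zorn_nonempty)
    show "\<A> \<noteq> {}" using assms(1,2) unfolding \<A>_def by blast
    fix C assume C: "C \<noteq> {}" "subset.chain \<A> C"
    then have "C \<subseteq> \<A>" and tot: "\<And>M N. M \<in> C \<Longrightarrow> N \<in> C \<Longrightarrow> M \<subseteq> N \<or> N \<subseteq> M"
      by (simp_all add: subset_chain_def)
    then have c: "\<And>M. M \<in> C \<Longrightarrow> closed_under \<Gamma> V M \<and> K \<subseteq> M \<and> P M" unfolding \<A>_def by blast
    have "closed_under \<Gamma> V (\<Union>C)" by (rule closed_under_chain_Union[OF C(1) conjunct1[OF c] tot])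
    moreover have "K \<subseteq> \<Union>C" using c C(1) by (meson Union_upper equals0I order_trans)
    moreover have "P (\<Union>C)" by (rule chain[OF C(1) c])
    ultimately show "\<Union>C \<in> \<A>" unfolding \<A>_def by simp
  qed
  then obtain M where M: "M \<in> \<A>" "\<And>M'. M' \<in> \<A> \<Longrightarrow> M \<subseteq> M' \<Longrightarrow> M' = M" by blast
  have "M' = M" if "closed_under \<Gamma> V M'" "M \<subseteq> M'" "P M'" for M'
    using M that unfolding \<A>_def by auto
  then show ?thesis using M(1) unfolding \<A>_def by (intro exI[of _ M]) simp
qed

text \<open>Modular law: a complement of \<open>A\<close> in \<open>V\<close>, intersected with
  \<open>S\<close>, is a complement of \<open>A\<close> in \<open>S\<close>.\<close>

lemma completely_reducible_sub:
  assumes "completely_reducible \<Gamma> V" "closed_under \<Gamma> V S"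
  shows "completely_reducible \<Gamma> S"
  unfolding completely_reducible_def
proof (intro allI impI)
  fix A assume A: "closed_under \<Gamma> S A"
  then obtain T where T: "closed_under \<Gamma> V T" "complements V A T"
    using assms closed_under_trans unfolding completely_reducible_def by blast
  have "closed_under \<Gamma> S (S \<inter> T)"
    using T(1) assms(2) by (auto simp: closed_under_def intro: subspace_inter)
  moreover have "complements S A (S \<inter> T)"
    unfolding complements_def
  proof (intro conjI ballI)
    show "A \<inter> (S \<inter> T) = {0}" using T(2) A subspace_0 closed_under_subspace assms(2) unfolding complements_def by blast
    fix x assume x: "x \<in> S"
    then obtain a t where at: "a \<in> A" "t \<in> T" "x = a + t"
      using T(2) assms(2) closed_under_subset unfolding complements_def by blast
    have "t = x - a" using at by simp
    then have "t \<in> S" using x at(1) A subspace_diff[OF closed_under_subspace[OF assms(2)]] closed_under_subset by blast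
    then show "\<exists>s\<in>A. \<exists>t\<in>S \<inter> T. x = s + t" using at by blast
  qed
  ultimately show "\<exists>T. closed_under \<Gamma> S T \<and> complements S A T" by blast
qed

text \<open>Let \<open>M\<close> be maximal among the stable subspaces that contain \<open>K\<close>
  and miss a fixed vector \<open>x\<close>. A complement \<open>S\<close> of \<open>M\<close> is
  irreducible: if it were the sum of nonzero stable \<open>A\<close> and \<open>B\<close> meeting in
  0, maximality would put \<open>x\<close> into both M + A and M + B, whose intersection is
  \<open>M\<close>.\<close>

lemma exists_irred:
  assumes \<Gamma>: "\<And>g. g \<in> \<Gamma> \<Longrightarrow> endo V g" and V: "lsub V" and cr: "completely_reducible \<Gamma> V"
    and K: "closed_under \<Gamma> V K" "K \<noteq> V"
  shows "\<exists>S. closed_under \<Gamma> V S \<and> irred \<Gamma> S \<and> S \<inter> K = {0}"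
proof -
  obtain x where x: "x \<in> V" "x \<notin> K" using K closed_under_subset by blast
  obtain M where M: "closed_under \<Gamma> V M" "K \<subseteq> M" "x \<notin> M"
    and max: "\<And>M'. closed_under \<Gamma> V M' \<Longrightarrow> M \<subseteq> M' \<Longrightarrow> x \<notin> M' \<Longrightarrow> M' = M"
    using maximal_closed_under[of \<Gamma> V K "\<lambda>M. x \<notin> M", OF K(1) x(2)] by blast
  obtain S where S: "closed_under \<Gamma> V S" "complements V M S"
    using cr M(1) unfolding completely_reducible_def by blast
  have "irred \<Gamma> S" unfolding irred_def
  proof (intro conjI allI impI)
    show "S \<noteq> {0}"
    proof
      assume "S = {0}"
      then show False using S(2) x(1) M(3) unfolding complements_def by fastforce
    qed
    fix A assume A: "closed_under \<Gamma> S A"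
    obtain B where B: "closed_under \<Gamma> S B" "complements S A B"
      using completely_reducible_sub[OF cr S(1)] A unfolding completely_reducible_def by blast
    have big: "x \<in> {m + a | m a. m \<in> M \<and> a \<in> E}" if E: "closed_under \<Gamma> S E" "E \<noteq> {0}" for E
    proof (rule ccontr)
      assume n: "x \<notin> {m + a | m a. m \<in> M \<and> a \<in> E}"
      have "M \<subseteq> {m + a | m a. m \<in> M \<and> a \<in> E}"
        using subspace_0[OF closed_under_subspace[OF E(1)]] by force
      then have eq: "{m + a | m a. m \<in> M \<and> a \<in> E} = M"
        using max closed_under_plus[OF \<Gamma> V M(1) closed_under_trans[OF S(1) E(1)]] n by blast
      have "E \<subseteq> {m + a | m a. m \<in> M \<and> a \<in> E}"
        using subspace_0[OF closed_under_subspace[OF M(1)]] by force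
      then have "E \<subseteq> M \<inter> S" using eq closed_under_subset[OF E(1)] by blast
      then have "E \<subseteq> {0}" using S(2) unfolding complements_def by blast
      then show False using E subspace_0[OF closed_under_subspace[OF E(1)]] by blast
    qed
    have "A = {0} \<or> B = {0}"
    proof (rule ccontr)
      assume "\<not> ?thesis"
      then obtain m a m' b where *: "x = m + a" "m \<in> M" "a \<in> A" "x = m' + b" "m' \<in> M" "b \<in> B"
        using big[OF A] big[OF B(1)] by blast
      have "m - m' = b - a" using * by (simp add: algebra_simps)
      moreover have "m - m' \<in> M" using * subspace_diff closed_under_subspace[OF M(1)] by blast
      moreover have "b - a \<in> S" using * subspace_diff closed_under_subspace[OF S(1)] closed_under_subset[OF A] closed_under_subset[OF B(1)] by blast
      ultimately have "b - a \<in> M \<inter> S" by simp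
      then have "b - a = 0" using S(2) unfolding complements_def by blast
      then have "a \<in> A \<inter> B" using * by simp
      then have "a = 0" using B(2) unfolding complements_def by blast
      then show False using * M(3) by simp
    qed
    moreover have "A = S" if "B = {0}"
      using B(2) that closed_under_subset[OF A] unfolding complements_def by fastforce
    ultimately show "A = {0} \<or> A = S" by blast
  qed
  moreover have "S \<inter> K = {0}"
    using S M(2) subspace_0[OF closed_under_subspace[OF S(1)]] subspace_0[OF closed_under_subspace[OF K(1)]]
    unfolding complements_def by blast
  ultimately show ?thesis using S(1) by blast
qed

text \<open>The chains generated by one irreducible \<open>S\<close> on which \<open>N ^^ n\<close>
  is injective form a direct summand, so by indecomposability they fill \<open>V\<close>. The
  complementary summand is explicit: with \<open>H\<close> a complement of the image of
  \<open>S\<close> under \<open>N ^^ n\<close>, it is the largest subspace of \<open>H\<close>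
  stable under \<open>N\<close>.\<close>

lemma nilpotent_split:
  assumes \<Gamma>: "\<And>g. g \<in> \<Gamma> \<Longrightarrow> endo V g" and V: "lsub V" and cr: "completely_reducible \<Gamma> V"
    and N: "endo V N" and quasi: "\<And>g. g \<in> \<Gamma> \<Longrightarrow> \<exists>c. c \<noteq> 0 \<and> (\<forall>x\<in>V. g (N x) = scale c (N (g x)))"
    and r: "\<And>x. x \<in> V \<Longrightarrow> (N ^^ Suc n) x = 0" "\<exists>x\<in>V. (N ^^ n) x \<noteq> 0"
    and ind: "indecomp (insert N \<Gamma>) V"
  shows "\<exists>S. closed_under \<Gamma> V S \<and> irred \<Gamma> S \<and>
    (\<forall>v\<in>V. \<exists>x. (\<forall>i. x i \<in> S) \<and> v = (\<Sum>i\<le>n. (N ^^ i) (x i))) \<and>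
    (\<forall>x. (\<forall>i. x i \<in> S) \<longrightarrow> (\<Sum>i\<le>n. (N ^^ i) (x i)) = 0 \<longrightarrow> (\<forall>i\<le>n. x i = 0))"
proof -
  have Np: "endo V (N ^^ i)" for i by (rule endo_funpow[OF N])
  have z: "(N ^^ i) x = 0" if "x \<in> V" "i > n" for x i
    using funpow_eq_0_mono[OF N V r(1)[OF that(1)]] that(2) by simp
  have comp: "(N ^^ i) ((N ^^ j) x) = (N ^^ (i + j)) x" for i j x by (simp add: funpow_add)
  have qp: "\<exists>c. c \<noteq> 0 \<and> (\<forall>x\<in>V. g ((N ^^ i) x) = scale c ((N ^^ i) (g x)))" if "g \<in> \<Gamma>" for g i
  proof -
    obtain c where c: "c \<noteq> 0" "\<forall>x\<in>V. g (N x) = scale c (N (g x))" using quasi[OF \<open>g \<in> \<Gamma>\<close>] by blast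
    then show ?thesis using funpow_quasi_commute[OF \<Gamma>[OF that] N, of c]
      by (intro exI[of _ "c ^ i"]) auto
  qed
  \<comment> \<open>Avoiding the kernel of \<open>N ^^ n\<close> makes every nonzero vector of
    \<open>S\<close> start a chain of full length n + 1.\<close>
  define K where "K = {x \<in> V. (N ^^ n) x = 0}"
  have K: "closed_under \<Gamma> V K" unfolding closed_under_def
  proof (intro conjI ballI)
    show "lsub K" unfolding K_def
      using V endo_0[OF Np V] endo_add[OF Np] endo_scale[OF Np]
      by (auto intro!: subspaceI simp: subspace_0 subspace_add subspace_scale)
    fix g x assume g: "g \<in> \<Gamma>" and x: "x \<in> K"
    obtain c where c: "c \<noteq> 0" "\<forall>x\<in>V. g ((N ^^ n) x) = scale c ((N ^^ n) (g x))" using qp[OF g] by blast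
    have "scale c ((N ^^ n) (g x)) = g 0" using c(2) x unfolding K_def by (metis (mono_tags, lifting) mem_Collect_eq)
    then have "(N ^^ n) (g x) = 0" using c(1) endo_0[OF \<Gamma>[OF g] V] by simp
    then show "g x \<in> K" using x endo_closed[OF \<Gamma>[OF g]] unfolding K_def by blast
  qed (auto simp: K_def)
  have "K \<noteq> V" using r(2) unfolding K_def by blast
  then obtain S where S: "closed_under \<Gamma> V S" "irred \<Gamma> S" "S \<inter> K = {0}"
    using exists_irred[OF \<Gamma> V cr K] by blast
  have Ssub: "lsub S" and SV: "\<And>s. s \<in> S \<Longrightarrow> s \<in> V" using S(1) unfolding closed_under_def by auto
  have inj: "s = 0" if "s \<in> S" "(N ^^ n) s = 0" for s
    using S(3) that SV unfolding K_def by blast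
  define Z where "Z = (N ^^ n) ` S"
  have Z: "closed_under \<Gamma> V Z" unfolding closed_under_def
  proof (intro conjI ballI)
    show "lsub Z" unfolding Z_def
    proof (rule subspaceI)
      show "0 \<in> (N ^^ n) ` S" using endo_0[OF Np[of n] V] subspace_0[OF Ssub] by (metis image_eqI)
      fix x y assume "x \<in> (N ^^ n) ` S" "y \<in> (N ^^ n) ` S"
      then obtain a b where "a \<in> S" "b \<in> S" "x = (N ^^ n) a" "y = (N ^^ n) b" by blast
      then show "x + y \<in> (N ^^ n) ` S"
        using endo_add[OF Np[of n], of a b] SV subspace_add[OF Ssub] by (metis image_eqI)
    next
      fix c x assume "x \<in> (N ^^ n) ` S"
      then obtain a where a: "a \<in> S" "x = (N ^^ n) a" by blast
      then have "scale c x = (N ^^ n) (scale c a)" using endo_scale[OF Np[of n] SV] by simp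
      then show "scale c x \<in> (N ^^ n) ` S" using a(1) subspace_scale[OF Ssub] by blast
    qed
    show "Z \<subseteq> V" unfolding Z_def using endo_closed[OF Np] SV by blast
    fix g x assume g: "g \<in> \<Gamma>" and x: "x \<in> Z"
    then obtain s where s: "s \<in> S" "x = (N ^^ n) s" unfolding Z_def by blast
    obtain c where "\<forall>x\<in>V. g ((N ^^ n) x) = scale c ((N ^^ n) (g x))" using qp[OF g] by blast
    then have "g x = (N ^^ n) (scale c (g s))"
      using s SV endo_scale[OF Np[of n], of "g s"] endo_closed[OF \<Gamma>[OF g]] by simp
    then show "g x \<in> Z" unfolding Z_def using s(1) subspace_scale[OF Ssub] closed_under_closed[OF S(1) g] by blast
  qed
  obtain H where H: "closed_under \<Gamma> V H" "complements V Z H"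
    using cr Z unfolding completely_reducible_def by blast
  have Hsub: "lsub H" using H(1) closed_under_subspace by blast
  define A where "A = {\<Sum>i\<le>n. (N ^^ i) (x i) | x. \<forall>i. x i \<in> S}"
  define B where "B = {x \<in> V. \<forall>i\<le>n. (N ^^ i) x \<in> H}"
  \<comment> \<open>\<open>N ^^ (n - j)\<close> kills the terms beyond index \<open>j\<close> and
    moves term \<open>j\<close> to the end of its chain; the earlier terms vanish by assumption. So
    the first nonzero component of a sum can be isolated.\<close>
  have lead: "(N ^^ (n - j)) (\<Sum>i\<le>n. (N ^^ i) (x i)) = (N ^^ n) (x j)"
    if x: "\<And>i. x i \<in> S" and j: "j \<le> n" "\<And>i. i < j \<Longrightarrow> x i = 0" for x j
  proof -
    have "(N ^^ (n - j)) (\<Sum>i\<le>n. (N ^^ i) (x i)) = (\<Sum>i\<le>n. (N ^^ (n - j + i)) (x i))"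
      using x SV by (subst endo_sum[OF Np V]) (auto simp: comp endo_closed[OF Np])
    also have "\<dots> = (\<Sum>i\<in>{j}. (N ^^ (n - j + i)) (x i))"
    proof (rule sum.mono_neutral_right)
      show "\<forall>i\<in>{..n} - {j}. (N ^^ (n - j + i)) (x i) = 0"
      proof
        fix i assume "i \<in> {..n} - {j}"
        then consider "i < j" | "i > j" by force
        then show "(N ^^ (n - j + i)) (x i) = 0"
          using j z[OF SV[OF x[of i]], of "n - j + i"] endo_0[OF Np V] by cases auto
      qed
    qed (use j in auto)
    finally show ?thesis using j by simp
  qed
  have indep: "\<forall>i\<le>n. x i = 0" if x: "\<And>i. x i \<in> S" and B: "(\<Sum>i\<le>n. (N ^^ i) (x i)) \<in> B" for x
  proof (intro allI impI)
    fix i assume "i \<le> n"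
    then show "x i = 0"
    proof (induction i rule: less_induct)
      case (less j)
      have "(N ^^ (n - j)) (\<Sum>i\<le>n. (N ^^ i) (x i)) \<in> H" using B unfolding B_def by simp
      moreover have "x i = 0" if "i < j" for i using less.IH[OF that] less.prems that by simp
      ultimately have "(N ^^ n) (x j) \<in> H" using lead[of x j, OF x less.prems] by simp
      then have "(N ^^ n) (x j) = 0" using H(2) x unfolding complements_def Z_def by blast
      then show ?case using inj x by blast
    qed
  qed
  have zeroB: "0 \<in> B" unfolding B_def using V Hsub endo_0[OF Np V] by (auto simp: subspace_0)
  have Asub: "lsub A" unfolding A_def
  proof (rule subspaceI)
    show "0 \<in> {\<Sum>i\<le>n. (N ^^ i) (x i) | x. \<forall>i. x i \<in> S}"
      using endo_0[OF Np V] subspace_0[OF Ssub] by (auto intro!: exI[of _ "\<lambda>_. 0"])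
    fix a b assume "a \<in> {\<Sum>i\<le>n. (N ^^ i) (x i) | x. \<forall>i. x i \<in> S}" "b \<in> {\<Sum>i\<le>n. (N ^^ i) (x i) | x. \<forall>i. x i \<in> S}"
    then obtain x y where xy: "\<forall>i. x i \<in> S" "\<forall>i. y i \<in> S" "a = (\<Sum>i\<le>n. (N ^^ i) (x i))" "b = (\<Sum>i\<le>n. (N ^^ i) (y i))" by blast
    then have "a + b = (\<Sum>i\<le>n. (N ^^ i) (x i + y i))" using endo_add[OF Np] SV by (simp add: sum.distrib)
    then show "a + b \<in> {\<Sum>i\<le>n. (N ^^ i) (x i) | x. \<forall>i. x i \<in> S}"
      using xy subspace_add[OF Ssub] by (auto intro!: exI[of _ "\<lambda>i. x i + y i"])
  next
    fix c a assume "a \<in> {\<Sum>i\<le>n. (N ^^ i) (x i) | x. \<forall>i. x i \<in> S}"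
    then obtain x where x: "\<forall>i. x i \<in> S" "a = (\<Sum>i\<le>n. (N ^^ i) (x i))" by blast
    then have "scale c a = (\<Sum>i\<le>n. (N ^^ i) (scale c (x i)))" using endo_scale[OF Np] SV by (simp add: scale_sum_right)
    then show "scale c a \<in> {\<Sum>i\<le>n. (N ^^ i) (x i) | x. \<forall>i. x i \<in> S}"
      using x subspace_scale[OF Ssub] by (auto intro!: exI[of _ "\<lambda>i. scale c (x i)"])
  qed
  have Asum: "(\<Sum>i\<le>n. (N ^^ i) (x i)) \<in> A" if "\<And>i. x i \<in> S" for x unfolding A_def using that by blast
  have NA: "(N ^^ k) s \<in> A" if "s \<in> S" for k s
  proof (cases "k \<le> n")
    case True
    have "(\<Sum>i\<le>n. (N ^^ i) (if i = k then s else 0)) = (\<Sum>i\<le>n. if i = k then (N ^^ k) s else 0)"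
      using endo_0[OF Np V] by (intro sum.cong) auto
    then have "(N ^^ k) s = (\<Sum>i\<le>n. (N ^^ i) (if i = k then s else 0))" using True by simp
    then show ?thesis using Asum[of "\<lambda>i. if i = k then s else 0"] that subspace_0[OF Ssub] by simp
  next
    case False
    then show ?thesis using z[OF SV[OF that]] subspace_0[OF Asub] by simp
  qed
  have A: "closed_under (insert N \<Gamma>) V A" unfolding closed_under_def
  proof (intro conjI ballI)
    show "A \<subseteq> V" unfolding A_def using SV endo_closed[OF Np] by (auto intro!: subspace_sum[OF V])
    fix g a assume "g \<in> insert N \<Gamma>" "a \<in> A"
    then obtain x where x: "\<forall>i. x i \<in> S" "a = (\<Sum>i\<le>n. (N ^^ i) (x i))" unfolding A_def by blast
    have iV: "(N ^^ i) (x i) \<in> V" for i using x SV endo_closed[OF Np] by blast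
    from \<open>g \<in> insert N \<Gamma>\<close> have eg: "endo V g" using N \<Gamma> by blast
    have "g ((N ^^ i) (x i)) \<in> A" for i
    proof (cases "g = N")
      case True
      then show ?thesis using NA[of "x i" "Suc i"] x by simp
    next
      case False
      then have g: "g \<in> \<Gamma>" using \<open>g \<in> insert N \<Gamma>\<close> by blast
      obtain c where "\<forall>x\<in>V. g ((N ^^ i) x) = scale c ((N ^^ i) (g x))" using qp[OF g] by blast
      then show ?thesis using x SV NA[of "g (x i)" i] closed_under_closed[OF S(1) g] subspace_scale[OF Asub] by simp
    qed
    then show "g a \<in> A" unfolding x(2) endo_sum[OF eg V iV] by (intro subspace_sum[OF Asub])
  qed (rule Asub)
  have B: "closed_under (insert N \<Gamma>) V B" unfolding closed_under_def
  proof (intro conjI ballI)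
    show "lsub B" unfolding B_def
      using V Hsub endo_0[OF Np V] endo_add[OF Np] endo_scale[OF Np]
      by (auto intro!: subspaceI simp: subspace_0 subspace_add subspace_scale)
    show "B \<subseteq> V" unfolding B_def by blast
    fix g b assume "g \<in> insert N \<Gamma>" and b: "b \<in> B"
    then consider "g = N" | "g \<in> \<Gamma>" by blast
    then show "g b \<in> B"
    proof cases
      case 1
      have "(N ^^ i) (N b) \<in> H" if "i \<le> n" for i
      proof (cases "i = n")
        case True
        then show ?thesis using z[of b "Suc n"] b subspace_0[OF Hsub] unfolding B_def by (simp add: funpow_swap1)
      next
        case False
        then have "(N ^^ Suc i) b \<in> H" using b that unfolding B_def by (metis (no_types, lifting) Suc_leI le_neq_implies_less mem_Collect_eq)
        then show ?thesis by (simp add: funpow_swap1)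
      qed
      then show ?thesis using 1 b endo_closed[OF N] unfolding B_def by blast
    next
      case 2
      have "(N ^^ i) (g b) \<in> H" if i: "i \<le> n" for i
      proof -
        obtain c where c: "c \<noteq> 0" "\<forall>x\<in>V. g ((N ^^ i) x) = scale c ((N ^^ i) (g x))" using qp[OF 2] by blast
        have "scale c ((N ^^ i) (g b)) \<in> H"
          using c(2) b i closed_under_closed[OF H(1) 2] unfolding B_def by (metis (no_types, lifting) mem_Collect_eq)
        then have "scale (inverse c) (scale c ((N ^^ i) (g b))) \<in> H" by (rule subspace_scale[OF Hsub])
        then show ?thesis using c(1) by simp
      qed
      then show ?thesis using b endo_closed[OF \<Gamma>[OF 2]] unfolding B_def by blast
    qed
  qed
  have AV: "a \<in> V" if "a \<in> A" for a using A that closed_under_subset by blast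
  \<comment> \<open>Membership of \<open>(N ^^ i) (y - t)\<close> in \<open>H\<close> is achieved
    from i = n downwards; after \<open>k\<close> rounds it holds for the top \<open>k\<close>
    indices. The correction \<open>(N ^^ k) s\<close> repairs index n - k and leaves the larger
    indices alone, since \<open>N ^^ Suc n\<close> is zero.\<close>
  have approx: "\<exists>t\<in>A. \<forall>i\<le>n. n < i + k \<longrightarrow> (N ^^ i) (y - t) \<in> H" if y: "y \<in> V" for y k
  proof (induction k)
    case 0
    show ?case using subspace_0[OF Asub] by (intro bexI[of _ 0]) auto
  next
    case (Suc k)
    then obtain t where t: "t \<in> A" "\<forall>i\<le>n. n < i + k \<longrightarrow> (N ^^ i) (y - t) \<in> H" by blast
    have yt: "y - t \<in> V" using y t(1) AV subspace_diff[OF V] by blast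
    show ?case
    proof (cases "k \<le> n")
      case False
      then show ?thesis using t by (intro bexI[of _ t]) auto
    next
      case True
      define i0 where "i0 = n - k"
      have "(N ^^ i0) (y - t) \<in> V" using yt endo_closed[OF Np] by blast
      then obtain u h where "u \<in> Z" "h \<in> H" "(N ^^ i0) (y - t) = u + h"
        using H(2) unfolding complements_def by blast
      then obtain s where s: "s \<in> S" "h \<in> H" "(N ^^ i0) (y - t) = (N ^^ n) s + h" unfolding Z_def by blast
      define t' where "t' = t + (N ^^ k) s"
      have Ns: "(N ^^ k) s \<in> V" using SV[OF s(1)] endo_closed[OF Np] by blast
      have e: "(N ^^ i) (y - t') = (N ^^ i) (y - t) - (N ^^ (i + k)) s" for i
        unfolding t'_def using endo_diff[OF Np V yt Ns, of i] by (simp add: comp algebra_simps)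
      have "(N ^^ i) (y - t') \<in> H" if "i \<le> n" "n < i + Suc k" for i
      proof (cases "i = i0")
        case True
        then show ?thesis using e[of i0] s \<open>k \<le> n\<close> unfolding i0_def by simp
      next
        case False
        then have "n < i + k" using that \<open>k \<le> n\<close> unfolding i0_def by simp
        then show ?thesis using e[of i] t(2) that(1) z[OF SV[OF s(1)]] by simp
      qed
      moreover have "t' \<in> A" unfolding t'_def using t(1) NA[OF s(1)] subspace_add[OF Asub] by blast
      ultimately show ?thesis by blast
    qed
  qed
  have "complements V A B" unfolding complements_def
  proof (intro conjI ballI)
    show "A \<inter> B = {0}"
    proof
      show "A \<inter> B \<subseteq> {0}"
      proof
        fix a assume a: "a \<in> A \<inter> B"
        then obtain x where x: "\<forall>i. x i \<in> S" "a = (\<Sum>i\<le>n. (N ^^ i) (x i))" unfolding A_def by blast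
        then have "\<forall>i\<le>n. x i = 0" using indep[of x] a by blast
        then show "a \<in> {0}" using x(2) endo_0[OF Np V] by simp
      qed
      show "{0} \<subseteq> A \<inter> B" using zeroB subspace_0[OF Asub] by blast
    qed
    fix y assume y: "y \<in> V"
    obtain t where t: "t \<in> A" "\<forall>i\<le>n. n < i + Suc n \<longrightarrow> (N ^^ i) (y - t) \<in> H" using approx[OF y] by blast
    then have "y - t \<in> B" unfolding B_def using y AV subspace_diff[OF V] by auto
    then show "\<exists>s\<in>A. \<exists>t\<in>B. y = s + t" using t(1) by (intro bexI[of _ t] bexI[of _ "y - t"]) auto
  qed
  then have "A = {0} \<or> B = {0}" using ind A B unfolding indecomp_def by blast
  moreover have "A \<noteq> {0}"
  proof
    assume "A = {0}"
    then have "s = 0" if "s \<in> S" for s using NA[OF that, of 0] by simp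
    then show False using S(2) subspace_0[OF Ssub] unfolding irred_def by blast
  qed
  ultimately have "B = {0}" by blast
  then have "v \<in> A" if "v \<in> V" for v using \<open>complements V A B\<close> that unfolding complements_def by fastforce
  then show ?thesis using S indep zeroB unfolding A_def
    by (intro exI[of _ S] conjI) (blast, blast, blast, metis)
qed

text \<open>The projection onto \<open>S\<close> along \<open>T\<close>. The last clause, uniqueness
  of the component, is what later shows that it commutes with operators preserving both
  subspaces.\<close>

lemma complements_projection:
  assumes S: "lsub S" "S \<subseteq> V" and T: "lsub T" "T \<subseteq> V" and V: "lsub V" and c: "complements V S T"
  shows "\<exists>q. endo V q \<and> (\<forall>x\<in>V. q x \<in> S \<and> x - q x \<in> T) \<and> (\<forall>x\<in>S. q x = x) \<and>
    (\<forall>x\<in>V. \<forall>s\<in>S. x - s \<in> T \<longrightarrow> q x = s)"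
proof -
  define q where "q x = (SOME s. s \<in> S \<and> x - s \<in> T)" for x
  have q: "q x \<in> S" "x - q x \<in> T" if "x \<in> V" for x
  proof -
    have "\<exists>s\<in>S. \<exists>t\<in>T. x = s + t" using c that unfolding complements_def by simp
    then have "\<exists>s. s \<in> S \<and> x - s \<in> T" by (elim bexE) (intro exI, auto)
    from someI_ex[OF this] show "q x \<in> S" "x - q x \<in> T" unfolding q_def by auto
  qed
  have uniq: "q x = s" if "x \<in> V" "s \<in> S" "x - s \<in> T" for x s
  proof -
    have "q x - s \<in> S" using q(1)[OF that(1)] that(2) subspace_diff[OF S(1)] by blast
    moreover have "(x - s) - (x - q x) \<in> T" using q(2)[OF that(1)] that(3) subspace_diff[OF T(1)] by blast
    ultimately have "q x - s \<in> S \<inter> T" by simp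
    then show ?thesis using c unfolding complements_def by auto
  qed
  show ?thesis
  proof (intro exI[of _ q] conjI)
    show "endo V q" unfolding endo_def
    proof (intro conjI ballI allI)
      fix x y assume x: "x \<in> V" and y: "y \<in> V"
      show "q x \<in> V" using q(1)[OF x] S(2) by blast
      have "(x - q x) + (y - q y) \<in> T" using q(2) x y subspace_add[OF T(1)] by blast
      then have "(x + y) - (q x + q y) \<in> T" by (simp add: algebra_simps)
      then show "q (x + y) = q x + q y"
        using q(1) x y by (intro uniq subspace_add[OF V] subspace_add[OF S(1)])
    next
      fix k x assume x: "x \<in> V"
      have "scale k (x - q x) \<in> T" using q(2)[OF x] subspace_scale[OF T(1)] by blast
      then have "scale k x - scale k (q x) \<in> T" by (simp add: scale_right_diff_distrib)
      then show "q (scale k x) = scale k (q x)"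
        using q(1) x by (intro uniq subspace_scale[OF V] subspace_scale[OF S(1)])
    qed
    show "\<forall>x\<in>S. q x = x"
      using S(2) subspace_0[OF T(1)] by (auto intro: uniq)
  qed (use q uniq in auto)
qed

text \<open>Averaging \<open>C^i q C^{-i}\<close> over \<open>i < m\<close>; the negative powers are
  \<open>C^{-i} = \<mu>^{-1} C^{m - i}\<close>.\<close>

lemma completely_reducible_insert:
  assumes \<Gamma>: "\<And>g. g \<in> \<Gamma> \<Longrightarrow> endo V g" and V: "lsub V" and cr: "completely_reducible \<Gamma> V"
    and C: "endo V C" and quasi: "\<And>g. g \<in> \<Gamma> \<Longrightarrow> \<exists>c. c \<noteq> 0 \<and> (\<forall>x\<in>V. g (C x) = scale c (C (g x)))"
    and m: "of_nat m \<noteq> (0 :: 'k)" and \<mu>: "\<mu> \<noteq> 0" "\<And>x. x \<in> V \<Longrightarrow> (C ^^ m) x = scale \<mu> x"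
  shows "completely_reducible (insert C \<Gamma>) V"
  unfolding completely_reducible_def
proof (intro allI impI)
  fix S assume S: "closed_under (insert C \<Gamma>) V S"
  then have S': "closed_under \<Gamma> V S" by (auto simp: closed_under_def)
  then obtain T where T: "closed_under \<Gamma> V T" "complements V S T"
    using cr unfolding completely_reducible_def by blast
  have Ssub: "lsub S" "S \<subseteq> V" and Tsub: "lsub T" "T \<subseteq> V"
    using S' T(1) unfolding closed_under_def by auto
  obtain q where q: "endo V q" "\<And>x. x \<in> V \<Longrightarrow> q x \<in> S" "\<And>x. x \<in> V \<Longrightarrow> x - q x \<in> T"
    "\<And>x. x \<in> S \<Longrightarrow> q x = x" "\<And>x s. x \<in> V \<Longrightarrow> s \<in> S \<Longrightarrow> x - s \<in> T \<Longrightarrow> q x = s"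
    using complements_projection[OF Ssub Tsub V T(2)] by (elim exE conjE) simp
  have Cp: "endo V (C ^^ i)" for i by (rule endo_funpow[OF C])
  have CS: "(C ^^ i) s \<in> S" if "s \<in> S" for i s
    using that S by (induction i) (auto simp: closed_under_def)
  have qg: "q (g x) = g (q x)" if "g \<in> \<Gamma>" "x \<in> V" for g x
  proof (rule q(5))
    show "g x \<in> V" using endo_closed[OF \<Gamma>[OF that(1)] that(2)] .
    show "g (q x) \<in> S" using closed_under_closed[OF S' that(1) q(2)[OF that(2)]] .
    have "q x \<in> V" using q(2)[OF that(2)] Ssub by blast
    then have "g x - g (q x) = g (x - q x)" using endo_diff[OF \<Gamma>[OF that(1)] V that(2)] by simp
    then show "g x - g (q x) \<in> T" using closed_under_closed[OF T(1) that(1) q(3)[OF that(2)]] by simp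
  qed
  \<comment> \<open>The average is left unnormalised: on \<open>S\<close> it is the scalar
    \<open>of_nat m * \<mu>\<close>, which is nonzero by assumption.\<close>
  define p where "p x = (\<Sum>i<m. (C ^^ i) (q ((C ^^ (m - i)) x)))" for x
  have tV: "(C ^^ i) (q ((C ^^ j) x)) \<in> V" if "x \<in> V" for i j x
    using endo_closed[OF Cp endo_closed[OF q(1) endo_closed[OF Cp that]]] .
  have pS: "p x \<in> S" if "x \<in> V" for x
    unfolding p_def by (intro subspace_sum[OF Ssub(1)] CS q(2) endo_closed[OF Cp that])
  have p_id: "p s = scale (of_nat m * \<mu>) s" if s: "s \<in> S" for s
  proof -
    have "(C ^^ i) (q ((C ^^ (m - i)) s)) = scale \<mu> s" if "i < m" for i
    proof -
      have "(C ^^ i) (q ((C ^^ (m - i)) s)) = (C ^^ (i + (m - i))) s"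
        using q(4)[OF CS[OF s]] by (simp add: funpow_add)
      then show ?thesis using that \<mu>(2)[of s] s Ssub by auto
    qed
    then show ?thesis unfolding p_def by (simp add: sum_constant_scale)
  qed
  have p: "endo V p" unfolding endo_def
  proof (intro conjI ballI allI)
    fix x y assume x: "x \<in> V" and y: "y \<in> V"
    show "p x \<in> V" using pS[OF x] Ssub by blast
    show "p (x + y) = p x + p y" unfolding p_def sum.distrib[symmetric]
      using x y endo_add[OF Cp] endo_add[OF q(1)] endo_closed[OF Cp] endo_closed[OF q(1)] by (intro sum.cong) simp_all
  next
    fix k x assume x: "x \<in> V"
    show "p (scale k x) = scale k (p x)" unfolding p_def scale_sum_right
      using x endo_scale[OF Cp] endo_scale[OF q(1)] endo_closed[OF Cp] endo_closed[OF q(1)] by (intro sum.cong) simp_all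
  qed
  \<comment> \<open>Commuting with \<open>C\<close> shifts the summation index by one. The two
    boundary terms agree because \<open>C ^^ m\<close> is scalar.\<close>
  have pC: "p (C x) = C (p x)" if x: "x \<in> V" for x
  proof -
    define h where "h i = (C ^^ i) (q ((C ^^ (Suc m - i)) x))" for i
    have qx: "q (C x) \<in> V" using endo_closed[OF q(1) endo_closed[OF C x]] .
    have Cm: "(C ^^ Suc m) x = scale \<mu> (C x)"
      using \<mu>(2)[OF endo_closed[OF C x]] by (simp add: funpow_swap1)
    have "h 0 = scale \<mu> (q (C x))" unfolding h_def
      using Cm endo_scale[OF q(1) endo_closed[OF C x]] by simp
    moreover have "h m = scale \<mu> (q (C x))" unfolding h_def using \<mu>(2)[OF qx] by simp
    ultimately have h0: "h 0 = h m" by simp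
    have "p (C x) = (\<Sum>i<m. h i)" unfolding p_def h_def
      by (intro sum.cong) (auto simp: Suc_diff_le funpow_swap1)
    moreover have "C (p x) = (\<Sum>i<m. h (Suc i))" unfolding p_def h_def
      using endo_sum[OF C V tV[OF x]] by simp
    moreover have "(\<Sum>i<m. h (Suc i)) + h 0 = (\<Sum>i<m. h i) + h m"
      using sum.lessThan_Suc_shift[of h m] by (simp add: add.commute)
    ultimately show ?thesis using h0 by simp
  qed
  \<comment> \<open>The powers of \<open>C\<close> to the left and right of \<open>q\<close>
    contribute \<open>c ^ i\<close> and \<open>c ^ (m - i)\<close>. The total scalar does not depend
    on the summand, which is enough for the kernel of \<open>p\<close> to be stable.\<close>
  have pg: "\<exists>c. c \<noteq> 0 \<and> (\<forall>x\<in>V. g (p x) = scale c (p (g x)))" if g: "g \<in> \<Gamma>" for g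
  proof -
    obtain c where c: "c \<noteq> 0" "\<forall>x\<in>V. g (C x) = scale c (C (g x))" using quasi[OF g] by blast
    have gC: "g ((C ^^ i) x) = scale (c ^ i) ((C ^^ i) (g x))" if "x \<in> V" for i x
      using funpow_quasi_commute[OF \<Gamma>[OF g] C _ that] c(2) by blast
    have "g (p x) = scale (c ^ m) (p (g x))" if x: "x \<in> V" for x
    proof -
      have "g ((C ^^ i) (q ((C ^^ (m - i)) x))) = scale (c ^ m) ((C ^^ i) (q ((C ^^ (m - i)) (g x))))" if i: "i < m" for i
      proof -
        have gx: "g x \<in> V" using endo_closed[OF \<Gamma>[OF g] x] .
        have "g ((C ^^ i) (q ((C ^^ (m - i)) x))) = scale (c ^ i) ((C ^^ i) (q (g ((C ^^ (m - i)) x))))"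
          using gC[OF endo_closed[OF q(1) endo_closed[OF Cp x]]] qg[OF g endo_closed[OF Cp x]] by simp
        also have "\<dots> = scale (c ^ i) ((C ^^ i) (q (scale (c ^ (m - i)) ((C ^^ (m - i)) (g x)))))"
          using gC[OF x] by simp
        also have "\<dots> = scale (c ^ i * c ^ (m - i)) ((C ^^ i) (q ((C ^^ (m - i)) (g x))))"
          using endo_scale[OF q(1) endo_closed[OF Cp gx]] endo_scale[OF Cp endo_closed[OF q(1) endo_closed[OF Cp gx]]]
          by simp
        finally show ?thesis using i by (simp flip: power_add)
      qed
      then show ?thesis unfolding p_def endo_sum[OF \<Gamma>[OF g] V tV[OF x]] scale_sum_right by (intro sum.cong) auto
    qed
    then show ?thesis using c(1) by (intro exI[of _ "c ^ m"]) simp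
  qed
  define K where "K = {x \<in> V. p x = 0}"
  have Ksub: "lsub K" unfolding K_def
    using V endo_0[OF p V] endo_add[OF p] endo_scale[OF p]
    by (auto intro!: subspaceI simp: subspace_0 subspace_add subspace_scale)
  have "closed_under (insert C \<Gamma>) V K" unfolding closed_under_def
  proof (intro conjI ballI)
    fix g x assume g: "g \<in> insert C \<Gamma>" and x: "x \<in> K"
    then have "endo V g" using C \<Gamma> by blast
    moreover have "p (g x) = 0"
    proof (cases "g = C")
      case True
      then show ?thesis using x pC endo_0[OF C V] unfolding K_def by simp
    next
      case False
      then have g': "g \<in> \<Gamma>" using g by blast
      then obtain c where "c \<noteq> 0" "\<forall>x\<in>V. g (p x) = scale c (p (g x))" using pg by blast
      moreover have "x \<in> V" "p x = 0" using x unfolding K_def by auto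
      ultimately have "scale c (p (g x)) = 0" using endo_0[OF \<Gamma>[OF g'] V] by metis
      then show ?thesis using \<open>c \<noteq> 0\<close> by simp
    qed
    ultimately show "g x \<in> K" using x endo_closed unfolding K_def by blast
  qed (use Ksub K_def in auto)
  moreover have "complements V S K" unfolding complements_def
  proof (intro conjI ballI)
    have nz: "of_nat m * \<mu> \<noteq> 0" using m \<mu>(1) by simp
    show "S \<inter> K = {0}"
    proof
      show "S \<inter> K \<subseteq> {0}" using p_id nz unfolding K_def by auto
      show "{0} \<subseteq> S \<inter> K" using subspace_0[OF Ssub(1)] subspace_0[OF Ksub] by blast
    qed
    fix x assume x: "x \<in> V"
    define s where "s = scale (inverse (of_nat m * \<mu>)) (p x)"
    have s: "s \<in> S" unfolding s_def using pS[OF x] subspace_scale[OF Ssub(1)] by blast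
    have "p s = p x" unfolding p_id[OF s] unfolding s_def scale_scale right_inverse[OF nz] by simp
    then have "p (x - s) = 0" using endo_diff[OF p V x] s Ssub by auto
    then have "x - s \<in> K" unfolding K_def using x s Ssub subspace_diff[OF V] by blast
    then show "\<exists>s\<in>S. \<exists>t\<in>K. x = s + t" using s by (intro bexI[of _ s] bexI[of _ "x - s"]) auto
  qed
  ultimately show "\<exists>T. closed_under (insert C \<Gamma>) V T \<and> complements V S T" by blast
qed

text \<open>This is p(U) x in Horner form. The ring laws are available for \<open>x\<close> in a
  subspace on which \<open>U\<close> is linear.\<close>

definition pact :: "('b \<Rightarrow> 'b) \<Rightarrow> 'k poly \<Rightarrow> 'b \<Rightarrow> 'b" where
  "pact U p x = fold_coeffs (\<lambda>a y. scale a x + U y) p 0"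

lemma pact_0 [simp]: "pact U 0 x = 0"
  by (simp add: pact_def)

section \<open>Polynomials in an endomorphism\<close>

context
  fixes V U
  assumes V: "lsub V" and U: "endo V U"
begin

lemma pact_pCons: "pact U (pCons a p) x = scale a x + U (pact U p x)"
  using endo_0[OF U V] by (cases "a = 0 \<and> p = 0") (auto simp: pact_def)

lemma pact_closed: "x \<in> V \<Longrightarrow> pact U p x \<in> V"
  by (induction p) (auto simp: pact_pCons subspace_0[OF V] intro: subspace_add[OF V] subspace_scale[OF V] endo_closed[OF U])

lemma endo_pact: "endo V (pact U p)"
proof (induction p)
  case 0
  show ?case by (auto simp: endo_def subspace_0[OF V])
next
  case (pCons a p)
  show ?case unfolding endo_def
  proof (intro conjI ballI allI)
    fix x y assume x: "x \<in> V" and y: "y \<in> V"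
    show "pact U (pCons a p) x \<in> V" by (rule pact_closed[OF x])
    show "pact U (pCons a p) (x + y) = pact U (pCons a p) x + pact U (pCons a p) y"
      using endo_add[OF pCons(2) x y] endo_add[OF U pact_closed[OF x] pact_closed[OF y]]
      by (simp add: pact_pCons scale_right_distrib algebra_simps)
  next
    fix c x assume x: "x \<in> V"
    show "pact U (pCons a p) (scale c x) = scale c (pact U (pCons a p) x)"
      using endo_scale[OF pCons(2) x] endo_scale[OF U pact_closed[OF x]]
      by (simp add: pact_pCons scale_right_distrib mult.commute)
  qed
qed

lemma pact_add: "x \<in> V \<Longrightarrow> pact U (p + q) x = pact U p x + pact U q x"
proof (induction p arbitrary: q)
  case (pCons a p)
  obtain b q' where q: "q = pCons b q'" by (cases q)
  have "pact U (pCons a p + q) x = scale (a + b) x + U (pact U p x + pact U q' x)"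
    unfolding q using pCons by (simp add: pact_pCons)
  also have "\<dots> = scale a x + scale b x + (U (pact U p x) + U (pact U q' x))"
    unfolding scale_left_distrib endo_add[OF U pact_closed[OF \<open>x \<in> V\<close>] pact_closed[OF \<open>x \<in> V\<close>]] ..
  finally show ?case unfolding q pact_pCons by (simp add: add_ac)
qed simp

lemma pact_smult: "x \<in> V \<Longrightarrow> pact U (smult c p) x = scale c (pact U p x)"
  by (induction p) (auto simp: pact_pCons scale_right_distrib endo_scale[OF U] pact_closed)

lemma pact_mult: "x \<in> V \<Longrightarrow> pact U (p * q) x = pact U p (pact U q x)"
  by (induction p) (auto simp: pact_pCons pact_add pact_smult pact_closed)

lemma pact_minus: "x \<in> V \<Longrightarrow> pact U (- p) x = - pact U p x"
  using pact_smult[of x "-1" p] by simp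

lemma pact_diff: "x \<in> V \<Longrightarrow> pact U (p - q) x = pact U p x - pact U q x"
  using pact_add[of x p "- q"] pact_minus[of x q] by simp

lemma pact_monom: "x \<in> V \<Longrightarrow> pact U (monom c n) x = scale c ((U ^^ n) x)"
  by (induction n) (auto simp: pact_pCons monom_0 monom_Suc endo_0[OF U V] endo_scale[OF U] endo_funpow_closed[OF U])

lemma pact_1: "x \<in> V \<Longrightarrow> pact U 1 x = x"
  using pact_monom[of x 1 0] endo_0[OF U V] by (simp add: monom_0 one_pCons[symmetric])

lemma pact_commute:
  assumes g: "endo V g" "\<And>x. x \<in> V \<Longrightarrow> g (U x) = U (g x)" and x: "x \<in> V"
  shows "g (pact U p x) = pact U p (g x)"
proof (induction p)
  case 0
  show ?case using endo_0[OF g(1) V] by simp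
next
  case (pCons a p)
  then show ?case
    using x endo_add[OF g(1)] endo_scale[OF g(1)] g(2) pact_closed[OF x] endo_closed[OF U] subspace_scale[OF V]
    by (simp add: pact_pCons)
qed

text \<open>Otherwise the iterates of \<open>U\<close> on \<open>x\<close> would be independent, and
  more of them than a finite spanning set permits.\<close>

lemma exists_annihilator:
  assumes "finite B" "V \<subseteq> module.span scale B" "x \<in> V"
  shows "\<exists>p. p \<noteq> 0 \<and> pact U p x = 0"
proof (rule ccontr)
  assume "\<not> ?thesis"
  then have n: "pact U p x \<noteq> 0" if "p \<noteq> 0" for p using that by blast
  have pow: "(U ^^ i) x = pact U (monom 1 i) x" for i using pact_monom[OF \<open>x \<in> V\<close>] by simp
  have "module.independent scale ((\<lambda>i. (U ^^ i) x) ` {..<k}) \<and> card ((\<lambda>i. (U ^^ i) x) ` {..<k}) = k" for k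
  proof (induction k)
    case (Suc k)
    define W where "W = {pact U p x | p. \<forall>i\<ge>k. coeff p i = 0}"
    have Wsub: "lsub W" unfolding W_def
    proof (rule subspaceI)
      show "0 \<in> {pact U p x | p. \<forall>i\<ge>k. coeff p i = 0}" by (auto intro!: exI[of _ 0])
      fix a b assume "a \<in> {pact U p x | p. \<forall>i\<ge>k. coeff p i = 0}" "b \<in> {pact U p x | p. \<forall>i\<ge>k. coeff p i = 0}"
      then obtain p q where "a = pact U p x" "b = pact U q x" "\<forall>i\<ge>k. coeff p i = 0" "\<forall>i\<ge>k. coeff q i = 0" by blast
      then show "a + b \<in> {pact U p x | p. \<forall>i\<ge>k. coeff p i = 0}"
        using pact_add[OF \<open>x \<in> V\<close>, of p q] by (intro CollectI exI[of _ "p + q"]) simp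
    next
      fix c a assume "a \<in> {pact U p x | p. \<forall>i\<ge>k. coeff p i = 0}"
      then obtain p where "a = pact U p x" "\<forall>i\<ge>k. coeff p i = 0" by blast
      then show "scale c a \<in> {pact U p x | p. \<forall>i\<ge>k. coeff p i = 0}"
        using pact_smult[OF \<open>x \<in> V\<close>, of c p] by (intro CollectI exI[of _ "smult c p"]) simp
    qed
    have "(\<lambda>i. (U ^^ i) x) ` {..<k} \<subseteq> W"
    proof safe
      fix i assume "i < k"
      then show "(U ^^ i) x \<in> W" unfolding W_def pow by (intro CollectI exI[of _ "monom 1 i"]) auto
    qed
    then have "module.span scale ((\<lambda>i. (U ^^ i) x) ` {..<k}) \<subseteq> W" using Wsub by (rule span_minimal)
    moreover have "(U ^^ k) x \<notin> W"
    proof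
      assume "(U ^^ k) x \<in> W"
      then obtain p where p: "(U ^^ k) x = pact U p x" "\<forall>i\<ge>k. coeff p i = 0" unfolding W_def by blast
      have "pact U (monom 1 k - p) x = 0" using pact_diff[OF \<open>x \<in> V\<close>] p(1) pow by simp
      then have "monom 1 k - p = 0" using n by blast
      then have "coeff (monom 1 k - p) k = 0" by simp
      then show False using p(2) by simp
    qed
    ultimately have nk: "(U ^^ k) x \<notin> module.span scale ((\<lambda>i. (U ^^ i) x) ` {..<k})" by blast
    from independent_insertI[OF nk conjunct1[OF Suc]]
    have "module.independent scale (insert ((U ^^ k) x) ((\<lambda>i. (U ^^ i) x) ` {..<k}))" .
    moreover have "(U ^^ k) x \<notin> (\<lambda>i. (U ^^ i) x) ` {..<k}"
      by (rule contrapos_nn[OF nk]) (rule span_base)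
    ultimately show ?case using Suc by (simp add: lessThan_Suc)
  qed (simp add: independent_empty)
  then have "module.independent scale ((\<lambda>i. (U ^^ i) x) ` {..<Suc (card B)})"
      "card ((\<lambda>i. (U ^^ i) x) ` {..<Suc (card B)}) = Suc (card B)" by blast+
  moreover have "(\<lambda>i. (U ^^ i) x) ` {..<Suc (card B)} \<subseteq> module.span scale B"
    using endo_funpow_closed[OF U \<open>x \<in> V\<close>] assms(2) by blast
  ultimately have "Suc (card B) \<le> card B" using independent_span_bound[OF assms(1)] by metis
  then show False by simp
qed

text \<open>Polynomials in \<open>U\<close> commute, so the product of annihilators of the finitely
  many generators kills everything.\<close>

lemma exists_annihilator_all:
  assumes "finite B" "V = module.span scale B"
  shows "\<exists>p. p \<noteq> 0 \<and> (\<forall>x\<in>V. pact U p x = 0)"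
proof -
  have "\<forall>b\<in>B. \<exists>p. p \<noteq> 0 \<and> pact U p b = 0"
    using exists_annihilator[OF assms(1)] assms(2) span_base by blast
  then obtain P where P: "\<And>b. b \<in> B \<Longrightarrow> P b \<noteq> 0" "\<And>b. b \<in> B \<Longrightarrow> pact U (P b) b = 0" by metis
  define p where "p = (\<Prod>b\<in>B. P b)"
  have "lsub {x \<in> V. pact U p x = 0}"
    using V endo_0[OF endo_pact V] endo_add[OF endo_pact] endo_scale[OF endo_pact]
    by (auto intro!: subspaceI simp: subspace_0 subspace_add subspace_scale)
  moreover have "B \<subseteq> {x \<in> V. pact U p x = 0}"
  proof
    fix b assume b: "b \<in> B"
    then have bV: "b \<in> V" using assms(2) span_base by blast
    have "p = (\<Prod>b\<in>B - {b}. P b) * P b" unfolding p_def using b assms(1)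
      by (simp add: prod.remove mult.commute)
    then have "pact U p b = 0" using pact_mult[OF bV] P(2)[OF b] endo_0[OF endo_pact V] by simp
    then show "b \<in> {x \<in> V. pact U p x = 0}" using bV by blast
  qed
  ultimately have "V \<subseteq> {x \<in> V. pact U p x = 0}" using span_minimal assms(2) by blast
  moreover have "p \<noteq> 0" unfolding p_def using P(1) assms(1) by simp
  ultimately show ?thesis by blast
qed

end

end

lemma (in linear_space) linear_factor_pact:
  assumes "lsub V" "endo V U" "y \<in> V" "pact U [:-a, 1:] y = 0"
  shows "U y = scale a y"
proof -
  have "scale (- a) y + U y = 0"
    using assms by (simp add: pact_pCons[OF assms(1,2)] endo_0[OF assms(2,1)])
  then show ?thesis by (simp add: add_eq_0_iff2)
qed

locale linear_space_ac = linear_space scale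
  for scale :: "'k::alg_closed_field \<Rightarrow> 'b::ab_group_add \<Rightarrow> 'b"
begin

text \<open>Linear factors of the annihilator are peeled off until one of them kills a nonzero
  vector.\<close>

lemma exists_eigenvector:
  assumes V: "lsub V" and U: "endo V U" and "x \<in> V" "x \<noteq> 0" "p \<noteq> 0" "pact U p x = 0"
  shows "\<exists>a. \<exists>y\<in>V. y \<noteq> 0 \<and> U y = scale a y"
  using assms(3-)
proof (induction "degree p" arbitrary: p)
  case 0
  then obtain c where "p = [:c:]" by (auto elim: degree_eq_zeroE)
  then show ?case using 0 by (simp add: pact_pCons[OF V U] endo_0[OF U V])
next
  case (Suc n)
  then obtain a where a: "poly p a = 0" using alg_closed_imp_poly_has_root[of p] by auto
  then have "[:-a, 1:] dvd p" using poly_eq_0_iff_dvd by blast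
  then obtain q where q: "p = [:-a, 1:] * q" by (rule dvdE)
  have q0: "q \<noteq> 0" using q Suc.prems by auto
  have "degree p = Suc (degree q)" unfolding q using q0 by (subst degree_mult_eq) auto
  show ?case
  proof (cases "pact U q x = 0")
    case True
    then show ?thesis using Suc \<open>degree p = Suc (degree q)\<close> q0 by simp
  next
    case False
    have "pact U [:-a, 1:] (pact U q x) = 0" using Suc.prems pact_mult[OF V U] q by metis
    then show ?thesis
      using False linear_factor_pact[OF V U pact_closed[OF V U]] pact_closed[OF V U] Suc.prems(1) by blast
  qed
qed

text \<open>Primary decomposition: the kernels of the part of \<open>p\<close> at a root
  \<open>a\<close> and of the coprime remaining factor are complementary, and they are stable
  because \<open>U\<close> commutes with \<Gamma>. Indecomposability makes one of them zero; then
  either the power of the linear factor at \<open>a\<close> annihilates, or the remaining factor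
  does and has smaller degree.\<close>

lemma single_eigenvalue:
  assumes V: "lsub V" and U: "endo V U" and "\<And>g. g \<in> \<Gamma> \<Longrightarrow> endo V g"
    and comm: "\<And>g x. g \<in> \<Gamma> \<Longrightarrow> x \<in> V \<Longrightarrow> g (U x) = U (g x)"
    and ind: "indecomp \<Gamma> V" and "p \<noteq> 0" "\<And>x. x \<in> V \<Longrightarrow> pact U p x = 0"
  shows "\<exists>a e. \<forall>x\<in>V. pact U ([:-a, 1:] ^ e) x = 0"
  using assms(6-)
proof (induction "degree p" arbitrary: p rule: less_induct)
  case less
  have ker: "closed_under \<Gamma> V {x \<in> V. pact U f x = 0}" for f
    unfolding closed_under_def
  proof (intro conjI ballI)
    show "lsub {x \<in> V. pact U f x = 0}"
      using V endo_0[OF endo_pact[OF V U] V] endo_add[OF endo_pact[OF V U]] endo_scale[OF endo_pact[OF V U]]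
      by (auto intro!: subspaceI simp: subspace_0 subspace_add subspace_scale)
    fix g x assume g: "g \<in> \<Gamma>" and x: "x \<in> {x \<in> V. pact U f x = 0}"
    then show "g x \<in> {x \<in> V. pact U f x = 0}"
      using pact_commute[OF V U assms(3)[OF g] comm[OF g], of x f] endo_0[OF assms(3)[OF g] V]
        endo_closed[OF assms(3)[OF g]] by simp
  qed auto
  have "degree p \<noteq> 0"
  proof
    assume "degree p = 0"
    then obtain c where c: "p = [:c:]" by (auto elim: degree_eq_zeroE)
    then have "x = 0" if "x \<in> V" for x
      using less.prems that by (auto simp: pact_pCons[OF V U] endo_0[OF U V])
    then show False using ind subspace_0[OF V] unfolding indecomp_def by blast
  qed
  then obtain a where a: "poly p a = 0" using alg_closed_imp_poly_has_root[of p] by auto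
  obtain g where g: "p = [:-a, 1:] ^ order a p * g" "\<not> [:-a, 1:] dvd g"
    using order_decomp[OF less.prems(1), of a] by blast
  define f where "f = [:-a, 1:] ^ order a p"
  have pf: "p = f * g" using g(1) unfolding f_def .
  have "order a p > 0" using a less.prems(1) by (simp add: order_root)
  have g0: "g \<noteq> 0" using g(2) by auto
  have f0: "f \<noteq> 0" unfolding f_def by simp
  have dg: "degree g < degree p"
  proof -
    have "degree p = degree f + degree g" using degree_mult_eq[OF f0 g0] by (simp flip: pf)
    moreover have "degree f > 0" unfolding f_def using \<open>order a p > 0\<close> by (simp add: degree_power_eq)
    ultimately show ?thesis by simp
  qed
  have "coprime [:-a, 1:] g"
  proof (rule coprimeI)
    fix d assume d: "d dvd [:-a, 1:]" "d dvd g"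
    from d(1) obtain k where k: "[:-a, 1:] = d * k" by (rule dvdE)
    have "d \<noteq> 0" "k \<noteq> 0" using k by auto
    then have deg: "degree d + degree k = 1" using degree_mult_eq[of d k] k[symmetric] by simp
    show "is_unit d"
    proof (cases "degree d = 0")
      case True
      then show ?thesis using \<open>d \<noteq> 0\<close> by (simp add: is_unit_iff_degree)
    next
      case False
      then have "is_unit k" using deg \<open>k \<noteq> 0\<close> by (simp add: is_unit_iff_degree)
      then have "[:-a, 1:] dvd d" unfolding k by (simp add: mult_unit_dvd_iff)
      then show ?thesis using d(2) g(2) dvd_trans by blast
    qed
  qed
  then obtain u0 w0 where uw0: "u0 * [:-a, 1:] + w0 * g = 1" using poly_bezout by blast
  have "\<exists>u w. u * [:-a, 1:] ^ n + w * g = 1" for n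
  proof (induction n)
    case (Suc n)
    then obtain u w where uw: "u * [:-a, 1:] ^ n + w * g = 1" by blast
    have "1 = (u * [:-a, 1:] ^ n + w * g) * (u0 * [:-a, 1:] + w0 * g)" unfolding uw uw0 by simp
    also have "\<dots> = (u * u0) * [:-a, 1:] ^ Suc n + (u * [:-a, 1:] ^ n * w0 + w * (u0 * [:-a, 1:] + w0 * g)) * g"
      unfolding power_Suc by (simp only: algebra_simps)
    finally show ?case by metis
  next
    case 0
    show ?case by (intro exI[of _ 1] exI[of _ 0]) simp
  qed
  then obtain u w where uw: "u * f + w * g = 1" unfolding f_def by blast
  have decomp: "x = pact U u (pact U f x) + pact U w (pact U g x)" if "x \<in> V" for x
  proof -
    have "pact U (u * f + w * g) x = x" unfolding uw using pact_1[OF V U that] .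
    then show ?thesis using that by (simp add: pact_add[OF V U] pact_mult[OF V U])
  qed
  have fg: "pact U f (pact U g x) = 0" if "x \<in> V" for x
    using less.prems(2)[OF that] pact_mult[OF V U that, of f g] by (simp flip: pf)
  have comm': "pact U h (pact U k x) = pact U k (pact U h x)" if "x \<in> V" for h k x
    using pact_mult[OF V U that, of h k] pact_mult[OF V U that, of k h] by (simp add: mult.commute)
  have cl: "pact U h x \<in> V" if "x \<in> V" for h x using pact_closed[OF V U that] .
  have z: "pact U h 0 = 0" for h using endo_0[OF endo_pact[OF V U] V] .
  have "complements V {x \<in> V. pact U f x = 0} {x \<in> V. pact U g x = 0}"
    unfolding complements_def
  proof (intro conjI ballI)
    show "{x \<in> V. pact U f x = 0} \<inter> {x \<in> V. pact U g x = 0} = {0}"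
    proof
      show "{x \<in> V. pact U f x = 0} \<inter> {x \<in> V. pact U g x = 0} \<subseteq> {0}"
      proof
        fix x assume "x \<in> {x \<in> V. pact U f x = 0} \<inter> {x \<in> V. pact U g x = 0}"
        then show "x \<in> {0}" using decomp[of x] z by simp
      qed
    qed (use z subspace_0[OF V] in auto)
    fix x assume x: "x \<in> V"
    have "pact U g (pact U u (pact U f x)) = 0"
      using comm'[OF cl[OF x], of g u f] comm'[OF x, of g f] fg[OF x] z by simp
    moreover have "pact U f (pact U w (pact U g x)) = 0"
      using comm'[OF cl[OF x], of f w g] fg[OF x] z by simp
    ultimately show "\<exists>s\<in>{x \<in> V. pact U f x = 0}. \<exists>t\<in>{x \<in> V. pact U g x = 0}. x = s + t"
      using decomp[OF x] cl x
      by (intro bexI[of _ "pact U w (pact U g x)"] bexI[of _ "pact U u (pact U f x)"]) (auto simp: add.commute)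
  qed
  then have "{x \<in> V. pact U f x = 0} = {0} \<or> {x \<in> V. pact U g x = 0} = {0}"
    using ind ker unfolding indecomp_def by blast
  then show ?case
  proof
    assume "{x \<in> V. pact U f x = 0} = {0}"
    then have "pact U g x = 0" if "x \<in> V" for x using fg[OF that] cl[OF that] by blast
    then show ?thesis using less.hyps[OF dg g0] by blast
  next
    assume "{x \<in> V. pact U g x = 0} = {0}"
    then have "pact U f x = 0" if "x \<in> V" for x using fg[OF that] comm'[OF that, of f g] cl[OF that] by auto
    then show ?thesis unfolding f_def by blast
  qed
qed

end

context linear_space
begin

lemma funpow_scale:
  assumes "endo V U" "x \<in> V"
  shows "((\<lambda>x. scale \<kappa> ((U ^^ L) x)) ^^ n) x = scale (\<kappa> ^ n) ((U ^^ (L * n)) x)"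
proof (induction n)
  case (Suc n)
  have "((\<lambda>x. scale \<kappa> ((U ^^ L) x)) ^^ Suc n) x = scale \<kappa> ((U ^^ L) (scale (\<kappa> ^ n) ((U ^^ (L * n)) x)))"
    by (simp add: Suc)
  also have "\<dots> = scale (\<kappa> * \<kappa> ^ n) ((U ^^ L) ((U ^^ (L * n)) x))"
    using endo_scale[OF endo_funpow[OF assms(1)] endo_funpow_closed[OF assms]] by simp
  finally show ?case by (simp add: funpow_add)
qed simp

lemma funpow_eigen:
  assumes "endo V A" "\<And>x. x \<in> V \<Longrightarrow> A x = scale \<mu> x" "x \<in> V"
  shows "(A ^^ n) x = scale (\<mu> ^ n) x"
proof (induction n)
  case (Suc n)
  then show ?case using assms(2)[OF endo_funpow_closed[OF assms(1,3), of n]] by simp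
qed simp

lemma endo_scaled: "lsub V \<Longrightarrow> endo V U \<Longrightarrow> endo V (\<lambda>x. scale \<kappa> (U x))"
  by (auto simp: endo_def scale_right_distrib mult.commute intro: subspace_scale)

lemma endo_minus_endo: "lsub V \<Longrightarrow> endo V f \<Longrightarrow> endo V g \<Longrightarrow> endo V (\<lambda>x. f x - g x)"
  by (auto simp: endo_def scale_right_diff_distrib intro: subspace_diff)

lemma funpow_pact:
  assumes "lsub V" "endo V U" "x \<in> V" "endo V N" "\<And>x. x \<in> V \<Longrightarrow> N x = pact U q x"
  shows "(N ^^ n) x = pact U (q ^ n) x"
proof (induction n)
  case 0
  show ?case using pact_1[OF assms(1,2,3)] by simp
next
  case (Suc n)
  then show ?case using assms pact_mult[OF assms(1,2,3), of q "q ^ n"] endo_funpow_closed[OF assms(4,3), of n] by simp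
qed

lemma completely_reducible_insert_zero:
  assumes "completely_reducible \<Gamma> V"
  shows "completely_reducible (insert (\<lambda>x. 0) \<Gamma>) V"
proof -
  have "closed_under (insert (\<lambda>x. 0) \<Gamma>) V S \<longleftrightarrow> closed_under \<Gamma> V S" for S
    using subspace_0[of S] by (auto simp: closed_under_def)
  then show ?thesis using assms unfolding completely_reducible_def by simp
qed

end

text \<open>\<open>l ^ e\<close> is 1 modulo \<open>l - 1\<close>. The quotient \<open>t\<close>
  enters the scalar \<kappa> in \<open>twisted_jordan\<close>.\<close>

lemma prime_power_minus_one:
  assumes l: "l \<ge> 1"
  shows "\<exists>t. (l - 1) * t + 1 = (l::nat) ^ e"
proof (induction e)
  case (Suc e)
  then obtain t where t: "(l - 1) * t + 1 = l ^ e" by blast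
  obtain k where k: "l = Suc k" using l by (cases l) auto
  have "l ^ Suc e = l * ((l - 1) * t + 1)" using t by simp
  also have "\<dots> = (l - 1) * (l * t + 1) + 1" unfolding k by (simp add: algebra_simps)
  finally show ?case by metis
qed (auto intro: exI[of _ 0])

section \<open>Jordan decomposition up to scalars\<close>

context linear_space_ac
begin

text \<open>An eigenspace of \<open>A\<close> is nonzero and stable, hence everything.\<close>

lemma schur:
  assumes V: "lsub V" "finite B" "V = module.span scale B" and \<Gamma>: "\<And>g. g \<in> \<Gamma> \<Longrightarrow> endo V g"
    and irr: "irred \<Gamma> V" and A: "endo V A" "\<And>g x. g \<in> \<Gamma> \<Longrightarrow> x \<in> V \<Longrightarrow> g (A x) = A (g x)"
  shows "\<exists>a. \<forall>x\<in>V. A x = scale a x"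
proof -
  obtain x where x: "x \<in> V" "x \<noteq> 0" using irr subspace_0[OF V(1)] unfolding irred_def by blast
  obtain p where "p \<noteq> 0" "pact A p x = 0"
    using exists_annihilator[OF V(1) A(1) V(2) _ x(1)] V(3) by blast
  then obtain a y where y: "y \<in> V" "y \<noteq> 0" "A y = scale a y"
    using exists_eigenvector[OF V(1) A(1) x] by blast
  define S where "S = {x \<in> V. A x = scale a x}"
  have "closed_under \<Gamma> V S" unfolding closed_under_def
  proof (intro conjI ballI)
    show "lsub S" unfolding S_def
      using V(1) endo_0[OF A(1) V(1)] endo_add[OF A(1)] endo_scale[OF A(1)]
      by (auto intro!: subspaceI simp: subspace_0 subspace_add subspace_scale scale_right_distrib mult.commute)
    fix g x assume g: "g \<in> \<Gamma>" and x: "x \<in> S"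
    then have "A (g x) = g (scale a x)" using A(2)[OF g, of x] unfolding S_def by simp
    then show "g x \<in> S" using x endo_closed[OF \<Gamma>[OF g]] endo_scale[OF \<Gamma>[OF g]] unfolding S_def by simp
  qed (auto simp: S_def)
  moreover have "S \<noteq> {0}" using y unfolding S_def by blast
  ultimately have "S = V" using irr unfolding irred_def by blast
  then show ?thesis unfolding S_def by blast
qed

text \<open>With m = l - 1 the operator \<open>U ^^ m\<close> commutes with everything, so some
  power of \<open>U ^^ m - a\<close> vanishes. Its power with exponent L = l ^ e vanishes as well
  and splits additively in characteristic l, which gives the exact relation
  \<open>U ^^ (m * L) = a ^ L\<close>. If \<open>a\<close> is zero, \<open>U\<close> is nilpotent;
  otherwise this one relation makes \<open>C ^^ m\<close> scalar and \<open>U - C\<close>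
  nilpotent.\<close>

lemma twisted_jordan:
  assumes V: "lsub V" "finite B" "V = module.span scale B"
    and \<Gamma>: "\<And>g. g \<in> \<Gamma> \<Longrightarrow> endo V g" and U: "endo V U"
    and quasi: "\<And>g. g \<in> \<Gamma> \<Longrightarrow> \<exists>c. c \<noteq> 0 \<and> c ^ CHAR('k) = c \<and> (\<forall>x\<in>V. g (U x) = scale c (U (g x)))"
    and ind: "indecomp (insert U \<Gamma>) V" and prime: "prime CHAR('k)"
  shows "(\<exists>n. \<forall>x\<in>V. (U ^^ n) x = 0) \<or>
    (\<exists>\<kappa> e \<mu> n. \<mu> \<noteq> 0 \<and> (\<forall>x\<in>V. ((\<lambda>x. scale \<kappa> ((U ^^ (CHAR('k) ^ e)) x)) ^^ (CHAR('k) - 1)) x = scale \<mu> x) \<and>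
       (\<forall>x\<in>V. ((\<lambda>x. U x - scale \<kappa> ((U ^^ (CHAR('k) ^ e)) x)) ^^ n) x = 0))"
proof -
  let ?l = "CHAR('k)"
  define m where "m = ?l - 1"
  have l2: "?l \<ge> 2" using prime_ge_2_nat[OF prime] .
  have lm: "?l = Suc m" using l2 unfolding m_def by simp
  define A where "A = U ^^ m"
  have A: "endo V A" unfolding A_def by (rule endo_funpow[OF U])
  have commA: "g (A x) = A (g x)" if "g \<in> insert U \<Gamma>" "x \<in> V" for g x
  proof (cases "g = U")
    case True
    then show ?thesis unfolding A_def by (simp add: funpow_swap1)
  next
    case False
    then have g: "g \<in> \<Gamma>" using that by blast
    obtain c where c: "c \<noteq> 0" "c ^ ?l = c" "\<forall>x\<in>V. g (U x) = scale c (U (g x))" using quasi[OF g] by blast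
    have "c ^ m = 1" using c(1,2) unfolding lm by simp
    then show ?thesis using funpow_quasi_commute[OF \<Gamma>[OF g] U _ that(2), of c m] c(3) unfolding A_def by simp
  qed
  have U\<Gamma>: "endo V g" if "g \<in> insert U \<Gamma>" for g using that U \<Gamma> by blast
  obtain p where p: "p \<noteq> 0" "\<forall>x\<in>V. pact A p x = 0" using exists_annihilator_all[OF V(1) A V(2,3)] by blast
  obtain a e where ae: "\<forall>x\<in>V. pact A ([:-a, 1:] ^ e) x = 0"
    using single_eigenvalue[OF V(1) A U\<Gamma> commA ind p(1)] p(2) by blast
  \<comment> \<open>The nilpotency exponent \<open>e\<close> doubles as the exponent of l, because e
    \<le> l ^ e.\<close>
  define L where "L = ?l ^ e"
  have "e < 2 ^ e" by (rule less_exp)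
  also have "\<dots> \<le> L" unfolding L_def using l2 by (rule power_mono) simp
  finally have Le: "e \<le> L" by simp
  have L0: "L > 0" unfolding L_def using l2 by simp
  \<comment> \<open>Deduced from \<open>(b + - b) ^ L = 0\<close>, uniformly in l, so that l = 2 is
    included.\<close>
  have neg: "(- b) ^ L = - (b ^ L)" for b :: 'k
  proof -
    have "(b + - b) ^ L = b ^ L + (- b) ^ L" unfolding L_def by (rule freshmans_dream'[OF _ refl]) (use prime in simp)
    moreover have "(b + - b) ^ L = 0" using L0 by (cases L) auto
    ultimately show ?thesis by (simp add: eq_neg_iff_add_eq_0 add.commute)
  qed
  have AL: "(U ^^ (m * L)) x = scale (a ^ L) x" if x: "x \<in> V" for x
  proof -
    have "[:-a, 1:] ^ L = [:-a, 1:] ^ (L - e) * [:-a, 1:] ^ e" using Le by (simp flip: power_add)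
    then have "pact A ([:-a, 1:] ^ L) x = 0"
      using pact_mult[OF V(1) A x] ae x endo_0[OF endo_pact[OF V(1) A] V(1)] by simp
    moreover have "[:-a, 1:] ^ L = (monom 1 1 + [:-a:]) ^ L" by (simp add: monom_Suc monom_0)
    moreover have "(monom 1 1 + [:-a:]) ^ L = monom (1::'k) 1 ^ L + [:-a:] ^ L"
      unfolding L_def by (rule freshmans_dream') (use prime in simp_all)
    moreover have "monom (1::'k) 1 ^ L + [:-a:] ^ L = monom 1 L + monom (- (a ^ L)) 0"
      by (simp add: monom_power poly_const_pow neg monom_0)
    ultimately have "pact A (monom 1 L + monom (- (a ^ L)) 0) x = 0" by simp
    then have "(A ^^ L) x - scale (a ^ L) x = 0"
      by (simp add: pact_add[OF V(1) A x] pact_monom[OF V(1) A x])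
    then show ?thesis unfolding A_def by (simp add: funpow_mult)
  qed
  show ?thesis
  proof (cases "a = 0")
    case True
    then have "\<forall>x\<in>V. (U ^^ (m * L)) x = 0" using AL L0 by simp
    then show ?thesis by blast
  next
    case False
    obtain t where t: "m * t + 1 = L" using prime_power_minus_one[of ?l e] l2 unfolding m_def L_def by auto
    \<comment> \<open>By additivity the L-th power of \<open>U - \<kappa> U ^ L\<close> is
      \<open>U ^ L - \<kappa> ^ L U ^ (L * L)\<close>. Since \<open>L * L = (m * L) * t + L\<close>,
      the second term equals \<open>\<kappa> ^ L a ^ (L * t) U ^ L\<close>; this \<kappa> makes the
      two cancel.\<close>
    define \<kappa> where "\<kappa> = inverse (a ^ t)"
    define C where "C = (\<lambda>x. scale \<kappa> ((U ^^ L) x))"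
    have C: "endo V C" unfolding C_def by (rule endo_scaled[OF V(1) endo_funpow[OF U]])
    have Cm: "(C ^^ m) x = scale (\<kappa> ^ m * a ^ L) x" if "x \<in> V" for x
      using funpow_scale[OF U that, where \<kappa> = \<kappa> and L = L and n = m] AL[OF that] unfolding C_def by (simp add: mult.commute)
    define N where "N = (\<lambda>x. U x - C x)"
    have N: "endo V N" unfolding N_def by (rule endo_minus_endo[OF V(1) U C])
    define q where "q = monom 1 1 + monom (- \<kappa>) L"
    have Nq: "N x = pact U q x" if "x \<in> V" for x
      unfolding N_def C_def q_def using that by (simp add: pact_add[OF V(1) U] pact_monom[OF V(1) U])
    have qL: "q ^ L = monom 1 L + monom (- (\<kappa> ^ L)) (L * L)"
    proof -
      have "q ^ L = monom 1 1 ^ L + monom (- \<kappa>) L ^ L"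
        unfolding q_def L_def by (rule freshmans_dream') (use prime in simp_all)
      then show ?thesis by (simp add: monom_power neg)
    qed
    have "(N ^^ L) x = 0" if x: "x \<in> V" for x
    proof -
      have ULV: "(U ^^ L) x \<in> V" using endo_funpow_closed[OF U x] .
      have "L * L = (m * L) * t + L" using t by (metis add.commute add_mult_distrib mult.assoc mult.commute mult_1)
      then have "(U ^^ (L * L)) x = ((U ^^ (m * L)) ^^ t) ((U ^^ L) x)"
        by (simp add: funpow_add funpow_mult)
      also have "\<dots> = scale ((a ^ L) ^ t) ((U ^^ L) x)"
        by (rule funpow_eigen[OF endo_funpow[OF U] AL ULV])
      finally have "(N ^^ L) x = (U ^^ L) x - scale (\<kappa> ^ L * (a ^ L) ^ t) ((U ^^ L) x)"
        using funpow_pact[OF V(1) U x N Nq, of L] unfolding qL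
        by (simp add: pact_add[OF V(1) U x] pact_monom[OF V(1) U x])
      moreover have "\<kappa> ^ L * (a ^ L) ^ t = 1" unfolding \<kappa>_def using False
        by (simp add: power_inverse flip: power_mult) (simp add: mult.commute)
      ultimately show ?thesis by simp
    qed
    moreover have "\<kappa> ^ m * a ^ L \<noteq> 0" unfolding \<kappa>_def using False by simp
    ultimately show ?thesis using Cm unfolding N_def C_def L_def m_def by blast
  qed
qed

text \<open>Three results are chained: the decomposition U = C + N, complete reducibility after
  adjoining \<open>C\<close>, and the splitting of \<open>V\<close> into chains under
  \<open>N\<close>. The clause on \<Gamma> records that \<open>C\<close> and \<open>N\<close>
  inherit every commutation scalar of \<open>U\<close> fixed by the l-th power map, hence the values
  of \<nu>.\<close>

lemma twisted_structure:
  assumes V: "lsub V" "finite B" "V = module.span scale B"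
    and \<Gamma>: "\<And>g. g \<in> \<Gamma> \<Longrightarrow> endo V g" and U: "endo V U"
    and quasi: "\<And>g. g \<in> \<Gamma> \<Longrightarrow> \<exists>c. c \<noteq> 0 \<and> c ^ CHAR('k) = c \<and> (\<forall>x\<in>V. g (U x) = scale c (U (g x)))"
    and ind: "indecomp (insert U \<Gamma>) V" and prime: "prime CHAR('k)" and cr: "completely_reducible \<Gamma> V"
  shows "\<exists>C N n S. endo V C \<and> endo V N \<and> (\<forall>x\<in>V. U x = C x + N x) \<and> (\<forall>x\<in>V. C (N x) = N (C x)) \<and>
    (\<forall>g\<in>\<Gamma>. \<forall>c. c ^ CHAR('k) = c \<longrightarrow> (\<forall>x\<in>V. g (U x) = scale c (U (g x))) \<longrightarrow>
       (\<forall>x\<in>V. g (C x) = scale c (C (g x))) \<and> (\<forall>x\<in>V. g (N x) = scale c (N (g x)))) \<and>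
    (\<forall>x\<in>V. (N ^^ Suc n) x = 0) \<and>
    closed_under (insert C \<Gamma>) V S \<and> irred (insert C \<Gamma>) S \<and>
    (\<forall>y\<in>V. \<exists>x. (\<forall>i. x i \<in> S) \<and> y = (\<Sum>i\<le>n. (N ^^ i) (x i))) \<and>
    (\<forall>x. (\<forall>i. x i \<in> S) \<longrightarrow> (\<Sum>i\<le>n. (N ^^ i) (x i)) = 0 \<longrightarrow> (\<forall>i\<le>n. x i = 0)) \<and>
    ((\<forall>x\<in>V. C x = 0) \<or> (\<exists>\<mu>. \<mu> \<noteq> 0 \<and> (\<forall>x\<in>V. (C ^^ (CHAR('k) - 1)) x = scale \<mu> x)))"
proof -
  let ?l = "CHAR('k)"
  have "\<exists>C N. endo V C \<and> endo V N \<and> (\<forall>x\<in>V. U x = C x + N x) \<and> (\<forall>x\<in>V. C (N x) = N (C x)) \<and>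
    (\<forall>g\<in>\<Gamma>. \<forall>c. c ^ ?l = c \<longrightarrow> (\<forall>x\<in>V. g (U x) = scale c (U (g x))) \<longrightarrow>
       (\<forall>x\<in>V. g (C x) = scale c (C (g x))) \<and> (\<forall>x\<in>V. g (N x) = scale c (N (g x)))) \<and>
    (\<exists>n. \<forall>x\<in>V. (N ^^ n) x = 0) \<and> completely_reducible (insert C \<Gamma>) V \<and>
    ((\<forall>x\<in>V. C x = 0) \<or> (\<exists>\<mu>. \<mu> \<noteq> 0 \<and> (\<forall>x\<in>V. (C ^^ (?l - 1)) x = scale \<mu> x)))"
  proof -
  have "(\<exists>n. \<forall>x\<in>V. (U ^^ n) x = 0) \<or>
    (\<exists>\<kappa> e \<mu> n. \<mu> \<noteq> 0 \<and> (\<forall>x\<in>V. ((\<lambda>x. scale \<kappa> ((U ^^ (?l ^ e)) x)) ^^ (?l - 1)) x = scale \<mu> x) \<and>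
       (\<forall>x\<in>V. ((\<lambda>x. U x - scale \<kappa> ((U ^^ (?l ^ e)) x)) ^^ n) x = 0))"
    by (rule twisted_jordan[OF V \<Gamma> U quasi ind prime])
  then show ?thesis
  proof (elim disjE exE conjE)
    fix n assume n: "\<forall>x\<in>V. (U ^^ n) x = 0"
    have "endo V (\<lambda>x. 0)" using subspace_0[OF V(1)] by (simp add: endo_def)
    then show ?thesis
      using U n completely_reducible_insert_zero[OF cr] endo_0[OF U V(1)] endo_0[OF \<Gamma> V(1)]
      by (intro exI[of _ "\<lambda>x. 0"] exI[of _ U]) auto
  next
    fix \<kappa> e \<mu> n
    assume \<mu>: "\<mu> \<noteq> 0" "\<forall>x\<in>V. ((\<lambda>x. scale \<kappa> ((U ^^ (?l ^ e)) x)) ^^ (?l - 1)) x = scale \<mu> x"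
      and n: "\<forall>x\<in>V. ((\<lambda>x. U x - scale \<kappa> ((U ^^ (?l ^ e)) x)) ^^ n) x = 0"
    define L where "L = ?l ^ e"
    define C where "C = (\<lambda>x. scale \<kappa> ((U ^^ L) x))"
    define N where "N = (\<lambda>x. U x - C x)"
    have C: "endo V C" unfolding C_def by (rule endo_scaled[OF V(1) endo_funpow[OF U]])
    have N: "endo V N" unfolding N_def by (rule endo_minus_endo[OF V(1) U C])
    have UC: "U (C x) = C (U x)" if "x \<in> V" for x
      unfolding C_def using endo_scale[OF U endo_funpow_closed[OF U that]] by (simp add: funpow_swap1)
    have CN: "C (N x) = N (C x)" if "x \<in> V" for x
      unfolding N_def using endo_diff[OF C V(1) endo_closed[OF U that] endo_closed[OF C that]] UC[OF that] by simp
    have tw: "(\<forall>x\<in>V. g (C x) = scale c (C (g x))) \<and> (\<forall>x\<in>V. g (N x) = scale c (N (g x)))"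
      if g: "g \<in> \<Gamma>" and c: "c ^ ?l = c" "\<forall>x\<in>V. g (U x) = scale c (U (g x))" for g c
    proof -
      have cL: "c ^ (?l ^ e) = c" for e
      proof (induction e)
        case (Suc e)
        have "c ^ (?l ^ Suc e) = (c ^ ?l) ^ (?l ^ e)" by (simp flip: power_mult)
        then show ?case using Suc c(1) by simp
      qed simp
      have 1: "g (C x) = scale c (C (g x))" if x: "x \<in> V" for x
      proof -
        have "g ((U ^^ L) x) = scale c ((U ^^ L) (g x))"
          using funpow_quasi_commute[OF \<Gamma>[OF g] U _ x, of c L] c(2) cL unfolding L_def by simp
        then show ?thesis unfolding C_def
          using endo_scale[OF \<Gamma>[OF g] endo_funpow_closed[OF U x]] by (simp add: mult.commute)
      qed
      moreover have "g (N x) = scale c (N (g x))" if x: "x \<in> V" for x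
        unfolding N_def using endo_diff[OF \<Gamma>[OF g] V(1) endo_closed[OF U x] endo_closed[OF C x]] 1[OF x] c(2) x
        by (simp add: scale_right_diff_distrib)
      ultimately show ?thesis by blast
    qed
    have l1: "of_nat (?l - 1) \<noteq> (0::'k)"
    proof
      assume "of_nat (?l - 1) = (0::'k)"
      then have "?l dvd ?l - 1" by (simp add: of_nat_eq_0_iff_char_dvd)
      then show False using prime_ge_2_nat[OF prime] by (auto dest: dvd_imp_le)
    qed
    have "completely_reducible (insert C \<Gamma>) V"
    proof (rule completely_reducible_insert[OF \<Gamma> V(1) cr C _ l1 \<mu>(1)])
      fix g assume g: "g \<in> \<Gamma>"
      obtain c where "c \<noteq> 0" "c ^ ?l = c" "\<forall>x\<in>V. g (U x) = scale c (U (g x))" using quasi[OF g] by blast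
      then show "\<exists>c. c \<noteq> 0 \<and> (\<forall>x\<in>V. g (C x) = scale c (C (g x)))" using tw[OF g] by blast
    qed (use \<mu>(2) in \<open>auto simp: C_def L_def\<close>)
    moreover have "\<forall>x\<in>V. (C ^^ (?l - 1)) x = scale \<mu> x" using \<mu>(2) unfolding C_def L_def .
    moreover have "\<forall>x\<in>V. (N ^^ n) x = 0" using n unfolding N_def C_def L_def .
    moreover have "\<forall>x\<in>V. U x = C x + N x" unfolding N_def by simp
    ultimately show ?thesis using C N CN tw \<mu>(1) by (intro exI[of _ C] exI[of _ N]) blast
  qed
  qed
  then obtain C N where C: "endo V C" and N: "endo V N" and UCN: "\<forall>x\<in>V. U x = C x + N x"
    and CN: "\<forall>x\<in>V. C (N x) = N (C x)"
    and tw: "\<forall>g\<in>\<Gamma>. \<forall>c. c ^ ?l = c \<longrightarrow> (\<forall>x\<in>V. g (U x) = scale c (U (g x))) \<longrightarrow>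
       (\<forall>x\<in>V. g (C x) = scale c (C (g x))) \<and> (\<forall>x\<in>V. g (N x) = scale c (N (g x)))"
    and nil: "\<exists>n. \<forall>x\<in>V. (N ^^ n) x = 0" and crC: "completely_reducible (insert C \<Gamma>) V"
    and alt: "(\<forall>x\<in>V. C x = 0) \<or> (\<exists>\<mu>. \<mu> \<noteq> 0 \<and> (\<forall>x\<in>V. (C ^^ (?l - 1)) x = scale \<mu> x))"
    by blast
  \<comment> \<open>\<open>nilpotent_split\<close> needs the exact nilpotency index, written as the
    successor of \<open>n\<close>.\<close>
  define n' where "n' = (LEAST n. \<forall>x\<in>V. (N ^^ n) x = 0)"
  have n': "\<forall>x\<in>V. (N ^^ n') x = 0" unfolding n'_def using nil by (rule LeastI_ex)
  have "n' \<noteq> 0"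
  proof
    assume "n' = 0"
    then have "V = {0}" using n' subspace_0[OF V(1)] by auto
    then show False using ind unfolding indecomp_def by blast
  qed
  then obtain n where n: "n' = Suc n" by (cases n') auto
  have "\<exists>x\<in>V. (N ^^ n) x \<noteq> 0" using not_less_Least[of n "\<lambda>n. \<forall>x\<in>V. (N ^^ n) x = 0"] n unfolding n'_def by auto
  moreover have "endo V g" if "g \<in> insert C \<Gamma>" for g using that C \<Gamma> by blast
  moreover have "\<exists>c. c \<noteq> 0 \<and> (\<forall>x\<in>V. g (N x) = scale c (N (g x)))" if g: "g \<in> insert C \<Gamma>" for g
  proof (cases "g = C")
    case True
    then show ?thesis using CN by (intro exI[of _ 1]) simp
  next
    case False
    then have g: "g \<in> \<Gamma>" using g by blast
    then show ?thesis using quasi[OF g] tw by blast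
  qed
  \<comment> \<open>A subspace stable under \<open>C\<close> and \<open>N\<close> is stable under
    their sum \<open>U\<close>, so indecomposability passes from \<open>U\<close> to the
    pair.\<close>
  moreover have "indecomp (insert N (insert C \<Gamma>)) V"
    unfolding indecomp_def
  proof (intro conjI allI impI)
    show "V \<noteq> {0}" using ind unfolding indecomp_def by blast
    have c: "closed_under (insert U \<Gamma>) V S" if S: "closed_under (insert N (insert C \<Gamma>)) V S" for S
      unfolding closed_under_def
    proof (intro conjI ballI)
      fix g x assume g: "g \<in> insert U \<Gamma>" and x: "x \<in> S"
      have xV: "x \<in> V" using x closed_under_subset[OF S] by blast
      have "C x + N x \<in> S"
        using closed_under_closed[OF S _ x] by (intro subspace_add[OF closed_under_subspace[OF S]]) auto
      then show "g x \<in> S" using g UCN xV closed_under_closed[OF S _ x] by auto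
    qed (use S in \<open>auto simp: closed_under_def\<close>)
    fix S T assume "closed_under (insert N (insert C \<Gamma>)) V S" "closed_under (insert N (insert C \<Gamma>)) V T" "complements V S T"
    then show "S = {0} \<or> T = {0}" using ind c unfolding indecomp_def by blast
  qed
  ultimately obtain S where S: "closed_under (insert C \<Gamma>) V S" "irred (insert C \<Gamma>) S"
    "\<forall>v\<in>V. \<exists>x. (\<forall>i. x i \<in> S) \<and> v = (\<Sum>i\<le>n. (N ^^ i) (x i))"
    "\<forall>x. (\<forall>i. x i \<in> S) \<longrightarrow> (\<Sum>i\<le>n. (N ^^ i) (x i)) = 0 \<longrightarrow> (\<forall>i\<le>n. x i = 0)"
    using nilpotent_split[of "insert C \<Gamma>" V N n] V(1) crC N n' n by auto
  show ?thesis
    by (intro exI[of _ C] exI[of _ N] exI[of _ n] exI[of _ S] conjI C N UCN CN tw S alt n'[unfolded n])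
qed

end

section \<open>Representations of the Weil group\<close>

text \<open>The coefficients are abstracted to an algebraically closed field of prime characteristic
  l different from p; the algebraic closure of the prime field is inserted in the final
  theorem.\<close>

locale weil_coeffs = nonarch_local_field v
  for v :: "'f::field \<Rightarrow> int" +
  fixes coeff_type :: "'k::alg_closed_field itself"
  assumes prime_CHAR: "prime CHAR('k)" and CHAR_ne_residue_char: "CHAR('k) \<noteq> residue_char v"
begin

abbreviation W :: "'f gal set" where "W \<equiv> carrier (weil_group v)"
abbreviation \<nu> :: "'f gal \<Rightarrow> 'k" where "\<nu> \<equiv> nu v"

sublocale weil: group "weil_group v" by (rule group_weil_group)

lemma residue_card_ne_0: "of_nat (residue_card v) \<noteq> (0 :: 'k)"
  by (rule residue_card_nonzero[OF prime_CHAR CHAR_ne_residue_char])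

lemma \<nu>_mult: "\<sigma> \<in> W \<Longrightarrow> \<tau> \<in> W \<Longrightarrow> \<nu> (\<sigma> \<otimes>\<^bsub>weil_group v\<^esub> \<tau>) = \<nu> \<sigma> * \<nu> \<tau>"
  by (rule nu_mult[OF _ _ residue_card_ne_0])

lemma \<nu>_nonzero: "\<sigma> \<in> W \<Longrightarrow> \<nu> \<sigma> \<noteq> 0"
  by (rule nu_nonzero[OF _ residue_card_ne_0])

lemma \<nu>_power_CHAR: "\<sigma> \<in> W \<Longrightarrow> \<nu> \<sigma> ^ CHAR('k) = \<nu> \<sigma>"
  by (rule nu_power_char[OF _ prime_CHAR])

lemma CHAR_ge_2: "CHAR('k) \<ge> 2" by (rule prime_ge_2_nat[OF prime_CHAR])

lemma \<nu>_power_CHAR_minus_1: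
  assumes "\<sigma> \<in> W"
  shows "\<nu> \<sigma> ^ (CHAR('k) - 1) = 1"
proof -
  have "CHAR('k) = Suc (CHAR('k) - 1)" using CHAR_ge_2 by simp
  then have "\<nu> \<sigma> * \<nu> \<sigma> ^ (CHAR('k) - 1) = \<nu> \<sigma>" using \<nu>_power_CHAR[OF assms] by (metis power_Suc)
  then show ?thesis using \<nu>_nonzero[OF assms] by simp
qed

text \<open>Separates the algebraic conditions on a representation from finiteness and smoothness,
  so that auxiliary spaces of tuples can be treated by algebra alone.\<close>

definition pre_rep :: "('f, 'k, 'v::ab_group_add) weil_rep \<Rightarrow> bool" where
  "pre_rep \<Phi> \<longleftrightarrow> vector_space (smul \<Phi>) \<and> module.subspace (smul \<Phi>) (vecs \<Phi>) \<and>
     (\<forall>\<sigma>\<in>W. act \<Phi> \<sigma> \<in> lin_maps \<Phi> \<Phi>) \<and>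
     (\<forall>x\<in>vecs \<Phi>. act \<Phi> \<one>\<^bsub>weil_group v\<^esub> x = x) \<and>
     (\<forall>\<sigma>\<in>W. \<forall>\<tau>\<in>W. \<forall>x\<in>vecs \<Phi>. act \<Phi> (\<sigma> \<otimes>\<^bsub>weil_group v\<^esub> \<tau>) x = act \<Phi> \<sigma> (act \<Phi> \<tau> x))"

definition fin_dim :: "('f, 'k, 'v::ab_group_add) weil_rep \<Rightarrow> bool" where
  "fin_dim \<Phi> \<longleftrightarrow> (\<exists>B. finite B \<and> vecs \<Phi> = module.span (smul \<Phi>) B)"

definition smooth :: "('f, 'k, 'v::ab_group_add) weil_rep \<Rightarrow> bool" where
  "smooth \<Phi> \<longleftrightarrow> (\<forall>x\<in>vecs \<Phi>. openin (weil_topology v) {\<sigma> \<in> W. act \<Phi> \<sigma> x = x})"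

lemma weil_rep_iff: "weil_rep v \<Phi> \<longleftrightarrow> pre_rep \<Phi> \<and> fin_dim \<Phi> \<and> smooth \<Phi>"
  unfolding weil_rep_def pre_rep_def fin_dim_def smooth_def by blast

lemma weil_rep_pre_rep: "weil_rep v \<Phi> \<Longrightarrow> pre_rep \<Phi>"
  by (simp add: weil_rep_iff)

lemma pre_rep_space: "pre_rep \<Phi> \<Longrightarrow> linear_space (smul \<Phi>)"
  by (simp add: pre_rep_def linear_space_def)

lemma pre_rep_space_ac: "pre_rep \<Phi> \<Longrightarrow> linear_space_ac (smul \<Phi>)"
  by (simp add: linear_space_ac_def pre_rep_space)

lemma pre_rep_module: "pre_rep \<Phi> \<Longrightarrow> Modules.module (smul \<Phi>)"
  by (simp add: pre_rep_def module_iff_vector_space)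

lemma pre_rep_subspace: "pre_rep \<Phi> \<Longrightarrow> module.subspace (smul \<Phi>) (vecs \<Phi>)"
  by (simp add: pre_rep_def)

lemma vecs_0: "pre_rep \<Phi> \<Longrightarrow> 0 \<in> vecs \<Phi>"
  and vecs_add: "pre_rep \<Phi> \<Longrightarrow> x \<in> vecs \<Phi> \<Longrightarrow> y \<in> vecs \<Phi> \<Longrightarrow> x + y \<in> vecs \<Phi>"
  and vecs_smul: "pre_rep \<Phi> \<Longrightarrow> x \<in> vecs \<Phi> \<Longrightarrow> smul \<Phi> c x \<in> vecs \<Phi>"
  by (rule module.subspace_0[OF pre_rep_module pre_rep_subspace] module.subspace_add[OF pre_rep_module pre_rep_subspace]
      module.subspace_scale[OF pre_rep_module pre_rep_subspace]; assumption)+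

lemma act_lin_maps: "pre_rep \<Phi> \<Longrightarrow> \<sigma> \<in> W \<Longrightarrow> act \<Phi> \<sigma> \<in> lin_maps \<Phi> \<Phi>"
  and act_one: "pre_rep \<Phi> \<Longrightarrow> x \<in> vecs \<Phi> \<Longrightarrow> act \<Phi> \<one>\<^bsub>weil_group v\<^esub> x = x"
  and act_mult: "pre_rep \<Phi> \<Longrightarrow> \<sigma> \<in> W \<Longrightarrow> \<tau> \<in> W \<Longrightarrow> x \<in> vecs \<Phi> \<Longrightarrow>
    act \<Phi> (\<sigma> \<otimes>\<^bsub>weil_group v\<^esub> \<tau>) x = act \<Phi> \<sigma> (act \<Phi> \<tau> x)"
  by (simp_all add: pre_rep_def)

lemma lin_maps_closed: "f \<in> lin_maps \<Phi> \<Phi>' \<Longrightarrow> x \<in> vecs \<Phi> \<Longrightarrow> f x \<in> vecs \<Phi>'"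
  and lin_maps_add: "f \<in> lin_maps \<Phi> \<Phi>' \<Longrightarrow> x \<in> vecs \<Phi> \<Longrightarrow> y \<in> vecs \<Phi> \<Longrightarrow> f (x + y) = f x + f y"
  and lin_maps_smul: "f \<in> lin_maps \<Phi> \<Phi>' \<Longrightarrow> x \<in> vecs \<Phi> \<Longrightarrow> f (smul \<Phi> c x) = smul \<Phi>' c (f x)"
  by (auto simp: lin_maps_def)

lemma lin_maps_0:
  assumes "pre_rep \<Phi>" "f \<in> lin_maps \<Phi> \<Phi>'"
  shows "f 0 = 0"
  using lin_maps_add[OF assms(2) vecs_0[OF assms(1)] vecs_0[OF assms(1)]] by simp

lemma lin_maps_diff:
  assumes "pre_rep \<Phi>" "f \<in> lin_maps \<Phi> \<Phi>'" "x \<in> vecs \<Phi>" "y \<in> vecs \<Phi>"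
  shows "f (x - y) = f x - f y"
proof -
  have "x - y \<in> vecs \<Phi>" using module.subspace_diff[OF pre_rep_module[OF assms(1)] pre_rep_subspace[OF assms(1)]] assms by blast
  then have "f (x - y + y) = f (x - y) + f y" using lin_maps_add[OF assms(2)] assms(4) by blast
  then show ?thesis by simp
qed

lemma lin_maps_sum:
  assumes "pre_rep \<Phi>" "f \<in> lin_maps \<Phi> \<Phi>'" "\<And>i. i \<in> A \<Longrightarrow> x i \<in> vecs \<Phi>"
  shows "f (\<Sum>i\<in>A. x i) = (\<Sum>i\<in>A. f (x i))"
  using assms(3)
proof (induction A rule: infinite_finite_induct)
  case (insert i A)
  then have "(\<Sum>i\<in>A. x i) \<in> vecs \<Phi>"
    using module.subspace_sum[OF pre_rep_module[OF assms(1)] pre_rep_subspace[OF assms(1)]] by blast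
  then show ?case using insert lin_maps_add[OF assms(2)] by simp
qed (simp_all add: lin_maps_0[OF assms(1,2)])

lemma act_closed: "pre_rep \<Phi> \<Longrightarrow> \<sigma> \<in> W \<Longrightarrow> x \<in> vecs \<Phi> \<Longrightarrow> act \<Phi> \<sigma> x \<in> vecs \<Phi>"
  using lin_maps_closed act_lin_maps by blast

lemma endo_iff_lin_maps:
  assumes "pre_rep \<Phi>"
  shows "linear_space.endo (smul \<Phi>) (vecs \<Phi>) f \<longleftrightarrow> f \<in> lin_maps \<Phi> \<Phi>"
  by (auto simp: linear_space.endo_def[OF pre_rep_space[OF assms]] lin_maps_def)

abbreviation actions :: "('f, 'k, 'v::ab_group_add) weil_rep \<Rightarrow> ('v \<Rightarrow> 'v) set" where
  "actions \<Phi> \<equiv> act \<Phi> ` W"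

abbreviation op_irred :: "('f, 'k, 'v::ab_group_add) weil_rep \<Rightarrow> ('v \<Rightarrow> 'v) \<Rightarrow> bool" where
  "op_irred \<Phi> U \<equiv> linear_space.irred (smul \<Phi>) (insert U (actions \<Phi>)) (vecs \<Phi>)"

abbreviation op_indecomp :: "('f, 'k, 'v::ab_group_add) weil_rep \<Rightarrow> ('v \<Rightarrow> 'v) \<Rightarrow> bool" where
  "op_indecomp \<Phi> U \<equiv> linear_space.indecomp (smul \<Phi>) (insert U (actions \<Phi>)) (vecs \<Phi>)"

lemma closed_under_insert:
  assumes "pre_rep \<Phi>"
  shows "linear_space.closed_under (smul \<Phi>) (insert U (actions \<Phi>)) (vecs \<Phi>) S \<longleftrightarrow>
    stable_subspace v \<Phi> S \<and> U ` S \<subseteq> S"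
  by (auto simp: linear_space.closed_under_def[OF pre_rep_space[OF assms]] stable_subspace_def)

lemma closed_under_actions:
  assumes "pre_rep \<Phi>"
  shows "linear_space.closed_under (smul \<Phi>) (actions \<Phi>) (vecs \<Phi>) S \<longleftrightarrow> stable_subspace v \<Phi> S"
  by (auto simp: linear_space.closed_under_def[OF pre_rep_space[OF assms]] stable_subspace_def)

text \<open>Membership in Hom(\<nu> \<Phi>, \<Phi>) written as a commutation rule, see
  \<open>dop_iff\<close>. In this form the linear algebra of operators commuting up to scalars
  applies.\<close>

definition dop :: "('f, 'k, 'v::ab_group_add) weil_rep \<Rightarrow> ('v \<Rightarrow> 'v) \<Rightarrow> bool" where
  "dop \<Phi> U \<longleftrightarrow> U \<in> lin_maps \<Phi> \<Phi> \<and> (\<forall>\<sigma>\<in>W. \<forall>x\<in>vecs \<Phi>. act \<Phi> \<sigma> (U x) = smul \<Phi> (\<nu> \<sigma>) (U (act \<Phi> \<sigma> x)))"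

lemma dop_iff:
  assumes "pre_rep \<Phi>"
  shows "U \<in> rep_hom v (twist v 1 \<Phi>) \<Phi> \<longleftrightarrow> dop \<Phi> U"
proof -
  have l: "lin_maps (twist v 1 \<Phi>) \<Phi> = lin_maps \<Phi> \<Phi>" by (simp add: lin_maps_def twist_def)
  show ?thesis unfolding rep_hom_def dop_def l
    using act_closed[OF assms] by (auto simp: twist_def lin_maps_smul)
qed

lemma deligne_rep_iff: "deligne_rep v (\<Phi>, U) \<longleftrightarrow> weil_rep v \<Phi> \<and> dop \<Phi> U"
  using dop_iff weil_rep_pre_rep by auto

lemma twist_simps [simp]:
  "vecs (twist v n \<Phi>) = vecs \<Phi>" "smul (twist v n \<Phi>) = smul \<Phi>"
  "act (twist v n \<Phi>) \<sigma> x = smul \<Phi> (\<nu> \<sigma> powi n) (act \<Phi> \<sigma> x)"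
  by (simp_all add: twist_def)

lemma lin_maps_twist [simp]:
  fixes \<Phi> :: "('f, 'k, _) weil_rep" and \<Phi>' :: "('f, 'k, _) weil_rep"
  shows "lin_maps (twist v n \<Phi>) \<Phi>' = lin_maps \<Phi> \<Phi>'" "lin_maps \<Phi> (twist v n \<Phi>') = lin_maps \<Phi> \<Phi>'"
  by (simp_all add: lin_maps_def)

lemma pre_rep_twist:
  assumes "pre_rep \<Phi>"
  shows "pre_rep (twist v n \<Phi>)"
proof -
  interpret linear_space "smul \<Phi>" by (rule pre_rep_space[OF assms])
  have "act (twist v n \<Phi>) \<sigma> \<in> lin_maps \<Phi> \<Phi>" if "\<sigma> \<in> W" for \<sigma>
    using act_lin_maps[OF assms that] vecs_smul[OF assms]
    by (auto simp: lin_maps_def scale_right_distrib mult.commute Pi_iff)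
  moreover have "act (twist v n \<Phi>) (\<sigma> \<otimes>\<^bsub>weil_group v\<^esub> \<tau>) x = act (twist v n \<Phi>) \<sigma> (act (twist v n \<Phi>) \<tau> x)"
    if "\<sigma> \<in> W" "\<tau> \<in> W" "x \<in> vecs \<Phi>" for \<sigma> \<tau> x
    using that act_closed[OF assms] lin_maps_smul[OF act_lin_maps[OF assms]]
    by (simp add: \<nu>_mult act_mult[OF assms] power_int_mult_distrib)
  ultimately show ?thesis using assms unfolding pre_rep_def by (simp add: nu_one)
qed

lemma fin_dim_twist [simp]: "fin_dim (twist v n \<Phi>) = fin_dim \<Phi>"
  by (simp add: fin_dim_def)

lemma weil_rep_twist:
  fixes \<Phi> :: "('f, 'k, _) weil_rep"
  assumes "weil_rep v \<Phi>"
  shows "weil_rep v (twist v n \<Phi>)"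
proof -
  have p: "pre_rep \<Phi>" "fin_dim \<Phi>" "smooth \<Phi>" using assms weil_rep_iff by auto
  have "openin (weil_topology v) {\<sigma> \<in> W. smul \<Phi> (\<nu> \<sigma> powi n) (act \<Phi> \<sigma> x) = x}" if x: "x \<in> vecs \<Phi>" for x
  proof (rule openin_twisted_stabilizer[where h = "\<lambda>\<sigma>. act \<Phi> \<sigma> x" and x = x])
    show "openin (weil_topology v) {\<sigma> \<in> W. act \<Phi> \<sigma> x = x}" using p(3) x unfolding smooth_def by blast
    show "act \<Phi> \<one>\<^bsub>weil_group v\<^esub> x = x" by (rule act_one[OF p(1) x])
    fix \<sigma> \<tau> assume "\<sigma> \<in> W" "smul \<Phi> (\<nu> \<sigma> powi n) (act \<Phi> \<sigma> x) = x" "\<tau> \<in> inertia v" "act \<Phi> \<tau> x = x"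
    then show "smul \<Phi> (\<nu> (\<sigma> \<otimes>\<^bsub>weil_group v\<^esub> \<tau>) powi n) (act \<Phi> (\<sigma> \<otimes>\<^bsub>weil_group v\<^esub> \<tau>) x) = x"
      using inertia_weil[of \<tau>] x by (simp add: \<nu>_mult nu_inertia act_mult[OF p(1)])
  qed
  then show ?thesis unfolding weil_rep_iff using p pre_rep_twist by (simp add: smooth_def)
qed

lemma pre_rep_restrict:
  assumes "pre_rep \<Phi>" "stable_subspace v \<Phi> S"
  shows "pre_rep (\<Phi>\<lparr>vecs := S\<rparr>)"
proof -
  have S: "module.subspace (smul \<Phi>) S" "\<And>x. x \<in> S \<Longrightarrow> x \<in> vecs \<Phi>"
    "\<And>\<sigma> x. \<sigma> \<in> W \<Longrightarrow> x \<in> S \<Longrightarrow> act \<Phi> \<sigma> x \<in> S"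
    using assms(2) unfolding stable_subspace_def by auto
  have "act \<Phi> \<sigma> \<in> lin_maps (\<Phi>\<lparr>vecs := S\<rparr>) (\<Phi>\<lparr>vecs := S\<rparr>)" if "\<sigma> \<in> W" for \<sigma>
    using S(3)[OF that] lin_maps_add[OF act_lin_maps[OF assms(1) that]] lin_maps_smul[OF act_lin_maps[OF assms(1) that]] S(2)
    by (simp add: lin_maps_def)
  moreover have "vector_space (smul \<Phi>)" using assms(1) by (simp add: pre_rep_def)
  ultimately show ?thesis
    using act_one[OF assms(1)] act_mult[OF assms(1)] S(1,2) unfolding pre_rep_def by simp
qed

lemma fin_dim_restrict:
  assumes "pre_rep \<Phi>" "fin_dim \<Phi>" "stable_subspace v \<Phi> S"
  shows "fin_dim (\<Phi>\<lparr>vecs := S\<rparr>)"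
proof -
  interpret linear_space "smul \<Phi>" by (rule pre_rep_space[OF assms(1)])
  obtain B where B: "finite B" "vecs \<Phi> = span B" using assms(2) unfolding fin_dim_def by blast
  obtain A where A: "A \<subseteq> S" "independent A" "S \<subseteq> span A" using maximal_independent_subset[of S] by blast
  have S: "lsub S" "S \<subseteq> vecs \<Phi>" using assms(3) unfolding stable_subspace_def by auto
  have "finite A" using independent_span_bound[OF B(1) A(2)] A(1) S(2) B(2) by blast
  moreover have "span A = S" using A S(1) by (intro span_subspace)
  ultimately show ?thesis unfolding fin_dim_def by auto
qed

lemma weil_rep_restrict:
  fixes \<Phi> :: "('f, 'k, _) weil_rep"
  assumes "weil_rep v \<Phi>" "stable_subspace v \<Phi> S"
  shows "weil_rep v (\<Phi>\<lparr>vecs := S\<rparr>)"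
proof -
  have p: "pre_rep \<Phi>" "fin_dim \<Phi>" "smooth \<Phi>" using assms(1) weil_rep_iff by auto
  have "smooth (\<Phi>\<lparr>vecs := S\<rparr>)" using p(3) assms(2) unfolding smooth_def stable_subspace_def by auto
  then show ?thesis using pre_rep_restrict[OF p(1) assms(2)] fin_dim_restrict[OF p(1,2) assms(2)] by (simp add: weil_rep_iff)
qed

section \<open>Homomorphisms, isomorphisms and transport\<close>

lemma rep_homD:
  assumes "f \<in> rep_hom v \<Phi> \<Phi>'"
  shows "f \<in> lin_maps \<Phi> \<Phi>'" "\<sigma> \<in> W \<Longrightarrow> x \<in> vecs \<Phi> \<Longrightarrow> f (act \<Phi> \<sigma> x) = act \<Phi>' \<sigma> (f x)"
  using assms by (auto simp: rep_hom_def)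

lemma rep_homI:
  assumes "\<And>x. x \<in> vecs \<Phi> \<Longrightarrow> f x \<in> vecs \<Phi>'"
    "\<And>x y. x \<in> vecs \<Phi> \<Longrightarrow> y \<in> vecs \<Phi> \<Longrightarrow> f (x + y) = f x + f y"
    "\<And>c x. x \<in> vecs \<Phi> \<Longrightarrow> f (smul \<Phi> c x) = smul \<Phi>' c (f x)"
    "\<And>\<sigma> x. \<sigma> \<in> W \<Longrightarrow> x \<in> vecs \<Phi> \<Longrightarrow> f (act \<Phi> \<sigma> x) = act \<Phi>' \<sigma> (f x)"
  shows "f \<in> rep_hom v \<Phi> \<Phi>'"
  using assms by (auto simp: rep_hom_def lin_maps_def)

lemma rep_isosD:
  assumes "f \<in> rep_isos v \<Phi> \<Phi>'"
  shows "f \<in> rep_hom v \<Phi> \<Phi>'" "f \<in> lin_maps \<Phi> \<Phi>'" "bij_betw f (vecs \<Phi>) (vecs \<Phi>')"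
    "\<sigma> \<in> W \<Longrightarrow> x \<in> vecs \<Phi> \<Longrightarrow> f (act \<Phi> \<sigma> x) = act \<Phi>' \<sigma> (f x)"
  using assms by (auto simp: rep_isos_def rep_hom_def)

lemma rep_isos_surj:
  assumes "f \<in> rep_isos v \<Phi> \<Phi>'" "y \<in> vecs \<Phi>'"
  obtains x where "x \<in> vecs \<Phi>" "y = f x"
  using rep_isosD(3)[OF assms(1)] assms(2) by (auto simp: bij_betw_def)

lemma rep_isos_inj: "f \<in> rep_isos v \<Phi> \<Phi>' \<Longrightarrow> x \<in> vecs \<Phi> \<Longrightarrow> y \<in> vecs \<Phi> \<Longrightarrow> f x = f y \<longleftrightarrow> x = y"
  using rep_isosD(3)[of f \<Phi> \<Phi>'] by (auto simp: bij_betw_def inj_on_def)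

lemma rep_isosI:
  assumes "pre_rep \<Phi>" "f \<in> rep_hom v \<Phi> \<Phi>'" "\<And>x. x \<in> vecs \<Phi> \<Longrightarrow> f x = 0 \<Longrightarrow> x = 0"
    "\<And>y. y \<in> vecs \<Phi>' \<Longrightarrow> \<exists>x\<in>vecs \<Phi>. y = f x"
  shows "f \<in> rep_isos v \<Phi> \<Phi>'"
proof -
  note l = rep_homD(1)[OF assms(2)]
  have "x = y" if "x \<in> vecs \<Phi>" "y \<in> vecs \<Phi>" "f x = f y" for x y
  proof -
    have "x - y \<in> vecs \<Phi>"
      using module.subspace_diff[OF pre_rep_module[OF assms(1)] pre_rep_subspace[OF assms(1)]] that by blast
    from assms(3)[OF this] have "x - y = 0" using lin_maps_diff[OF assms(1) l that(1,2)] that(3) by simp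
    then show ?thesis by simp
  qed
  then have "bij_betw f (vecs \<Phi>) (vecs \<Phi>')"
    using assms(4) lin_maps_closed[OF l] unfolding bij_betw_def inj_on_def by blast
  then show ?thesis using assms(2) by (simp add: rep_isos_def)
qed

lemma rep_isos_comp:
  assumes "f \<in> rep_isos v \<Phi> \<Phi>'" "g \<in> rep_isos v \<Phi>' \<Phi>''"
  shows "g \<circ> f \<in> rep_isos v \<Phi> \<Phi>''"
proof -
  have "bij_betw (g \<circ> f) (vecs \<Phi>) (vecs \<Phi>'')" using assms bij_betw_trans by (auto simp: rep_isos_def)
  then show ?thesis using assms by (auto simp: rep_isos_def rep_hom_def lin_maps_def Pi_iff)
qed

lemma rep_isos_inv:
  assumes "pre_rep \<Phi>" "f \<in> rep_isos v \<Phi> \<Phi>'"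
  shows "inv_into (vecs \<Phi>) f \<in> rep_isos v \<Phi>' \<Phi>"
proof -
  note f = rep_isosD[OF assms(2)]
  let ?g = "inv_into (vecs \<Phi>) f"
  have g: "?g (f x) = x" if "x \<in> vecs \<Phi>" for x using bij_betw_inv_into_left[OF f(3) that] .
  have b: "bij_betw ?g (vecs \<Phi>') (vecs \<Phi>)" by (rule bij_betw_inv_into[OF f(3)])
  have "?g (x + y) = ?g x + ?g y" if xy: "x \<in> vecs \<Phi>'" "y \<in> vecs \<Phi>'" for x y
  proof -
    obtain a where a: "a \<in> vecs \<Phi>" "x = f a" using rep_isos_surj[OF assms(2) xy(1)] .
    obtain b where b: "b \<in> vecs \<Phi>" "y = f b" using rep_isos_surj[OF assms(2) xy(2)] .
    have "?g (x + y) = ?g (f (a + b))" using lin_maps_add[OF f(2) a(1) b(1)] a b by simp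
    then show ?thesis using g a b vecs_add[OF assms(1) a(1) b(1)] by simp
  qed
  moreover have "?g (smul \<Phi>' c x) = smul \<Phi> c (?g x)" if xy: "x \<in> vecs \<Phi>'" for c x
  proof -
    obtain a where a: "a \<in> vecs \<Phi>" "x = f a" using rep_isos_surj[OF assms(2) xy] .
    then have "?g (smul \<Phi>' c x) = ?g (f (smul \<Phi> c a))" using lin_maps_smul[OF f(2), of a c] by simp
    then show ?thesis using g a vecs_smul[OF assms(1)] by simp
  qed
  moreover have "?g (act \<Phi>' \<sigma> x) = act \<Phi> \<sigma> (?g x)" if xy: "\<sigma> \<in> W" "x \<in> vecs \<Phi>'" for \<sigma> x
  proof -
    obtain a where a: "a \<in> vecs \<Phi>" "x = f a" using rep_isos_surj[OF assms(2) xy(2)] .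
    then have "?g (act \<Phi>' \<sigma> x) = ?g (f (act \<Phi> \<sigma> a))" using f(4)[OF xy(1) a(1)] by simp
    then show ?thesis using g a act_closed[OF assms(1) xy(1)] by simp
  qed
  ultimately show ?thesis using b by (auto simp: rep_isos_def rep_hom_def lin_maps_def bij_betw_def)
qed

lemma rep_isos_ident: "(\<lambda>x. x) \<in> rep_isos v \<Phi> \<Phi>"
  by (auto simp: rep_isos_def rep_hom_def lin_maps_def bij_betw_def)

lemma rep_iso_refl: "rep_iso v \<Phi> \<Phi>"
  using rep_isos_ident by (auto simp: rep_iso_def)

lemma rep_iso_sym: "pre_rep \<Phi> \<Longrightarrow> rep_iso v \<Phi> \<Phi>' \<Longrightarrow> rep_iso v \<Phi>' \<Phi>"
  unfolding rep_iso_def using rep_isos_inv by blast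

lemma rep_iso_trans: "rep_iso v \<Phi> \<Phi>' \<Longrightarrow> rep_iso v \<Phi>' \<Phi>'' \<Longrightarrow> rep_iso v \<Phi> \<Phi>''"
  unfolding rep_iso_def using rep_isos_comp by blast

lemma deligne_iso_trans:
  assumes "deligne_iso v D D'" "deligne_iso v D' D''"
  shows "deligne_iso v D D''"
proof -
  obtain \<Phi> U \<Phi>' U' \<Phi>'' U'' where D: "D = (\<Phi>, U)" "D' = (\<Phi>', U')" "D'' = (\<Phi>'', U'')"
    by (metis surj_pair)
  obtain f g where fg: "f \<in> rep_isos v \<Phi> \<Phi>'" "\<forall>x\<in>vecs \<Phi>. f (U x) = U' (f x)"
    "g \<in> rep_isos v \<Phi>' \<Phi>''" "\<forall>x\<in>vecs \<Phi>'. g (U' x) = U'' (g x)" using assms unfolding D by auto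
  then show ?thesis unfolding D
    using rep_isos_comp[OF fg(1,3)] lin_maps_closed[OF rep_isosD(2)[OF fg(1)]] by (auto intro!: bexI[of _ "g \<circ> f"])
qed

lemma deligne_iso_sym:
  assumes "pre_rep \<Phi>" "\<And>x. x \<in> vecs \<Phi> \<Longrightarrow> U x \<in> vecs \<Phi>" "deligne_iso v (\<Phi>, U) (\<Phi>', U')"
  shows "deligne_iso v (\<Phi>', U') (\<Phi>, U)"
proof -
  obtain f where f: "f \<in> rep_isos v \<Phi> \<Phi>'" "\<forall>x\<in>vecs \<Phi>. f (U x) = U' (f x)" using assms(3) by auto
  have "inv_into (vecs \<Phi>) f (U' y) = U (inv_into (vecs \<Phi>) f y)" if y: "y \<in> vecs \<Phi>'" for y
  proof -
    obtain x where x: "x \<in> vecs \<Phi>" "y = f x" using rep_isos_surj[OF f(1) y] .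
    then show ?thesis using f(2) assms(2)[OF x(1)] bij_betw_inv_into_left[OF rep_isosD(3)[OF f(1)]] by metis
  qed
  then show ?thesis using rep_isos_inv[OF assms(1) f(1)] by auto
qed

lemma deligne_iso_refl: "deligne_iso v (\<Phi>, U) (\<Phi>, U)"
  using rep_isos_ident by force

text \<open>Maps of representations are linear on a subspace only. Extending from a basis of it
  gives a globally linear map, to which general facts on spans, images and independence
  apply.\<close>

lemma lin_maps_extend:
  assumes "pre_rep \<Phi>" "vector_space (smul \<Phi>')" "f \<in> lin_maps \<Phi> \<Phi>'"
  obtains F where "module_hom (smul \<Phi>) (smul \<Phi>') F" "\<And>x. x \<in> vecs \<Phi> \<Longrightarrow> F x = f x"
proof -
  interpret linear_space "smul \<Phi>" by (rule pre_rep_space[OF assms(1)])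
  interpret vector_space_pair "smul \<Phi>" "smul \<Phi>'"
    using assms(2) vector_space_axioms by (simp add: vector_space_pair_def)
  obtain B where B: "B \<subseteq> vecs \<Phi>" "independent B" "vecs \<Phi> \<subseteq> span B" using maximal_independent_subset[of "vecs \<Phi>"] by blast
  obtain F where F: "Vector_Spaces.linear (smul \<Phi>) (smul \<Phi>') F" "\<forall>x\<in>B. F x = f x"
    using linear_independent_extend[OF B(2), of f] by blast
  interpret F: module_hom "smul \<Phi>" "smul \<Phi>'" F using F(1) by (simp add: linear_iff_module_hom)
  have "lsub {x \<in> vecs \<Phi>. F x = f x}"
    using vecs_0[OF assms(1)] vecs_add[OF assms(1)] vecs_smul[OF assms(1)] lin_maps_0[OF assms(1,3)]
      lin_maps_add[OF assms(3)] lin_maps_smul[OF assms(3)]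
    by (auto intro!: subspaceI simp: F.add F.scale)
  then have "span B \<subseteq> {x \<in> vecs \<Phi>. F x = f x}" using B(1) F(2) by (intro span_minimal) auto
  then have "F x = f x" if "x \<in> vecs \<Phi>" for x using B(3) that by blast
  then show ?thesis using that F.module_hom_axioms by blast
qed

lemma lin_maps_transfer:
  assumes "pre_rep \<Phi>" "g \<in> rep_isos v \<Phi> \<Phi>'" "h \<in> lin_maps \<Phi> \<Phi>" "\<And>x. x \<in> vecs \<Phi> \<Longrightarrow> g (h x) = h' (g x)"
  shows "h' \<in> lin_maps \<Phi>' \<Phi>'"
  unfolding lin_maps_def
proof (intro CollectI conjI ballI allI funcsetI)
  note g = rep_isosD(2)[OF assms(2)]
  fix x assume x: "x \<in> vecs \<Phi>'"
  then obtain a where a: "a \<in> vecs \<Phi>" "x = g a" using rep_isos_surj[OF assms(2)] by metis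
  show "h' x \<in> vecs \<Phi>'" using a assms(4)[OF a(1)] lin_maps_closed[OF assms(3) a(1)] lin_maps_closed[OF g] by metis
  show "h' (smul \<Phi>' c x) = smul \<Phi>' c (h' x)" for c
    using a assms(4)[OF a(1)] assms(4)[OF vecs_smul[OF assms(1) a(1)]] lin_maps_smul[OF assms(3) a(1)]
      lin_maps_smul[OF g a(1)] lin_maps_smul[OF g lin_maps_closed[OF assms(3) a(1)]] by simp
  fix y assume y: "y \<in> vecs \<Phi>'"
  then obtain b where b: "b \<in> vecs \<Phi>" "y = g b" using rep_isos_surj[OF assms(2)] by metis
  show "h' (x + y) = h' x + h' y"
    using a b assms(4)[OF a(1)] assms(4)[OF b(1)] assms(4)[OF vecs_add[OF assms(1) a(1) b(1)]] lin_maps_add[OF assms(3) a(1) b(1)]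
      lin_maps_add[OF g a(1) b(1)] lin_maps_add[OF g lin_maps_closed[OF assms(3) a(1)] lin_maps_closed[OF assms(3) b(1)]] by simp
qed

text \<open>Of the target only the scalar multiplication is assumed lawful; everything else is
  transported. The tensor product is recognised as a representation in this way.\<close>

lemma pre_rep_iso:
  assumes "pre_rep \<Phi>" "f \<in> rep_isos v \<Phi> \<Phi>'" "vector_space (smul \<Phi>')"
  shows "pre_rep \<Phi>'"
proof -
  note f = rep_isosD[OF assms(2)]
  obtain F where F: "module_hom (smul \<Phi>) (smul \<Phi>') F" "\<And>x. x \<in> vecs \<Phi> \<Longrightarrow> F x = f x"
    using lin_maps_extend[OF assms(1,3) f(2)] by blast
  have "vecs \<Phi>' = F ` vecs \<Phi>" using f(3) F(2) by (auto simp: bij_betw_def)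
  then have sub: "module.subspace (smul \<Phi>') (vecs \<Phi>')"
    using module_hom.subspace_image[OF F(1) pre_rep_subspace[OF assms(1)]] by simp
  have "act \<Phi>' \<sigma> \<in> lin_maps \<Phi>' \<Phi>'" if \<sigma>: "\<sigma> \<in> W" for \<sigma>
    by (rule lin_maps_transfer[OF assms(1,2) act_lin_maps[OF assms(1) \<sigma>]]) (rule f(4)[OF \<sigma>])
  moreover have "act \<Phi>' \<one>\<^bsub>weil_group v\<^esub> y = y" if y: "y \<in> vecs \<Phi>'" for y
  proof -
    obtain x where "x \<in> vecs \<Phi>" "y = f x" using rep_isos_surj[OF assms(2) y] .
    then show ?thesis using f(4)[OF weil.one_closed, of x] act_one[OF assms(1)] by simp
  qed
  moreover have "act \<Phi>' (\<sigma> \<otimes>\<^bsub>weil_group v\<^esub> \<tau>) y = act \<Phi>' \<sigma> (act \<Phi>' \<tau> y)"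
    if st: "\<sigma> \<in> W" "\<tau> \<in> W" and y: "y \<in> vecs \<Phi>'" for \<sigma> \<tau> y
  proof -
    obtain x where "x \<in> vecs \<Phi>" "y = f x" using rep_isos_surj[OF assms(2) y] .
    then show ?thesis using f(4) st act_mult[OF assms(1) st] act_closed[OF assms(1) st(2)] by (metis weil.m_closed)
  qed
  ultimately show ?thesis unfolding pre_rep_def using assms(3) sub by blast
qed

lemma weil_rep_iso:
  fixes \<Phi> :: "('f, 'k, _) weil_rep" and \<Phi>' :: "('f, 'k, _) weil_rep"
  assumes "weil_rep v \<Phi>" "f \<in> rep_isos v \<Phi> \<Phi>'" "vector_space (smul \<Phi>')"
  shows "weil_rep v \<Phi>'"
proof -
  have p: "pre_rep \<Phi>" "fin_dim \<Phi>" "smooth \<Phi>" using assms(1) weil_rep_iff by auto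
  note f = rep_isosD[OF assms(2)]
  obtain F where F: "module_hom (smul \<Phi>) (smul \<Phi>') F" "\<And>x. x \<in> vecs \<Phi> \<Longrightarrow> F x = f x"
    using lin_maps_extend[OF p(1) assms(3) f(2)] by blast
  obtain B where B: "finite B" "vecs \<Phi> = module.span (smul \<Phi>) B" using p(2) unfolding fin_dim_def by blast
  have "vecs \<Phi>' = F ` vecs \<Phi>" using f(3) F(2) by (auto simp: bij_betw_def)
  then have "vecs \<Phi>' = module.span (smul \<Phi>') (F ` B)" using module_hom.span_image[OF F(1), of B] B(2) by simp
  then have "fin_dim \<Phi>'" unfolding fin_dim_def using B(1) by blast
  moreover have "smooth \<Phi>'" unfolding smooth_def
  proof
    fix y assume "y \<in> vecs \<Phi>'"
    then obtain x where x: "x \<in> vecs \<Phi>" "y = f x" using rep_isos_surj[OF assms(2), of y] by blast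
    have "act \<Phi>' \<sigma> y = y \<longleftrightarrow> act \<Phi> \<sigma> x = x" if "\<sigma> \<in> W" for \<sigma>
      using f(4)[OF that x(1)] rep_isos_inj[OF assms(2) act_closed[OF p(1) that x(1)] x(1)] x(2) by simp
    then have "{\<sigma> \<in> W. act \<Phi>' \<sigma> y = y} = {\<sigma> \<in> W. act \<Phi> \<sigma> x = x}" by blast
    then show "openin (weil_topology v) {\<sigma> \<in> W. act \<Phi>' \<sigma> y = y}" using p(3) x(1) unfolding smooth_def by simp
  qed
  ultimately show ?thesis unfolding weil_rep_iff using pre_rep_iso[OF p(1) assms(2,3)] by blast
qed

lemma dop_iso:
  assumes "pre_rep \<Phi>" "f \<in> rep_isos v \<Phi> \<Phi>'" "dop \<Phi> U" "\<And>x. x \<in> vecs \<Phi> \<Longrightarrow> f (U x) = U' (f x)"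
  shows "dop \<Phi>' U'"
proof -
  note f = rep_isosD[OF assms(2)]
  have U: "U \<in> lin_maps \<Phi> \<Phi>" "\<And>\<sigma> x. \<sigma> \<in> W \<Longrightarrow> x \<in> vecs \<Phi> \<Longrightarrow> act \<Phi> \<sigma> (U x) = smul \<Phi> (\<nu> \<sigma>) (U (act \<Phi> \<sigma> x))"
    using assms(3) unfolding dop_def by auto
  show ?thesis unfolding dop_def
  proof (intro conjI ballI)
    show "U' \<in> lin_maps \<Phi>' \<Phi>'" by (rule lin_maps_transfer[OF assms(1,2) U(1) assms(4)])
    fix \<sigma> x assume \<sigma>: "\<sigma> \<in> W" and "x \<in> vecs \<Phi>'"
    then obtain a where a: "a \<in> vecs \<Phi>" "x = f a" using rep_isos_surj[OF assms(2), of x] by blast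
    have "act \<Phi>' \<sigma> (U' x) = f (act \<Phi> \<sigma> (U a))"
      using a assms(4) f(4)[OF \<sigma> lin_maps_closed[OF U(1) a(1)]] by simp
    also have "\<dots> = smul \<Phi>' (\<nu> \<sigma>) (f (U (act \<Phi> \<sigma> a)))"
      using U(2)[OF \<sigma> a(1)] lin_maps_smul[OF f(2) lin_maps_closed[OF U(1) act_closed[OF assms(1) \<sigma> a(1)]]] by simp
    also have "\<dots> = smul \<Phi>' (\<nu> \<sigma>) (U' (act \<Phi>' \<sigma> x))"
      using assms(4)[OF act_closed[OF assms(1) \<sigma> a(1)]] f(4)[OF \<sigma> a(1)] a(2) by simp
    finally show "act \<Phi>' \<sigma> (U' x) = smul \<Phi>' (\<nu> \<sigma>) (U' (act \<Phi>' \<sigma> x))" .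
  qed
qed

lemma deligne_rep_iso:
  fixes \<Phi> :: "('f, 'k, _) weil_rep" and \<Phi>' :: "('f, 'k, _) weil_rep"
  assumes "deligne_rep v (\<Phi>, U)" "deligne_iso v (\<Phi>, U) (\<Phi>', U')" "vector_space (smul \<Phi>')"
  shows "deligne_rep v (\<Phi>', U')"
proof -
  have p: "weil_rep v \<Phi>" "dop \<Phi> U" using assms(1) by (simp_all only: deligne_rep_iff)
  obtain f where f: "f \<in> rep_isos v \<Phi> \<Phi>'" "\<forall>x\<in>vecs \<Phi>. f (U x) = U' (f x)" using assms(2) by auto
  have "dop \<Phi>' U'" using f(2) by (intro dop_iso[OF weil_rep_pre_rep[OF p(1)] f(1) p(2)]) blast
  then show ?thesis unfolding deligne_rep_iff using weil_rep_iso[OF p(1) f(1) assms(3)] by blast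
qed

lemma closed_under_preimage:
  assumes \<Phi>: "pre_rep \<Phi>" and \<Phi>': "pre_rep \<Phi>'" and f: "f \<in> lin_maps \<Phi> \<Phi>'"
    and g: "\<And>g. g \<in> \<Gamma> \<Longrightarrow> \<exists>g'\<in>\<Gamma>'. \<forall>x\<in>vecs \<Phi>. g x \<in> vecs \<Phi> \<and> f (g x) = g' (f x)"
    and S: "linear_space.closed_under (smul \<Phi>') \<Gamma>' (vecs \<Phi>') S"
  shows "linear_space.closed_under (smul \<Phi>) \<Gamma> (vecs \<Phi>) {x \<in> vecs \<Phi>. f x \<in> S}"
proof -
  interpret A: linear_space "smul \<Phi>" by (rule pre_rep_space[OF \<Phi>])
  interpret B: linear_space "smul \<Phi>'" by (rule pre_rep_space[OF \<Phi>'])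
  note S' = B.closed_under_subspace[OF S]
  show ?thesis unfolding A.closed_under_def
  proof (intro conjI ballI)
    show "A.lsub {x \<in> vecs \<Phi>. f x \<in> S}"
      using vecs_0[OF \<Phi>] vecs_add[OF \<Phi>] vecs_smul[OF \<Phi>] lin_maps_0[OF \<Phi> f] lin_maps_add[OF f] lin_maps_smul[OF f]
        B.subspace_0[OF S'] B.subspace_add[OF S'] B.subspace_scale[OF S']
      by (auto intro!: A.subspaceI)
    fix h x assume h: "h \<in> \<Gamma>" and x: "x \<in> {x \<in> vecs \<Phi>. f x \<in> S}"
    obtain h' where h': "h' \<in> \<Gamma>'" "\<forall>x\<in>vecs \<Phi>. h x \<in> vecs \<Phi> \<and> f (h x) = h' (f x)" using g[OF h] by blast
    then show "h x \<in> {x \<in> vecs \<Phi>. f x \<in> S}" using x B.closed_under_closed[OF S h'(1)] by auto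
  qed auto
qed

lemma deligne_iso_ops:
  assumes "pre_rep \<Phi>" "dop \<Phi> U" "f \<in> rep_isos v \<Phi> \<Phi>'" "\<And>x. x \<in> vecs \<Phi> \<Longrightarrow> f (U x) = U' (f x)"
    "g \<in> insert U (actions \<Phi>)"
  shows "\<exists>g'\<in>insert U' (actions \<Phi>'). \<forall>x\<in>vecs \<Phi>. g x \<in> vecs \<Phi> \<and> f (g x) = g' (f x)"
  using assms(5)
proof
  assume "g = U"
  then show ?thesis using assms(2,4) lin_maps_closed unfolding dop_def by (intro bexI[of _ U']) auto
next
  assume "g \<in> actions \<Phi>"
  then obtain \<sigma> where "\<sigma> \<in> W" "g = act \<Phi> \<sigma>" by blast
  then show ?thesis using act_closed[OF assms(1)] rep_isosD(4)[OF assms(3)] by (intro bexI[of _ "act \<Phi>' \<sigma>"]) auto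
qed

lemma preimage_eq_zero_iff:
  assumes "pre_rep \<Phi>" "f \<in> rep_isos v \<Phi> \<Phi>'" "S \<subseteq> vecs \<Phi>'"
  shows "{x \<in> vecs \<Phi>. f x \<in> S} = {0} \<longleftrightarrow> S = {0}"
proof -
  note f = rep_isosD[OF assms(2)]
  have f0: "f 0 = 0" using lin_maps_0[OF assms(1) f(2)] .
  have S: "S = f ` {x \<in> vecs \<Phi>. f x \<in> S}" using f(3) assms(3) by (auto simp: bij_betw_def)
  show ?thesis
  proof
    assume "{x \<in> vecs \<Phi>. f x \<in> S} = {0}"
    then show "S = {0}" using S f0 by simp
  next
    assume "S = {0}"
    then show "{x \<in> vecs \<Phi>. f x \<in> S} = {0}"
      using f0 vecs_0[OF assms(1)] rep_isos_inj[OF assms(2) _ vecs_0[OF assms(1)]] by auto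
  qed
qed

lemma irred_iso:
  assumes \<Phi>: "pre_rep \<Phi>" "dop \<Phi> U" and \<Phi>': "pre_rep \<Phi>'"
    and f: "f \<in> rep_isos v \<Phi> \<Phi>'" "\<And>x. x \<in> vecs \<Phi> \<Longrightarrow> f (U x) = U' (f x)"
    and irr: "op_irred \<Phi> U"
  shows "op_irred \<Phi>' U'"
proof -
  interpret A: linear_space "smul \<Phi>" by (rule pre_rep_space[OF \<Phi>(1)])
  interpret B: linear_space "smul \<Phi>'" by (rule pre_rep_space[OF \<Phi>'])
  have im: "S = f ` {x \<in> vecs \<Phi>. f x \<in> S}" if "S \<subseteq> vecs \<Phi>'" for S
    using rep_isosD(3)[OF f(1)] that by (auto simp: bij_betw_def)
  show ?thesis unfolding B.irred_def
  proof (intro conjI allI impI)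
    have "{x \<in> vecs \<Phi>. f x \<in> vecs \<Phi>'} = vecs \<Phi>" using lin_maps_closed[OF rep_isosD(2)[OF f(1)]] by auto
    then show "vecs \<Phi>' \<noteq> {0}" using preimage_eq_zero_iff[OF \<Phi>(1) f(1), of "vecs \<Phi>'"] irr unfolding A.irred_def by auto
    fix S assume S: "B.closed_under (insert U' (actions \<Phi>')) (vecs \<Phi>') S"
    have "A.closed_under (insert U (actions \<Phi>)) (vecs \<Phi>) {x \<in> vecs \<Phi>. f x \<in> S}"
      by (rule closed_under_preimage[OF \<Phi>(1) \<Phi>' rep_isosD(2)[OF f(1)] deligne_iso_ops[OF \<Phi> f] S])
    then have "{x \<in> vecs \<Phi>. f x \<in> S} = {0} \<or> {x \<in> vecs \<Phi>. f x \<in> S} = vecs \<Phi>" using irr unfolding A.irred_def by blast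
    then show "S = {0} \<or> S = vecs \<Phi>'"
      using preimage_eq_zero_iff[OF \<Phi>(1) f(1) B.closed_under_subset[OF S]] im[OF B.closed_under_subset[OF S]]
        rep_isosD(3)[OF f(1)] by (auto simp: bij_betw_def)
  qed
qed

lemma complements_preimage:
  assumes \<Phi>: "pre_rep \<Phi>" and \<Phi>': "pre_rep \<Phi>'" and f: "f \<in> rep_isos v \<Phi> \<Phi>'"
    and S: "S \<subseteq> vecs \<Phi>'" and T: "T \<subseteq> vecs \<Phi>'" and c: "linear_space.complements (vecs \<Phi>') S T"
  shows "linear_space.complements (vecs \<Phi>) {x \<in> vecs \<Phi>. f x \<in> S} {x \<in> vecs \<Phi>. f x \<in> T}"
proof -
  interpret A: linear_space "smul \<Phi>" by (rule pre_rep_space[OF \<Phi>])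
  interpret B: linear_space "smul \<Phi>'" by (rule pre_rep_space[OF \<Phi>'])
  have "S \<inter> T = {0}" using c unfolding B.complements_def by blast
  then have "{x \<in> vecs \<Phi>. f x \<in> S \<inter> T} = {0}" using preimage_eq_zero_iff[OF \<Phi> f, of "S \<inter> T"] S by auto
  moreover have "\<exists>s\<in>{x \<in> vecs \<Phi>. f x \<in> S}. \<exists>t\<in>{x \<in> vecs \<Phi>. f x \<in> T}. x = s + t" if x: "x \<in> vecs \<Phi>" for x
  proof -
    obtain s t where st: "s \<in> S" "t \<in> T" "f x = s + t"
      using c lin_maps_closed[OF rep_isosD(2)[OF f] x] unfolding B.complements_def by blast
    obtain a where a: "a \<in> vecs \<Phi>" "s = f a" using rep_isos_surj[OF f] S st(1) by (metis subsetD)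
    obtain b where b: "b \<in> vecs \<Phi>" "t = f b" using rep_isos_surj[OF f] T st(2) by (metis subsetD)
    have "f x = f (a + b)" using st(3) a b lin_maps_add[OF rep_isosD(2)[OF f] a(1) b(1)] by simp
    then have "x = a + b" using rep_isos_inj[OF f x vecs_add[OF \<Phi> a(1) b(1)]] by simp
    then show ?thesis using a b st by blast
  qed
  ultimately show ?thesis unfolding A.complements_def by blast
qed

lemma indecomp_iso:
  assumes \<Phi>: "pre_rep \<Phi>" "dop \<Phi> U" and \<Phi>': "pre_rep \<Phi>'"
    and f: "f \<in> rep_isos v \<Phi> \<Phi>'" "\<And>x. x \<in> vecs \<Phi> \<Longrightarrow> f (U x) = U' (f x)"
    and ind: "op_indecomp \<Phi> U"
  shows "op_indecomp \<Phi>' U'"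
proof -
  interpret A: linear_space "smul \<Phi>" by (rule pre_rep_space[OF \<Phi>(1)])
  interpret B: linear_space "smul \<Phi>'" by (rule pre_rep_space[OF \<Phi>'])
  show ?thesis unfolding B.indecomp_def
  proof (intro conjI allI impI)
    have "{x \<in> vecs \<Phi>. f x \<in> vecs \<Phi>'} = vecs \<Phi>" using lin_maps_closed[OF rep_isosD(2)[OF f(1)]] by auto
    then show "vecs \<Phi>' \<noteq> {0}" using preimage_eq_zero_iff[OF \<Phi>(1) f(1), of "vecs \<Phi>'"] ind unfolding A.indecomp_def by auto
    fix S T assume S: "B.closed_under (insert U' (actions \<Phi>')) (vecs \<Phi>') S"
      and T: "B.closed_under (insert U' (actions \<Phi>')) (vecs \<Phi>') T" and c: "B.complements (vecs \<Phi>') S T"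
    have cl: "A.closed_under (insert U (actions \<Phi>)) (vecs \<Phi>) {x \<in> vecs \<Phi>. f x \<in> S}"
      if S: "B.closed_under (insert U' (actions \<Phi>')) (vecs \<Phi>') S" for S
      by (rule closed_under_preimage[OF \<Phi>(1) \<Phi>' rep_isosD(2)[OF f(1)] deligne_iso_ops[OF \<Phi> f] S])
    have "{x \<in> vecs \<Phi>. f x \<in> S} = {0} \<or> {x \<in> vecs \<Phi>. f x \<in> T} = {0}"
      using ind cl[OF S] cl[OF T] complements_preimage[OF \<Phi>(1) \<Phi>' f(1) B.closed_under_subset[OF S] B.closed_under_subset[OF T] c]
      unfolding A.indecomp_def by blast
    then show "S = {0} \<or> T = {0}"
      using preimage_eq_zero_iff[OF \<Phi>(1) f(1) B.closed_under_subset[OF S]]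
        preimage_eq_zero_iff[OF \<Phi>(1) f(1) B.closed_under_subset[OF T]] by blast
  qed
qed

section \<open>Irreducible, indecomposable and semisimple objects\<close>

lemma deligne_irreducible_iff:
  shows "deligne_irreducible v (\<Phi>, U) \<longleftrightarrow> deligne_rep v (\<Phi>, U) \<and>
    op_irred \<Phi> U"
proof (cases "deligne_rep v (\<Phi>, U)")
  case True
  then have "pre_rep \<Phi>" unfolding deligne_rep_iff using weil_rep_pre_rep by blast
  then show ?thesis using True
    by (simp add: linear_space.irred_def[OF pre_rep_space] closed_under_insert del: deligne_rep.simps)
qed (auto simp del: deligne_rep.simps)

lemma dop_restrict:
  "dop \<Phi> U \<Longrightarrow> S \<subseteq> vecs \<Phi> \<Longrightarrow> U ` S \<subseteq> S \<Longrightarrow> dop (\<Phi>\<lparr>vecs := S\<rparr>) U"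
  unfolding dop_def lin_maps_def by (simp add: subset_iff image_subset_iff Pi_iff)

text \<open>Passes between external direct sums and complementary stable subspaces. Complementary
  subspaces give two summands in the same ambient type, through the projection; conversely the
  summands of an external sum are recovered as the vectors whose image has one coordinate
  zero.\<close>

lemma indecomposable_iff:
  fixes \<Phi> :: "('f, 'k, 'v::ab_group_add) weil_rep"
  shows "indecomposable v (\<Phi>, U) \<longleftrightarrow> deligne_rep v (\<Phi>, U) \<and>
    op_indecomp \<Phi> U"
proof (cases "deligne_rep v (\<Phi>, U)")
  case True
  then have w: "weil_rep v \<Phi>" and U: "dop \<Phi> U" by (simp_all only: deligne_rep_iff)
  have \<Phi>: "pre_rep \<Phi>" using w weil_rep_pre_rep by blast
  interpret linear_space "smul \<Phi>" by (rule pre_rep_space[OF \<Phi>])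
  show ?thesis
  proof
    assume ind: "indecomposable v (\<Phi>, U)"
    show "deligne_rep v (\<Phi>, U) \<and> indecomp (insert U (actions \<Phi>)) (vecs \<Phi>)"
    proof (intro conjI True)
      show "indecomp (insert U (actions \<Phi>)) (vecs \<Phi>)" unfolding indecomp_def
      proof (intro conjI allI impI)
        show "vecs \<Phi> \<noteq> {0}" using ind by (simp add: indecomposable_def)
        fix S T assume "closed_under (insert U (actions \<Phi>)) (vecs \<Phi>) S"
          "closed_under (insert U (actions \<Phi>)) (vecs \<Phi>) T" and c: "complements (vecs \<Phi>) S T"
        then have S: "stable_subspace v \<Phi> S" "U ` S \<subseteq> S" and T: "stable_subspace v \<Phi> T" "U ` T \<subseteq> T"
          using closed_under_insert[OF \<Phi>] by auto
        have S': "lsub S" "S \<subseteq> vecs \<Phi>" "\<And>\<sigma> x. \<sigma> \<in> W \<Longrightarrow> x \<in> S \<Longrightarrow> act \<Phi> \<sigma> x \<in> S"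
          and T': "lsub T" "T \<subseteq> vecs \<Phi>" "\<And>\<sigma> x. \<sigma> \<in> W \<Longrightarrow> x \<in> T \<Longrightarrow> act \<Phi> \<sigma> x \<in> T"
          using S(1) T(1) unfolding stable_subspace_def by (auto simp: image_subset_iff)
        show "S = {0} \<or> T = {0}"
        proof (rule ccontr)
          assume nz: "\<not> (S = {0} \<or> T = {0})"
          define D1 where "D1 = (\<Phi>\<lparr>vecs := S\<rparr>, U)"
          define D2 where "D2 = (\<Phi>\<lparr>vecs := T\<rparr>, U)"
          have "deligne_rep v D1" "deligne_rep v D2" unfolding D1_def D2_def deligne_rep_iff
            using weil_rep_restrict[OF w] dop_restrict[OF U] S T S'(2) T'(2) by auto
          moreover have "nonzero D1" "nonzero D2" unfolding D1_def D2_def using nz by auto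
          moreover have "deligne_iso v (\<Phi>, U) (deligne_sum D1 D2)"
          proof -
            obtain q where q: "endo (vecs \<Phi>) q" "\<And>x. x \<in> vecs \<Phi> \<Longrightarrow> q x \<in> S" "\<And>x. x \<in> vecs \<Phi> \<Longrightarrow> x - q x \<in> T"
              "\<And>x. x \<in> S \<Longrightarrow> q x = x" "\<And>x s. x \<in> vecs \<Phi> \<Longrightarrow> s \<in> S \<Longrightarrow> x - s \<in> T \<Longrightarrow> q x = s"
              using complements_projection[OF S'(1,2) T'(1,2) pre_rep_subspace[OF \<Phi>] c] by (elim exE conjE) simp
            define f where "f x = (q x, x - q x)" for x
            have comm: "q (g x) = g (q x)" if g: "g \<in> lin_maps \<Phi> \<Phi>" "\<And>x. x \<in> S \<Longrightarrow> g x \<in> S" "\<And>x. x \<in> T \<Longrightarrow> g x \<in> T"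
              and x: "x \<in> vecs \<Phi>" for g x
            proof (rule q(5))
              show "g x \<in> vecs \<Phi>" by (rule lin_maps_closed[OF g(1) x])
              show "g (q x) \<in> S" using g(2) q(2)[OF x] by blast
              have "g (x - q x) = g x - g (q x)" using lin_maps_diff[OF \<Phi> g(1) x] q(2)[OF x] S'(2) by blast
              then show "g x - g (q x) \<in> T" using g(3)[OF q(3)[OF x]] by simp
            qed
            have f: "f \<in> rep_hom v \<Phi> (rep_sum (\<Phi>\<lparr>vecs := S\<rparr>) (\<Phi>\<lparr>vecs := T\<rparr>))"
            proof (rule rep_homI)
              fix \<sigma> x assume \<sigma>: "\<sigma> \<in> W" and x: "x \<in> vecs \<Phi>"
              have "q (act \<Phi> \<sigma> x) = act \<Phi> \<sigma> (q x)"
                using S'(3) T'(3) \<sigma> x by (intro comm act_lin_maps[OF \<Phi>]) auto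
              moreover have "act \<Phi> \<sigma> (x - q x) = act \<Phi> \<sigma> x - act \<Phi> \<sigma> (q x)"
                using lin_maps_diff[OF \<Phi> act_lin_maps[OF \<Phi> \<sigma>] x] q(2)[OF x] S'(2) by blast
              ultimately show "f (act \<Phi> \<sigma> x) = act (rep_sum (\<Phi>\<lparr>vecs := S\<rparr>) (\<Phi>\<lparr>vecs := T\<rparr>)) \<sigma> (f x)"
                by (simp add: f_def rep_sum_def)
            qed (use q endo_add[OF q(1)] endo_scale[OF q(1)] in
                \<open>auto simp: f_def rep_sum_def scale_right_diff_distrib\<close>)
            have "f \<in> rep_isos v \<Phi> (rep_sum (\<Phi>\<lparr>vecs := S\<rparr>) (\<Phi>\<lparr>vecs := T\<rparr>))"
            proof (rule rep_isosI[OF \<Phi> f])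
              fix x assume "x \<in> vecs \<Phi>" "f x = 0"
              then show "x = 0" by (auto simp: f_def zero_prod_def)
            next
              fix y assume "y \<in> vecs (rep_sum (\<Phi>\<lparr>vecs := S\<rparr>) (\<Phi>\<lparr>vecs := T\<rparr>))"
              then obtain s t where st: "y = (s, t)" "s \<in> S" "t \<in> T" by (auto simp: rep_sum_def)
              have stV: "s + t \<in> vecs \<Phi>" using st S'(2) T'(2) vecs_add[OF \<Phi>] by blast
              have "q (s + t) = s" using st by (intro q(5) stV) auto
              then show "\<exists>x\<in>vecs \<Phi>. y = f x" using stV st by (intro bexI[of _ "s + t"]) (auto simp: f_def)
            qed
            moreover have "f (U x) = map_prod U U (f x)" if x: "x \<in> vecs \<Phi>" for x
            proof -
              have UL: "U \<in> lin_maps \<Phi> \<Phi>" using U by (simp add: dop_def)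
              have "q (U x) = U (q x)" using S(2) T(2) x by (intro comm UL) auto
              moreover have "U (x - q x) = U x - U (q x)"
                using lin_maps_diff[OF \<Phi> UL x] q(2)[OF x] S'(2) by blast
              ultimately show ?thesis by (simp add: f_def)
            qed
            ultimately show ?thesis unfolding D1_def D2_def by auto
          qed
          ultimately show False using ind unfolding indecomposable_def by blast
        qed
      qed
    qed
  next
    assume "deligne_rep v (\<Phi>, U) \<and> indecomp (insert U (actions \<Phi>)) (vecs \<Phi>)"
    then have ind: "indecomp (insert U (actions \<Phi>)) (vecs \<Phi>)" by blast
    have False if D: "deligne_rep v D1" "nonzero D1" "deligne_rep v D2" "nonzero D2" "deligne_iso v (\<Phi>, U) (deligne_sum D1 D2)"
      for D1 D2 :: "('f, 'k, 'v) deligne"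
    proof -
      obtain A1 U1 A2 U2 where D12: "D1 = (A1, U1)" "D2 = (A2, U2)" by (metis surj_pair)
      have A: "pre_rep A1" "pre_rep A2" "dop A1 U1" "dop A2 U2"
        using D(1,3) weil_rep_pre_rep unfolding D12 deligne_rep_iff by auto
      obtain f where f: "f \<in> rep_isos v \<Phi> (rep_sum A1 A2)" "\<forall>x\<in>vecs \<Phi>. f (U x) = map_prod U1 U2 (f x)"
        using D(5) unfolding D12 by auto
      note f' = rep_isosD[OF f(1)]
      have add: "f (x + y) = f x + f y" if "x \<in> vecs \<Phi>" "y \<in> vecs \<Phi>" for x y using lin_maps_add[OF f'(2) that] .
      have scl: "f (smul \<Phi> c x) = (smul A1 c (fst (f x)), smul A2 c (snd (f x)))" if "x \<in> vecs \<Phi>" for c x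
        using lin_maps_smul[OF f'(2) that, of c] by (simp add: rep_sum_def map_prod_def split_beta)
      have ac: "f (act \<Phi> \<sigma> x) = (act A1 \<sigma> (fst (f x)), act A2 \<sigma> (snd (f x)))" if "\<sigma> \<in> W" "x \<in> vecs \<Phi>" for \<sigma> x
        using f'(4)[OF that] by (simp add: rep_sum_def map_prod_def split_beta)
      have op: "f (U x) = (U1 (fst (f x)), U2 (snd (f x)))" if "x \<in> vecs \<Phi>" for x
        using f(2) that by (simp add: map_prod_def split_beta)
      have UV: "U x \<in> vecs \<Phi>" if "x \<in> vecs \<Phi>" for x using U lin_maps_closed that by (auto simp: dop_def)
      interpret A1: linear_space "smul A1" by (rule pre_rep_space[OF A(1)])
      interpret A2: linear_space "smul A2" by (rule pre_rep_space[OF A(2)])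
      have a0: "act A1 \<sigma> 0 = 0" "act A2 \<sigma> 0 = 0" if "\<sigma> \<in> W" for \<sigma>
        using lin_maps_0 act_lin_maps A that by blast+
      have u0: "U1 0 = 0" "U2 0 = 0" using lin_maps_0 A unfolding dop_def by blast+
      have f0: "f 0 = 0" by (rule lin_maps_0[OF \<Phi> f'(2)])
      define S where "S = {x \<in> vecs \<Phi>. snd (f x) = 0}"
      define T where "T = {x \<in> vecs \<Phi>. fst (f x) = 0}"
      have "lsub S" "lsub T" unfolding S_def T_def
        using vecs_0[OF \<Phi>] vecs_add[OF \<Phi>] vecs_smul[OF \<Phi>] f0 by (auto intro!: subspaceI simp: add scl)
      then have "closed_under (insert U (actions \<Phi>)) (vecs \<Phi>) S" "closed_under (insert U (actions \<Phi>)) (vecs \<Phi>) T"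
        unfolding closed_under_def using UV act_closed[OF \<Phi>] a0 u0 by (auto simp: S_def T_def op ac)
      moreover have "complements (vecs \<Phi>) S T" unfolding complements_def
      proof (intro conjI ballI)
        show "S \<inter> T = {0}"
        proof
          show "S \<inter> T \<subseteq> {0}"
          proof
            fix x assume x: "x \<in> S \<inter> T"
            then have "f x = f 0" using f0 by (auto simp: S_def T_def prod_eq_iff)
            then show "x \<in> {0}" using rep_isos_inj[OF f(1) _ vecs_0[OF \<Phi>], of x] x by (auto simp: S_def)
          qed
        qed (use f0 vecs_0[OF \<Phi>] in \<open>auto simp: S_def T_def\<close>)
        fix x assume x: "x \<in> vecs \<Phi>"
        have fx: "fst (f x) \<in> vecs A1" "snd (f x) \<in> vecs A2"
          using lin_maps_closed[OF f'(2) x] by (auto simp: rep_sum_def)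
        have "(fst (f x), 0) \<in> vecs (rep_sum A1 A2)" "(0, snd (f x)) \<in> vecs (rep_sum A1 A2)"
          using fx vecs_0[OF A(1)] vecs_0[OF A(2)] by (auto simp: rep_sum_def)
        then obtain s t where st: "s \<in> vecs \<Phi>" "(fst (f x), 0) = f s" "t \<in> vecs \<Phi>" "(0, snd (f x)) = f t"
          using rep_isos_surj[OF f(1)] by metis
        have "f (s + t) = f x" using add[OF st(1,3)] by (simp add: st(2,4)[symmetric])
        then have "x = s + t" using rep_isos_inj[OF f(1) vecs_add[OF \<Phi> st(1,3)] x] by simp
        moreover have "s \<in> S" "t \<in> T" unfolding S_def T_def by (simp_all add: st(1,3) st(2,4)[symmetric])
        ultimately show "\<exists>s\<in>S. \<exists>t\<in>T. x = s + t" by blast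
      qed
      ultimately have "S = {0} \<or> T = {0}" using ind unfolding indecomp_def by blast
      moreover have "S \<noteq> {0}"
      proof
        assume S0: "S = {0}"
        obtain a where a: "a \<in> vecs A1" "a \<noteq> 0" using D(2) vecs_0[OF A(1)] unfolding D12 by auto
        then have "(a, 0) \<in> vecs (rep_sum A1 A2)" using vecs_0[OF A(2)] by (simp add: rep_sum_def)
        then obtain x where x: "x \<in> vecs \<Phi>" "(a, 0) = f x" using rep_isos_surj[OF f(1)] by metis
        then have "x \<in> S" unfolding S_def by (simp flip: x(2))
        then show False using S0 x(2) f0 a(2) by (auto simp: zero_prod_def)
      qed
      moreover have "T \<noteq> {0}"
      proof
        assume S0: "T = {0}"
        obtain a where a: "a \<in> vecs A2" "a \<noteq> 0" using D(4) vecs_0[OF A(2)] unfolding D12 by auto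
        then have "(0, a) \<in> vecs (rep_sum A1 A2)" using vecs_0[OF A(1)] by (simp add: rep_sum_def)
        then obtain x where x: "x \<in> vecs \<Phi>" "(0, a) = f x" using rep_isos_surj[OF f(1)] by metis
        then have "x \<in> T" unfolding T_def by (simp flip: x(2))
        then show False using S0 x(2) f0 a(2) by (auto simp: zero_prod_def)
      qed
      ultimately show False by blast
    qed
    moreover have "nonzero (\<Phi>, U)" using ind by (simp add: indecomp_def)
    ultimately show "indecomposable v (\<Phi>, U)" using True unfolding indecomposable_def by blast
  qed
qed (auto simp: indecomposable_def simp del: deligne_rep.simps)

lemma indecomposable_transfer:
  fixes \<Phi> :: "('f, 'k, _) weil_rep" and \<Phi>' :: "('f, 'k, _) weil_rep"
  assumes "indecomposable v (\<Phi>, U)" "deligne_iso v (\<Phi>, U) (\<Phi>', U')" "vector_space (smul \<Phi>')"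
  shows "indecomposable v (\<Phi>', U')"
proof -
  have i: "deligne_rep v (\<Phi>, U)" "op_indecomp \<Phi> U"
    using assms(1) unfolding indecomposable_iff by auto
  have p: "pre_rep \<Phi>" "dop \<Phi> U" using i(1) weil_rep_pre_rep unfolding deligne_rep_iff by auto
  have d: "deligne_rep v (\<Phi>', U')" by (rule deligne_rep_iso[OF i(1) assms(2,3)])
  then have p': "pre_rep \<Phi>'" using weil_rep_pre_rep unfolding deligne_rep_iff by blast
  obtain f where f: "f \<in> rep_isos v \<Phi> \<Phi>'" "\<forall>x\<in>vecs \<Phi>. f (U x) = U' (f x)" using assms(2) by auto
  have "op_indecomp \<Phi>' U'"
    by (rule indecomp_iso[OF p p' f(1) _ i(2)]) (use f(2) in blast)
  then show ?thesis unfolding indecomposable_iff using d by blast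
qed

lemma irreducible_rep_iff:
  shows "irreducible_rep v \<Phi> \<longleftrightarrow> weil_rep v \<Phi> \<and> linear_space.irred (smul \<Phi>) (actions \<Phi>) (vecs \<Phi>)"
proof (cases "weil_rep v \<Phi>")
  case True
  then have "pre_rep \<Phi>" using weil_rep_pre_rep by blast
  then show ?thesis using True unfolding irreducible_rep_def
    by (simp add: linear_space.irred_def[OF pre_rep_space] closed_under_actions)
qed (auto simp: irreducible_rep_def)

lemma irreducible_rep_transfer:
  fixes \<Phi> :: "('f, 'k, _) weil_rep" and \<Phi>' :: "('f, 'k, _) weil_rep"
  assumes irr: "irreducible_rep v \<Phi>" and f: "f \<in> rep_isos v \<Phi> \<Phi>'" and vs: "vector_space (smul \<Phi>')"
  shows "irreducible_rep v \<Phi>'"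
proof -
  have w: "weil_rep v \<Phi>" "weil_rep v \<Phi>'" using irr weil_rep_iso[OF _ f vs] by (auto simp: irreducible_rep_def)
  have p: "pre_rep \<Phi>" "pre_rep \<Phi>'" using w weil_rep_pre_rep by blast+
  interpret A: linear_space "smul \<Phi>" by (rule pre_rep_space[OF p(1)])
  interpret B: linear_space "smul \<Phi>'" by (rule pre_rep_space[OF p(2)])
  have im: "S = f ` {x \<in> vecs \<Phi>. f x \<in> S}" if "S \<subseteq> vecs \<Phi>'" for S
    using rep_isosD(3)[OF f] that by (auto simp: bij_betw_def)
  have irr': "A.irred (actions \<Phi>) (vecs \<Phi>)" using irr irreducible_rep_iff by blast
  have "B.irred (actions \<Phi>') (vecs \<Phi>')" unfolding B.irred_def
  proof (intro conjI allI impI)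
    have "{x \<in> vecs \<Phi>. f x \<in> vecs \<Phi>'} = vecs \<Phi>" using lin_maps_closed[OF rep_isosD(2)[OF f]] by auto
    then show "vecs \<Phi>' \<noteq> {0}" using preimage_eq_zero_iff[OF p(1) f, of "vecs \<Phi>'"] irr' unfolding A.irred_def by auto
    fix S assume S: "B.closed_under (actions \<Phi>') (vecs \<Phi>') S"
    have "A.closed_under (actions \<Phi>) (vecs \<Phi>) {x \<in> vecs \<Phi>. f x \<in> S}"
      by (rule closed_under_preimage[OF p rep_isosD(2)[OF f] _ S])
         (use act_closed[OF p(1)] rep_isosD(4)[OF f] in auto)
    then have "{x \<in> vecs \<Phi>. f x \<in> S} = {0} \<or> {x \<in> vecs \<Phi>. f x \<in> S} = vecs \<Phi>" using irr' unfolding A.irred_def by blast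
    then show "S = {0} \<or> S = vecs \<Phi>'"
      using preimage_eq_zero_iff[OF p(1) f B.closed_under_subset[OF S]] im[OF B.closed_under_subset[OF S]]
        rep_isosD(3)[OF f] by (auto simp: bij_betw_def)
  qed
  then show ?thesis using w(2) irreducible_rep_iff by blast
qed

lemma semisimple_repE:
  assumes "semisimple_rep v \<Phi>"
  obtains \<S> where "module.span (smul \<Phi>) (\<Union>\<S>) = vecs \<Phi>" "\<forall>S\<in>\<S>. stable_subspace v \<Phi> S"
    "\<forall>S\<in>\<S>. irreducible_rep v (\<Phi>\<lparr>vecs := S\<rparr>)" "\<forall>S\<in>\<S>. S \<inter> module.span (smul \<Phi>) (\<Union>(\<S> - {S})) = {0}"
  using assms unfolding semisimple_rep_def by (elim conjE exE) (rule that, assumption, blast+)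

text \<open>The simple summands are carried over by a globally linear extension of \<open>f\<close>.
  Its injectivity on the space keeps distinct summands distinct and independent.\<close>

lemma semisimple_rep_transfer:
  fixes \<Phi> :: "('f, 'k, _) weil_rep" and \<Phi>' :: "('f, 'k, _) weil_rep"
  assumes ss: "semisimple_rep v \<Phi>" and f: "f \<in> rep_isos v \<Phi> \<Phi>'" and vs: "vector_space (smul \<Phi>')"
  shows "semisimple_rep v \<Phi>'"
proof -
  have w: "weil_rep v \<Phi>" "weil_rep v \<Phi>'" using ss weil_rep_iso[OF _ f vs] by (auto simp: semisimple_rep_def)
  have p: "pre_rep \<Phi>" "pre_rep \<Phi>'" using w weil_rep_pre_rep by blast+
  interpret A: linear_space "smul \<Phi>" by (rule pre_rep_space[OF p(1)])
  interpret B: linear_space "smul \<Phi>'" by (rule pre_rep_space[OF p(2)])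
  obtain \<S> where \<S>0: "A.span (\<Union>\<S>) = vecs \<Phi>" "\<forall>S\<in>\<S>. stable_subspace v \<Phi> S"
    "\<forall>S\<in>\<S>. irreducible_rep v (\<Phi>\<lparr>vecs := S\<rparr>)" "\<forall>S\<in>\<S>. S \<inter> A.span (\<Union>(\<S> - {S})) = {0}"
    by (rule semisimple_repE[OF ss])
  note \<S> = \<S>0(2)[rule_format] \<S>0(3)[rule_format] \<S>0(1) \<S>0(4)[rule_format]
  note f' = rep_isosD[OF f]
  obtain F where F: "module_hom (smul \<Phi>) (smul \<Phi>') F" "\<And>x. x \<in> vecs \<Phi> \<Longrightarrow> F x = f x"
    using lin_maps_extend[OF p(1) vs f'(2)] by blast
  interpret F: module_hom "smul \<Phi>" "smul \<Phi>'" F by (rule F(1))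
  have Finj: "inj_on F (vecs \<Phi>)" using f'(3) F(2) by (auto simp: bij_betw_def inj_on_def)
  have Fim: "F ` vecs \<Phi> = vecs \<Phi>'" using f'(3) F(2) by (auto simp: bij_betw_def)
  have sub: "S \<subseteq> vecs \<Phi>" if "S \<in> \<S>" for S using \<S>(1)[OF that] by (simp add: stable_subspace_def)
  have spansub: "A.span (\<Union>\<T>) \<subseteq> vecs \<Phi>" if "\<T> \<subseteq> \<S>" for \<T>
    using \<S>(3) A.span_mono[of "\<Union>\<T>" "\<Union>\<S>"] that by blast
  define \<S>' where "\<S>' = (\<lambda>S. F ` S) ` \<S>"
  have st: "stable_subspace v \<Phi>' (F ` S)" if S: "S \<in> \<S>" for S
    unfolding stable_subspace_def
  proof (intro conjI ballI)
    show "B.lsub (F ` S)" using F.subspace_image \<S>(1)[OF S] by (simp add: stable_subspace_def)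
    show "F ` S \<subseteq> vecs \<Phi>'" using Fim sub[OF S] by blast
    fix \<sigma> assume \<sigma>: "\<sigma> \<in> W"
    have "act \<Phi>' \<sigma> (F x) = F (act \<Phi> \<sigma> x)" if "x \<in> S" for x
      using that sub[OF S] F(2) f'(4)[OF \<sigma>] act_closed[OF p(1) \<sigma>] by auto
    moreover have "act \<Phi> \<sigma> x \<in> S" if "x \<in> S" for x using \<S>(1)[OF S] \<sigma> that by (auto simp: stable_subspace_def)
    ultimately show "act \<Phi>' \<sigma> ` F ` S \<subseteq> F ` S" by auto
  qed
  have ir: "irreducible_rep v (\<Phi>'\<lparr>vecs := F ` S\<rparr>)" if S: "S \<in> \<S>" for S
  proof (rule irreducible_rep_transfer[OF \<S>(2)[OF S]])
    show "F \<in> rep_isos v (\<Phi>\<lparr>vecs := S\<rparr>) (\<Phi>'\<lparr>vecs := F ` S\<rparr>)"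
      unfolding rep_isos_def rep_hom_def lin_maps_def
      using sub[OF S] F(2) f'(4) act_closed[OF p(1)] inj_on_subset[OF Finj sub[OF S]]
      by (auto simp: F.add F.scale bij_betw_def subset_iff)
    show "vector_space (smul (\<Phi>'\<lparr>vecs := F ` S\<rparr>))" using vs by simp
  qed
  have UF: "\<Union>((\<lambda>S. F ` S) ` \<T>) = F ` \<Union>\<T>" for \<T> by blast
  have "B.span (\<Union>\<S>') = vecs \<Phi>'" unfolding \<S>'_def UF F.span_image \<S>(3) Fim ..
  moreover have "S' \<inter> B.span (\<Union>(\<S>' - {S'})) = {0}" if S': "S' \<in> \<S>'" for S'
  proof -
    obtain S where S: "S \<in> \<S>" "S' = F ` S" using S' unfolding \<S>'_def by blast
    have "F ` T = F ` S \<longleftrightarrow> T = S" if "T \<in> \<S>" for T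
      using inj_on_image_eq_iff[OF Finj sub[OF that] sub[OF S(1)]] .
    then have "\<S>' - {S'} = (\<lambda>S. F ` S) ` (\<S> - {S})" unfolding \<S>'_def S(2) by blast
    then have "B.span (\<Union>(\<S>' - {S'})) = F ` A.span (\<Union>(\<S> - {S}))" by (simp only: UF F.span_image)
    then have "S' \<inter> B.span (\<Union>(\<S>' - {S'})) = F ` (S \<inter> A.span (\<Union>(\<S> - {S})))"
      unfolding S(2) using inj_on_image_Int[OF Finj sub[OF S(1)] spansub[of "\<S> - {S}"]] by blast
    then show ?thesis using \<S>(4)[OF S(1)] by (simp add: F.zero)
  qed
  ultimately show ?thesis unfolding semisimple_rep_def using w(2) st ir
    by (intro conjI exI[of _ \<S>']) (auto simp: \<S>'_def)
qed

text \<open>A stable \<open>T\<close> maximal with A \<inter> T = 0 is a complement of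
  \<open>A\<close>: a simple summand not contained in A + T would meet it in 0 only and could be
  added to \<open>T\<close>.\<close>

lemma semisimple_completely_reducible:
  assumes ss: "semisimple_rep v \<Phi>"
  shows "linear_space.completely_reducible (smul \<Phi>) (actions \<Phi>) (vecs \<Phi>)"
proof -
  have p: "pre_rep \<Phi>" using ss weil_rep_pre_rep by (auto simp: semisimple_rep_def)
  interpret linear_space "smul \<Phi>" by (rule pre_rep_space[OF p])
  obtain \<S> where \<S>0: "span (\<Union>\<S>) = vecs \<Phi>" "\<forall>S\<in>\<S>. stable_subspace v \<Phi> S"
    "\<forall>S\<in>\<S>. irreducible_rep v (\<Phi>\<lparr>vecs := S\<rparr>)" "\<forall>S\<in>\<S>. S \<inter> span (\<Union>(\<S> - {S})) = {0}"
    by (rule semisimple_repE[OF ss])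
  note \<S> = \<S>0(2)[rule_format] \<S>0(3)[rule_format] \<S>0(1) \<S>0(4)[rule_format]
  have V: "lsub (vecs \<Phi>)" by (rule pre_rep_subspace[OF p])
  have en: "endo (vecs \<Phi>) g" if "g \<in> actions \<Phi>" for g using that act_lin_maps[OF p] endo_iff_lin_maps[OF p] by auto
  show ?thesis unfolding completely_reducible_def
  proof (intro allI impI)
    fix A assume A: "closed_under (actions \<Phi>) (vecs \<Phi>) A"
    have A0: "0 \<in> A" using subspace_0 closed_under_subspace[OF A] by blast
    have z: "closed_under (actions \<Phi>) (vecs \<Phi>) {0}"
      using vecs_0[OF p] endo_0[OF en V] by (auto simp: closed_under_def)
    obtain T where T: "closed_under (actions \<Phi>) (vecs \<Phi>) T" "A \<inter> T = {0}"
      and max: "\<And>T'. closed_under (actions \<Phi>) (vecs \<Phi>) T' \<Longrightarrow> T \<subseteq> T' \<Longrightarrow> A \<inter> T' = {0} \<Longrightarrow> T' = T"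
    proof -
      have "\<exists>M. closed_under (actions \<Phi>) (vecs \<Phi>) M \<and> {0} \<subseteq> M \<and> A \<inter> M = {0} \<and>
        (\<forall>M'. closed_under (actions \<Phi>) (vecs \<Phi>) M' \<longrightarrow> M \<subseteq> M' \<longrightarrow> A \<inter> M' = {0} \<longrightarrow> M' = M)"
        by (rule maximal_closed_under[OF z]) (use A0 in blast)+
      then show ?thesis using that by blast
    qed
    have T0: "0 \<in> T" using subspace_0 closed_under_subspace[OF T(1)] by blast
    define P where "P = {a + t | a t. a \<in> A \<and> t \<in> T}"
    have P: "closed_under (actions \<Phi>) (vecs \<Phi>) P" unfolding P_def by (rule closed_under_plus[OF en V A T(1)])
    have "S \<subseteq> P" if S: "S \<in> \<S>" for S
    proof -
      have S': "closed_under (actions \<Phi>) (vecs \<Phi>) S" using \<S>(1)[OF S] closed_under_actions[OF p] by blast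
      have "stable_subspace v (\<Phi>\<lparr>vecs := S\<rparr>) (S \<inter> P)"
        using S' P by (auto simp: stable_subspace_def closed_under_def intro: subspace_inter)
      then have alt: "S \<inter> P = {0} \<or> S \<inter> P = S" and S0: "S \<noteq> {0}"
        using \<S>(2)[OF S] unfolding irreducible_rep_def by auto
      have "S \<inter> P \<noteq> {0}"
      proof
        assume SP: "S \<inter> P = {0}"
        define T' where "T' = {t + s | t s. t \<in> T \<and> s \<in> S}"
        have T': "closed_under (actions \<Phi>) (vecs \<Phi>) T'" unfolding T'_def by (rule closed_under_plus[OF en V T(1) S'])
        have sS: "0 \<in> S" using subspace_0 closed_under_subspace[OF S'] by blast
        have "T \<subseteq> T'" unfolding T'_def using sS by force
        moreover have "A \<inter> T' = {0}"
        proof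
          show "A \<inter> T' \<subseteq> {0}"
          proof
            fix a assume a: "a \<in> A \<inter> T'"
            then obtain t s where ts: "t \<in> T" "s \<in> S" "a = t + s" unfolding T'_def by blast
            have "s = a + (- t)" using ts by simp
            moreover have "- t \<in> T" using subspace_neg closed_under_subspace[OF T(1)] ts(1) by blast
            ultimately have "s \<in> S \<inter> P" unfolding P_def using a ts(2) by blast
            then have "s = 0" using SP by blast
            then have "a \<in> A \<inter> T" using a ts by simp
            then show "a \<in> {0}" using T(2) by simp
          qed
        qed (use A0 T0 \<open>T \<subseteq> T'\<close> in auto)
        ultimately have "T' = T" using max[OF T'] by blast
        moreover have "S \<subseteq> T'" unfolding T'_def using T0 by force
        ultimately have "S \<subseteq> T" by simp
        moreover have "T \<subseteq> P" unfolding P_def using A0 by force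
        ultimately have "S \<subseteq> {0}" using SP by blast
        then show False using S0 sS by blast
      qed
      then show ?thesis using alt by blast
    qed
    then have "\<Union>\<S> \<subseteq> P" by blast
    then have "vecs \<Phi> \<subseteq> P" using span_minimal[OF _ closed_under_subspace[OF P]] \<S>(3) by blast
    then have "complements (vecs \<Phi>) A T" unfolding complements_def P_def using T(2) by blast
    then show "\<exists>T. closed_under (actions \<Phi>) (vecs \<Phi>) T \<and> complements (vecs \<Phi>) A T" using T(1) by blast
  qed
qed

end

section \<open>Segments and cycles\<close>

lemma sum_fun_apply: "(\<Sum>i\<in>A. f i) x = (\<Sum>i\<in>A. f i x)"
  by (induction A rule: infinite_finite_induct) auto

context weil_coeffs
begin

section \<open>Tuples as a model of the tensor product\<close>

lemma rep_Sum_simps [simp]: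
  "x \<in> vecs (rep_Sum n R) \<longleftrightarrow> (\<forall>i<n. x i \<in> vecs (R i)) \<and> (\<forall>i\<ge>n. x i = 0)"
  "smul (rep_Sum n R) c x = (\<lambda>i. smul (R i) c (x i))"
  "act (rep_Sum n R) \<sigma> x = (\<lambda>i. act (R i) \<sigma> (x i))"
  by (simp_all add: rep_Sum_def)

lemma pre_rep_rep_Sum:
  assumes "\<And>i. pre_rep (R i)"
  shows "pre_rep (rep_Sum n R)"
proof -
  have vs: "vector_space (smul (R i))" for i using assms[of i] by (simp add: pre_rep_def)
  have V: "vector_space (smul (rep_Sum n R))"
    unfolding vector_space_def
    using vs unfolding vector_space_def by (auto simp: fun_eq_iff)
  interpret linear_space "smul (rep_Sum n R)" using V by (simp add: linear_space_def)
  note l = vecs_0[OF assms] vecs_add[OF assms] vecs_smul[OF assms] act_closed[OF assms]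
    lin_maps_0[OF assms act_lin_maps[OF assms]] Modules.module.scale_zero_right[OF pre_rep_module[OF assms]]
  have "lsub (vecs (rep_Sum n R))" using l by (auto intro!: subspaceI)
  moreover have "act (rep_Sum n R) \<sigma> \<in> lin_maps (rep_Sum n R) (rep_Sum n R)" if "\<sigma> \<in> W" for \<sigma>
    unfolding lin_maps_def
  proof (intro CollectI conjI ballI allI funcsetI)
    fix x assume "x \<in> vecs (rep_Sum n R)"
    then show "act (rep_Sum n R) \<sigma> x \<in> vecs (rep_Sum n R)" using l that by auto
  next
    fix x y assume x: "x \<in> vecs (rep_Sum n R)" and y: "y \<in> vecs (rep_Sum n R)"
    have "act (R i) \<sigma> (x i + y i) = act (R i) \<sigma> (x i) + act (R i) \<sigma> (y i)" for i
      using x y l that lin_maps_add[OF act_lin_maps[OF assms that]] by (cases "i < n") auto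
    then show "act (rep_Sum n R) \<sigma> (x + y) = act (rep_Sum n R) \<sigma> x + act (rep_Sum n R) \<sigma> y"
      by (auto simp: fun_eq_iff)
  next
    fix c x assume x: "x \<in> vecs (rep_Sum n R)"
    have "act (R i) \<sigma> (smul (R i) c (x i)) = smul (R i) c (act (R i) \<sigma> (x i))" for i
      using x l that lin_maps_smul[OF act_lin_maps[OF assms that]] by (cases "i < n") auto
    then show "act (rep_Sum n R) \<sigma> (smul (rep_Sum n R) c x) = smul (rep_Sum n R) c (act (rep_Sum n R) \<sigma> x)"
      by simp
  qed
  moreover have "act (rep_Sum n R) \<one>\<^bsub>weil_group v\<^esub> x = x" if "x \<in> vecs (rep_Sum n R)" for x
  proof
    fix i show "act (rep_Sum n R) \<one>\<^bsub>weil_group v\<^esub> x i = x i"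
      using that act_one[OF assms] l(1) by (cases "i < n") auto
  qed
  moreover have "act (rep_Sum n R) (\<sigma> \<otimes>\<^bsub>weil_group v\<^esub> \<tau>) x = act (rep_Sum n R) \<sigma> (act (rep_Sum n R) \<tau> x)"
    if "\<sigma> \<in> W" "\<tau> \<in> W" "x \<in> vecs (rep_Sum n R)" for \<sigma> \<tau> x
  proof
    fix i show "act (rep_Sum n R) (\<sigma> \<otimes>\<^bsub>weil_group v\<^esub> \<tau>) x i = act (rep_Sum n R) \<sigma> (act (rep_Sum n R) \<tau> x) i"
      using that act_mult[OF assms that(1,2)] l(1) by (cases "i < n") auto
  qed
  ultimately show ?thesis unfolding pre_rep_def using V by blast
qed

definition single :: "nat \<Rightarrow> 'v::zero \<Rightarrow> nat \<Rightarrow> 'v" where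
  "single i y = (\<lambda>j. if j = i then y else 0)"

lemma sum_single:
  fixes x :: "nat \<Rightarrow> 'v::ab_group_add"
  assumes "\<And>i. i \<ge> n \<Longrightarrow> x i = 0"
  shows "x = (\<Sum>i<n. single i (x i))"
proof
  fix j
  have "(\<Sum>i<n. single i (x i)) j = (\<Sum>i<n. if i = j then x i else 0)"
    by (simp add: single_def eq_commute[of j] sum_fun_apply)
  then show "x j = (\<Sum>i<n. single i (x i)) j" using assms by (simp add: sum.delta not_less)
qed

text \<open>Model of the representation underlying [0, r - 1] \<otimes> \<Phi>. With r = o(\<Psi>)
  the same construction over \<Psi> is the space of a cycle, so one set of lemmas serves
  both.\<close>

definition seg_rep :: "nat \<Rightarrow> ('f, 'k, 'v::ab_group_add) weil_rep \<Rightarrow> ('f, 'k, nat \<Rightarrow> 'v) weil_rep" where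
  "seg_rep r \<Phi> = rep_Sum r (\<lambda>k. twist v (int k) \<Phi>)"

text \<open>On tuples this is N(r) \<otimes> 1 + 1 \<otimes> C: the shift plus \<open>C\<close> in
  every slot. Slot 0 receives nothing from the shift.\<close>

definition seg_op :: "nat \<Rightarrow> ('v::ab_group_add \<Rightarrow> 'v) \<Rightarrow> (nat \<Rightarrow> 'v) \<Rightarrow> nat \<Rightarrow> 'v" where
  "seg_op r C = (\<lambda>x i. if i = 0 then C (x 0) else if i < r then C (x i) + x (i - 1) else 0)"

lemma seg_rep_simps [simp]:
  "x \<in> vecs (seg_rep r \<Phi>) \<longleftrightarrow> (\<forall>i<r. x i \<in> vecs \<Phi>) \<and> (\<forall>i\<ge>r. x i = 0)"
  "smul (seg_rep r \<Phi>) c x = (\<lambda>i. smul \<Phi> c (x i))"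
  "act (seg_rep r \<Phi>) \<sigma> x = (\<lambda>i. smul \<Phi> (\<nu> \<sigma> powi int i) (act \<Phi> \<sigma> (x i)))"
  by (simp_all add: seg_rep_def)

lemma pre_rep_seg_rep: "pre_rep \<Phi> \<Longrightarrow> pre_rep (seg_rep r \<Phi>)"
  unfolding seg_rep_def by (intro pre_rep_rep_Sum pre_rep_twist)

lemma seg_op_lin_maps:
  assumes \<Phi>: "pre_rep \<Phi>" and C: "C \<in> lin_maps \<Phi> \<Phi>" and r: "r \<ge> 1"
  shows "seg_op r C \<in> lin_maps (seg_rep r \<Phi>) (seg_rep r \<Phi>)"
proof -
  interpret linear_space "smul \<Phi>" by (rule pre_rep_space[OF \<Phi>])
  show ?thesis unfolding lin_maps_def
  proof (intro CollectI conjI ballI allI funcsetI)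
    fix x assume "x \<in> vecs (seg_rep r \<Phi>)"
    then show "seg_op r C x \<in> vecs (seg_rep r \<Phi>)"
      using lin_maps_closed[OF C] vecs_add[OF \<Phi>] r by (auto simp: seg_op_def)
  next
    fix x y assume "x \<in> vecs (seg_rep r \<Phi>)" "y \<in> vecs (seg_rep r \<Phi>)"
    then show "seg_op r C (x + y) = seg_op r C x + seg_op r C y"
      using lin_maps_add[OF C] r by (auto simp: seg_op_def fun_eq_iff algebra_simps)
  next
    fix c x assume "x \<in> vecs (seg_rep r \<Phi>)"
    then show "seg_op r C (smul (seg_rep r \<Phi>) c x) = smul (seg_rep r \<Phi>) c (seg_op r C x)"
      using lin_maps_smul[OF C] r by (auto simp: seg_op_def fun_eq_iff scale_right_distrib)
  qed
qed

lemma dop_seg: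
  assumes \<Phi>: "pre_rep \<Phi>" and C: "dop \<Phi> C" and r: "r \<ge> 1"
  shows "dop (seg_rep r \<Phi>) (seg_op r C)"
proof -
  interpret linear_space "smul \<Phi>" by (rule pre_rep_space[OF \<Phi>])
  have CL: "C \<in> lin_maps \<Phi> \<Phi>" and tw: "\<And>\<sigma> x. \<sigma> \<in> W \<Longrightarrow> x \<in> vecs \<Phi> \<Longrightarrow> act \<Phi> \<sigma> (C x) = smul \<Phi> (\<nu> \<sigma>) (C (act \<Phi> \<sigma> x))"
    using C unfolding dop_def by auto
  have "act (seg_rep r \<Phi>) \<sigma> (seg_op r C x) = smul (seg_rep r \<Phi>) (\<nu> \<sigma>) (seg_op r C (act (seg_rep r \<Phi>) \<sigma> x))"
    if \<sigma>: "\<sigma> \<in> W" and x: "x \<in> vecs (seg_rep r \<Phi>)" for \<sigma> x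
  proof
    fix i
    have xi: "x i \<in> vecs \<Phi>" for i using x vecs_0[OF \<Phi>] by (cases "i < r") auto
    have axi: "act \<Phi> \<sigma> (x i) \<in> vecs \<Phi>" for i by (rule act_closed[OF \<Phi> \<sigma> xi])
    have "act \<Phi> \<sigma> (C (x i) + x (i - 1)) = smul \<Phi> (\<nu> \<sigma>) (C (act \<Phi> \<sigma> (x i))) + act \<Phi> \<sigma> (x (i - 1))"
      using lin_maps_add[OF act_lin_maps[OF \<Phi> \<sigma>] lin_maps_closed[OF CL xi] xi] tw[OF \<sigma> xi] by simp
    moreover have "act \<Phi> \<sigma> 0 = 0" using lin_maps_0[OF \<Phi> act_lin_maps[OF \<Phi> \<sigma>]] .
    ultimately show "act (seg_rep r \<Phi>) \<sigma> (seg_op r C x) i = smul (seg_rep r \<Phi>) (\<nu> \<sigma>) (seg_op r C (act (seg_rep r \<Phi>) \<sigma> x)) i"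
      using tw[OF \<sigma> xi] lin_maps_smul[OF CL axi] r
      by (cases i) (auto simp: seg_op_def scale_right_distrib mult.commute)
  qed
  then show ?thesis unfolding dop_def using seg_op_lin_maps[OF \<Phi> CL r] by blast
qed

lemma vector_space_tensor: "vector_space (\<lambda>c t B. (c :: 'k) * t B)"
  by unfold_locales (auto simp: fun_eq_iff algebra_simps)

lemma exists_functional:
  assumes "pre_rep \<Phi>" "y \<noteq> 0"
  shows "\<exists>\<phi>. (\<forall>a b. \<phi> (a + b) = \<phi> a + \<phi> b) \<and> (\<forall>c a. \<phi> (smul \<Phi> c a) = c * \<phi> a) \<and> \<phi> y = 1"
proof -
  interpret linear_space "smul \<Phi>" by (rule pre_rep_space[OF assms(1)])
  interpret K: vector_space "(*) :: 'k \<Rightarrow> 'k \<Rightarrow> 'k" by unfold_locales (auto simp: algebra_simps)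
  interpret vector_space_pair "smul \<Phi>" "(*) :: 'k \<Rightarrow> 'k \<Rightarrow> 'k" ..
  have "independent {y}" using assms(2) by simp
  then obtain g where "Vector_Spaces.linear (smul \<Phi>) (*) g" "\<forall>x\<in>{y}. g x = 1"
    using linear_independent_extend[of "{y}" "\<lambda>_. 1"] by blast
  then show ?thesis by (auto simp: Vector_Spaces.linear_iff)
qed

text \<open>The isomorphism sends \<open>x\<close> to the sum of the tensors of \<open>e i\<close>
  with \<open>x i\<close>. Tensors are functions on bilinear forms, so injectivity is tested on the
  form (a, y) \<mapsto> a_i \<phi>(y), where \<phi> is a functional with value 1 on a nonzero
  \<open>x i\<close>. Surjectivity holds because the image is a subspace containing the pure
  tensors.\<close>

lemma seg_iso_tensor:
  fixes \<Phi> :: "('f, 'k, 'v::ab_group_add) weil_rep"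
  assumes \<Phi>: "pre_rep \<Phi>" and C: "C \<in> lin_maps \<Phi> \<Phi>" and r: "r \<ge> 1"
  shows "deligne_iso v (seg_rep r \<Phi>, seg_op r C) (deligne_tensor (segment v r) (\<Phi>, C))"
proof -
  interpret linear_space "smul \<Phi>" by (rule pre_rep_space[OF \<Phi>])
  interpret T: vector_space "\<lambda>(c::'k) (t::('k, nat \<Rightarrow> 'k, 'v) tensor) B. c * t B" by (rule vector_space_tensor)
  define S :: "('f, 'k, nat \<Rightarrow> 'k) weil_rep" where "S = fst (segment v r)"
  define N :: "(nat \<Rightarrow> 'k) \<Rightarrow> nat \<Rightarrow> 'k" where "N = snd (segment v r)"
  have SN: "segment v r = (S, N)" by (simp add: S_def N_def)
  have S: "\<And>x. x \<in> vecs S \<longleftrightarrow> (\<forall>i\<ge>r. x i = 0)" "\<And>c x. smul S c x = (\<lambda>i. c * x i)"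
    "\<And>\<sigma> x. act S \<sigma> x = (\<lambda>i. \<nu> \<sigma> powi int i * x i)"
    unfolding S_def by (auto simp: segment_def nu_rep_def)
  have N: "N x = (\<lambda>i. if i = 0 then 0 else if i < r then x (i - 1) else 0)" for x
    unfolding N_def by (auto simp: segment_def)
  define e :: "nat \<Rightarrow> nat \<Rightarrow> 'k" where "e i = single i 1" for i
  have eS: "e i \<in> vecs S" if "i < r" for i using that by (auto simp: S e_def single_def)
  have Sadd: "a + b \<in> vecs S" "smul S c a \<in> vecs S" if "a \<in> vecs S" "b \<in> vecs S" for a b c
    using that by (auto simp: S)
  have S0: "0 \<in> vecs S" by (simp add: S)
  define pt where "pt = pure_tensor S \<Phi>"
  have pt_add: "pt a (x + y) = pt a x + pt a y" if "a \<in> vecs S" "x \<in> vecs \<Phi>" "y \<in> vecs \<Phi>" for a x y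
    unfolding pt_def pure_tensor_def bilinear_forms_def using that by (auto simp: fun_eq_iff)
  have pt_smul: "pt a (smul \<Phi> c x) = (\<lambda>B. c * pt a x B)" if "a \<in> vecs S" "x \<in> vecs \<Phi>" for a x c
    unfolding pt_def pure_tensor_def bilinear_forms_def using that by (auto simp: fun_eq_iff)
  have pt_add': "pt (a + b) x = pt a x + pt b x" if "a \<in> vecs S" "b \<in> vecs S" "x \<in> vecs \<Phi>" for a b x
    unfolding pt_def pure_tensor_def bilinear_forms_def using that by (auto simp: fun_eq_iff)
  have pt_smul': "pt (smul S c a) x = (\<lambda>B. c * pt a x B)" if "a \<in> vecs S" "x \<in> vecs \<Phi>" for a x c
    unfolding pt_def pure_tensor_def bilinear_forms_def using that by (auto simp: fun_eq_iff)
  have pt_0: "pt a 0 = 0" if "a \<in> vecs S" for a using pt_add[OF that vecs_0[OF \<Phi>] vecs_0[OF \<Phi>]] by simp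
  have pt_0': "pt 0 x = 0" if "x \<in> vecs \<Phi>" for x using pt_add'[OF S0 S0 that] by simp
  have pt_sum': "pt (\<Sum>i\<in>A. a i) x = (\<Sum>i\<in>A. pt (a i) x)" if "\<And>i. i \<in> A \<Longrightarrow> a i \<in> vecs S" "x \<in> vecs \<Phi>" for A a and x
    using that(1)
  proof (induction A rule: infinite_finite_induct)
    case (insert i A)
    have "(\<Sum>i\<in>A. a i) \<in> vecs S" using insert(4) by (auto simp: S sum_fun_apply intro!: sum.neutral)
    then have step: "pt (a i + (\<Sum>i\<in>A. a i)) x = pt (a i) x + pt (\<Sum>i\<in>A. a i) x"
      by (intro pt_add' that(2) insert(4)) auto
    have IH: "pt (\<Sum>i\<in>A. a i) x = (\<Sum>i\<in>A. pt (a i) x)" by (rule insert(3), rule insert(4)) simp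
    show ?case unfolding sum.insert[OF insert(1,2)] step IH ..
  qed (simp_all add: pt_0'[OF that(2)])
  have actS: "act S \<sigma> \<in> lin_maps S S" for \<sigma> by (auto simp: lin_maps_def S fun_eq_iff algebra_simps)
  have NL: "N \<in> lin_maps S S" using r by (auto simp: lin_maps_def S N fun_eq_iff)
  have idL: "id \<in> lin_maps S S" "id \<in> lin_maps \<Phi> \<Phi>" by (auto simp: lin_maps_def)
  have tm_sum: "tensor_map S \<Phi> f g (\<Sum>i\<in>A. t i) = (\<Sum>i\<in>A. tensor_map S \<Phi> f g (t i))" for f g A and t :: "nat \<Rightarrow> _"
    unfolding tensor_map_def by (auto simp: fun_eq_iff sum_fun_apply)
  define f where "f x = (\<Sum>i<r. pt (e i) (x i))" for x
  have vS: "vecs (tensor_rep S \<Phi>) = T.span {pure_tensor S \<Phi> x y | x y. x \<in> vecs S \<and> y \<in> vecs \<Phi>}"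
    and sS: "smul (tensor_rep S \<Phi>) = (\<lambda>c t B. c * t B)"
    and aS: "act (tensor_rep S \<Phi>) \<sigma> = tensor_map S \<Phi> (act S \<sigma>) (act \<Phi> \<sigma>)" for \<sigma>
    by (simp_all add: tensor_rep_def)
  have f_add: "f (x + y) = f x + f y" if "x \<in> vecs (seg_rep r \<Phi>)" "y \<in> vecs (seg_rep r \<Phi>)" for x y
    unfolding f_def sum.distrib[symmetric] using that eS by (intro sum.cong refl) (auto intro!: pt_add)
  have f_smul: "f (smul (seg_rep r \<Phi>) c x) = (\<lambda>B. c * f x B)" if "x \<in> vecs (seg_rep r \<Phi>)" for c x
    unfolding f_def using that eS by (auto simp: pt_smul fun_eq_iff sum_fun_apply sum_distrib_left)
  have f: "f \<in> rep_hom v (seg_rep r \<Phi>) (tensor_rep S \<Phi>)"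
  proof (rule rep_homI)
    fix x assume "x \<in> vecs (seg_rep r \<Phi>)"
    then show "f x \<in> vecs (tensor_rep S \<Phi>)" unfolding vS f_def pt_def using eS
      by (intro T.span_sum T.span_base) auto
  next
    fix \<sigma> x assume \<sigma>: "\<sigma> \<in> W" and x: "x \<in> vecs (seg_rep r \<Phi>)"
    have "pt (e i) (smul \<Phi> (\<nu> \<sigma> powi int i) (act \<Phi> \<sigma> (x i))) = tensor_map S \<Phi> (act S \<sigma>) (act \<Phi> \<sigma>) (pt (e i) (x i))"
      if i: "i < r" for i
    proof -
      have xi: "x i \<in> vecs \<Phi>" using x i by simp
      have "act S \<sigma> (e i) = smul S (\<nu> \<sigma> powi int i) (e i)" by (auto simp: S e_def single_def)
      then have "tensor_map S \<Phi> (act S \<sigma>) (act \<Phi> \<sigma>) (pt (e i) (x i)) = pt (smul S (\<nu> \<sigma> powi int i) (e i)) (act \<Phi> \<sigma> (x i))"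
        unfolding pt_def using tensor_map_pure_tensor[OF actS act_lin_maps[OF \<Phi> \<sigma>]] by simp
      then show ?thesis using pt_smul[OF eS[OF i] act_closed[OF \<Phi> \<sigma> xi]] pt_smul'[OF eS[OF i] act_closed[OF \<Phi> \<sigma> xi]] by simp
    qed
    then show "f (act (seg_rep r \<Phi>) \<sigma> x) = act (tensor_rep S \<Phi>) \<sigma> (f x)"
      unfolding aS f_def tm_sum by (intro sum.cong) auto
  qed (use f_add f_smul sS in auto)
  have "f \<in> rep_isos v (seg_rep r \<Phi>) (tensor_rep S \<Phi>)"
  proof (rule rep_isosI[OF pre_rep_seg_rep[OF \<Phi>] f])
    fix x assume x: "x \<in> vecs (seg_rep r \<Phi>)" "f x = 0"
    show "x = 0"
    proof (rule ccontr)
      assume "x \<noteq> 0"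
      then obtain i where i: "x i \<noteq> 0" by (auto simp: fun_eq_iff)
      then have ir: "i < r" using x(1) by (metis not_le seg_rep_simps(1))
      obtain \<phi> where \<phi>: "\<forall>a b. \<phi> (a + b) = \<phi> a + \<phi> b" "\<forall>c a. \<phi> (smul \<Phi> c a) = c * \<phi> a" "\<phi> (x i) = 1"
        using exists_functional[OF \<Phi> i] by blast
      define B where "B = (\<lambda>a y. a i * \<phi> y :: 'k)"
      have B: "B \<in> bilinear_forms S \<Phi>" unfolding bilinear_forms_def B_def using \<phi>(1,2) by (auto simp: S algebra_simps)
      have "f x B = (\<Sum>j<r. pt (e j) (x j) B)" unfolding f_def by (simp add: sum_fun_apply)
      also have "\<dots> = (\<Sum>j<r. if j = i then \<phi> (x i) else 0)"
        unfolding pt_def pure_tensor_def using B by (intro sum.cong) (auto simp: B_def e_def single_def)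
      also have "\<dots> = 1" using ir \<phi>(3) by simp
      finally show False using x(2) by simp
    qed
  next
    fix t assume t: "t \<in> vecs (tensor_rep S \<Phi>)"
    define Im where "Im = {t. \<exists>x\<in>vecs (seg_rep r \<Phi>). t = f x}"
    have "T.subspace Im"
    proof (rule T.subspaceI)
      have "f 0 = 0" unfolding f_def using eS pt_0 by simp
      then show "0 \<in> Im" unfolding Im_def using vecs_0[OF pre_rep_seg_rep[OF \<Phi>], of r] by force
      fix s t assume "s \<in> Im" "t \<in> Im"
      then obtain x y where "x \<in> vecs (seg_rep r \<Phi>)" "s = f x" "y \<in> vecs (seg_rep r \<Phi>)" "t = f y"
        unfolding Im_def by blast
      then show "s + t \<in> Im" unfolding Im_def using f_add[of x y] vecs_add[OF pre_rep_seg_rep[OF \<Phi>], of x r y]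
        by (intro CollectI bexI[of _ "x + y"]) (simp_all only:)
    next
      fix c t assume "t \<in> Im"
      then obtain x where "x \<in> vecs (seg_rep r \<Phi>)" "t = f x" unfolding Im_def by blast
      then show "(\<lambda>B. c * t B) \<in> Im" unfolding Im_def using f_smul[of x c] vecs_smul[OF pre_rep_seg_rep[OF \<Phi>], of x r c]
        by (intro CollectI bexI[of _ "smul (seg_rep r \<Phi>) c x"]) (simp_all only:)
    qed
    moreover have "pure_tensor S \<Phi> a y \<in> Im" if a: "a \<in> vecs S" and y: "y \<in> vecs \<Phi>" for a y
    proof -
      define x where "x = (\<lambda>i. if i < r then smul \<Phi> (a i) y else 0)"
      have x: "x \<in> vecs (seg_rep r \<Phi>)" using vecs_smul[OF \<Phi> y] by (simp add: x_def)
      have ae: "a = (\<Sum>i<r. smul S (a i) (e i))"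
      proof -
        have "smul S (a i) (e i) = single i (a i)" for i by (auto simp: S e_def single_def)
        then show ?thesis using sum_single[of r a] a by (simp add: S)
      qed
      then have "pt a y = (\<Sum>i<r. pt (smul S (a i) (e i)) y)"
        by (subst ae, intro pt_sum' y) (use eS Sadd(2) in auto)
      also have "\<dots> = f x" unfolding f_def x_def using eS y by (intro sum.cong) (auto simp: pt_smul pt_smul')
      finally show ?thesis unfolding Im_def pt_def using x by blast
    qed
    ultimately have "vecs (tensor_rep S \<Phi>) \<subseteq> Im" unfolding vS by (intro T.span_minimal) auto
    then show "\<exists>x\<in>vecs (seg_rep r \<Phi>). t = f x" using t unfolding Im_def by blast
  qed
  moreover have "f (seg_op r C x) = tensor_map S \<Phi> N id (f x) + tensor_map S \<Phi> id C (f x)"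
    if x: "x \<in> vecs (seg_rep r \<Phi>)" for x
  proof -
    have xi: "x i \<in> vecs \<Phi>" for i using x vecs_0[OF \<Phi>] by (cases "i < r") auto
    have "tensor_map S \<Phi> id C (f x) = (\<Sum>i<r. pt (e i) (C (x i)))"
      unfolding f_def tm_sum pt_def using tensor_map_pure_tensor[OF idL(1) C] by simp
    \<comment> \<open>\<open>N\<close> sends each unit vector to the next and kills the last, so
      reindexing the sum turns it into the shift of the tuple.\<close>
    moreover have "tensor_map S \<Phi> N id (f x) = (\<Sum>i<r. if i = 0 then 0 else pt (e i) (x (i - 1)))"
    proof -
      obtain s where s: "r = Suc s" using r by (cases r) auto
      have Ne: "N (e i) = (if Suc i < r then e (Suc i) else 0)" for i
        by (auto simp: N e_def single_def fun_eq_iff)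
      have "tensor_map S \<Phi> N id (f x) = (\<Sum>i<r. pt (N (e i)) (x i))"
        unfolding f_def tm_sum pt_def using tensor_map_pure_tensor[OF NL idL(2)] by simp
      also have "\<dots> = (\<Sum>i<s. pt (e (Suc i)) (x i))" unfolding s using pt_0'[OF xi] by (simp add: Ne s)
      also have "\<dots> = (\<Sum>i<r. if i = 0 then 0 else pt (e i) (x (i - 1)))"
        unfolding s by (subst sum.lessThan_Suc_shift) simp
      finally show ?thesis .
    qed
    moreover have "f (seg_op r C x) = (\<Sum>i<r. (if i = 0 then 0 else pt (e i) (x (i - 1))) + pt (e i) (C (x i)))"
      unfolding f_def using eS pt_add xi lin_maps_closed[OF C xi] by (intro sum.cong) (auto simp: seg_op_def)
    ultimately show ?thesis by (simp add: sum.distrib)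
  qed
  ultimately show ?thesis unfolding SN deligne_tensor.simps deligne_iso.simps by (metis (no_types, lifting))
qed

section \<open>Irreducible representations and their twists\<close>

lemma irreducible_repD:
  assumes "irreducible_rep v \<Phi>"
  shows "weil_rep v \<Phi>" "pre_rep \<Phi>" "fin_dim \<Phi>" "vecs \<Phi> \<noteq> {0}"
    "\<And>S. stable_subspace v \<Phi> S \<Longrightarrow> S = {0} \<or> S = vecs \<Phi>"
  using assms by (auto simp: irreducible_rep_def weil_rep_iff)

lemma stable_subspace_kernel:
  assumes "pre_rep \<Phi>" "pre_rep \<Phi>'" "f \<in> rep_hom v \<Phi> \<Phi>'"
  shows "stable_subspace v \<Phi> {x \<in> vecs \<Phi>. f x = 0}"
proof -
  note f = rep_homD[OF assms(3)]
  interpret A: linear_space "smul \<Phi>" by (rule pre_rep_space[OF assms(1)])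
  interpret B: linear_space "smul \<Phi>'" by (rule pre_rep_space[OF assms(2)])
  have "f (act \<Phi> \<sigma> x) = 0" if "\<sigma> \<in> W" "x \<in> vecs \<Phi>" "f x = 0" for \<sigma> x
    using f(2)[OF that(1,2)] that(3) lin_maps_0[OF assms(2) act_lin_maps[OF assms(2) that(1)]] by simp
  then show ?thesis unfolding stable_subspace_def
    using vecs_0[OF assms(1)] vecs_add[OF assms(1)] vecs_smul[OF assms(1)] act_closed[OF assms(1)]
      lin_maps_0[OF assms(1) f(1)] lin_maps_add[OF f(1)] lin_maps_smul[OF f(1)]
    by (auto intro!: A.subspaceI)
qed

lemma stable_subspace_image:
  assumes "pre_rep \<Phi>" "pre_rep \<Phi>'" "f \<in> rep_hom v \<Phi> \<Phi>'"
  shows "stable_subspace v \<Phi>' (f ` vecs \<Phi>)"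
proof -
  note f = rep_homD[OF assms(3)]
  interpret B: linear_space "smul \<Phi>'" by (rule pre_rep_space[OF assms(2)])
  have "B.lsub (f ` vecs \<Phi>)"
  proof (rule B.subspaceI)
    show "0 \<in> f ` vecs \<Phi>" using lin_maps_0[OF assms(1) f(1)] vecs_0[OF assms(1)] by (metis image_eqI)
    fix x y assume "x \<in> f ` vecs \<Phi>" "y \<in> f ` vecs \<Phi>"
    then obtain a b where "a \<in> vecs \<Phi>" "x = f a" "b \<in> vecs \<Phi>" "y = f b" by blast
    then show "x + y \<in> f ` vecs \<Phi>" using lin_maps_add[OF f(1), of a b] vecs_add[OF assms(1), of a b] by (metis image_eqI)
  next
    fix c x assume "x \<in> f ` vecs \<Phi>"
    then obtain a where "a \<in> vecs \<Phi>" "x = f a" by blast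
    then show "smul \<Phi>' c x \<in> f ` vecs \<Phi>" using lin_maps_smul[OF f(1), of a c] vecs_smul[OF assms(1), of a c] by (metis image_eqI)
  qed
  moreover have "act \<Phi>' \<sigma> (f x) \<in> f ` vecs \<Phi>" if "\<sigma> \<in> W" "x \<in> vecs \<Phi>" for \<sigma> x
    using f(2)[OF that] act_closed[OF assms(1) that] by (metis image_eqI)
  ultimately show ?thesis unfolding stable_subspace_def using lin_maps_closed[OF f(1)] by auto
qed

lemma irreducible_hom_iso:
  fixes \<Phi> :: "('f, 'k, _) weil_rep" and \<Phi>' :: "('f, 'k, _) weil_rep"
  assumes "irreducible_rep v \<Phi>" "irreducible_rep v \<Phi>'" "f \<in> rep_hom v \<Phi> \<Phi>'" "x \<in> vecs \<Phi>" "f x \<noteq> 0"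
  shows "f \<in> rep_isos v \<Phi> \<Phi>'"
proof (rule rep_isosI[OF irreducible_repD(2)[OF assms(1)] assms(3)])
  note p = irreducible_repD(2)[OF assms(1)] irreducible_repD(2)[OF assms(2)]
  have "{x \<in> vecs \<Phi>. f x = 0} = {0} \<or> {x \<in> vecs \<Phi>. f x = 0} = vecs \<Phi>"
    by (rule irreducible_repD(5)[OF assms(1) stable_subspace_kernel[OF p assms(3)]])
  then show "y = 0" if "y \<in> vecs \<Phi>" "f y = 0" for y using that assms(4,5) by blast
  have "f ` vecs \<Phi> = {0} \<or> f ` vecs \<Phi> = vecs \<Phi>'"
    by (rule irreducible_repD(5)[OF assms(2) stable_subspace_image[OF p assms(3)]])
  then show "\<exists>x\<in>vecs \<Phi>. y = f x" if "y \<in> vecs \<Phi>'" for y using that assms(4,5) by blast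
qed

lemma irreducible_rep_twist:
  fixes \<Phi> :: "('f, 'k, _) weil_rep"
  assumes "irreducible_rep v \<Phi>"
  shows "irreducible_rep v (twist v n \<Phi>)"
proof -
  note p = irreducible_repD[OF assms]
  interpret linear_space "smul \<Phi>" by (rule pre_rep_space[OF p(2)])
  have "stable_subspace v \<Phi> S" if S: "stable_subspace v (twist v n \<Phi>) S" for S
  proof -
    have S': "lsub S" "S \<subseteq> vecs \<Phi>" "\<And>\<sigma> x. \<sigma> \<in> W \<Longrightarrow> x \<in> S \<Longrightarrow> smul \<Phi> (\<nu> \<sigma> powi n) (act \<Phi> \<sigma> x) \<in> S"
      using S by (auto simp: stable_subspace_def image_subset_iff)
    have "act \<Phi> \<sigma> x \<in> S" if "\<sigma> \<in> W" "x \<in> S" for \<sigma> x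
      using subspace_scale[OF S'(1) S'(3)[OF that], of "inverse (\<nu> \<sigma> powi n)"] \<nu>_nonzero[OF that(1)] by simp
    then show ?thesis using S'(1,2) by (auto simp: stable_subspace_def)
  qed
  then show ?thesis using p weil_rep_twist[OF p(1)] unfolding irreducible_rep_def by auto
qed

text \<open>The same map works: a further twist multiplies the actions on both sides by the same
  scalar.\<close>

lemma rep_isos_twist_shift:
  assumes \<Phi>: "pre_rep \<Phi>" "pre_rep \<Phi>'" and f: "f \<in> rep_isos v (twist v a \<Phi>) (twist v b \<Phi>')"
  shows "f \<in> rep_isos v (twist v (a + c) \<Phi>) (twist v (b + c) \<Phi>')"
proof -
  interpret A: linear_space "smul \<Phi>" by (rule pre_rep_space[OF \<Phi>(1)])
  interpret B: linear_space "smul \<Phi>'" by (rule pre_rep_space[OF \<Phi>(2)])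
  note f' = rep_isosD[OF f]
  have l: "f \<in> lin_maps \<Phi> \<Phi>'" using f'(2) by simp
  have "f (smul \<Phi> (\<nu> \<sigma> powi (a + c)) (act \<Phi> \<sigma> x)) = smul \<Phi>' (\<nu> \<sigma> powi (b + c)) (act \<Phi>' \<sigma> (f x))"
    if \<sigma>: "\<sigma> \<in> W" and x: "x \<in> vecs \<Phi>" for \<sigma> x
  proof -
    have "f (smul \<Phi> (\<nu> \<sigma> powi (a + c)) (act \<Phi> \<sigma> x)) = smul \<Phi>' (\<nu> \<sigma> powi c) (f (smul \<Phi> (\<nu> \<sigma> powi a) (act \<Phi> \<sigma> x)))"
      using lin_maps_smul[OF l] act_closed[OF \<Phi>(1) \<sigma> x] \<nu>_nonzero[OF \<sigma>] vecs_smul[OF \<Phi>(1)]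
      by (simp add: power_int_add mult.commute)
    then show ?thesis using f'(4)[OF \<sigma>, of x] x \<nu>_nonzero[OF \<sigma>] by (simp add: power_int_add mult.commute)
  qed
  then show ?thesis using f'(3) l unfolding rep_isos_def rep_hom_def by simp
qed

lemma rep_iso_twist_shift:
  assumes "pre_rep \<Phi>" "pre_rep \<Phi>'" "rep_iso v (twist v a \<Phi>) (twist v b \<Phi>')"
  shows "rep_iso v (twist v (a + c) \<Phi>) (twist v (b + c) \<Phi>')"
  using assms rep_isos_twist_shift unfolding rep_iso_def by blast

lemma rep_isos_twist_0:
  assumes "pre_rep \<Phi>"
  shows "(\<lambda>x. x) \<in> rep_isos v (twist v 0 \<Phi>) \<Phi>" "(\<lambda>x. x) \<in> rep_isos v \<Phi> (twist v 0 \<Phi>)"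
proof -
  interpret linear_space "smul \<Phi>" by (rule pre_rep_space[OF assms])
  show "(\<lambda>x. x) \<in> rep_isos v (twist v 0 \<Phi>) \<Phi>" "(\<lambda>x. x) \<in> rep_isos v \<Phi> (twist v 0 \<Phi>)"
    by (auto simp: rep_isos_def rep_hom_def lin_maps_def bij_betw_def)
qed

lemma rep_iso_twist_0:
  assumes "pre_rep \<Phi>"
  shows "rep_iso v (twist v 0 \<Phi>) \<Phi>" "rep_iso v \<Phi> (twist v 0 \<Phi>)"
  using rep_isos_twist_0[OF assms] by (auto simp: rep_iso_def)

lemma rep_class_eq_iff:
  fixes \<Phi> \<Phi>' :: "('f, 'k, _) weil_rep"
  assumes "weil_rep v \<Phi>" "weil_rep v \<Phi>'"
  shows "rep_class v \<Phi> = rep_class v \<Phi>' \<longleftrightarrow> rep_iso v \<Phi> \<Phi>'"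
proof
  assume e: "rep_class v \<Phi> = rep_class v \<Phi>'"
  have "\<Phi>' \<in> rep_class v \<Phi>'" using assms(2) rep_iso_refl by (simp add: rep_class_def)
  then show "rep_iso v \<Phi> \<Phi>'" unfolding e[symmetric] by (simp add: rep_class_def)
next
  assume i: "rep_iso v \<Phi> \<Phi>'"
  have "rep_iso v \<Phi>' \<Phi>" by (rule rep_iso_sym[OF weil_rep_pre_rep[OF assms(1)] i])
  then show "rep_class v \<Phi> = rep_class v \<Phi>'" unfolding rep_class_def using i rep_iso_trans by blast
qed

text \<open>The integers k for which \<Psi> is isomorphic to its k-th twist form a subgroup, which
  is nonzero because \<nu> ^ (l - 1) is trivial; its positive generator is the size of the orbit.
  That it divides l - 1 later makes a power of the twisted isomorphism scalar.\<close>

lemma orbit_card: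
  fixes \<Psi> :: "('f, 'k, _) weil_rep"
  assumes w: "weil_rep v \<Psi>"
  shows "orbit_card v \<Psi> \<ge> 1"
    "rep_iso v (twist v a \<Psi>) (twist v b \<Psi>) \<longleftrightarrow> int (orbit_card v \<Psi>) dvd a - b"
    "orbit_card v \<Psi> dvd CHAR('k) - 1"
proof -
  note p = weil_rep_pre_rep[OF w]
  interpret linear_space "smul \<Psi>" by (rule pre_rep_space[OF p])
  define P where "P k \<longleftrightarrow> rep_iso v (twist v k \<Psi>) (twist v 0 \<Psi>)" for k
  have shift: "rep_iso v (twist v a \<Psi>) (twist v b \<Psi>) \<longleftrightarrow> P (a - b)" for a b
    unfolding P_def using rep_iso_twist_shift[OF p p, of a b "- b"] rep_iso_twist_shift[OF p p, of "a - b" 0 b] by auto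
  have P0: "P 0" unfolding P_def by (rule rep_iso_refl)
  have Pdiff: "P (a - b)" if "P a" "P b" for a b
  proof -
    have "rep_iso v (twist v 0 \<Psi>) (twist v b \<Psi>)"
      using that(2) rep_iso_sym[OF pre_rep_twist[OF p]] unfolding P_def by blast
    then show ?thesis using that(1) rep_iso_trans shift unfolding P_def by blast
  qed
  have Pneg: "P (- a)" if "P a" for a using Pdiff[OF P0 that] by simp
  have Padd: "P (a + b)" if "P a" "P b" for a b using Pdiff[OF that(1) Pneg[OF that(2)]] by simp
  have Pmul: "P (n * a)" if "P a" for n a
  proof (induction n rule: int_induct[where k = 0])
    case (step1 i)
    then show ?case using Padd[OF step1(2) that] by (simp add: algebra_simps)
  next
    case (step2 i)
    then show ?case using Pdiff[OF step2(2) that] by (simp add: algebra_simps)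
  qed (simp add: P0)
  have Pm: "P (int (CHAR('k) - 1))"
  proof -
    have "\<nu> \<sigma> powi int (CHAR('k) - 1) = 1" if "\<sigma> \<in> W" for \<sigma>
      using \<nu>_power_CHAR_minus_1[OF that] by (simp only: power_int_of_nat)
    then have "(\<lambda>x. x) \<in> rep_isos v (twist v (int (CHAR('k) - 1)) \<Psi>) (twist v 0 \<Psi>)"
      by (auto simp: rep_isos_def rep_hom_def lin_maps_def bij_betw_def)
    then show ?thesis unfolding P_def rep_iso_def by blast
  qed
  define d where "d = (LEAST n. n > 0 \<and> P (int n))"
  have "CHAR('k) - 1 > 0" using CHAR_ge_2 by simp
  then have d: "d > 0" "P (int d)" using LeastI[of "\<lambda>n. n > 0 \<and> P (int n)"] Pm unfolding d_def by blast+
  have dmin: "d \<le> n" if "n > 0" "P (int n)" for n unfolding d_def using that by (intro Least_le) simp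
  have Pd: "P k \<longleftrightarrow> int d dvd k" for k
  proof
    assume "P k"
    have "k mod int d = k - (k div int d) * int d" by (simp add: minus_div_mult_eq_mod)
    then have "P (k mod int d)" using Pdiff[OF \<open>P k\<close> Pmul[OF d(2), of "k div int d"]] by simp
    moreover have "0 \<le> k mod int d" "k mod int d < int d" using d(1) by simp_all
    ultimately have "nat (k mod int d) = 0" using dmin[of "nat (k mod int d)"] by (cases "k mod int d = 0") auto
    then show "int d dvd k" using \<open>0 \<le> k mod int d\<close> by (simp add: dvd_eq_mod_eq_0)
  next
    assume "int d dvd k"
    then obtain n where "k = n * int d" by (metis dvd_def mult.commute)
    then show "P k" using Pmul[OF d(2)] by simp
  qed
  have cls: "rep_class v (twist v a \<Psi>) = rep_class v (twist v b \<Psi>) \<longleftrightarrow> int d dvd a - b" for a b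
    unfolding rep_class_eq_iff[OF weil_rep_twist[OF w] weil_rep_twist[OF w]] shift Pd ..
  have "nu_orbit v \<Psi> = (\<lambda>k. rep_class v (twist v k \<Psi>)) ` {0..<int d}"
  proof
    show "nu_orbit v \<Psi> \<subseteq> (\<lambda>k. rep_class v (twist v k \<Psi>)) ` {0..<int d}"
    proof
      fix c assume "c \<in> nu_orbit v \<Psi>"
      then obtain k where k: "c = rep_class v (twist v k \<Psi>)" unfolding nu_orbit_def by blast
      have "int d dvd k - k mod int d" by (simp add: minus_mod_eq_mult_div)
      then have "c = rep_class v (twist v (k mod int d) \<Psi>)" unfolding k cls .
      moreover have "k mod int d \<in> {0..<int d}" using d(1) by simp
      ultimately show "c \<in> (\<lambda>k. rep_class v (twist v k \<Psi>)) ` {0..<int d}" by blast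
    qed
  qed (auto simp: nu_orbit_def)
  moreover have "inj_on (\<lambda>k. rep_class v (twist v k \<Psi>)) {0..<int d}"
  proof (rule inj_onI)
    fix a b assume ab: "a \<in> {0..<int d}" "b \<in> {0..<int d}" "rep_class v (twist v a \<Psi>) = rep_class v (twist v b \<Psi>)"
    then have "int d dvd a - b" using cls by blast
    then have "a mod int d = b mod int d" by (simp add: mod_eq_dvd_iff)
    then show "a = b" using ab by simp
  qed
  ultimately have o: "orbit_card v \<Psi> = d" unfolding orbit_card_def by (simp add: card_image)
  show "orbit_card v \<Psi> \<ge> 1" using d(1) o by simp
  show "rep_iso v (twist v a \<Psi>) (twist v b \<Psi>) \<longleftrightarrow> int (orbit_card v \<Psi>) dvd a - b" unfolding o shift Pd ..
  show "orbit_card v \<Psi> dvd CHAR('k) - 1" using Pm unfolding o Pd by (simp only: int_dvd_int_iff)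
qed

section \<open>Cycles\<close>

definition cycle_op :: "nat \<Rightarrow> ('v::zero \<Rightarrow> 'v) \<Rightarrow> (nat \<Rightarrow> 'v) \<Rightarrow> nat \<Rightarrow> 'v" where
  "cycle_op n I = (\<lambda>x i. if i = 0 then I (x (n - 1)) else if i < n then x (i - 1) else 0)"

lemma cycle_eq: "cycle v \<Psi> I = (seg_rep (orbit_card v \<Psi>) \<Psi>, cycle_op (orbit_card v \<Psi>) I)"
  by (simp add: cycle_def seg_rep_def cycle_op_def)

lemma twisted_iso_act:
  assumes \<Psi>: "pre_rep \<Psi>" and I: "I \<in> rep_isos v (twist v (int n) \<Psi>) \<Psi>" and "\<sigma> \<in> W" "x \<in> vecs \<Psi>"
  shows "act \<Psi> \<sigma> (I x) = smul \<Psi> (\<nu> \<sigma> ^ n) (I (act \<Psi> \<sigma> x))"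
proof -
  have l: "I \<in> lin_maps \<Psi> \<Psi>" using rep_isosD(2)[OF I] by simp
  show ?thesis using rep_isosD(4)[OF I assms(3), of x] assms(4) lin_maps_smul[OF l act_closed[OF \<Psi> assms(3,4)]] by simp
qed

lemma dop_cycle:
  assumes \<Psi>: "pre_rep \<Psi>" and I: "I \<in> rep_isos v (twist v (int n) \<Psi>) \<Psi>" and n: "n \<ge> 1"
  shows "dop (seg_rep n \<Psi>) (cycle_op n I)"
proof -
  interpret linear_space "smul \<Psi>" by (rule pre_rep_space[OF \<Psi>])
  have l: "I \<in> lin_maps \<Psi> \<Psi>" using rep_isosD(2)[OF I] by simp
  show ?thesis unfolding dop_def
  proof (intro conjI ballI)
    show "cycle_op n I \<in> lin_maps (seg_rep n \<Psi>) (seg_rep n \<Psi>)"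
      unfolding lin_maps_def
      using lin_maps_closed[OF l] lin_maps_add[OF l] lin_maps_smul[OF l] n
      by (auto simp: cycle_op_def fun_eq_iff)
    fix \<sigma> x assume \<sigma>: "\<sigma> \<in> W" and x: "x \<in> vecs (seg_rep n \<Psi>)"
    show "act (seg_rep n \<Psi>) \<sigma> (cycle_op n I x) = smul (seg_rep n \<Psi>) (\<nu> \<sigma>) (cycle_op n I (act (seg_rep n \<Psi>) \<sigma> x))"
    proof
      fix i
      have xn: "x (n - 1) \<in> vecs \<Psi>" using x n by simp
      have "\<nu> \<sigma> ^ n = \<nu> \<sigma> * \<nu> \<sigma> ^ (n - 1)" using n by (cases n) auto
      then have "act \<Psi> \<sigma> (I (x (n - 1))) = smul \<Psi> (\<nu> \<sigma>) (I (smul \<Psi> (\<nu> \<sigma> ^ (n - 1)) (act \<Psi> \<sigma> (x (n - 1)))))"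
        using twisted_iso_act[OF \<Psi> I \<sigma> xn] lin_maps_smul[OF l act_closed[OF \<Psi> \<sigma> xn]] by simp
      moreover have "act \<Psi> \<sigma> 0 = 0" using lin_maps_0[OF \<Psi> act_lin_maps[OF \<Psi> \<sigma>]] .
      ultimately show "act (seg_rep n \<Psi>) \<sigma> (cycle_op n I x) i = smul (seg_rep n \<Psi>) (\<nu> \<sigma>) (cycle_op n I (act (seg_rep n \<Psi>) \<sigma> x)) i"
        by (cases i) (auto simp: cycle_op_def)
    qed
  qed
qed

lemma seg_component_hom:
  assumes "i < n" "S \<subseteq> vecs (seg_rep n \<Psi>)"
  shows "(\<lambda>x. x i) \<in> rep_hom v ((seg_rep n \<Psi>)\<lparr>vecs := S\<rparr>) (twist v (int i) \<Psi>)"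
  using assms by (auto simp: rep_hom_def lin_maps_def)

text \<open>For n \<le> o(\<Psi>) the slots are pairwise non-isomorphic. Let \<open>A\<close> be a
  minimal support of a nonzero vector of \<open>S\<close>. The vectors of \<open>S\<close> supported
  in \<open>A\<close> have full support when nonzero, so they project isomorphically to each slot in
  \<open>A\<close>; hence \<open>A\<close> has one element and that slot lies in
  \<open>S\<close>.\<close>

lemma stable_subspace_contains_component:
  fixes \<Psi> :: "('f, 'k, 'v::ab_group_add) weil_rep"
  assumes \<Psi>: "irreducible_rep v \<Psi>" and n: "n \<le> orbit_card v \<Psi>"
    and S: "stable_subspace v (seg_rep n \<Psi>) S" "S \<noteq> {0}"
  shows "\<exists>i<n. \<forall>y\<in>vecs \<Psi>. single i y \<in> S"
proof -
  note p = irreducible_repD[OF \<Psi>]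
  note ps = pre_rep_seg_rep[OF p(2), of n]
  interpret L: linear_space "smul \<Psi>" by (rule pre_rep_space[OF p(2)])
  interpret linear_space "smul (seg_rep n \<Psi>)" by (rule pre_rep_space[OF ps])
  have S': "lsub S" "S \<subseteq> vecs (seg_rep n \<Psi>)" "\<And>\<sigma> x. \<sigma> \<in> W \<Longrightarrow> x \<in> S \<Longrightarrow> act (seg_rep n \<Psi>) \<sigma> x \<in> S"
    using S(1) by (auto simp: stable_subspace_def image_subset_iff)
  define supp where "supp x = {i. x i \<noteq> (0::'v)}" for x :: "nat \<Rightarrow> 'v"
  have supp: "supp x \<subseteq> {..<n}" if "x \<in> S" for x using S'(2) that by (force simp: supp_def not_le[symmetric])
  then have fin: "finite (supp x)" if "x \<in> S" for x using that finite_subset by blast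
  obtain x0 where "x0 \<in> S" "x0 \<noteq> 0" using S(2) subspace_0[OF S'(1)] by blast
  then obtain x where x: "x \<in> S" "x \<noteq> 0" and xmin: "\<And>y. y \<in> S \<Longrightarrow> y \<noteq> 0 \<Longrightarrow> card (supp x) \<le> card (supp y)"
    using ex_has_least_nat[of "\<lambda>x. x \<in> S \<and> x \<noteq> 0" x0 "\<lambda>x. card (supp x)"] by blast
  define A where "A = supp x"
  define P where "P = {y \<in> S. supp y \<subseteq> A}"
  have full: "supp y = A" if "y \<in> P" "y \<noteq> 0" for y
    using that xmin[of y] card_seteq[of A "supp y"] fin[OF x(1)] unfolding P_def A_def by auto
  have P: "stable_subspace v (seg_rep n \<Psi>) P" unfolding stable_subspace_def
  proof (intro conjI ballI)
    show "lsub P"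
    proof (rule subspaceI)
      show "0 \<in> P" unfolding P_def using subspace_0[OF S'(1)] by (auto simp: supp_def)
      show "y + z \<in> P" if "y \<in> P" "z \<in> P" for y z
        using that subspace_add[OF S'(1)] unfolding P_def supp_def by (auto simp: subset_iff) (metis add.right_neutral)
      show "smul (seg_rep n \<Psi>) c y \<in> P" if "y \<in> P" for c y
        using that subspace_scale[OF S'(1), of y c] unfolding P_def supp_def by (auto simp: subset_iff)
    qed
    show "P \<subseteq> vecs (seg_rep n \<Psi>)" using S'(2) unfolding P_def by blast
    fix \<sigma> assume \<sigma>: "\<sigma> \<in> W"
    have "act \<Psi> \<sigma> 0 = 0" using lin_maps_0[OF p(2) act_lin_maps[OF p(2) \<sigma>]] .
    then have "y \<noteq> 0" if "act \<Psi> \<sigma> y \<noteq> 0" for y using that by blast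
    then show "act (seg_rep n \<Psi>) \<sigma> ` P \<subseteq> P" using S'(3)[OF \<sigma>] unfolding P_def supp_def by (auto simp: subset_iff)
  qed
  have xP: "x \<in> P" using x(1) unfolding P_def A_def by blast
  have isoA: "(\<lambda>y. y i) \<in> rep_isos v ((seg_rep n \<Psi>)\<lparr>vecs := P\<rparr>) (twist v (int i) \<Psi>)" if i: "i \<in> A" for i
  proof -
    have "i < n" using i supp[OF x(1)] unfolding A_def by blast
    then have h: "(\<lambda>y. y i) \<in> rep_hom v ((seg_rep n \<Psi>)\<lparr>vecs := P\<rparr>) (twist v (int i) \<Psi>)"
      using P by (intro seg_component_hom) (auto simp: stable_subspace_def)
    note pP = pre_rep_restrict[OF ps P]
    note tw = irreducible_rep_twist[OF \<Psi>, of "int i"]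
    have "(\<lambda>y. y i) ` P = {0} \<or> (\<lambda>y. y i) ` P = vecs \<Psi>"
      using irreducible_repD(5)[OF tw stable_subspace_image[OF pP irreducible_repD(2)[OF tw] h]] by simp
    moreover have "x i \<noteq> 0" using i unfolding A_def supp_def by simp
    ultimately have im: "(\<lambda>y. y i) ` P = vecs \<Psi>" using xP by blast
    show ?thesis
    proof (rule rep_isosI[OF pP h])
      fix y assume "y \<in> vecs ((seg_rep n \<Psi>)\<lparr>vecs := P\<rparr>)" "y i = 0"
      then show "y = 0" using full[of y] i unfolding supp_def by auto
    next
      fix z assume "z \<in> vecs (twist v (int i) \<Psi>)"
      then have "z \<in> (\<lambda>y. y i) ` P" using im by simp
      then show "\<exists>y\<in>vecs ((seg_rep n \<Psi>)\<lparr>vecs := P\<rparr>). z = y i" by auto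
    qed
  qed
  have uniq: "i = j" if ij: "i \<in> A" "j \<in> A" for i j
  proof -
    have "i < n" "j < n" using ij supp[OF x(1)] unfolding A_def by auto
    then have lt: "i < orbit_card v \<Psi>" "j < orbit_card v \<Psi>" using n by auto
    have "rep_iso v (twist v (int i) \<Psi>) (twist v (int j) \<Psi>)"
      using isoA[OF ij(1)] isoA[OF ij(2)] rep_iso_sym[OF pre_rep_restrict[OF ps P]] rep_iso_trans unfolding rep_iso_def by blast
    then have "int (orbit_card v \<Psi>) dvd int i - int j" using orbit_card(2)[OF p(1)] by blast
    then have "int i mod int (orbit_card v \<Psi>) = int j mod int (orbit_card v \<Psi>)" by (simp add: mod_eq_dvd_iff)
    then show ?thesis using lt by simp
  qed
  have "A \<noteq> {}" using x(2) unfolding A_def supp_def by (auto simp: fun_eq_iff)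
  then obtain i where i: "i \<in> A" by blast
  then have Ai: "A = {i}" using uniq by blast
  have "single i y \<in> S" if y: "y \<in> vecs \<Psi>" for y
  proof -
    obtain z where z: "z \<in> P" "y = z i" using rep_isos_surj[OF isoA[OF i], of y] y by auto
    have "z = single i y" using z Ai unfolding P_def supp_def single_def by (auto simp: fun_eq_iff)
    then show ?thesis using z(1) unfolding P_def by blast
  qed
  moreover have "i < n" using i supp[OF x(1)] unfolding A_def by blast
  ultimately show ?thesis by blast
qed

text \<open>A nonzero stable subspace contains a whole slot. The cycle operator carries it into all
  the others, passing from the last slot to the first through \<open>I\<close>, which is
  onto.\<close>

lemma cycle_irred:
  assumes \<Psi>: "irreducible_rep v \<Psi>" and I: "I \<in> rep_isos v (twist v (int (orbit_card v \<Psi>)) \<Psi>) \<Psi>"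
  defines "n \<equiv> orbit_card v \<Psi>"
  shows "op_irred (seg_rep n \<Psi>) (cycle_op n I)"
proof -
  note p = irreducible_repD[OF \<Psi>]
  note ps = pre_rep_seg_rep[OF p(2), of n]
  have n: "n \<ge> 1" using orbit_card(1)[OF p(1)] unfolding n_def .
  interpret linear_space "smul (seg_rep n \<Psi>)" by (rule pre_rep_space[OF ps])
  have l: "I \<in> lin_maps \<Psi> \<Psi>" using rep_isosD(2)[OF I] by simp
  have I0: "I 0 = 0" by (rule lin_maps_0[OF p(2) l])
  show ?thesis unfolding irred_def
  proof (intro conjI allI impI)
    obtain y where y: "y \<in> vecs \<Psi>" "y \<noteq> 0" using p(4) vecs_0[OF p(2)] by blast
    then have "single 0 y \<in> vecs (seg_rep n \<Psi>)" "single 0 y \<noteq> 0"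
      using n vecs_0[OF p(2)] by (auto simp: single_def fun_eq_iff)
    then show "vecs (seg_rep n \<Psi>) \<noteq> {0}" by blast
    fix S assume "closed_under (insert (cycle_op n I) (actions (seg_rep n \<Psi>))) (vecs (seg_rep n \<Psi>)) S"
    then have S: "stable_subspace v (seg_rep n \<Psi>) S" and C: "\<And>x. x \<in> S \<Longrightarrow> cycle_op n I x \<in> S"
      using closed_under_insert[OF ps] by auto
    have sub: "lsub S" "S \<subseteq> vecs (seg_rep n \<Psi>)" using S by (auto simp: stable_subspace_def)
    show "S = {0} \<or> S = vecs (seg_rep n \<Psi>)"
    proof (cases "S = {0}")
      case False
      then obtain i where i: "i < n" "\<forall>y\<in>vecs \<Psi>. single i y \<in> S"
        using stable_subspace_contains_component[OF \<Psi> _ S] unfolding n_def by blast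
      have up: "\<forall>y\<in>vecs \<Psi>. single (j + k) y \<in> S" if "j + k < n" "\<forall>y\<in>vecs \<Psi>. single j y \<in> S" for j k
        using that(1)
      proof (induction k)
        case (Suc k)
        show ?case
        proof
          fix y assume "y \<in> vecs \<Psi>"
          then have "cycle_op n I (single (j + k) y) \<in> S" using C Suc by simp
          moreover have "cycle_op n I (single (j + k) y) = single (j + Suc k) y"
            using Suc.prems I0 by (auto simp: cycle_op_def single_def fun_eq_iff)
          ultimately show "single (j + Suc k) y \<in> S" by simp
        qed
      qed (use that(2) in simp)
      have top: "\<forall>y\<in>vecs \<Psi>. single (n - 1) y \<in> S" using up[of i "n - 1 - i"] i by simp
      have "\<forall>y\<in>vecs \<Psi>. single 0 y \<in> S"
      proof
        fix y assume "y \<in> vecs \<Psi>"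
        then obtain z where z: "z \<in> vecs \<Psi>" "y = I z" using rep_isos_surj[OF I, of y] by auto
        have "cycle_op n I (single (n - 1) z) = single 0 y"
          using n z(2) I0 by (auto simp: cycle_op_def single_def fun_eq_iff)
        then show "single 0 y \<in> S" using C top z(1) by metis
      qed
      then have all: "single j y \<in> S" if "j < n" "y \<in> vecs \<Psi>" for j y using up[of 0 j] that by simp
      have "vecs (seg_rep n \<Psi>) \<subseteq> S"
      proof
        fix x assume x: "x \<in> vecs (seg_rep n \<Psi>)"
        have "(\<Sum>i<n. single i (x i)) \<in> S" using all x by (intro subspace_sum[OF sub(1)]) auto
        moreover have "x = (\<Sum>i<n. single i (x i))" by (rule sum_single) (use x in simp)
        ultimately show "x \<in> S" by simp
      qed
      then show ?thesis using sub(2) by blast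
    qed simp
  qed
qed

text \<open>Schur's lemma for pairs: kernel and image of \<open>f\<close> are stable under the group
  and the operator.\<close>

lemma irred_hom_iso:
  assumes \<Phi>: "pre_rep \<Phi>" "U \<in> lin_maps \<Phi> \<Phi>" and \<Phi>': "pre_rep \<Phi>'" "U' \<in> lin_maps \<Phi>' \<Phi>'"
    and irr: "op_irred \<Phi> U"
    and irr': "op_irred \<Phi>' U'"
    and f: "f \<in> rep_hom v \<Phi> \<Phi>'" "\<And>x. x \<in> vecs \<Phi> \<Longrightarrow> f (U x) = U' (f x)" and x: "x \<in> vecs \<Phi>" "f x \<noteq> 0"
  shows "f \<in> rep_isos v \<Phi> \<Phi>'"
proof (rule rep_isosI[OF \<Phi>(1) f(1)])
  interpret A: linear_space "smul \<Phi>" by (rule pre_rep_space[OF \<Phi>(1)])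
  interpret B: linear_space "smul \<Phi>'" by (rule pre_rep_space[OF \<Phi>'(1)])
  have "A.closed_under (insert U (actions \<Phi>)) (vecs \<Phi>) {x \<in> vecs \<Phi>. f x = 0}"
    unfolding closed_under_insert[OF \<Phi>(1)]
    using stable_subspace_kernel[OF \<Phi>(1) \<Phi>'(1) f(1)] f(2) lin_maps_closed[OF \<Phi>(2)] lin_maps_0[OF \<Phi>'] by auto
  then have "{x \<in> vecs \<Phi>. f x = 0} = {0} \<or> {x \<in> vecs \<Phi>. f x = 0} = vecs \<Phi>" using irr unfolding A.irred_def by blast
  then show "y = 0" if "y \<in> vecs \<Phi>" "f y = 0" for y using that x by blast
  have "U' (f x) \<in> f ` vecs \<Phi>" if "x \<in> vecs \<Phi>" for x
    using f(2)[OF that] lin_maps_closed[OF \<Phi>(2) that] by (metis image_eqI)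
  then have "B.closed_under (insert U' (actions \<Phi>')) (vecs \<Phi>') (f ` vecs \<Phi>)"
    unfolding closed_under_insert[OF \<Phi>'(1)]
    using stable_subspace_image[OF \<Phi>(1) \<Phi>'(1) f(1)] by blast
  then have "f ` vecs \<Phi> = {0} \<or> f ` vecs \<Phi> = vecs \<Phi>'" using irr' unfolding B.irred_def by blast
  then show "\<exists>x\<in>vecs \<Phi>. y = f x" if "y \<in> vecs \<Phi>'" for y using that x by blast
qed

lemma rep_isos_smul:
  assumes \<Phi>: "pre_rep \<Phi>" "pre_rep \<Phi>'" and f: "f \<in> rep_isos v \<Phi> \<Phi>'" and c: "c \<noteq> 0"
  shows "(\<lambda>x. smul \<Phi>' c (f x)) \<in> rep_isos v \<Phi> \<Phi>'"
proof (rule rep_isosI[OF \<Phi>(1)])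
  note f' = rep_isosD[OF f]
  interpret A: linear_space "smul \<Phi>" by (rule pre_rep_space[OF \<Phi>(1)])
  interpret B: linear_space "smul \<Phi>'" by (rule pre_rep_space[OF \<Phi>(2)])
  show "(\<lambda>x. smul \<Phi>' c (f x)) \<in> rep_hom v \<Phi> \<Phi>'"
    using lin_maps_closed[OF f'(2)] lin_maps_add[OF f'(2)] lin_maps_smul[OF f'(2)] f'(4) vecs_smul[OF \<Phi>(2)]
      lin_maps_smul[OF act_lin_maps[OF \<Phi>(2)]]
    by (auto simp: rep_hom_def lin_maps_def B.scale_right_distrib mult.commute)
  show "x = 0" if "x \<in> vecs \<Phi>" "smul \<Phi>' c (f x) = 0" for x
    using that c rep_isos_inj[OF f that(1) vecs_0[OF \<Phi>(1)]] lin_maps_0[OF \<Phi>(1) f'(2)] by simp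
  show "\<exists>x\<in>vecs \<Phi>. y = smul \<Phi>' c (f x)" if y: "y \<in> vecs \<Phi>'" for y
  proof -
    obtain x where "x \<in> vecs \<Phi>" "smul \<Phi>' (inverse c) y = f x" using rep_isos_surj[OF f vecs_smul[OF \<Phi>(2) y]] .
    then show ?thesis using c by (intro bexI[of _ x]) (auto simp flip: \<open>smul \<Phi>' (inverse c) y = f x\<close>)
  qed
qed

lemma twisted_endomorphism_exists:
  fixes \<Psi> :: "('f, 'k, _) weil_rep"
  assumes "weil_rep v \<Psi>"
  shows "\<exists>I. I \<in> rep_isos v (twist v (int (orbit_card v \<Psi>)) \<Psi>) \<Psi>"
proof -
  have "rep_iso v (twist v (int (orbit_card v \<Psi>)) \<Psi>) (twist v 0 \<Psi>)" using orbit_card(2)[OF assms] by simp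
  then have "rep_iso v (twist v (int (orbit_card v \<Psi>)) \<Psi>) \<Psi>"
    using rep_iso_twist_0(1)[OF weil_rep_pre_rep[OF assms]] rep_iso_trans by blast
  then show ?thesis unfolding rep_iso_def by blast
qed

lemma schur_rep:
  fixes \<Psi> :: "('f, 'k, _) weil_rep"
  assumes \<Psi>: "irreducible_rep v \<Psi>" and A: "A \<in> rep_hom v \<Psi> \<Psi>"
  shows "\<exists>a. \<forall>x\<in>vecs \<Psi>. A x = smul \<Psi> a x"
proof -
  note p = irreducible_repD[OF \<Psi>]
  interpret linear_space_ac "smul \<Psi>" by (rule pre_rep_space_ac[OF p(2)])
  obtain B where B: "finite B" "vecs \<Psi> = span B" using p(3) unfolding fin_dim_def by blast
  show ?thesis
  proof (rule schur[OF pre_rep_subspace[OF p(2)] B])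
    show "endo (vecs \<Psi>) g" if "g \<in> actions \<Psi>" for g using that act_lin_maps[OF p(2)] endo_iff_lin_maps[OF p(2)] by auto
    show "irred (actions \<Psi>) (vecs \<Psi>)" using \<Psi> irreducible_rep_iff by blast
    show "endo (vecs \<Psi>) A" using rep_homD(1)[OF A] endo_iff_lin_maps[OF p(2)] by blast
    show "g (A x) = A (g x)" if "g \<in> actions \<Psi>" "x \<in> vecs \<Psi>" for g x using that rep_homD(2)[OF A] by auto
  qed
qed

text \<open>\<open>J\<close> commutes with the group up to the inverse of \<nu> ^ n. As n M = l - 1,
  its M-th power commutes exactly, and Schur's lemma applies.\<close>

lemma twisted_iso_funpow_scalar:
  fixes \<Psi> :: "('f, 'k, _) weil_rep"
  assumes \<Psi>: "irreducible_rep v \<Psi>" and J: "J \<in> rep_isos v \<Psi> (twist v (int n) \<Psi>)" and M: "n * M = CHAR('k) - 1"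
  shows "\<exists>c. c \<noteq> 0 \<and> (\<forall>x\<in>vecs \<Psi>. (J ^^ M) x = smul \<Psi> c x)"
proof -
  note p = irreducible_repD[OF \<Psi>]
  note J' = rep_isosD[OF J]
  interpret linear_space "smul \<Psi>" by (rule pre_rep_space[OF p(2)])
  have JE: "endo (vecs \<Psi>) J" using J'(2) endo_iff_lin_maps[OF p(2)] by simp
  have "act \<Psi> \<sigma> (J x) = smul \<Psi> (inverse (\<nu> \<sigma> ^ n)) (J (act \<Psi> \<sigma> x))" if "\<sigma> \<in> W" "x \<in> vecs \<Psi>" for \<sigma> x
    using J'(4)[OF that] \<nu>_nonzero[OF that(1)] by simp
  then have "act \<Psi> \<sigma> ((J ^^ M) x) = smul \<Psi> (inverse (\<nu> \<sigma> ^ n) ^ M) ((J ^^ M) (act \<Psi> \<sigma> x))"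
    if "\<sigma> \<in> W" "x \<in> vecs \<Psi>" for \<sigma> x
    using that act_lin_maps[OF p(2)] endo_iff_lin_maps[OF p(2)] JE by (intro funpow_quasi_commute) auto
  moreover have "inverse (\<nu> \<sigma> ^ n) ^ M = 1" if "\<sigma> \<in> W" for \<sigma>
  proof -
    have "inverse (\<nu> \<sigma> ^ n) ^ M = inverse (\<nu> \<sigma> ^ (n * M))" by (simp add: power_mult power_inverse)
    then show ?thesis unfolding M using \<nu>_power_CHAR_minus_1[OF that] by simp
  qed
  ultimately have "J ^^ M \<in> rep_hom v \<Psi> \<Psi>"
    using endo_funpow[OF JE] endo_iff_lin_maps[OF p(2)] by (auto simp: rep_hom_def)
  then obtain c where c: "\<forall>x\<in>vecs \<Psi>. (J ^^ M) x = smul \<Psi> c x" using schur_rep[OF \<Psi>] by blast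
  obtain x where x: "x \<in> vecs \<Psi>" "x \<noteq> 0" using p(4) vecs_0[OF p(2)] by blast
  have "J y \<noteq> 0" if "y \<in> vecs \<Psi>" "y \<noteq> 0" for y
    using that rep_isos_inj[OF J that(1) vecs_0[OF p(2)]] lin_maps_0[OF p(2) J'(2)] by simp
  then have "(J ^^ j) x \<noteq> 0" for j using endo_funpow_closed[OF JE x(1)] x(2) by (induction j) auto
  then have "c \<noteq> 0" using c x(1) by auto
  then show ?thesis using c by blast
qed

text \<open>A homomorphism \<open>g\<close> from \<Psi> to \<open>E\<close> extends to the cycle
  over \<Psi> with \<open>I\<close> as soon as \<open>C ^^ n\<close> after \<open>g\<close> equals
  \<open>g\<close> after \<open>I\<close>. To find such a pair, let \<open>T\<close> send
  \<open>g\<close> to the composite of \<open>J\<close>, \<open>g\<close> and \<open>C ^^ n\<close>,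
  with \<open>J\<close> inverse to some \<open>I0\<close>. Since \<open>C ^^ (l - 1)\<close> and
  \<open>J ^^ M\<close> are nonzero scalars, so is \<open>T ^^ M\<close>; an eigenvector
  \<open>g\<close> with eigenvalue \<open>a\<close> then gives I = a I0. Both pairs being simple,
  the resulting map is an isomorphism.\<close>

lemma cycle_recognition:
  fixes \<Psi> :: "('f, 'k, 'w::ab_group_add) weil_rep" and E :: "('f, 'k, 'v::ab_group_add) weil_rep"
  assumes \<Psi>: "irreducible_rep v \<Psi>" and E: "pre_rep E" "dop E C"
    and irr: "op_irred E C"
    and \<mu>: "\<mu> \<noteq> 0" "\<And>x. x \<in> vecs E \<Longrightarrow> (C ^^ (CHAR('k) - 1)) x = smul E \<mu> x"
    and f: "f \<in> rep_hom v \<Psi> E" "x0 \<in> vecs \<Psi>" "f x0 \<noteq> 0"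
  shows "\<exists>I\<in>rep_isos v (twist v (int (orbit_card v \<Psi>)) \<Psi>) \<Psi>. deligne_iso v (cycle v \<Psi> I) (E, C)"
proof -
  note p = irreducible_repD[OF \<Psi>]
  define n where "n = orbit_card v \<Psi>"
  have n: "n \<ge> 1" using orbit_card(1)[OF p(1)] unfolding n_def .
  obtain M where M: "CHAR('k) - 1 = n * M" using orbit_card(3)[OF p(1)] unfolding n_def by blast
  have M1: "M \<ge> 1" using M CHAR_ge_2 by (cases M) auto
  interpret A: linear_space "smul \<Psi>" by (rule pre_rep_space[OF p(2)])
  interpret B: linear_space "smul E" by (rule pre_rep_space[OF E(1)])
  obtain I0 where I0: "I0 \<in> rep_isos v (twist v (int n) \<Psi>) \<Psi>"
    using twisted_endomorphism_exists[OF p(1)] unfolding n_def by blast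
  define J where "J = inv_into (vecs \<Psi>) I0"
  have J: "J \<in> rep_isos v \<Psi> (twist v (int n) \<Psi>)"
    using rep_isos_inv[OF pre_rep_twist[OF p(2)] I0] unfolding J_def by simp
  note J' = rep_isosD[OF J]
  have JL: "J \<in> lin_maps \<Psi> \<Psi>" using J'(2) by simp
  have JI: "J (I0 x) = x" if "x \<in> vecs \<Psi>" for x
    using bij_betw_inv_into_left[OF rep_isosD(3)[OF I0]] that unfolding J_def by simp
  obtain c where c: "c \<noteq> 0" "\<And>x. x \<in> vecs \<Psi> \<Longrightarrow> (J ^^ M) x = smul \<Psi> c x"
    using twisted_iso_funpow_scalar[OF \<Psi> J M[symmetric]] by blast
  have CL: "C \<in> lin_maps E E" and tw: "\<And>\<sigma> x. \<sigma> \<in> W \<Longrightarrow> x \<in> vecs E \<Longrightarrow> act E \<sigma> (C x) = smul E (\<nu> \<sigma>) (C (act E \<sigma> x))"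
    using E(2) unfolding dop_def by auto
  have CE: "B.endo (vecs E) C" using CL endo_iff_lin_maps[OF E(1)] by simp
  have aE: "B.endo (vecs E) (act E \<sigma>)" if "\<sigma> \<in> W" for \<sigma> using act_lin_maps[OF E(1) that] endo_iff_lin_maps[OF E(1)] by simp
  have twn: "act E \<sigma> ((C ^^ k) x) = smul E (\<nu> \<sigma> ^ k) ((C ^^ k) (act E \<sigma> x))" if "\<sigma> \<in> W" "x \<in> vecs E" for \<sigma> k x
    using that tw by (intro B.funpow_quasi_commute[OF aE CE]) auto
  have CnL: "C ^^ k \<in> lin_maps E E" for k using B.endo_funpow[OF CE] endo_iff_lin_maps[OF E(1)] by simp
  define sc :: "'k \<Rightarrow> ('w \<Rightarrow> 'v) \<Rightarrow> 'w \<Rightarrow> 'v" where "sc = (\<lambda>c g x. smul E c (g x))"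
  have "vector_space sc" unfolding vector_space_def sc_def
    by (auto simp: fun_eq_iff B.scale_right_distrib B.scale_left_distrib)
  then interpret H: linear_space_ac sc by (simp add: linear_space_ac_def linear_space_def)
  \<comment> \<open>Homomorphisms are extended by zero off \<Psi>, so that functions on the ambient
    type model Hom(\<Psi>, E) faithfully. An explicit polynomial equation for \<open>T\<close> takes
    the place of finite dimensionality when the eigenvector is sought.\<close>
  define Hm where "Hm = {g \<in> rep_hom v \<Psi> E. \<forall>x. x \<notin> vecs \<Psi> \<longrightarrow> g x = 0}"
  define T where "T g x = (if x \<in> vecs \<Psi> then (C ^^ n) (g (J x)) else 0)" for g x
  have sub: "H.lsub Hm"
  proof (rule H.subspaceI)
    show "0 \<in> Hm" using vecs_0[OF E(1)] lin_maps_0[OF E(1) act_lin_maps[OF E(1)]]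
      by (auto simp: Hm_def rep_hom_def lin_maps_def)
    show "g + h \<in> Hm" if g: "g \<in> Hm" and h: "h \<in> Hm" for g h
    proof -
      have gh: "g \<in> rep_hom v \<Psi> E" "h \<in> rep_hom v \<Psi> E" using g h by (auto simp: Hm_def)
      note gl = rep_homD[OF gh(1)] and hl = rep_homD[OF gh(2)]
      have "g + h \<in> rep_hom v \<Psi> E" unfolding rep_hom_def lin_maps_def
        using lin_maps_closed[OF gl(1)] lin_maps_closed[OF hl(1)] lin_maps_add[OF gl(1)] lin_maps_add[OF hl(1)]
          lin_maps_smul[OF gl(1)] lin_maps_smul[OF hl(1)] gl(2) hl(2) vecs_add[OF E(1)] lin_maps_add[OF act_lin_maps[OF E(1)]]
        by (auto simp: B.scale_right_distrib)
      then show ?thesis using g h by (auto simp: Hm_def)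
    qed
    show "sc a g \<in> Hm" if g: "g \<in> Hm" for a g
    proof -
      have gh: "g \<in> rep_hom v \<Psi> E" using g by (auto simp: Hm_def)
      note gl = rep_homD[OF gh]
      have "sc a g \<in> rep_hom v \<Psi> E" unfolding rep_hom_def lin_maps_def sc_def
        using lin_maps_closed[OF gl(1)] lin_maps_add[OF gl(1)]
          lin_maps_smul[OF gl(1)] gl(2) vecs_smul[OF E(1)] lin_maps_smul[OF act_lin_maps[OF E(1)]]
        by (auto simp: B.scale_right_distrib mult.commute)
      then show ?thesis using g by (auto simp: Hm_def sc_def)
    qed
  qed
  have TE: "H.endo Hm T" unfolding H.endo_def
  proof (intro conjI ballI allI)
    fix g assume g: "g \<in> Hm"
    have gh: "g \<in> rep_hom v \<Psi> E" using g by (auto simp: Hm_def)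
    note gl = rep_homD[OF gh]
    have gJ: "g (J x) \<in> vecs E" if "x \<in> vecs \<Psi>" for x using lin_maps_closed[OF gl(1) lin_maps_closed[OF JL that]] .
    have "T g \<in> rep_hom v \<Psi> E"
    proof (rule rep_homI)
      fix x assume x: "x \<in> vecs \<Psi>"
      show "T g x \<in> vecs E" using lin_maps_closed[OF CnL gJ[OF x]] x by (simp add: T_def)
      fix y assume y: "y \<in> vecs \<Psi>"
      show "T g (x + y) = T g x + T g y"
        using x y vecs_add[OF p(2) x y] lin_maps_add[OF JL x y] lin_maps_add[OF gl(1) lin_maps_closed[OF JL x] lin_maps_closed[OF JL y]]
          lin_maps_add[OF CnL gJ[OF x] gJ[OF y]] by (simp add: T_def)
    next
      fix a x assume x: "x \<in> vecs \<Psi>"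
      show "T g (smul \<Psi> a x) = smul E a (T g x)"
        using x vecs_smul[OF p(2) x] lin_maps_smul[OF JL x] lin_maps_smul[OF gl(1) lin_maps_closed[OF JL x]]
          lin_maps_smul[OF CnL gJ[OF x]] by (simp add: T_def)
    next
      fix \<sigma> x assume \<sigma>: "\<sigma> \<in> W" and x: "x \<in> vecs \<Psi>"
      have Jx: "J x \<in> vecs \<Psi>" by (rule lin_maps_closed[OF JL x])
      have "T g (act \<Psi> \<sigma> x) = (C ^^ n) (g (smul \<Psi> (\<nu> \<sigma> ^ n) (act \<Psi> \<sigma> (J x))))"
        using act_closed[OF p(2) \<sigma> x] J'(4)[OF \<sigma> x] by (simp add: T_def)
      also have "\<dots> = smul E (\<nu> \<sigma> ^ n) ((C ^^ n) (act E \<sigma> (g (J x))))"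
        using lin_maps_smul[OF gl(1) act_closed[OF p(2) \<sigma> Jx]] gl(2)[OF \<sigma> Jx] lin_maps_smul[OF CnL act_closed[OF E(1) \<sigma> gJ[OF x]]] by simp
      also have "\<dots> = act E \<sigma> (T g x)" using twn[OF \<sigma> gJ[OF x]] x by (simp add: T_def)
      finally show "T g (act \<Psi> \<sigma> x) = act E \<sigma> (T g x)" .
    qed
    then show "T g \<in> Hm" by (simp add: Hm_def T_def)
    show "T (sc a g) = sc a (T g)" for a
      using lin_maps_smul[OF CnL gJ] by (auto simp: T_def sc_def fun_eq_iff)
    fix h assume h: "h \<in> Hm"
    then have "h (J x) \<in> vecs E" if "x \<in> vecs \<Psi>" for x
      using lin_maps_closed[OF rep_homD(1) lin_maps_closed[OF JL that]] by (auto simp: Hm_def)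
    then show "T (g + h) = T g + T h" using lin_maps_add[OF CnL gJ] by (auto simp: T_def fun_eq_iff)
  qed
  have Tn: "(T ^^ j) g x = (C ^^ (n * j)) (g ((J ^^ j) x))" if "x \<in> vecs \<Psi>" for j g x
    using that
  proof (induction j arbitrary: x)
    case (Suc j)
    then show ?case using lin_maps_closed[OF JL Suc.prems] by (simp add: T_def funpow_add funpow_swap1[of J])
  qed simp
  have TM: "(T ^^ M) g = sc (\<mu> * c) g" if g: "g \<in> Hm" for g
  proof
    fix x
    have gl: "g \<in> lin_maps \<Psi> E" and g0: "\<And>x. x \<notin> vecs \<Psi> \<Longrightarrow> g x = 0"
      using g by (auto simp: Hm_def rep_hom_def)
    have "(T ^^ M) g \<in> Hm" by (rule H.endo_funpow_closed[OF TE g])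
    then have z: "(T ^^ M) g x = 0" if "x \<notin> vecs \<Psi>" using that by (auto simp: Hm_def)
    show "(T ^^ M) g x = sc (\<mu> * c) g x"
    proof (cases "x \<in> vecs \<Psi>")
      case True
      have "(T ^^ M) g x = (C ^^ (CHAR('k) - 1)) (g (smul \<Psi> c x))" using Tn[OF True] c(2)[OF True] M by simp
      also have "\<dots> = smul E \<mu> (g (smul \<Psi> c x))" by (rule \<mu>(2)[OF lin_maps_closed[OF gl vecs_smul[OF p(2) True]]])
      also have "\<dots> = sc (\<mu> * c) g x" using lin_maps_smul[OF gl True] by (simp add: sc_def)
      finally show ?thesis .
    qed (simp add: z sc_def g0)
  qed
  define f1 where "f1 x = (if x \<in> vecs \<Psi> then f x else 0)" for x
  note fl = rep_homD[OF f(1)]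
  have "f1 \<in> rep_hom v \<Psi> E" unfolding rep_hom_def lin_maps_def
    using lin_maps_closed[OF fl(1)] lin_maps_add[OF fl(1)] lin_maps_smul[OF fl(1)] fl(2) vecs_add[OF p(2)] vecs_smul[OF p(2)] act_closed[OF p(2)]
    by (auto simp: f1_def)
  then have f1: "f1 \<in> Hm" by (simp add: Hm_def f1_def)
  have f1n: "f1 \<noteq> 0" using f(2,3) by (auto simp: f1_def fun_eq_iff)
  define q where "q = monom 1 M - monom (\<mu> * c) 0"
  have "coeff q M = 1" using M1 unfolding q_def by simp
  then have q0: "q \<noteq> 0" by auto
  have "H.pact T q f1 = 0" unfolding q_def
    using H.pact_diff[OF sub TE f1] H.pact_monom[OF sub TE f1] TM[OF f1] by simp
  then have "\<exists>a. \<exists>g\<in>Hm. g \<noteq> 0 \<and> T g = sc a g" by (rule H.exists_eigenvector[OF sub TE f1 f1n q0])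
  then obtain a g where g: "g \<in> Hm" "g \<noteq> 0" "T g = sc a g" by blast
  have gh: "g \<in> rep_hom v \<Psi> E" using g(1) by (auto simp: Hm_def)
  note gl = rep_homD[OF gh]
  have "\<exists>x. g x \<noteq> 0" using g(2) by (auto simp: fun_eq_iff)
  then obtain x1 where x1: "x1 \<in> vecs \<Psi>" "g x1 \<noteq> 0" using g(1) by (auto simp: Hm_def)
  have a0: "a \<noteq> 0"
  proof
    assume "a = 0"
    then have Tg: "T g = 0" using g(3) by simp
    have "(T ^^ M) g = (T ^^ (M - 1)) (T g)" using M1 by (cases M) (auto simp: funpow_swap1)
    then have "(T ^^ M) g = 0" unfolding Tg using H.endo_0[OF H.endo_funpow[OF TE] sub] by simp
    then show False using TM[OF g(1)] \<mu>(1) c(1) g(2) by simp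
  qed
  define I where "I x = smul \<Psi> a (I0 x)" for x
  have I: "I \<in> rep_isos v (twist v (int n) \<Psi>) \<Psi>"
    unfolding I_def by (rule rep_isos_smul[OF pre_rep_twist[OF p(2)] p(2) I0 a0])
  have gI: "(C ^^ n) (g x) = g (I x)" if x: "x \<in> vecs \<Psi>" for x
  proof -
    have Ix: "I0 x \<in> vecs \<Psi>" using lin_maps_closed[OF rep_isosD(2)[OF I0], of x] x by simp
    have "(C ^^ n) (g x) = T g (I0 x)" using Ix JI[OF x] by (simp add: T_def)
    also have "\<dots> = g (I x)" using g(3) lin_maps_smul[OF gl(1) Ix] by (simp add: sc_def I_def)
    finally show ?thesis .
  qed
  \<comment> \<open>Slot \<open>k\<close> of the cycle is mapped by \<open>C ^^ k\<close> after
    \<open>g\<close>; the relation \<open>gI\<close> is what closes the cycle at the last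
    slot.\<close>
  define h where "h x = (\<Sum>k<n. (C ^^ k) (g (x k)))" for x
  have gx: "g (x k) \<in> vecs E" if "x \<in> vecs (seg_rep n \<Psi>)" "k < n" for x k
    using that lin_maps_closed[OF gl(1)] by simp
  have h: "h \<in> rep_hom v (seg_rep n \<Psi>) E"
  proof (rule rep_homI)
    fix x assume x: "x \<in> vecs (seg_rep n \<Psi>)"
    show "h x \<in> vecs E" unfolding h_def
      using gx[OF x] lin_maps_closed[OF CnL] by (intro B.subspace_sum[OF pre_rep_subspace[OF E(1)]]) auto
    fix y assume y: "y \<in> vecs (seg_rep n \<Psi>)"
    show "h (x + y) = h x + h y" unfolding h_def sum.distrib[symmetric]
    proof (rule sum.cong)
      fix k assume "k \<in> {..<n}"
      then show "(C ^^ k) (g ((x + y) k)) = (C ^^ k) (g (x k)) + (C ^^ k) (g (y k))"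
        using x y lin_maps_add[OF gl(1), of "x k" "y k"] lin_maps_add[OF CnL gx[OF x] gx[OF y], of k k k] by simp
    qed simp
  next
    fix b x assume x: "x \<in> vecs (seg_rep n \<Psi>)"
    show "h (smul (seg_rep n \<Psi>) b x) = smul E b (h x)" unfolding h_def B.scale_sum_right
    proof (rule sum.cong)
      fix k assume "k \<in> {..<n}"
      then show "(C ^^ k) (g (smul (seg_rep n \<Psi>) b x k)) = smul E b ((C ^^ k) (g (x k)))"
        using x lin_maps_smul[OF gl(1), of "x k" b] lin_maps_smul[OF CnL gx[OF x], of k k b] by simp
    qed simp
  next
    fix \<sigma> x assume \<sigma>: "\<sigma> \<in> W" and x: "x \<in> vecs (seg_rep n \<Psi>)"
    have "act E \<sigma> (h x) = (\<Sum>k<n. act E \<sigma> ((C ^^ k) (g (x k))))" unfolding h_def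
      using gx[OF x] lin_maps_closed[OF CnL] by (intro lin_maps_sum[OF E(1) act_lin_maps[OF E(1) \<sigma>]]) auto
    also have "\<dots> = h (act (seg_rep n \<Psi>) \<sigma> x)" unfolding h_def
    proof (rule sum.cong)
      fix k assume "k \<in> {..<n}"
      then have k: "k < n" "x k \<in> vecs \<Psi>" using x by auto
      have "act E \<sigma> ((C ^^ k) (g (x k))) = smul E (\<nu> \<sigma> ^ k) ((C ^^ k) (g (act \<Psi> \<sigma> (x k))))"
        using twn[OF \<sigma> gx[OF x k(1)]] gl(2)[OF \<sigma> k(2)] by simp
      also have "\<dots> = (C ^^ k) (g (smul \<Psi> (\<nu> \<sigma> ^ k) (act \<Psi> \<sigma> (x k))))"
        using lin_maps_smul[OF gl(1) act_closed[OF p(2) \<sigma> k(2)]] lin_maps_smul[OF CnL lin_maps_closed[OF gl(1) act_closed[OF p(2) \<sigma> k(2)]]] by simp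
      finally show "act E \<sigma> ((C ^^ k) (g (x k))) = (C ^^ k) (g (act (seg_rep n \<Psi>) \<sigma> x k))" by simp
    qed simp
    finally show "h (act (seg_rep n \<Psi>) \<sigma> x) = act E \<sigma> (h x)" by simp
  qed
  have hc: "h (cycle_op n I x) = C (h x)" if x: "x \<in> vecs (seg_rep n \<Psi>)" for x
  proof -
    obtain n' where n': "n = Suc n'" using n by (cases n) auto
    have "C (h x) = (\<Sum>k<n. C ((C ^^ k) (g (x k))))" unfolding h_def
      using gx[OF x] lin_maps_closed[OF CnL] by (intro lin_maps_sum[OF E(1) CL]) auto
    also have "\<dots> = (C ^^ n) (g (x n')) + (\<Sum>k<n'. (C ^^ Suc k) (g (x k)))" unfolding n' by (simp add: add.commute)
    also have "(C ^^ n) (g (x n')) = g (I (x n'))" using x n' by (intro gI) simp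
    also have "g (I (x n')) + (\<Sum>k<n'. (C ^^ Suc k) (g (x k))) = h (cycle_op n I x)"
      unfolding h_def n' by (subst sum.lessThan_Suc_shift) (simp add: cycle_op_def)
    finally show ?thesis by simp
  qed
  have s1: "single 0 x1 \<in> vecs (seg_rep n \<Psi>)" using x1(1) n vecs_0[OF p(2)] by (simp add: single_def)
  have "g 0 = 0" by (rule lin_maps_0[OF p(2) gl(1)])
  then have "(C ^^ k) (g (single 0 x1 k)) = (if k = 0 then g x1 else 0)" for k
    using lin_maps_0[OF E(1) CnL] by (simp add: single_def)
  then have h1: "h (single 0 x1) = g x1" unfolding h_def using n by simp
  have I': "I \<in> rep_isos v (twist v (int (orbit_card v \<Psi>)) \<Psi>) \<Psi>" using I unfolding n_def .
  have "h \<in> rep_isos v (seg_rep n \<Psi>) E"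
  proof (rule irred_hom_iso[where U = "cycle_op n I" and U' = C and x = "single 0 x1"])
    show "cycle_op n I \<in> lin_maps (seg_rep n \<Psi>) (seg_rep n \<Psi>)"
      using dop_cycle[OF p(2) I n] unfolding dop_def by blast
    show "op_irred (seg_rep n \<Psi>) (cycle_op n I)"
      using cycle_irred[OF \<Psi> I'] unfolding n_def .
    show "h (single 0 x1) \<noteq> 0" using h1 x1(2) by simp
  qed (fact pre_rep_seg_rep[OF p(2)] E(1) CL irr h hc s1)+
  then have "deligne_iso v (cycle v \<Psi> I) (E, C)" unfolding cycle_eq deligne_iso.simps n_def[symmetric]
    using hc by blast
  then show ?thesis using I' by blast
qed

text \<open>Scaling slot \<open>i\<close> by \<open>c ^ i\<close> multiplies the shift by
  \<open>c\<close>, so the factor relating \<open>C\<close> and \<open>C'\<close> becomes a factor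
  of the whole operator. For zero operators this exhibits a segment as isomorphic to its
  rescalings.\<close>

lemma seg_iso_scaled:
  assumes A: "pre_rep A" "C \<in> lin_maps A A" and B: "pre_rep B" "C' \<in> lin_maps B B" and r: "r \<ge> 1" and c: "c \<noteq> 0"
    and f: "f \<in> rep_isos v A B" "\<And>x. x \<in> vecs A \<Longrightarrow> f (C x) = smul B c (C' (f x))"
  shows "deligne_iso v (seg_rep r A, seg_op r C) (seg_rep r B, \<lambda>x. smul (seg_rep r B) c (seg_op r C' x))"
proof -
  interpret LA: linear_space "smul A" by (rule pre_rep_space[OF A(1)])
  interpret LB: linear_space "smul B" by (rule pre_rep_space[OF B(1)])
  note f' = rep_isosD[OF f(1)]
  have f0: "f 0 = 0" by (rule lin_maps_0[OF A(1) f'(2)])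
  define F where "F x i = smul B (c ^ i) (f (x i))" for x i
  have xi: "x i \<in> vecs A" if "x \<in> vecs (seg_rep r A)" for x i using that vecs_0[OF A(1)] by (cases "i < r") auto
  have F: "F \<in> rep_hom v (seg_rep r A) (seg_rep r B)"
  proof (rule rep_homI)
    fix x assume x: "x \<in> vecs (seg_rep r A)"
    show "F x \<in> vecs (seg_rep r B)" using x lin_maps_closed[OF f'(2)] vecs_smul[OF B(1)] f0 by (simp add: F_def)
    fix y assume y: "y \<in> vecs (seg_rep r A)"
    show "F (x + y) = F x + F y" using lin_maps_add[OF f'(2) xi[OF x] xi[OF y]] by (simp add: F_def fun_eq_iff LB.scale_right_distrib)
  next
    fix b x assume x: "x \<in> vecs (seg_rep r A)"
    show "F (smul (seg_rep r A) b x) = smul (seg_rep r B) b (F x)"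
      using lin_maps_smul[OF f'(2) xi[OF x]] by (simp add: F_def fun_eq_iff mult.commute)
  next
    fix \<sigma> x assume \<sigma>: "\<sigma> \<in> W" and x: "x \<in> vecs (seg_rep r A)"
    show "F (act (seg_rep r A) \<sigma> x) = act (seg_rep r B) \<sigma> (F x)"
      using lin_maps_smul[OF f'(2) act_closed[OF A(1) \<sigma> xi[OF x]]] f'(4)[OF \<sigma> xi[OF x]]
        lin_maps_smul[OF act_lin_maps[OF B(1) \<sigma>] lin_maps_closed[OF f'(2) xi[OF x]]]
      by (simp add: F_def fun_eq_iff mult.commute)
  qed
  have "F \<in> rep_isos v (seg_rep r A) (seg_rep r B)"
  proof (rule rep_isosI[OF pre_rep_seg_rep[OF A(1)] F])
    fix x assume x: "x \<in> vecs (seg_rep r A)" "F x = 0"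
    have "x i = 0" for i
    proof -
      have "f (x i) = 0" using fun_cong[OF x(2), of i] c by (simp add: F_def)
      then show ?thesis using rep_isos_inj[OF f(1) xi[OF x(1)] vecs_0[OF A(1)]] f0 by simp
    qed
    then show "x = 0" by (simp add: fun_eq_iff)
  next
    fix y assume y: "y \<in> vecs (seg_rep r B)"
    define g where "g = inv_into (vecs A) f"
    have g: "g z \<in> vecs A" "f (g z) = z" if "z \<in> vecs B" for z
      using lin_maps_closed[OF rep_isosD(2)[OF rep_isos_inv[OF A(1) f(1)]] that] bij_betw_inv_into_right[OF f'(3) that] unfolding g_def by auto
    define x where "x i = (if i < r then g (smul B (inverse (c ^ i)) (y i)) else 0)" for i
    have "x \<in> vecs (seg_rep r A)" using y g(1) vecs_smul[OF B(1)] by (simp add: x_def)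
    moreover have "y = F x" using y g(2)[OF vecs_smul[OF B(1)]] c f0 by (auto simp: F_def x_def fun_eq_iff)
    ultimately show "\<exists>x\<in>vecs (seg_rep r A). y = F x" by blast
  qed
  moreover have "F (seg_op r C x) = smul (seg_rep r B) c (seg_op r C' (F x))" if x: "x \<in> vecs (seg_rep r A)" for x
  proof
    fix i
    have Cx: "C (x i) \<in> vecs A" for i by (rule lin_maps_closed[OF A(2) xi[OF x]])
    have fx: "f (x i) \<in> vecs B" for i by (rule lin_maps_closed[OF f'(2) xi[OF x]])
    show "F (seg_op r C x) i = smul (seg_rep r B) c (seg_op r C' (F x)) i"
      using lin_maps_add[OF f'(2) Cx xi[OF x]] f(2)[OF xi[OF x]] lin_maps_smul[OF B(2) fx] f0 r
      by (cases i) (auto simp: F_def seg_op_def LB.scale_right_distrib mult.commute)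
  qed
  ultimately show ?thesis unfolding deligne_iso.simps by blast
qed

end

section \<open>The classification\<close>

context weil_coeffs
begin

text \<open>Common ground of the two cases: (\<Psi>, 0) and C(\<Psi>, I) are both of this kind, and
  their tensor products with segments are studied together.\<close>

definition simple_pair :: "('f, 'k, 'v::ab_group_add) weil_rep \<Rightarrow> ('v \<Rightarrow> 'v) \<Rightarrow> bool" where
  "simple_pair E C \<longleftrightarrow> pre_rep E \<and> dop E C \<and> op_irred E C"

lemma simple_pairD:
  assumes "simple_pair E C"
  shows "pre_rep E" "dop E C" "C \<in> lin_maps E E" "op_irred E C" "vecs E \<noteq> {0}"
  using assms linear_space.irred_def[OF pre_rep_space, of E "insert C (actions E)" "vecs E"]
  by (simp_all add: simple_pair_def dop_def)

lemma simple_pair_zero: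
  assumes "irreducible_rep v \<Psi>"
  shows "simple_pair \<Psi> (\<lambda>x. 0)"
proof -
  note p = irreducible_repD[OF assms]
  interpret linear_space "smul \<Psi>" by (rule pre_rep_space[OF p(2)])
  have "dop \<Psi> (\<lambda>x. 0)" using vecs_0[OF p(2)] lin_maps_0[OF p(2) act_lin_maps[OF p(2)]] by (auto simp: dop_def lin_maps_def)
  moreover have "irred (insert (\<lambda>x. 0) (actions \<Psi>)) (vecs \<Psi>)"
    unfolding irred_def closed_under_insert[OF p(2)] using p(4,5) by blast
  ultimately show ?thesis using p(2) by (simp add: simple_pair_def)
qed

lemma simple_pair_cycle:
  assumes "irreducible_rep v \<Psi>" "I \<in> rep_isos v (twist v (int (orbit_card v \<Psi>)) \<Psi>) \<Psi>"
  shows "simple_pair (seg_rep (orbit_card v \<Psi>) \<Psi>) (cycle_op (orbit_card v \<Psi>) I)"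
  using cycle_irred[OF assms] dop_cycle[OF irreducible_repD(2)[OF assms(1)] assms(2) orbit_card(1)[OF irreducible_repD(1)[OF assms(1)]]]
    pre_rep_seg_rep[OF irreducible_repD(2)[OF assms(1)]] by (simp add: simple_pair_def)

lemma seg_iso_sym:
  assumes E: "pre_rep E" "C \<in> lin_maps E E" and r: "r \<ge> 1"
    and i: "deligne_iso v (seg_rep r E, seg_op r C) D"
  shows "deligne_iso v D (seg_rep r E, seg_op r C)"
proof -
  obtain A T where AT: "D = (A, T)" by (metis surj_pair)
  show ?thesis using i unfolding AT
    by (intro deligne_iso_sym[OF pre_rep_seg_rep[OF E(1)]] lin_maps_closed[OF seg_op_lin_maps[OF E r]])
qed

text \<open>Turns both type predicates into statements about tuples.\<close>

lemma deligne_iso_tensor_iff: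
  assumes E: "pre_rep E" "dop E C" and r: "r \<ge> 1"
  shows "deligne_iso v D (deligne_tensor (segment v r) (E, C)) \<longleftrightarrow> deligne_iso v D (seg_rep r E, seg_op r C)"
proof -
  have C: "C \<in> lin_maps E E" using E(2) by (simp add: dop_def)
  note i = seg_iso_tensor[OF E(1) C r]
  show ?thesis using deligne_iso_trans[OF _ i] deligne_iso_trans[OF _ seg_iso_sym[OF E(1) C r i]] by blast
qed

lemma nilpotent_type_iff:
  shows "nilpotent_type v \<Psi> r D \<longleftrightarrow> irreducible_rep v \<Psi> \<and> 1 \<le> r \<and> deligne_iso v D (seg_rep r \<Psi>, seg_op r (\<lambda>x. 0))"
  unfolding nilpotent_type_def of_rep_def
  using deligne_iso_tensor_iff simple_pairD[OF simple_pair_zero] by blast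

lemma cyclic_type_iff:
  shows "cyclic_type v \<Psi> r I D \<longleftrightarrow> irreducible_rep v \<Psi> \<and> 1 \<le> r \<and>
    I \<in> rep_isos v (twist v (int (orbit_card v \<Psi>)) \<Psi>) \<Psi> \<and>
    deligne_iso v D (seg_rep r (seg_rep (orbit_card v \<Psi>) \<Psi>), seg_op r (cycle_op (orbit_card v \<Psi>) I))"
  unfolding cyclic_type_def cycle_eq
  using deligne_iso_tensor_iff simple_pairD[OF simple_pair_cycle] by blast

lemma seg_iso:
  assumes A: "pre_rep A" "C \<in> lin_maps A A" and B: "pre_rep B" "C' \<in> lin_maps B B" and r: "r \<ge> 1"
    and f: "f \<in> rep_isos v A B" "\<And>x. x \<in> vecs A \<Longrightarrow> f (C x) = C' (f x)"
  shows "deligne_iso v (seg_rep r A, seg_op r C) (seg_rep r B, seg_op r C')"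
proof -
  interpret linear_space "smul B" by (rule pre_rep_space[OF B(1)])
  have "deligne_iso v (seg_rep r A, seg_op r C) (seg_rep r B, \<lambda>x. smul (seg_rep r B) 1 (seg_op r C' x))"
    using f(2) by (intro seg_iso_scaled[OF A B r _ f(1)]) auto
  then show ?thesis by simp
qed

text \<open>The decomposition into chains is read as a map \<Theta> from tuples over
  \<open>S\<close>. It carries the shift to \<open>N\<close>, the operator in each slot to
  \<open>C\<close>, and the twist of slot \<open>i\<close> to the scalar with which
  \<open>N ^^ i\<close> commutes past the group.\<close>

lemma indecomposable_structure:
  fixes \<Phi> :: "('f, 'k, 'v::ab_group_add) weil_rep"
  assumes ind: "indecomposable v (\<Phi>, U)" and ss: "semisimple_rep v \<Phi>"
  shows "\<exists>r (E :: ('f, 'k, 'v) weil_rep) C. r \<ge> 1 \<and> weil_rep v E \<and> simple_pair E C \<and>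
    linear_space.completely_reducible (smul E) (actions E) (vecs E) \<and>
    ((\<forall>x\<in>vecs E. C x = 0) \<or> (\<exists>\<mu>. \<mu> \<noteq> 0 \<and> (\<forall>x\<in>vecs E. (C ^^ (CHAR('k) - 1)) x = smul E \<mu> x))) \<and>
    deligne_iso v (\<Phi>, U) (seg_rep r E, seg_op r C)"
proof -
  have d: "weil_rep v \<Phi>" "dop \<Phi> U" "op_indecomp \<Phi> U"
    using ind unfolding indecomposable_iff deligne_rep_iff by auto
  have p: "pre_rep \<Phi>" "fin_dim \<Phi>" using d(1) weil_rep_iff by auto
  interpret linear_space_ac "smul \<Phi>" by (rule pre_rep_space_ac[OF p(1)])
  obtain B where B: "finite B" "vecs \<Phi> = span B" using p(2) unfolding fin_dim_def by blast
  have \<Gamma>: "endo (vecs \<Phi>) g" if "g \<in> actions \<Phi>" for g using that act_lin_maps[OF p(1)] endo_iff_lin_maps[OF p(1)] by auto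
  have aE: "endo (vecs \<Phi>) (act \<Phi> \<sigma>)" if "\<sigma> \<in> W" for \<sigma> using \<Gamma> that by blast
  have U: "endo (vecs \<Phi>) U" using d(2) endo_iff_lin_maps[OF p(1)] by (simp add: dop_def)
  have tw: "\<forall>x\<in>vecs \<Phi>. act \<Phi> \<sigma> (U x) = smul \<Phi> (\<nu> \<sigma>) (U (act \<Phi> \<sigma> x))" if "\<sigma> \<in> W" for \<sigma>
    using d(2) that by (simp add: dop_def)
  have quasi: "\<exists>c. c \<noteq> 0 \<and> c ^ CHAR('k) = c \<and> (\<forall>x\<in>vecs \<Phi>. g (U x) = smul \<Phi> c (U (g x)))" if "g \<in> actions \<Phi>" for g
    using that tw \<nu>_nonzero \<nu>_power_CHAR by blast
  obtain C N n S where C: "endo (vecs \<Phi>) C" and N: "endo (vecs \<Phi>) N" and UCN: "\<forall>x\<in>vecs \<Phi>. U x = C x + N x"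
    and CN: "\<forall>x\<in>vecs \<Phi>. C (N x) = N (C x)"
    and twCN: "\<forall>g\<in>actions \<Phi>. \<forall>c. c ^ CHAR('k) = c \<longrightarrow> (\<forall>x\<in>vecs \<Phi>. g (U x) = smul \<Phi> c (U (g x))) \<longrightarrow>
       (\<forall>x\<in>vecs \<Phi>. g (C x) = smul \<Phi> c (C (g x))) \<and> (\<forall>x\<in>vecs \<Phi>. g (N x) = smul \<Phi> c (N (g x)))"
    and Nn: "\<forall>x\<in>vecs \<Phi>. (N ^^ Suc n) x = 0"
    and S: "closed_under (insert C (actions \<Phi>)) (vecs \<Phi>) S" "irred (insert C (actions \<Phi>)) S"
    and surj: "\<forall>y\<in>vecs \<Phi>. \<exists>x. (\<forall>i. x i \<in> S) \<and> y = (\<Sum>i\<le>n. (N ^^ i) (x i))"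
    and inj: "\<forall>x. (\<forall>i. x i \<in> S) \<longrightarrow> (\<Sum>i\<le>n. (N ^^ i) (x i)) = 0 \<longrightarrow> (\<forall>i\<le>n. x i = 0)"
    and \<mu>: "(\<forall>x\<in>vecs \<Phi>. C x = 0) \<or> (\<exists>\<mu>. \<mu> \<noteq> 0 \<and> (\<forall>x\<in>vecs \<Phi>. (C ^^ (CHAR('k) - 1)) x = smul \<Phi> \<mu> x))"
    by (insert twisted_structure[OF pre_rep_subspace[OF p(1)] B \<Gamma> U quasi d(3) prime_CHAR semisimple_completely_reducible[OF ss]],
        drule meta_mp, assumption, drule meta_mp, assumption, elim exE conjE) (rule that; assumption)
  have twC: "act \<Phi> \<sigma> (C x) = smul \<Phi> (\<nu> \<sigma>) (C (act \<Phi> \<sigma> x))" and twN: "act \<Phi> \<sigma> (N x) = smul \<Phi> (\<nu> \<sigma>) (N (act \<Phi> \<sigma> x))"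
    if "\<sigma> \<in> W" "x \<in> vecs \<Phi>" for \<sigma> x
    using twCN that \<nu>_power_CHAR[OF that(1)] tw[OF that(1)] by blast+
  have st: "stable_subspace v \<Phi> S" and CS: "C ` S \<subseteq> S" using S(1) closed_under_insert[OF p(1)] by auto
  have SV: "lsub S" "S \<subseteq> vecs \<Phi>" using st by (auto simp: stable_subspace_def)
  have S0: "0 \<in> S" by (rule subspace_0[OF SV(1)])
  define E where "E = \<Phi>\<lparr>vecs := S\<rparr>"
  have E: "weil_rep v E" "pre_rep E" using weil_rep_restrict[OF d(1) st] weil_rep_pre_rep unfolding E_def by auto
  have Es: "vecs E = S" "smul E = smul \<Phi>" "act E = act \<Phi>" by (simp_all add: E_def)
  have "dop \<Phi> C" using C endo_iff_lin_maps[OF p(1)] twC by (simp add: dop_def)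
  then have dC: "dop E C" unfolding E_def by (rule dop_restrict[OF _ SV(2) CS])
  have sp: "simple_pair E C" unfolding simple_pair_def using E(2) dC S(2) by (simp add: Es)
  have cl: "closed_under (actions \<Phi>) (vecs \<Phi>) S" using st closed_under_actions[OF p(1)] by blast
  have cr: "completely_reducible (actions \<Phi>) S"
    by (rule completely_reducible_sub[OF semisimple_completely_reducible[OF ss] cl])
  define \<Theta> where "\<Theta> x = (\<Sum>i<Suc n. (N ^^ i) (x i))" for x
  have Nk: "N ^^ k \<in> lin_maps \<Phi> \<Phi>" for k using endo_funpow[OF N] endo_iff_lin_maps[OF p(1)] by blast
  have CL: "C \<in> lin_maps \<Phi> \<Phi>" using C endo_iff_lin_maps[OF p(1)] by blast
  have NL: "N \<in> lin_maps \<Phi> \<Phi>" using N endo_iff_lin_maps[OF p(1)] by blast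
  have xi: "x i \<in> S" "x i \<in> vecs \<Phi>" if "x \<in> vecs (seg_rep (Suc n) E)" for x i
    using that S0 SV(2) by (cases "i < Suc n"; auto simp: Es)+
  have \<Theta>: "\<Theta> \<in> rep_hom v (seg_rep (Suc n) E) \<Phi>"
  proof (rule rep_homI)
    fix x assume x: "x \<in> vecs (seg_rep (Suc n) E)"
    show "\<Theta> x \<in> vecs \<Phi>" unfolding \<Theta>_def
      by (intro subspace_sum[OF pre_rep_subspace[OF p(1)]] lin_maps_closed[OF Nk] xi(2)[OF x])
    fix y assume y: "y \<in> vecs (seg_rep (Suc n) E)"
    show "\<Theta> (x + y) = \<Theta> x + \<Theta> y" unfolding \<Theta>_def sum.distrib[symmetric]
      using lin_maps_add[OF Nk xi(2)[OF x] xi(2)[OF y]] by (intro sum.cong) auto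
  next
    fix b x assume x: "x \<in> vecs (seg_rep (Suc n) E)"
    show "\<Theta> (smul (seg_rep (Suc n) E) b x) = smul \<Phi> b (\<Theta> x)" unfolding \<Theta>_def scale_sum_right
      using lin_maps_smul[OF Nk xi(2)[OF x]] by (intro sum.cong) (auto simp: Es)
  next
    fix \<sigma> x assume \<sigma>: "\<sigma> \<in> W" and x: "x \<in> vecs (seg_rep (Suc n) E)"
    have "act \<Phi> \<sigma> (\<Theta> x) = (\<Sum>i<Suc n. act \<Phi> \<sigma> ((N ^^ i) (x i)))" unfolding \<Theta>_def
      by (intro lin_maps_sum[OF p(1) act_lin_maps[OF p(1) \<sigma>]] lin_maps_closed[OF Nk] xi(2)[OF x])
    also have "\<dots> = \<Theta> (act (seg_rep (Suc n) E) \<sigma> x)" unfolding \<Theta>_def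
    proof (rule sum.cong)
      fix i
      have "act \<Phi> \<sigma> ((N ^^ i) (x i)) = smul \<Phi> (\<nu> \<sigma> ^ i) ((N ^^ i) (act \<Phi> \<sigma> (x i)))"
        by (rule funpow_quasi_commute[OF aE[OF \<sigma>] N twN[OF \<sigma>] xi(2)[OF x]])
      then show "act \<Phi> \<sigma> ((N ^^ i) (x i)) = (N ^^ i) (act (seg_rep (Suc n) E) \<sigma> x i)"
        using lin_maps_smul[OF Nk act_closed[OF p(1) \<sigma> xi(2)[OF x]]] by (simp add: Es)
    qed simp
    finally show "\<Theta> (act (seg_rep (Suc n) E) \<sigma> x) = act \<Phi> \<sigma> (\<Theta> x)" by simp
  qed
  have "\<Theta> \<in> rep_isos v (seg_rep (Suc n) E) \<Phi>"
  proof (rule rep_isosI[OF pre_rep_seg_rep[OF E(2)] \<Theta>])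
    fix x assume x: "x \<in> vecs (seg_rep (Suc n) E)" "\<Theta> x = 0"
    have "\<forall>i\<le>n. x i = 0" using inj xi(1)[OF x(1)] x(2) unfolding \<Theta>_def lessThan_Suc_atMost by blast
    moreover have "\<forall>i\<ge>Suc n. x i = 0" using x(1) by simp
    ultimately show "x = 0" by (auto simp: fun_eq_iff not_le Suc_le_eq) (metis not_le)
  next
    fix y assume "y \<in> vecs \<Phi>"
    then obtain x where x: "\<forall>i. x i \<in> S" "y = (\<Sum>i\<le>n. (N ^^ i) (x i))" using surj by blast
    define x' where "x' = (\<lambda>i. if i < Suc n then x i else 0)"
    have "x' \<in> vecs (seg_rep (Suc n) E)" using x(1) by (simp add: x'_def Es)
    moreover have "y = \<Theta> x'" unfolding x(2) \<Theta>_def lessThan_Suc_atMost by (intro sum.cong) (auto simp: x'_def)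
    ultimately show "\<exists>x\<in>vecs (seg_rep (Suc n) E). y = \<Theta> x" by blast
  qed
  moreover have "\<Theta> (seg_op (Suc n) C x) = U (\<Theta> x)" if x: "x \<in> vecs (seg_rep (Suc n) E)" for x
  proof -
    have cx: "C (x i) \<in> vecs \<Phi>" for i by (rule lin_maps_closed[OF CL xi(2)[OF x]])
    have "C ((N ^^ i) (x i)) = smul \<Phi> (1 ^ i) ((N ^^ i) (C (x i)))" for i
      by (rule funpow_quasi_commute[OF C N _ xi(2)[OF x]]) (use CN in simp)
    then have CNi: "C ((N ^^ i) (x i)) = (N ^^ i) (C (x i))" for i by simp
    have "\<Theta> x \<in> vecs \<Phi>" using lin_maps_closed[OF rep_homD(1)[OF \<Theta>] x] .
    then have "U (\<Theta> x) = C (\<Theta> x) + N (\<Theta> x)" using UCN by blast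
    also have "C (\<Theta> x) = (\<Sum>i<Suc n. (N ^^ i) (C (x i)))" unfolding \<Theta>_def CNi[symmetric]
      by (intro lin_maps_sum[OF p(1) CL] lin_maps_closed[OF Nk] xi(2)[OF x])
    also have "N (\<Theta> x) = (\<Sum>i<Suc n. N ((N ^^ i) (x i)))" unfolding \<Theta>_def
      by (intro lin_maps_sum[OF p(1) NL] lin_maps_closed[OF Nk] xi(2)[OF x])
    \<comment> \<open>The top term is zero because \<open>N ^^ Suc n\<close> is, just as the shift
      drops the last slot.\<close>
    also have "\<dots> = (\<Sum>i<n. (N ^^ Suc i) (x i))" using Nn xi(2)[OF x] by simp
    also have "\<dots> = (\<Sum>i<Suc n. if i = 0 then 0 else (N ^^ i) (x (i - 1)))" by (subst sum.lessThan_Suc_shift) simp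
    also have "(\<Sum>i<Suc n. (N ^^ i) (C (x i))) + (\<Sum>i<Suc n. if i = 0 then 0 else (N ^^ i) (x (i - 1))) = \<Theta> (seg_op (Suc n) C x)"
      unfolding \<Theta>_def sum.distrib[symmetric]
    proof (rule sum.cong)
      fix i assume "i \<in> {..<Suc n}"
      then show "(N ^^ i) (C (x i)) + (if i = 0 then 0 else (N ^^ i) (x (i - 1))) = (N ^^ i) (seg_op (Suc n) C x i)"
        using lin_maps_add[OF Nk cx xi(2)[OF x]] by (simp add: seg_op_def)
    qed simp
    finally show ?thesis by simp
  qed
  ultimately have "deligne_iso v (seg_rep (Suc n) E, seg_op (Suc n) C) (\<Phi>, U)" unfolding deligne_iso.simps by blast
  then have "deligne_iso v (\<Phi>, U) (seg_rep (Suc n) E, seg_op (Suc n) C)"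
    using simple_pairD[OF sp] by (intro deligne_iso_sym[OF pre_rep_seg_rep lin_maps_closed[OF seg_op_lin_maps]]) auto
  moreover have "(\<forall>x\<in>vecs E. C x = 0) \<or> (\<exists>\<mu>. \<mu> \<noteq> 0 \<and> (\<forall>x\<in>vecs E. (C ^^ (CHAR('k) - 1)) x = smul E \<mu> x))"
    using \<mu> SV(2) by (auto simp: Es)
  moreover have "linear_space.completely_reducible (smul E) (actions E) (vecs E)" using cr by (simp add: Es)
  ultimately show ?thesis using E(1) sp by (intro exI[of _ "Suc n"] exI[of _ E] exI[of _ C]) simp
qed

text \<open>If \<open>C\<close> vanishes, stability under it is automatic, so \<open>E\<close> is
  irreducible for the Weil group. Otherwise complete reducibility provides an irreducible
  subrepresentation of \<open>E\<close>, whose inclusion is fed to \<open>cycle_recognition\<close>.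
  In both cases \<Psi> lives in the ambient type of \<Phi>.\<close>

lemma type_exists:
  fixes \<Phi> :: "('f, 'k, 'v::ab_group_add) weil_rep"
  assumes ind: "indecomposable v (\<Phi>, U)" and ss: "semisimple_rep v \<Phi>"
  shows "\<exists>(\<Psi> :: ('f, 'k, 'v) weil_rep) r. nilpotent_type v \<Psi> r (\<Phi>, U) \<or> (\<exists>I. cyclic_type v \<Psi> r I (\<Phi>, U))"
proof -
  obtain r C and E :: "('f, 'k, 'v) weil_rep" where r: "r \<ge> 1" and E: "weil_rep v E" and sp: "simple_pair E C"
    and cr: "linear_space.completely_reducible (smul E) (actions E) (vecs E)"
    and \<mu>: "(\<forall>x\<in>vecs E. C x = 0) \<or> (\<exists>\<mu>. \<mu> \<noteq> 0 \<and> (\<forall>x\<in>vecs E. (C ^^ (CHAR('k) - 1)) x = smul E \<mu> x))"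
    and i: "deligne_iso v (\<Phi>, U) (seg_rep r E, seg_op r C)"
    using indecomposable_structure[OF assms] by (elim exE conjE) (rule that)
  note sp' = simple_pairD[OF sp]
  interpret linear_space "smul E" by (rule pre_rep_space[OF sp'(1)])
  from \<mu> show ?thesis
  proof
    assume C0: "\<forall>x\<in>vecs E. C x = 0"
    have "irred (actions E) (vecs E)" unfolding irred_def closed_under_actions[OF sp'(1)]
    proof (intro conjI allI impI)
      fix S assume S: "stable_subspace v E S"
      then have "lsub S" "S \<subseteq> vecs E" by (auto simp: stable_subspace_def)
      then have "C ` S \<subseteq> S" using C0 subspace_0 by auto
      then show "S = {0} \<or> S = vecs E" using S sp'(4) unfolding irred_def closed_under_insert[OF sp'(1)] by blast
    qed (rule sp'(5))
    then have irr: "irreducible_rep v E" using E irreducible_rep_iff by blast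
    have "deligne_iso v (seg_rep r E, seg_op r C) (seg_rep r E, seg_op r (\<lambda>x. 0))"
      by (rule seg_iso[OF sp'(1,3) sp'(1) simple_pairD(3)[OF simple_pair_zero[OF irr]] r rep_isos_ident]) (use C0 in simp)
    then have "nilpotent_type v E r (\<Phi>, U)" unfolding nilpotent_type_iff using irr r i deligne_iso_trans by blast
    then show ?thesis by blast
  next
    assume "\<exists>\<mu>. \<mu> \<noteq> 0 \<and> (\<forall>x\<in>vecs E. (C ^^ (CHAR('k) - 1)) x = smul E \<mu> x)"
    then obtain \<mu> where \<mu>: "\<mu> \<noteq> 0" "\<And>x. x \<in> vecs E \<Longrightarrow> (C ^^ (CHAR('k) - 1)) x = smul E \<mu> x" by blast
    have \<Gamma>: "endo (vecs E) g" if "g \<in> actions E" for g using that act_lin_maps[OF sp'(1)] endo_iff_lin_maps[OF sp'(1)] by auto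
    have z: "closed_under (actions E) (vecs E) {0}"
      using vecs_0[OF sp'(1)] endo_0[OF \<Gamma> pre_rep_subspace[OF sp'(1)]] by (auto simp: closed_under_def)
    obtain S where S: "closed_under (actions E) (vecs E) S" "irred (actions E) S"
      using exists_irred[OF \<Gamma> pre_rep_subspace[OF sp'(1)] cr z sp'(5)[symmetric]] by blast
    have st: "stable_subspace v E S" using S(1) closed_under_actions[OF sp'(1)] by blast
    define \<Psi> where "\<Psi> = E\<lparr>vecs := S\<rparr>"
    have \<Psi>: "irreducible_rep v \<Psi>" unfolding irreducible_rep_iff
      using weil_rep_restrict[OF E st] S(2) by (simp add: \<Psi>_def)
    have hom: "(\<lambda>x. x) \<in> rep_hom v \<Psi> E" using closed_under_subset[OF S(1)] by (auto simp: rep_hom_def lin_maps_def \<Psi>_def)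
    obtain x where x: "x \<in> vecs \<Psi>" "x \<noteq> 0" using irreducible_repD(2,4)[OF \<Psi>] vecs_0 by blast
    obtain I where I: "I \<in> rep_isos v (twist v (int (orbit_card v \<Psi>)) \<Psi>) \<Psi>" "deligne_iso v (cycle v \<Psi> I) (E, C)"
      using cycle_recognition[OF \<Psi> sp'(1,2,4) \<mu> hom x] by blast
    note sc = simple_pairD[OF simple_pair_cycle[OF \<Psi> I(1)]]
    obtain f where "f \<in> rep_isos v (seg_rep (orbit_card v \<Psi>) \<Psi>) E"
      "\<forall>x\<in>vecs (seg_rep (orbit_card v \<Psi>) \<Psi>). f (cycle_op (orbit_card v \<Psi>) I x) = C (f x)"
      using I(2) unfolding cycle_eq deligne_iso.simps by blast
    then have "deligne_iso v (seg_rep r (seg_rep (orbit_card v \<Psi>) \<Psi>), seg_op r (cycle_op (orbit_card v \<Psi>) I)) (seg_rep r E, seg_op r C)"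
      by (intro seg_iso[OF sc(1,3) sp'(1,3) r]) blast+
    then have "deligne_iso v (seg_rep r E, seg_op r C) (seg_rep r (seg_rep (orbit_card v \<Psi>) \<Psi>), seg_op r (cycle_op (orbit_card v \<Psi>) I))"
      by (rule seg_iso_sym[OF sc(1,3) r])
    then have "cyclic_type v \<Psi> r I (\<Phi>, U)" unfolding cyclic_type_iff using \<Psi> r I(1) i deligne_iso_trans by blast
    then show ?thesis by blast
  qed
qed

end

lemma CHAR_mod_ring: "CHAR('l::prime_card mod_ring) = CARD('l)"
  by (rule CHAR_eqI) (simp, rule of_nat_0_mod_ring_dvd)

section \<open>Equivalence classes and uniqueness\<close>

context weil_coeffs
begin

lemma indecomposable_pre_rep:
  assumes "indecomposable v (\<Phi>, U)"
  shows "deligne_rep v (\<Phi>, U)" "pre_rep \<Phi>" "\<And>x. x \<in> vecs \<Phi> \<Longrightarrow> U x \<in> vecs \<Phi>" "vector_space (smul \<Phi>)"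
proof -
  show d: "deligne_rep v (\<Phi>, U)" using assms by (simp add: indecomposable_def)
  then show p: "pre_rep \<Phi>" unfolding deligne_rep_iff by (simp add: weil_rep_pre_rep)
  show "U x \<in> vecs \<Phi>" if "x \<in> vecs \<Phi>" for x using d that lin_maps_closed unfolding deligne_rep_iff dop_def by blast
  show "vector_space (smul \<Phi>)" using p by (simp add: pre_rep_def)
qed

lemma deligne_iso_scale:
  fixes \<Phi> :: "('f, 'k, _) weil_rep" and \<Phi>' :: "('f, 'k, _) weil_rep"
  assumes "\<And>x. x \<in> vecs \<Phi> \<Longrightarrow> U x \<in> vecs \<Phi>" "deligne_iso v (\<Phi>, U) (\<Phi>', U')"
  shows "deligne_iso v (\<Phi>, \<lambda>x. smul \<Phi> c (U x)) (\<Phi>', \<lambda>x. smul \<Phi>' c (U' x))"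
proof -
  obtain f where f: "f \<in> rep_isos v \<Phi> \<Phi>'" "\<forall>x\<in>vecs \<Phi>. f (U x) = U' (f x)" using assms(2) by auto
  have "\<forall>x\<in>vecs \<Phi>. f (smul \<Phi> c (U x)) = smul \<Phi>' c (U' (f x))"
    using lin_maps_smul[OF rep_isosD(2)[OF f(1)] assms(1)] f(2) by simp
  then show ?thesis unfolding deligne_iso.simps using f(1) by blast
qed

lemma indecomposable_scale:
  fixes \<Phi> :: "('f, 'k, _) weil_rep"
  assumes ind: "indecomposable v (\<Phi>, U)" and c: "c \<noteq> 0"
  shows "indecomposable v (\<Phi>, \<lambda>x. smul \<Phi> c (U x))"
proof -
  have d: "weil_rep v \<Phi>" "dop \<Phi> U" "op_indecomp \<Phi> U"
    using ind unfolding indecomposable_iff deligne_rep_iff by auto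
  have p: "pre_rep \<Phi>" by (rule weil_rep_pre_rep[OF d(1)])
  interpret linear_space "smul \<Phi>" by (rule pre_rep_space[OF p])
  have eq: "(\<lambda>x. smul \<Phi> c (U x)) ` S \<subseteq> S \<longleftrightarrow> U ` S \<subseteq> S" if S: "lsub S" for S
  proof
    show "U ` S \<subseteq> S" if h: "(\<lambda>x. smul \<Phi> c (U x)) ` S \<subseteq> S"
    proof
      fix y assume "y \<in> U ` S"
      then obtain x where x: "x \<in> S" "y = U x" by blast
      then have "smul \<Phi> c (U x) \<in> S" using h by blast
      then have "smul \<Phi> (inverse c) (smul \<Phi> c (U x)) \<in> S" by (rule subspace_scale[OF S])
      then show "y \<in> S" using c x(2) by simp
    qed
  qed (use subspace_scale[OF S] in blast)
  have "closed_under (insert (\<lambda>x. smul \<Phi> c (U x)) (actions \<Phi>)) (vecs \<Phi>) S \<longleftrightarrow>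
      closed_under (insert U (actions \<Phi>)) (vecs \<Phi>) S" for S
    unfolding closed_under_insert[OF p] stable_subspace_def by (cases "lsub S") (simp_all add: eq)
  then have "indecomp (insert (\<lambda>x. smul \<Phi> c (U x)) (actions \<Phi>)) (vecs \<Phi>)" using d(3) unfolding indecomp_def by simp
  moreover have "dop \<Phi> (\<lambda>x. smul \<Phi> c (U x))"
  proof -
    have UL: "U \<in> lin_maps \<Phi> \<Phi>" using d(2) by (simp add: dop_def)
    then have "(\<lambda>x. smul \<Phi> c (U x)) \<in> lin_maps \<Phi> \<Phi>"
      using vecs_smul[OF p] by (auto simp: lin_maps_def scale_right_distrib mult.commute Pi_iff)
    moreover have "act \<Phi> \<sigma> (smul \<Phi> c (U x)) = smul \<Phi> (\<nu> \<sigma>) (smul \<Phi> c (U (act \<Phi> \<sigma> x)))"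
      if "\<sigma> \<in> W" "x \<in> vecs \<Phi>" for \<sigma> x
      using lin_maps_smul[OF act_lin_maps[OF p that(1)] lin_maps_closed[OF UL that(2)]] d(2) that by (simp add: dop_def mult.commute)
    ultimately show ?thesis by (simp add: dop_def)
  qed
  ultimately show ?thesis unfolding indecomposable_iff deligne_rep_iff using d(1) by blast
qed

lemma deligne_equiv_refl:
  fixes \<Phi> :: "('f, 'k, _) weil_rep"
  assumes "indecomposable v (\<Phi>, U)" "semisimple_rep v \<Phi>"
  shows "deligne_equiv v (\<Phi>, U) (\<Phi>, U)"
proof -
  interpret vector_space "smul \<Phi>" by (rule indecomposable_pre_rep(4)[OF assms(1)])
  have "deligne_iso v (\<Phi>, U) (\<Phi>, \<lambda>x. smul \<Phi> 1 (U x))" using deligne_iso_refl by simp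
  then show ?thesis using assms unfolding deligne_equiv.simps weil_semisimple.simps by (metis one_neq_zero)
qed

text \<open>The scalars of two equivalences are multiplied or divided. The members of the classes
  may live in a third ambient type.\<close>

lemma equiv_class_eq:
  fixes \<Phi> :: "('f, 'k, 'v::ab_group_add) weil_rep" and \<Phi>' :: "('f, 'k, 'w::ab_group_add) weil_rep"
  assumes e: "deligne_equiv v (\<Phi>, U) (\<Phi>', U')"
  shows "(equiv_class v (\<Phi>, U) :: ('f, 'k, 'u::ab_group_add) deligne set) = equiv_class v (\<Phi>', U')"
proof -
  obtain c where c: "c \<noteq> 0" "deligne_iso v (\<Phi>', U') (\<Phi>, \<lambda>x. smul \<Phi> c (U x))" using e by auto
  have i: "indecomposable v (\<Phi>, U)" "weil_semisimple v (\<Phi>, U)" "indecomposable v (\<Phi>', U')" "weil_semisimple v (\<Phi>', U')"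
    using e by auto
  note q = indecomposable_pre_rep[OF i(1)] indecomposable_pre_rep[OF i(3)]
  interpret A: vector_space "smul \<Phi>" by (rule q(4))
  have s: "deligne_iso v (\<Phi>, \<lambda>x. smul \<Phi> c (U x)) (\<Phi>', U')" by (rule deligne_iso_sym[OF q(6,7) c(2)])
  have "deligne_equiv v (\<Phi>, U) D \<longleftrightarrow> deligne_equiv v (\<Phi>', U') D" for D :: "('f, 'k, 'u) deligne"
  proof -
    obtain \<Phi>'' U'' where D: "D = (\<Phi>'', U'')" by (metis surj_pair)
    have "\<exists>d. d \<noteq> 0 \<and> deligne_iso v D (\<Phi>', \<lambda>x. smul \<Phi>' d (U' x))"
      if d: "d \<noteq> 0" "deligne_iso v D (\<Phi>, \<lambda>x. smul \<Phi> d (U x))" for d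
    proof -
      have "deligne_iso v (\<Phi>, \<lambda>x. smul \<Phi> (d / c) (smul \<Phi> c (U x))) (\<Phi>', \<lambda>x. smul \<Phi>' (d / c) (U' x))"
        by (rule deligne_iso_scale[OF _ s]) (use vecs_smul[OF q(2)] q(3) in blast)
      moreover have "(\<lambda>x. smul \<Phi> (d / c) (smul \<Phi> c (U x))) = (\<lambda>x. smul \<Phi> d (U x))" using c(1) by simp
      ultimately have "deligne_iso v (\<Phi>, \<lambda>x. smul \<Phi> d (U x)) (\<Phi>', \<lambda>x. smul \<Phi>' (d / c) (U' x))" by metis
      then have "deligne_iso v D (\<Phi>', \<lambda>x. smul \<Phi>' (d / c) (U' x))" by (rule deligne_iso_trans[OF d(2)])
      then show ?thesis using d(1) c(1) by (intro exI[of _ "d / c"]) simp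
    qed
    moreover have "\<exists>d. d \<noteq> 0 \<and> deligne_iso v D (\<Phi>, \<lambda>x. smul \<Phi> d (U x))"
      if d: "d \<noteq> 0" "deligne_iso v D (\<Phi>', \<lambda>x. smul \<Phi>' d (U' x))" for d
    proof -
      have "deligne_iso v (\<Phi>', \<lambda>x. smul \<Phi>' d (U' x)) (\<Phi>, \<lambda>x. smul \<Phi> d (smul \<Phi> c (U x)))"
        by (rule deligne_iso_scale[OF q(7) c(2)])
      from deligne_iso_trans[OF d(2) this] have "deligne_iso v D (\<Phi>, \<lambda>x. smul \<Phi> (d * c) (U x))" by simp
      then show ?thesis using d(1) c(1) by (intro exI[of _ "d * c"]) simp
    qed
    ultimately show ?thesis using i unfolding D deligne_equiv.simps by blast
  qed
  then show ?thesis unfolding equiv_class_def by (rule Collect_cong)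
qed

text \<open>The tuples with vanishing slot 0 are stable under the group and the operator; for r > 1
  they form a proper nonzero subspace.\<close>

lemma seg_irred_iff:
  fixes E :: "('f, 'k, 'v::ab_group_add) weil_rep"
  assumes sp: "simple_pair E C" and r: "r \<ge> 1"
  shows "op_irred (seg_rep r E) (seg_op r C) \<longleftrightarrow> r = 1"
proof -
  note p = simple_pairD[OF sp]
  note ps = pre_rep_seg_rep[OF p(1), of r]
  interpret L: linear_space "smul E" by (rule pre_rep_space[OF p(1)])
  interpret linear_space "smul (seg_rep r E)" by (rule pre_rep_space[OF ps])
  show ?thesis
  proof
    assume irr: "irred (insert (seg_op r C) (actions (seg_rep r E))) (vecs (seg_rep r E))"
    define S where "S = {x \<in> vecs (seg_rep r E). x 0 = 0}"
    have "lsub S" unfolding S_def using vecs_0[OF ps] vecs_add[OF ps] vecs_smul[OF ps]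
      by (intro subspaceI) auto
    then have "stable_subspace v (seg_rep r E) S" unfolding stable_subspace_def
      using act_closed[OF ps] lin_maps_0[OF p(1) act_lin_maps[OF p(1)]] by (auto simp: S_def simp del: seg_rep_simps(1))
    moreover have "seg_op r C ` S \<subseteq> S"
    proof (rule image_subsetI)
      fix x assume "x \<in> S"
      then have x: "x \<in> vecs (seg_rep r E)" "x 0 = 0" unfolding S_def by auto
      have "seg_op r C x 0 = 0" using x(2) lin_maps_0[OF p(1,3)] by (simp add: seg_op_def)
      then show "seg_op r C x \<in> S" using lin_maps_closed[OF seg_op_lin_maps[OF p(1,3) r] x(1)] unfolding S_def by blast
    qed
    ultimately have alt: "S = {0} \<or> S = vecs (seg_rep r E)" using irr unfolding irred_def closed_under_insert[OF ps] by blast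
    obtain y where y: "y \<in> vecs E" "y \<noteq> 0" using p(5) vecs_0[OF p(1)] by blast
    show "r = 1"
    proof (rule ccontr)
      assume "r \<noteq> 1"
      then have "single 1 y \<in> S" using y r vecs_0[OF p(1)] by (auto simp: S_def single_def)
      moreover have "single 1 y \<noteq> 0" "single 0 y \<noteq> 0" using y by (auto simp: single_def fun_eq_iff)
      moreover have "single 0 y \<in> vecs (seg_rep r E)" "single 0 y \<notin> S" using y r vecs_0[OF p(1)] by (auto simp: S_def single_def)
      ultimately show False using alt by blast
    qed
  next
    assume r1: "r = 1"
    have h: "single 0 \<in> rep_hom v E (seg_rep 1 E)"
      using vecs_0[OF p(1)] by (auto simp: rep_hom_def lin_maps_def single_def fun_eq_iff lin_maps_0[OF p(1) act_lin_maps[OF p(1)]])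
    have "single 0 \<in> rep_isos v E (seg_rep 1 E)"
    proof (rule rep_isosI[OF p(1) h])
      show "x = 0" if "single 0 x = 0" for x :: 'v using fun_cong[OF that, of 0] by (simp add: single_def)
      show "\<exists>x\<in>vecs E. y = single 0 x" if "y \<in> vecs (seg_rep 1 E)" for y
        using that by (intro bexI[of _ "y 0"]) (auto simp: single_def fun_eq_iff)
    qed
    then show "irred (insert (seg_op r C) (actions (seg_rep r E))) (vecs (seg_rep r E))"
      unfolding r1 by (rule irred_iso[OF p(1,2) ps[unfolded r1] _ _ p(4)]) (simp add: single_def seg_op_def fun_eq_iff)
  qed
qed

lemma deligne_irreducible_iff_length:
  assumes d: "deligne_rep v (\<Phi>, U)" and sp: "simple_pair E C" and r: "r \<ge> 1"
    and i: "deligne_iso v (\<Phi>, U) (seg_rep r E, seg_op r C)"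
  shows "deligne_irreducible v (\<Phi>, U) \<longleftrightarrow> r = 1"
proof -
  note p = simple_pairD[OF sp]
  note ps = pre_rep_seg_rep[OF p(1), of r]
  have q: "pre_rep \<Phi>" "dop \<Phi> U" using d weil_rep_pre_rep unfolding deligne_rep_iff by auto
  have UV: "U x \<in> vecs \<Phi>" if "x \<in> vecs \<Phi>" for x using q(2) that lin_maps_closed unfolding dop_def by blast
  obtain f where f: "f \<in> rep_isos v \<Phi> (seg_rep r E)" "\<forall>x\<in>vecs \<Phi>. f (U x) = seg_op r C (f x)"
    using i unfolding deligne_iso.simps by blast
  obtain g where g: "g \<in> rep_isos v (seg_rep r E) \<Phi>" "\<forall>x\<in>vecs (seg_rep r E). g (seg_op r C x) = U (g x)"
    using deligne_iso_sym[OF q(1) UV i] unfolding deligne_iso.simps by blast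
  have "op_irred \<Phi> U \<longleftrightarrow>
    op_irred (seg_rep r E) (seg_op r C)"
    using irred_iso[OF q ps f(1), of "seg_op r C"] irred_iso[OF ps dop_seg[OF p(1,2) r] q(1) g(1), of U] f(2) g(2) by blast
  then show ?thesis unfolding deligne_irreducible_iff seg_irred_iff[OF sp r] using d by blast
qed

text \<open>In the kernel, the slots vanish one after another from slot 0 on, since the shift into a
  slot comes from the one before.\<close>

lemma seg_op_inj:
  assumes C: "\<And>y. y \<in> vecs E \<Longrightarrow> C y = 0 \<Longrightarrow> y = 0" and x: "x \<in> vecs (seg_rep r E)" "seg_op r C x = 0"
  shows "x = 0"
proof -
  have "i < r \<longrightarrow> x i = 0" for i
  proof (induction i)
    case 0
    show ?case using C[of "x 0"] x(1) fun_cong[OF x(2), of 0] by (auto simp: seg_op_def)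
  next
    case (Suc i)
    show ?case using C[of "x (Suc i)"] x(1) fun_cong[OF x(2), of "Suc i"] Suc by (auto simp: seg_op_def)
  qed
  moreover have "x i = 0" if "\<not> i < r" for i using x(1) that by simp
  ultimately show ?thesis by (auto simp: fun_eq_iff)
qed

lemma cycle_op_inj:
  assumes \<Psi>: "pre_rep \<Psi>" and I: "I \<in> rep_isos v (twist v (int n) \<Psi>) \<Psi>" and n: "n \<ge> 1"
    and x: "x \<in> vecs (seg_rep n \<Psi>)" "cycle_op n I x = 0"
  shows "x = 0"
proof
  fix i
  have "I (x (n - 1)) = 0" using fun_cong[OF x(2), of 0] by (simp add: cycle_op_def)
  moreover have "I 0 = 0" using lin_maps_0[OF \<Psi>] rep_isosD(2)[OF I] by simp
  ultimately have last: "x (n - 1) = 0"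
    using rep_isos_inj[OF I, of "x (n - 1)" 0] x(1) n vecs_0[OF \<Psi>] by simp
  have "x i = 0" if "Suc i < n" using fun_cong[OF x(2), of "Suc i"] that by (simp add: cycle_op_def)
  moreover have "i = n - 1" if "\<not> Suc i < n" "i < n" using that by simp
  ultimately show "x i = 0 i" using last x(1) by (cases "i < n"; cases "Suc i < n") auto
qed

text \<open>In the nilpotent case the operator kills the last slot; in the cyclic case it is
  injective.\<close>

lemma not_both_types:
  fixes \<Phi> :: "('f, 'k, _) weil_rep" and \<Psi> :: "('f, 'k, _) weil_rep" and \<Psi>' :: "('f, 'k, _) weil_rep"
  assumes ind: "indecomposable v (\<Phi>, U)" and n: "nilpotent_type v \<Psi> r (\<Phi>, U)" and c: "cyclic_type v \<Psi>' r' I (\<Phi>, U)"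
  shows False
proof -
  have n': "irreducible_rep v \<Psi>" "r \<ge> 1" "deligne_iso v (\<Phi>, U) (seg_rep r \<Psi>, seg_op r (\<lambda>x. 0))"
    using n unfolding nilpotent_type_iff by auto
  define m where "m = orbit_card v \<Psi>'"
  have c': "irreducible_rep v \<Psi>'" "r' \<ge> 1" "I \<in> rep_isos v (twist v (int m) \<Psi>') \<Psi>'"
    "deligne_iso v (\<Phi>, U) (seg_rep r' (seg_rep m \<Psi>'), seg_op r' (cycle_op m I))"
    using c unfolding cyclic_type_iff m_def by auto
  note p = irreducible_repD[OF n'(1)]
  have "deligne_iso v (seg_rep r \<Psi>, seg_op r (\<lambda>x. 0)) (\<Phi>, U)"
    by (rule deligne_iso_sym[OF indecomposable_pre_rep(2,3)[OF ind] n'(3)])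
  then have "deligne_iso v (seg_rep r \<Psi>, seg_op r (\<lambda>x. 0)) (seg_rep r' (seg_rep m \<Psi>'), seg_op r' (cycle_op m I))"
    using c'(4) deligne_iso_trans by blast
  then obtain h where h: "h \<in> rep_isos v (seg_rep r \<Psi>) (seg_rep r' (seg_rep m \<Psi>'))"
    "\<forall>x\<in>vecs (seg_rep r \<Psi>). h (seg_op r (\<lambda>x. 0) x) = seg_op r' (cycle_op m I) (h x)" unfolding deligne_iso.simps by blast
  note h0 = lin_maps_0[OF pre_rep_seg_rep[OF p(2)] rep_isosD(2)[OF h(1)]]
  obtain y where y: "y \<in> vecs \<Psi>" "y \<noteq> 0" using p(4) vecs_0[OF p(2)] by blast
  define x where "x = single (r - 1) y"
  have x: "x \<in> vecs (seg_rep r \<Psi>)" using y n'(2) vecs_0[OF p(2)] by (auto simp: x_def single_def)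
  have "seg_op r (\<lambda>x. 0) x = 0" using n'(2) by (auto simp: x_def single_def seg_op_def fun_eq_iff)
  then have "seg_op r' (cycle_op m I) (h x) = 0" using h(2) h0 x by (metis)
  then have "h x = 0"
    using seg_op_inj[OF cycle_op_inj[OF irreducible_repD(2)[OF c'(1)] c'(3)] lin_maps_closed[OF rep_isosD(2)[OF h(1)] x]]
      orbit_card(1)[OF irreducible_repD(1)[OF c'(1)]] unfolding m_def by blast
  then have "x = 0" using rep_isos_inj[OF h(1) x vecs_0[OF pre_rep_seg_rep[OF p(2)]]] h0 by simp
  then have "x (r - 1) = 0" by simp
  then show False using y(2) by (simp add: x_def single_def)
qed

text \<open>Slotwise scaling gives an isomorphism of \<open>U\<close> with all its nonzero
  multiples, the operator on \<Psi> itself being zero. Indecomposability and semisimplicity of the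
  members of the isomorphism class come by transport.\<close>

lemma iso_class_eq_equiv_class:
  fixes \<Phi> :: "('f, 'k, 'v::ab_group_add) weil_rep" and \<Psi> :: "('f, 'k, 'w::ab_group_add) weil_rep"
  assumes ind: "indecomposable v (\<Phi>, U)" and ss: "semisimple_rep v \<Phi>" and n: "nilpotent_type v \<Psi> r (\<Phi>, U)"
  shows "(iso_class v (\<Phi>, U) :: ('f, 'k, 'u::ab_group_add) deligne set) = equiv_class v (\<Phi>, U)"
proof -
  note q = indecomposable_pre_rep[OF ind]
  interpret A: vector_space "smul \<Phi>" by (rule q(4))
  have n': "irreducible_rep v \<Psi>" "r \<ge> 1" "deligne_iso v (\<Phi>, U) (seg_rep r \<Psi>, seg_op r (\<lambda>x. 0))"
    using n unfolding nilpotent_type_iff by auto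
  note p = simple_pairD[OF simple_pair_zero[OF n'(1)]]
  interpret B: vector_space "smul \<Psi>" using p(1) by (simp add: pre_rep_def)
  have sc: "deligne_iso v (\<Phi>, U) (\<Phi>, \<lambda>x. smul \<Phi> c (U x))" if c: "c \<noteq> 0" for c
  proof -
    have 1: "deligne_iso v (seg_rep r \<Psi>, seg_op r (\<lambda>x. 0)) (seg_rep r \<Psi>, \<lambda>x. smul (seg_rep r \<Psi>) c (seg_op r (\<lambda>x. 0) x))"
      by (rule seg_iso_scaled[OF p(1,3) p(1,3) n'(2) c rep_isos_ident]) simp
    have 2: "deligne_iso v (\<Phi>, \<lambda>x. smul \<Phi> c (U x)) (seg_rep r \<Psi>, \<lambda>x. smul (seg_rep r \<Psi>) c (seg_op r (\<lambda>x. 0) x))"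
      by (rule deligne_iso_scale[OF q(3) n'(3)])
    have "deligne_iso v (seg_rep r \<Psi>, \<lambda>x. smul (seg_rep r \<Psi>) c (seg_op r (\<lambda>x. 0) x)) (\<Phi>, \<lambda>x. smul \<Phi> c (U x))"
      by (rule deligne_iso_sym[OF q(2) vecs_smul[OF q(2) q(3)] 2])
    then show ?thesis by (rule deligne_iso_trans[OF deligne_iso_trans[OF n'(3) 1]])
  qed
  have "deligne_rep v D \<and> deligne_iso v (\<Phi>, U) D \<longleftrightarrow> deligne_equiv v (\<Phi>, U) D" for D :: "('f, 'k, 'u) deligne"
  proof -
    obtain \<Phi>' U' where D: "D = (\<Phi>', U')" by (metis surj_pair)
    show ?thesis
    proof
      assume h: "deligne_rep v D \<and> deligne_iso v (\<Phi>, U) D"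
      have vs: "vector_space (smul \<Phi>')" using h weil_rep_pre_rep by (auto simp: D pre_rep_def)
      have i: "indecomposable v (\<Phi>', U')" using h by (intro indecomposable_transfer[OF ind _ vs]) (simp only: D)
      obtain f where f: "f \<in> rep_isos v \<Phi> \<Phi>'" using h by (auto simp: D)
      have s: "semisimple_rep v \<Phi>'" by (rule semisimple_rep_transfer[OF ss f vs])
      have "deligne_iso v (\<Phi>', U') (\<Phi>, U)" using h by (intro deligne_iso_sym[OF q(2,3)]) (simp_all only: D)
      then have "deligne_iso v (\<Phi>', U') (\<Phi>, \<lambda>x. smul \<Phi> 1 (U x))" by simp
      then show "deligne_equiv v (\<Phi>, U) D" unfolding D deligne_equiv.simps weil_semisimple.simps
        using ind ss i s by (metis one_neq_zero)
    next
      assume h: "deligne_equiv v (\<Phi>, U) D"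
      then obtain c where c: "c \<noteq> 0" "deligne_iso v (\<Phi>', U') (\<Phi>, \<lambda>x. smul \<Phi> c (U x))" by (auto simp: D)
      have i: "indecomposable v (\<Phi>', U')" using h by (simp add: D)
      have "deligne_iso v (\<Phi>, \<lambda>x. smul \<Phi> c (U x)) (\<Phi>', U')"
        by (rule deligne_iso_sym[OF indecomposable_pre_rep(2,3)[OF i] c(2)])
      then have "deligne_iso v (\<Phi>, U) D" unfolding D by (rule deligne_iso_trans[OF sc[OF c(1)]])
      then show "deligne_rep v D \<and> deligne_iso v (\<Phi>, U) D" using indecomposable_pre_rep(1)[OF i] unfolding D by blast
    qed
  qed
  then show ?thesis unfolding iso_class_def equiv_class_def by (rule Collect_cong)
qed

text \<open>Dimension recovers the length \<open>r\<close> once \<Psi> is known up to isomorphism or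
  twist.\<close>

definition rep_dim :: "('f, 'k, 'v::ab_group_add) weil_rep \<Rightarrow> nat" where
  "rep_dim \<Phi> = vector_space.dim (smul \<Phi>) (vecs \<Phi>)"

lemma fin_dim_basis:
  assumes "pre_rep \<Phi>" "fin_dim \<Phi>"
  obtains B where "finite B" "\<not> module.dependent (smul \<Phi>) B" "module.span (smul \<Phi>) B = vecs \<Phi>" "card B = rep_dim \<Phi>"
proof -
  interpret linear_space "smul \<Phi>" by (rule pre_rep_space[OF assms(1)])
  obtain A where A: "finite A" "vecs \<Phi> = span A" using assms(2) unfolding fin_dim_def by blast
  obtain B where B: "B \<subseteq> vecs \<Phi>" "independent B" "vecs \<Phi> \<subseteq> span B" "card B = dim (vecs \<Phi>)" using basis_exists by blast
  have "finite B" using independent_span_bound[OF A(1) B(2)] B(1) A(2) by blast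
  moreover have "span B = vecs \<Phi>" using B span_minimal[OF _ pre_rep_subspace[OF assms(1)]] by blast
  ultimately show ?thesis using that B(2,4) unfolding rep_dim_def by blast
qed

lemma rep_dim_iso:
  assumes "pre_rep \<Phi>" "fin_dim \<Phi>" "pre_rep \<Phi>'" "rep_iso v \<Phi> \<Phi>'"
  shows "rep_dim \<Phi> = rep_dim \<Phi>'"
proof -
  interpret A: linear_space "smul \<Phi>" by (rule pre_rep_space[OF assms(1)])
  interpret B: linear_space "smul \<Phi>'" by (rule pre_rep_space[OF assms(3)])
  obtain f where f: "f \<in> rep_isos v \<Phi> \<Phi>'" using assms(4) unfolding rep_iso_def by blast
  obtain F where F: "module_hom (smul \<Phi>) (smul \<Phi>') F" "\<And>x. x \<in> vecs \<Phi> \<Longrightarrow> F x = f x"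
    using lin_maps_extend[OF assms(1) B.vector_space_axioms rep_isosD(2)[OF f]] by blast
  interpret F: module_hom "smul \<Phi>" "smul \<Phi>'" F by (rule F(1))
  obtain B where B: "finite B" "A.independent B" "A.span B = vecs \<Phi>" "card B = rep_dim \<Phi>"
    using fin_dim_basis[OF assms(1,2)] by blast
  have inj: "inj_on F (A.span B)" and im: "F ` A.span B = vecs \<Phi>'"
    using rep_isosD(3)[OF f] F(2) unfolding B(3) by (auto simp: bij_betw_def inj_on_def)
  have s: "B.span (F ` B) = vecs \<Phi>'" using F.span_image im by simp
  have "rep_dim \<Phi>' = card B" unfolding rep_dim_def
  proof (rule B.dim_unique)
    show "B.independent (F ` B)" by (rule F.independent_injective_image[OF B(2) inj])
    show "F ` B \<subseteq> vecs \<Phi>'" unfolding s[symmetric] by (rule B.span_superset)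
    show "vecs \<Phi>' \<subseteq> B.span (F ` B)" unfolding s by (rule order_refl)
    have "inj_on F B" by (rule inj_on_subset[OF inj]) (rule A.span_superset)
    then show "card (F ` B) = card B" by (rule card_image)
  qed
  then show ?thesis unfolding B(4) by (rule sym)
qed

text \<open>A basis of \<Psi> is placed in each slot; independence is tested by projecting to the
  slot concerned.\<close>

lemma seg_rep_basis:
  assumes \<Psi>: "pre_rep \<Psi>" "fin_dim \<Psi>"
  shows "fin_dim (seg_rep n \<Psi>)" "rep_dim (seg_rep n \<Psi>) = n * rep_dim \<Psi>"
proof -
  interpret L: linear_space "smul \<Psi>" by (rule pre_rep_space[OF \<Psi>(1)])
  note ps = pre_rep_seg_rep[OF \<Psi>(1), of n]
  interpret linear_space "smul (seg_rep n \<Psi>)" by (rule pre_rep_space[OF ps])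
  obtain B where B: "finite B" "L.independent B" "L.span B = vecs \<Psi>" "card B = rep_dim \<Psi>"
    using fin_dim_basis[OF \<Psi>] by blast
  have hom: "module_hom (smul \<Psi>) (smul (seg_rep n \<Psi>)) (single i)" for i
    unfolding module_hom_iff_linear Vector_Spaces.linear_iff
    using L.vector_space_axioms vector_space_axioms by (auto simp: single_def fun_eq_iff)
  have com: "module_hom (smul (seg_rep n \<Psi>)) (smul \<Psi>) (\<lambda>x. x i)" for i
    unfolding module_hom_iff_linear Vector_Spaces.linear_iff
    using L.vector_space_axioms vector_space_axioms by auto
  have B0: "0 \<notin> B" using B(2) L.dependent_zero by blast
  define C where "C = (\<lambda>(i, b). single i b) ` ({..<n} \<times> B)"
  have "inj_on (\<lambda>(i, b). single i b) ({..<n} \<times> B)"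
  proof (rule inj_onI, clarify)
    fix i a j b assume "a \<in> B" "b \<in> B" and e: "single i a = single j b"
    then have "a \<noteq> 0" using B0 by blast
    moreover have "a = (if i = j then b else 0)" using fun_cong[OF e, of i] by (simp add: single_def)
    ultimately show "i = j \<and> a = b" by (auto split: if_splits)
  qed
  then have card: "card C = n * card B" unfolding C_def by (simp add: card_image card_cartesian_product)
  have fin: "finite C" unfolding C_def using B(1) by simp
  have sub: "C \<subseteq> vecs (seg_rep n \<Psi>)"
    using L.span_superset[of B] B(3) vecs_0[OF \<Psi>(1)] by (auto simp: C_def single_def)
  have sup: "vecs (seg_rep n \<Psi>) \<subseteq> span C"
  proof
    fix x assume x: "x \<in> vecs (seg_rep n \<Psi>)"
    have "single i (x i) \<in> span C" if i: "i < n" for i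
    proof -
      have "x i \<in> L.span B" using x i B(3) by simp
      then have "single i (x i) \<in> span (single i ` B)" unfolding module_hom.span_image[OF hom] by blast
      moreover have "single i ` B \<subseteq> C" using i unfolding C_def by auto
      ultimately show ?thesis using span_mono by blast
    qed
    then have "(\<Sum>i<n. single i (x i)) \<in> span C" by (intro span_sum) auto
    moreover have "x = (\<Sum>i<n. single i (x i))" by (rule sum_single) (use x in simp)
    ultimately show "x \<in> span C" by simp
  qed
  have ind: "independent C" unfolding dependent_def
  proof
    assume "\<exists>c\<in>C. c \<in> span (C - {c})"
    then obtain i b where ib: "i < n" "b \<in> B" "single i b \<in> span (C - {single i b})" unfolding C_def by auto
    have "(\<lambda>x. x i) ` span (C - {single i b}) = L.span ((\<lambda>x. x i) ` (C - {single i b}))"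
      by (rule module_hom.span_image[OF com, symmetric])
    moreover have "b \<in> (\<lambda>x. x i) ` span (C - {single i b})"
      by (rule image_eqI[OF _ ib(3)]) (simp add: single_def)
    ultimately have "b \<in> L.span ((\<lambda>x. x i) ` (C - {single i b}))" by (simp only:)
    moreover have "(\<lambda>x. x i) ` (C - {single i b}) \<subseteq> insert 0 (B - {b})"
    proof (rule image_subsetI)
      fix c assume c: "c \<in> C - {single i b}"
      then obtain j b' where c': "c = single j b'" "b' \<in> B" unfolding C_def by auto
      have "c i = (if i = j then b' else 0)" unfolding c'(1) single_def by simp
      moreover have "b' \<noteq> b" if "i = j" using c c'(1) that by blast
      ultimately show "c i \<in> insert 0 (B - {b})" using c'(2) by auto
    qed
    then have "L.span ((\<lambda>x. x i) ` (C - {single i b})) \<subseteq> L.span (B - {b})" using L.span_mono[of _ "insert 0 (B - {b})"] by simp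
    ultimately show False using ib(2) B(2) unfolding L.dependent_def by blast
  qed
  show "rep_dim (seg_rep n \<Psi>) = n * rep_dim \<Psi>"
    unfolding rep_dim_def[of "seg_rep n \<Psi>"] B(4)[symmetric] card[symmetric] by (rule dim_unique[OF sub sup ind refl])
  have "vecs (seg_rep n \<Psi>) = span C" using sup span_minimal[OF sub pre_rep_subspace[OF ps]] by blast
  then show "fin_dim (seg_rep n \<Psi>)" unfolding fin_dim_def using fin by blast
qed

lemma rep_dim_pos:
  fixes \<Psi> :: "('f, 'k, _) weil_rep"
  assumes "irreducible_rep v \<Psi>"
  shows "rep_dim \<Psi> > 0"
proof (rule ccontr)
  note p = irreducible_repD[OF assms]
  interpret linear_space "smul \<Psi>" by (rule pre_rep_space[OF p(2)])
  assume "\<not> rep_dim \<Psi> > 0"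
  then obtain B where "finite B" "span B = vecs \<Psi>" "card B = 0" using fin_dim_basis[OF p(2,3)] by (metis gr0I)
  then show False using p(4) by simp
qed

text \<open>Slot 0 is a model of the cokernel of the operator. Including it, applying the
  isomorphism and projecting to slot 0 gives a map from \<Psi> to \<Psi>'. It is nonzero because
  every tuple is its slot 0 plus an image of the operator, and such images have slot 0 zero on the
  other side too. Schur's lemma identifies \<Psi> with \<Psi>', and dimensions then give r =
  r'.\<close>

lemma nilpotent_type_unique:
  fixes \<Phi> :: "('f, 'k, _) weil_rep" and \<Psi> :: "('f, 'k, _) weil_rep" and \<Psi>' :: "('f, 'k, _) weil_rep"
  assumes ind: "indecomposable v (\<Phi>, U)" and n: "nilpotent_type v \<Psi> r (\<Phi>, U)" and n': "nilpotent_type v \<Psi>' r' (\<Phi>, U)"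
  shows "rep_iso v \<Psi> \<Psi>' \<and> r = r'"
proof -
  have a: "irreducible_rep v \<Psi>" "r \<ge> 1" "deligne_iso v (\<Phi>, U) (seg_rep r \<Psi>, seg_op r (\<lambda>x. 0))"
    using n unfolding nilpotent_type_iff by auto
  have b: "irreducible_rep v \<Psi>'" "r' \<ge> 1" "deligne_iso v (\<Phi>, U) (seg_rep r' \<Psi>', seg_op r' (\<lambda>x. 0))"
    using n' unfolding nilpotent_type_iff by auto
  note p = irreducible_repD[OF a(1)] and p' = irreducible_repD[OF b(1)]
  have "deligne_iso v (seg_rep r \<Psi>, seg_op r (\<lambda>x. 0)) (seg_rep r' \<Psi>', seg_op r' (\<lambda>x. 0))"
    by (rule deligne_iso_trans[OF deligne_iso_sym[OF indecomposable_pre_rep(2,3)[OF ind] a(3)] b(3)])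
  then obtain h where h: "h \<in> rep_isos v (seg_rep r \<Psi>) (seg_rep r' \<Psi>')"
    "\<And>x. x \<in> vecs (seg_rep r \<Psi>) \<Longrightarrow> h (seg_op r (\<lambda>x. 0) x) = seg_op r' (\<lambda>x. 0) (h x)" unfolding deligne_iso.simps by blast
  note h' = rep_isosD[OF h(1)]
  interpret L: linear_space "smul \<Psi>" by (rule pre_rep_space[OF p(2)])
  interpret L': linear_space "smul \<Psi>'" by (rule pre_rep_space[OF p'(2)])
  define g where "g y = h (single 0 y) 0" for y
  have s: "single 0 y \<in> vecs (seg_rep r \<Psi>)" if "y \<in> vecs \<Psi>" for y
    using that a(2) vecs_0[OF p(2)] by (simp add: single_def)
  have g: "g \<in> rep_hom v \<Psi> \<Psi>'"
  proof (rule rep_homI)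
    fix x assume x: "x \<in> vecs \<Psi>"
    show "g x \<in> vecs \<Psi>'" using lin_maps_closed[OF h'(2) s[OF x]] b(2) by (simp add: g_def)
    fix y assume y: "y \<in> vecs \<Psi>"
    have "single 0 (x + y) = single 0 x + single 0 y" by (auto simp: single_def fun_eq_iff)
    then show "g (x + y) = g x + g y" using lin_maps_add[OF h'(2) s[OF x] s[OF y]] by (simp add: g_def)
  next
    fix c x assume x: "x \<in> vecs \<Psi>"
    have "single 0 (smul \<Psi> c x) = smul (seg_rep r \<Psi>) c (single 0 x)" by (auto simp: single_def fun_eq_iff)
    then show "g (smul \<Psi> c x) = smul \<Psi>' c (g x)" using lin_maps_smul[OF h'(2) s[OF x], of c] by (simp add: g_def)
  next
    fix \<sigma> x assume \<sigma>: "\<sigma> \<in> W" and x: "x \<in> vecs \<Psi>"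
    have "single 0 (act \<Psi> \<sigma> x) = act (seg_rep r \<Psi>) \<sigma> (single 0 x)"
      using lin_maps_0[OF p(2) act_lin_maps[OF p(2) \<sigma>]] by (auto simp: single_def fun_eq_iff)
    then show "g (act \<Psi> \<sigma> x) = act \<Psi>' \<sigma> (g x)" using h'(4)[OF \<sigma> s[OF x]] by (simp add: g_def)
  qed
  have "\<exists>y\<in>vecs \<Psi>. g y \<noteq> 0"
  proof (rule ccontr)
    assume "\<not> (\<exists>y\<in>vecs \<Psi>. g y \<noteq> 0)"
    then have g0: "h (single 0 y) 0 = 0" if "y \<in> vecs \<Psi>" for y using that by (auto simp: g_def)
    obtain z where z: "z \<in> vecs \<Psi>'" "z \<noteq> 0" using p'(4) vecs_0[OF p'(2)] by blast
    then have "single 0 z \<in> vecs (seg_rep r' \<Psi>')" using b(2) vecs_0[OF p'(2)] by (simp add: single_def)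
    then obtain x where x: "x \<in> vecs (seg_rep r \<Psi>)" "single 0 z = h x" using rep_isos_surj[OF h(1)] by blast
    \<comment> \<open>Shifting \<open>x'\<close> gives back \<open>x\<close> without its slot
      0.\<close>
    define x' where "x' i = (if Suc i < r then x (Suc i) else 0)" for i
    have x': "x' \<in> vecs (seg_rep r \<Psi>)" using x(1) vecs_0[OF p(2)] by (simp add: x'_def)
    have x0: "x 0 \<in> vecs \<Psi>" using x(1) a(2) by simp
    have "x i = (single 0 (x 0) + seg_op r (\<lambda>x. 0) x') i" for i
      using x(1) by (cases i) (auto simp: single_def seg_op_def x'_def)
    then have "x = single 0 (x 0) + seg_op r (\<lambda>x. 0) x'" by blast
    moreover have "seg_op r (\<lambda>x. 0) x' \<in> vecs (seg_rep r \<Psi>)"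
      by (rule lin_maps_closed[OF seg_op_lin_maps[OF p(2) simple_pairD(3)[OF simple_pair_zero[OF a(1)]] a(2)] x'])
    ultimately have "h x = h (single 0 (x 0)) + h (seg_op r (\<lambda>x. 0) x')" using lin_maps_add[OF h'(2) s[OF x0]] by metis
    then have "h x 0 = 0" using g0[OF x0] h(2)[OF x'] by (simp add: seg_op_def)
    then have "single 0 z 0 = 0" using x(2) by simp
    then show False using z(2) by (simp add: single_def)
  qed
  then have iso: "rep_iso v \<Psi> \<Psi>'" using irreducible_hom_iso[OF a(1) b(1) g] unfolding rep_iso_def by blast
  have "rep_iso v (seg_rep r \<Psi>) (seg_rep r' \<Psi>')" using h(1) unfolding rep_iso_def by blast
  then have "r * rep_dim \<Psi> = r' * rep_dim \<Psi>'"
    using rep_dim_iso[OF pre_rep_seg_rep[OF p(2)] seg_rep_basis(1)[OF p(2,3)] pre_rep_seg_rep[OF p'(2)]]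
      seg_rep_basis(2)[OF p(2,3)] seg_rep_basis(2)[OF p'(2,3)] by metis
  moreover have "rep_dim \<Psi> = rep_dim \<Psi>'" by (rule rep_dim_iso[OF p(2,3) p'(2) iso])
  ultimately show ?thesis using iso rep_dim_pos[OF b(1)] by simp
qed

lemma nu_orbit_eq:
  fixes \<Psi> \<Psi>' :: "('f, 'k, _) weil_rep"
  assumes w: "weil_rep v \<Psi>" "weil_rep v \<Psi>'" and i: "rep_iso v \<Psi> (twist v n \<Psi>')"
  shows "nu_orbit v \<Psi> = nu_orbit v \<Psi>'"
proof -
  note p = weil_rep_pre_rep[OF w(1)] weil_rep_pre_rep[OF w(2)]
  have "rep_iso v (twist v 0 \<Psi>) (twist v n \<Psi>')" by (rule rep_iso_trans[OF rep_iso_twist_0(1)[OF p(1)] i])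
  then have e: "rep_class v (twist v k \<Psi>) = rep_class v (twist v (n + k) \<Psi>')" for k
    using rep_iso_twist_shift[OF p, of 0 n k] rep_class_eq_iff[OF weil_rep_twist[OF w(1)] weil_rep_twist[OF w(2)]] by simp
  have e': "rep_class v (twist v k \<Psi>') = rep_class v (twist v (k - n) \<Psi>)" for k using e[of "k - n"] by simp
  show ?thesis unfolding nu_orbit_def
  proof (intro subset_antisym image_subsetI)
    show "rep_class v (twist v k \<Psi>) \<in> range (\<lambda>k. rep_class v (twist v k \<Psi>'))" for k
      by (subst e) (rule rangeI)
    show "rep_class v (twist v k \<Psi>') \<in> range (\<lambda>k. rep_class v (twist v k \<Psi>))" for k
      by (subst e') (rule rangeI)
  qed
qed

lemma nu_orbit_eq_imp_twist:
  fixes \<Psi> \<Psi>' :: "('f, 'k, _) weil_rep"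
  assumes w: "weil_rep v \<Psi>" "weil_rep v \<Psi>'" and e: "nu_orbit v \<Psi> = nu_orbit v \<Psi>'"
  shows "\<exists>k. rep_iso v \<Psi> (twist v k \<Psi>')"
proof -
  have "rep_class v (twist v 0 \<Psi>) \<in> nu_orbit v \<Psi>" unfolding nu_orbit_def by (rule rangeI)
  then have "rep_class v (twist v 0 \<Psi>) \<in> nu_orbit v \<Psi>'" unfolding e .
  then obtain k where "rep_class v (twist v 0 \<Psi>) = rep_class v (twist v k \<Psi>')" unfolding nu_orbit_def by blast
  then have "rep_iso v (twist v 0 \<Psi>) (twist v k \<Psi>')" using rep_class_eq_iff weil_rep_twist w by blast
  then show ?thesis using rep_iso_trans[OF rep_iso_twist_0(2)[OF weil_rep_pre_rep[OF w(1)]]] by blast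
qed

text \<open>Every doubly indexed slot on the right is a twist of \<Psi>'. Any slot in which the
  image of the corner copy of \<Psi> does not vanish identifies \<Psi> with that twist.\<close>

lemma nu_orbit_unique:
  fixes \<Psi> \<Psi>' :: "('f, 'k, 'v::ab_group_add) weil_rep"
  assumes a: "irreducible_rep v \<Psi>" "r \<ge> 1" "n \<ge> 1" and b: "irreducible_rep v \<Psi>'"
    and i: "rep_iso v (seg_rep r (seg_rep n \<Psi>)) (seg_rep r' (seg_rep n' \<Psi>'))"
  shows "nu_orbit v \<Psi> = nu_orbit v \<Psi>'"
proof -
  note p = irreducible_repD[OF a(1)] and p' = irreducible_repD[OF b]
  interpret L: linear_space "smul \<Psi>" by (rule pre_rep_space[OF p(2)])
  interpret L': linear_space "smul \<Psi>'" by (rule pre_rep_space[OF p'(2)])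
  let ?A = "seg_rep r (seg_rep n \<Psi>)" and ?B = "seg_rep r' (seg_rep n' \<Psi>')"
  have pA: "pre_rep ?A" by (intro pre_rep_seg_rep p(2))
  obtain h where h: "h \<in> rep_isos v ?A ?B" using i unfolding rep_iso_def by blast
  note h' = rep_isosD[OF h]
  define e where "e y = single 0 (single 0 y)" for y :: 'v
  have eA: "e y \<in> vecs ?A" if "y \<in> vecs \<Psi>" for y
    using that a(2,3) vecs_0[OF p(2)] by (simp add: e_def single_def)
  obtain y where y: "y \<in> vecs \<Psi>" "y \<noteq> 0" using p(4) vecs_0[OF p(2)] by blast
  have "e y \<noteq> 0" using y(2) by (auto simp: e_def single_def fun_eq_iff)
  then have "h (e y) \<noteq> 0" using rep_isos_inj[OF h eA[OF y(1)] vecs_0[OF pA]] lin_maps_0[OF pA h'(2)] by simp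
  then obtain i k where ik: "h (e y) i k \<noteq> 0" by (auto simp: fun_eq_iff)
  have hB: "h (e y) \<in> vecs ?B" by (rule lin_maps_closed[OF h'(2) eA[OF y(1)]])
  have ir: "i < r'"
  proof (rule ccontr)
    assume "\<not> i < r'"
    then have "h (e y) i = 0" using hB by simp
    then show False using ik by simp
  qed
  have kn: "k < n'"
  proof (rule ccontr)
    assume "\<not> k < n'"
    then show False using hB ir ik by (simp add: not_less)
  qed
  define g where "g y = h (e y) i k" for y
  have "g \<in> rep_hom v \<Psi> (twist v (int (i + k)) \<Psi>')"
  proof (rule rep_homI)
    fix x assume x: "x \<in> vecs \<Psi>"
    show "g x \<in> vecs (twist v (int (i + k)) \<Psi>')" using lin_maps_closed[OF h'(2) eA[OF x]] ir kn by (simp add: g_def)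
    fix y assume y: "y \<in> vecs \<Psi>"
    have "e (x + y) = e x + e y" by (auto simp: e_def single_def fun_eq_iff)
    then show "g (x + y) = g x + g y" using lin_maps_add[OF h'(2) eA[OF x] eA[OF y]] by (simp add: g_def)
  next
    fix c x assume x: "x \<in> vecs \<Psi>"
    have "e (smul \<Psi> c x) = smul ?A c (e x)" by (auto simp: e_def single_def fun_eq_iff)
    then show "g (smul \<Psi> c x) = smul (twist v (int (i + k)) \<Psi>') c (g x)" using lin_maps_smul[OF h'(2) eA[OF x], of c] by (simp add: g_def)
  next
    fix \<sigma> x assume \<sigma>: "\<sigma> \<in> W" and x: "x \<in> vecs \<Psi>"
    have "e (act \<Psi> \<sigma> x) = act ?A \<sigma> (e x)"
      using lin_maps_0[OF p(2) act_lin_maps[OF p(2) \<sigma>]] by (auto simp: e_def single_def fun_eq_iff)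
    then have "g (act \<Psi> \<sigma> x) = smul \<Psi>' (\<nu> \<sigma> powi int i) (smul \<Psi>' (\<nu> \<sigma> powi int k) (act \<Psi>' \<sigma> (g x)))"
      using h'(4)[OF \<sigma> eA[OF x]] by (simp add: g_def)
    then show "g (act \<Psi> \<sigma> x) = act (twist v (int (i + k)) \<Psi>') \<sigma> (g x)"
      using \<nu>_nonzero[OF \<sigma>] by (simp add: power_int_add)
  qed
  moreover have "g y \<noteq> 0" using ik by (simp add: g_def)
  ultimately have "g \<in> rep_isos v \<Psi> (twist v (int (i + k)) \<Psi>')"
    using irreducible_hom_iso[OF a(1) irreducible_rep_twist[OF b]] y(1) by blast
  then show ?thesis using nu_orbit_eq[OF p(1) p'(1)] unfolding rep_iso_def by blast
qed

lemma nu_orbit_length_unique: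
  assumes a: "irreducible_rep v \<Psi>" "r \<ge> 1" and b: "irreducible_rep v \<Psi>'"
    and i: "rep_iso v (seg_rep r (seg_rep (orbit_card v \<Psi>) \<Psi>)) (seg_rep r' (seg_rep (orbit_card v \<Psi>') \<Psi>'))"
  shows "nu_orbit v \<Psi> = nu_orbit v \<Psi>' \<and> r = r'"
proof -
  note p = irreducible_repD[OF a(1)] and p' = irreducible_repD[OF b]
  have o: "orbit_card v \<Psi> \<ge> 1" "orbit_card v \<Psi>' \<ge> 1" using orbit_card(1) p(1) p'(1) by blast+
  have e: "nu_orbit v \<Psi> = nu_orbit v \<Psi>'" by (rule nu_orbit_unique[OF a o(1) b i])
  then have oe: "orbit_card v \<Psi> = orbit_card v \<Psi>'" by (simp add: orbit_card_def)
  obtain k where "rep_iso v \<Psi> (twist v k \<Psi>')" using nu_orbit_eq_imp_twist[OF p(1) p'(1) e] by blast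
  then have d: "rep_dim \<Psi> = rep_dim \<Psi>'"
    using rep_dim_iso[OF p(2,3) pre_rep_twist[OF p'(2)], of k] by (simp add: rep_dim_def)
  note f = seg_rep_basis[OF p(2,3)] and f' = seg_rep_basis[OF p'(2,3)]
  note q = pre_rep_seg_rep[OF p(2)] and q' = pre_rep_seg_rep[OF p'(2)]
  have "r * (orbit_card v \<Psi> * rep_dim \<Psi>) = r' * (orbit_card v \<Psi>' * rep_dim \<Psi>')"
    using rep_dim_iso[OF pre_rep_seg_rep[OF q] seg_rep_basis(1)[OF q f(1)] pre_rep_seg_rep[OF q'] i]
      seg_rep_basis(2)[OF q f(1)] seg_rep_basis(2)[OF q' f'(1)] f(2) f'(2) by simp
  then show ?thesis using e o(2) rep_dim_pos[OF b] unfolding oe d by simp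
qed

text \<open>\<open>C ^^ (l - 1)\<close> commutes with \<open>C\<close> and, since \<nu> ^ (l - 1) is
  trivial, with the group; Schur's lemma for the pair makes it scalar. Injectivity of
  \<open>C\<close> keeps the scalar nonzero.\<close>

lemma cycle_funpow_scalar:
  assumes sp: "simple_pair E C" and fin: "fin_dim E" and inj: "\<And>x. x \<in> vecs E \<Longrightarrow> C x = 0 \<Longrightarrow> x = 0"
  shows "\<exists>\<mu>. \<mu> \<noteq> 0 \<and> (\<forall>x\<in>vecs E. (C ^^ (CHAR('k) - 1)) x = smul E \<mu> x)"
proof -
  note p = simple_pairD[OF sp]
  let ?m = "CHAR('k) - 1"
  interpret linear_space_ac "smul E" by (rule pre_rep_space_ac[OF p(1)])
  obtain B where B: "finite B" "vecs E = span B" using fin unfolding fin_dim_def by blast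
  have CE: "endo (vecs E) C" using p(3) endo_iff_lin_maps[OF p(1)] by blast
  have aE: "endo (vecs E) (act E \<sigma>)" if "\<sigma> \<in> W" for \<sigma> using act_lin_maps[OF p(1) that] endo_iff_lin_maps[OF p(1)] by blast
  have tw: "act E \<sigma> (C x) = smul E (\<nu> \<sigma>) (C (act E \<sigma> x))" if "\<sigma> \<in> W" "x \<in> vecs E" for \<sigma> x
    using p(2) that by (simp add: dop_def)
  have "act E \<sigma> ((C ^^ ?m) x) = (C ^^ ?m) (act E \<sigma> x)" if "\<sigma> \<in> W" "x \<in> vecs E" for \<sigma> x
    using funpow_quasi_commute[OF aE[OF that(1)] CE tw[OF that(1)] that(2), of ?m] \<nu>_power_CHAR_minus_1[OF that(1)] by simp
  then have comm: "g ((C ^^ ?m) x) = (C ^^ ?m) (g x)" if "g \<in> insert C (actions E)" "x \<in> vecs E" for g x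
    using that by (auto simp: funpow_swap1)
  have en: "endo (vecs E) g" if "g \<in> insert C (actions E)" for g using that CE aE by blast
  obtain \<mu> where \<mu>: "\<forall>x\<in>vecs E. (C ^^ ?m) x = smul E \<mu> x"
    using schur[OF pre_rep_subspace[OF p(1)] B en p(4) endo_funpow[OF CE] comm] by (elim meta_impE exE) auto
  obtain x where x: "x \<in> vecs E" "x \<noteq> 0" using p(5) vecs_0[OF p(1)] by blast
  have "(C ^^ j) x \<noteq> 0" for j using endo_funpow_closed[OF CE x(1)] x(2) inj by (induction j) auto
  then have "\<mu> \<noteq> 0" using \<mu> x(1) by auto
  then show ?thesis using \<mu> by blast
qed

lemma rep_isos_scalar:
  fixes \<Psi> :: "('f, 'k, _) weil_rep"
  assumes \<Psi>: "irreducible_rep v \<Psi>" and I: "I \<in> rep_isos v (twist v n \<Psi>) \<Psi>" and J: "J \<in> rep_isos v (twist v n \<Psi>) \<Psi>"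
  shows "\<exists>a. a \<noteq> 0 \<and> (\<forall>x\<in>vecs \<Psi>. J x = smul \<Psi> a (I x))"
proof -
  note p = irreducible_repD[OF \<Psi>]
  interpret linear_space "smul \<Psi>" by (rule pre_rep_space[OF p(2)])
  define K where "K = inv_into (vecs \<Psi>) I"
  have K: "K \<in> rep_isos v \<Psi> (twist v n \<Psi>)"
    using rep_isos_inv[OF pre_rep_twist[OF p(2)] I] unfolding K_def by simp
  have JK: "J \<circ> K \<in> rep_isos v \<Psi> \<Psi>" by (rule rep_isos_comp[OF K J])
  obtain a where a: "\<forall>x\<in>vecs \<Psi>. (J \<circ> K) x = smul \<Psi> a x" using schur_rep[OF \<Psi> rep_isosD(1)[OF JK]] by blast
  have "J x = smul \<Psi> a (I x)" if x: "x \<in> vecs \<Psi>" for x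
  proof -
    have "K (I x) = x" using bij_betw_inv_into_left[OF rep_isosD(3)[OF I]] x unfolding K_def by simp
    moreover have "I x \<in> vecs \<Psi>" using lin_maps_closed[OF rep_isosD(2)[OF I], of x] x by simp
    ultimately show ?thesis using a by (metis comp_apply)
  qed
  moreover have "a \<noteq> 0"
  proof
    assume a0: "a = 0"
    obtain x where x: "x \<in> vecs \<Psi>" "x \<noteq> 0" using p(4) vecs_0[OF p(2)] by blast
    have "(J \<circ> K) x = (J \<circ> K) 0" using a x(1) vecs_0[OF p(2)] a0 by simp
    then show False using rep_isos_inj[OF JK x(1) vecs_0[OF p(2)]] x(2) by blast
  qed
  ultimately show ?thesis by blast
qed

text \<open>Scaling slot \<open>k\<close> by \<open>t ^ k\<close> multiplies each shift by
  \<open>t\<close>. Once round the cycle the product \<open>t ^ n\<close> must compensate the factor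
  \<open>a\<close> between \<open>I\<close> and \<open>J\<close>, so \<open>t\<close> is an n-th
  root of the inverse of \<open>a\<close>.\<close>

lemma cycle_rescale:
  fixes \<Psi> :: "('f, 'k, 'v::ab_group_add) weil_rep"
  assumes \<Psi>: "pre_rep \<Psi>" and I: "I \<in> rep_isos v (twist v (int n) \<Psi>) \<Psi>" and n: "n \<ge> 1"
    and a: "a \<noteq> 0" "\<And>x. x \<in> vecs \<Psi> \<Longrightarrow> J x = smul \<Psi> a (I x)"
  shows "\<exists>t f. t \<noteq> 0 \<and> f \<in> rep_isos v (seg_rep n \<Psi>) (seg_rep n \<Psi>) \<and>
    (\<forall>x\<in>vecs (seg_rep n \<Psi>). f (cycle_op n I x) = smul (seg_rep n \<Psi>) t (cycle_op n J (f x)))"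
proof -
  interpret linear_space "smul \<Psi>" by (rule pre_rep_space[OF \<Psi>])
  obtain t where t: "t ^ n = inverse a" using nth_root_exists[of n "inverse a"] n by auto
  have t0: "t \<noteq> 0"
  proof
    assume "t = 0"
    then have "t ^ n = 0" using n by simp
    then show False using t a(1) by simp
  qed
  define f where "f x = (\<lambda>k. smul \<Psi> (t ^ k) (x k))" for x :: "nat \<Rightarrow> 'v"
  have IL: "I \<in> lin_maps \<Psi> \<Psi>" using rep_isosD(2)[OF I] by simp
  have xi: "x i \<in> vecs \<Psi>" if "x \<in> vecs (seg_rep n \<Psi>)" for x i using that vecs_0[OF \<Psi>] by (cases "i < n") auto
  have h: "f \<in> rep_hom v (seg_rep n \<Psi>) (seg_rep n \<Psi>)"
  proof (rule rep_homI)
    fix \<sigma> x assume \<sigma>: "\<sigma> \<in> W" and x: "x \<in> vecs (seg_rep n \<Psi>)"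
    show "f (act (seg_rep n \<Psi>) \<sigma> x) = act (seg_rep n \<Psi>) \<sigma> (f x)"
      using lin_maps_smul[OF act_lin_maps[OF \<Psi> \<sigma>] xi[OF x]] by (simp add: f_def fun_eq_iff mult.commute)
  qed (use vecs_smul[OF \<Psi>] in \<open>auto simp: f_def fun_eq_iff scale_right_distrib mult.commute\<close>)
  have "f \<in> rep_isos v (seg_rep n \<Psi>) (seg_rep n \<Psi>)"
  proof (rule rep_isosI[OF pre_rep_seg_rep[OF \<Psi>] h])
    show "x = 0" if "f x = 0" for x using that t0 by (auto simp: f_def fun_eq_iff)
    show "\<exists>x\<in>vecs (seg_rep n \<Psi>). y = f x" if y: "y \<in> vecs (seg_rep n \<Psi>)" for y
      using y vecs_smul[OF \<Psi>] t0 by (intro bexI[of _ "\<lambda>k. smul \<Psi> (inverse (t ^ k)) (y k)"]) (auto simp: f_def fun_eq_iff)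
  qed
  moreover have "f (cycle_op n I x) = smul (seg_rep n \<Psi>) t (cycle_op n J (f x))" if x: "x \<in> vecs (seg_rep n \<Psi>)" for x
  proof
    fix k
    have "t * (a * t ^ (n - 1)) = a * t ^ n" using n by (cases n) auto
    also have "\<dots> = 1" using t a(1) by simp
    finally have e: "t * (a * t ^ (n - 1)) = 1" .
    have "J (smul \<Psi> (t ^ (n - 1)) (x (n - 1))) = smul \<Psi> (a * t ^ (n - 1)) (I (x (n - 1)))"
      using a(2)[OF vecs_smul[OF \<Psi> xi[OF x]]] lin_maps_smul[OF IL xi[OF x]] by simp
    then have "I (x (n - 1)) = smul \<Psi> t (J (smul \<Psi> (t ^ (n - 1)) (x (n - 1))))" using e by simp
    then show "f (cycle_op n I x) k = smul (seg_rep n \<Psi>) t (cycle_op n J (f x)) k"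
      by (cases k) (auto simp: f_def cycle_op_def)
  qed
  ultimately show ?thesis using t0 by blast
qed

text \<open>Equal orbits embed \<Psi> in a slot of the cycle over \<Psi>', so
  \<open>cycle_recognition\<close> rewrites that cycle as one over \<Psi> with some
  \<open>J\<close>. By Schur's lemma \<open>J\<close> is a multiple of \<open>I\<close>, and
  \<open>cycle_rescale\<close> trades this multiple for a scalar on the operator.\<close>

lemma cycle_iso_of_nu_orbit_eq:
  assumes \<Psi>: "irreducible_rep v \<Psi>" and I: "I \<in> rep_isos v (twist v (int (orbit_card v \<Psi>)) \<Psi>) \<Psi>"
    and \<Psi>': "irreducible_rep v \<Psi>'" and I': "I' \<in> rep_isos v (twist v (int (orbit_card v \<Psi>')) \<Psi>') \<Psi>'"
    and e: "nu_orbit v \<Psi> = nu_orbit v \<Psi>'"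
  defines "E \<equiv> seg_rep (orbit_card v \<Psi>) \<Psi>" and "E' \<equiv> seg_rep (orbit_card v \<Psi>') \<Psi>'"
  shows "\<exists>t f. t \<noteq> 0 \<and> f \<in> rep_isos v E E' \<and>
    (\<forall>x\<in>vecs E. f (cycle_op (orbit_card v \<Psi>) I x) = smul E' t (cycle_op (orbit_card v \<Psi>') I' (f x)))"
proof -
  note p = irreducible_repD[OF \<Psi>] and p' = irreducible_repD[OF \<Psi>']
  let ?n = "orbit_card v \<Psi>" and ?n' = "orbit_card v \<Psi>'"
  interpret L': linear_space "smul \<Psi>'" by (rule pre_rep_space[OF p'(2)])
  have n: "?n \<ge> 1" "?n' \<ge> 1" using orbit_card(1)[OF p(1)] orbit_card(1)[OF p'(1)] by auto
  obtain k where k: "rep_iso v \<Psi> (twist v k \<Psi>')" using nu_orbit_eq_imp_twist[OF p(1) p'(1) e] by blast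
  \<comment> \<open>The exponent is reduced modulo the size of the orbit so as to be the index of a
    slot.\<close>
  define j where "j = nat (k mod int ?n')"
  have j: "j < ?n'" "int j = k mod int ?n'" using n(2) by (auto simp: j_def nat_less_iff)
  have "rep_iso v (twist v k \<Psi>') (twist v (int j) \<Psi>')"
    unfolding orbit_card(2)[OF p'(1)] j(2) by (simp add: minus_mod_eq_mult_div)
  then have "rep_iso v \<Psi> (twist v (int j) \<Psi>')"
    by (rule rep_iso_trans[OF k])
  then obtain \<phi> where \<phi>: "\<phi> \<in> rep_isos v \<Psi> (twist v (int j) \<Psi>')" unfolding rep_iso_def by blast
  note \<phi>' = rep_isosD[OF \<phi>]
  have \<phi>L: "\<phi> \<in> lin_maps \<Psi> \<Psi>'" using \<phi>'(2) by simp
  define g where "g y = single j (\<phi> y)" for y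
  have g: "g \<in> rep_hom v \<Psi> E'" unfolding rep_hom_def lin_maps_def E'_def
  proof (intro CollectI conjI ballI allI funcsetI)
    fix \<sigma> x assume \<sigma>: "\<sigma> \<in> W" and x: "x \<in> vecs \<Psi>"
    show "g (act \<Psi> \<sigma> x) = act (seg_rep ?n' \<Psi>') \<sigma> (g x)"
      using \<phi>'(4)[OF \<sigma> x] lin_maps_0[OF p'(2) act_lin_maps[OF p'(2) \<sigma>]] by (auto simp: g_def single_def fun_eq_iff)
  qed (use j(1) lin_maps_closed[OF \<phi>L] vecs_0[OF p'(2)] lin_maps_add[OF \<phi>L] lin_maps_smul[OF \<phi>L] in
      \<open>auto simp: g_def single_def fun_eq_iff\<close>)
  obtain y where y: "y \<in> vecs \<Psi>" "y \<noteq> 0" using p(4) vecs_0[OF p(2)] by blast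
  have "\<phi> y \<noteq> 0" using rep_isos_inj[OF \<phi> y(1) vecs_0[OF p(2)]] lin_maps_0[OF p(2) \<phi>L] y(2) by simp
  then have gy: "g y \<noteq> 0" by (auto simp: g_def single_def fun_eq_iff)
  have sp: "simple_pair E' (cycle_op ?n' I')" unfolding E'_def by (rule simple_pair_cycle[OF \<Psi>' I'])
  have "\<exists>\<mu>. \<mu> \<noteq> 0 \<and> (\<forall>x\<in>vecs E'. (cycle_op ?n' I' ^^ (CHAR('k) - 1)) x = smul E' \<mu> x)"
  proof (rule cycle_funpow_scalar[OF sp])
    show "fin_dim E'" unfolding E'_def by (rule seg_rep_basis(1)[OF p'(2,3)])
    show "x = 0" if "x \<in> vecs E'" "cycle_op ?n' I' x = 0" for x
      using cycle_op_inj[OF p'(2) I' n(2)] that unfolding E'_def by blast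
  qed
  then obtain \<mu> where \<mu>: "\<mu> \<noteq> 0" "\<And>x. x \<in> vecs E' \<Longrightarrow> (cycle_op ?n' I' ^^ (CHAR('k) - 1)) x = smul E' \<mu> x" by blast
  obtain J where J: "J \<in> rep_isos v (twist v (int ?n) \<Psi>) \<Psi>" and iso: "deligne_iso v (cycle v \<Psi> J) (E', cycle_op ?n' I')"
    using cycle_recognition[OF \<Psi> simple_pairD(1,2,4)[OF sp] \<mu> g y(1) gy] by blast
  obtain h where h: "h \<in> rep_isos v E E'" "\<forall>x\<in>vecs E. h (cycle_op ?n J x) = cycle_op ?n' I' (h x)"
    using iso unfolding cycle_eq deligne_iso.simps E_def by blast
  obtain a where a: "a \<noteq> 0" "\<And>x. x \<in> vecs \<Psi> \<Longrightarrow> J x = smul \<Psi> a (I x)" using rep_isos_scalar[OF \<Psi> I J] by blast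
  obtain t f where f: "t \<noteq> 0" "f \<in> rep_isos v E E" "\<forall>x\<in>vecs E. f (cycle_op ?n I x) = smul E t (cycle_op ?n J (f x))"
    using cycle_rescale[OF p(2) I n(1) a] unfolding E_def by blast
  have CJ: "cycle_op ?n J \<in> lin_maps E E" using simple_pairD(3)[OF simple_pair_cycle[OF \<Psi> J]] unfolding E_def .
  have "(h \<circ> f) (cycle_op ?n I x) = smul E' t (cycle_op ?n' I' ((h \<circ> f) x))" if x: "x \<in> vecs E" for x
  proof -
    have fx: "f x \<in> vecs E" by (rule lin_maps_closed[OF rep_isosD(2)[OF f(2)] x])
    have "(h \<circ> f) (cycle_op ?n I x) = h (smul E t (cycle_op ?n J (f x)))" using f(3) x by simp
    also have "\<dots> = smul E' t (h (cycle_op ?n J (f x)))" by (rule lin_maps_smul[OF rep_isosD(2)[OF h(1)] lin_maps_closed[OF CJ fx]])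
    finally show ?thesis using h(2) fx by simp
  qed
  then show ?thesis using f(1) rep_isos_comp[OF f(2) h(1)] by blast
qed

text \<open>Both classes are taken in the ambient type of \<Phi>, so (\<Phi>, U) is a member of its
  own class. If the classes agree, it also belongs to the other, and the two tuple models are
  isomorphic as representations, which determines the datum. If the data agree, the cycles agree up
  to a scalar, and the tensor product inherits indecomposability and semisimplicity from (\<Phi>,
  U).\<close>

lemma cyclic_type_equiv_class:
  fixes \<Phi> :: "('f, 'k, 'v::ab_group_add) weil_rep" and \<Psi> \<Psi>' :: "('f, 'k, 'w::ab_group_add) weil_rep"
  assumes ind: "indecomposable v (\<Phi>, U)" and ss: "semisimple_rep v \<Phi>" and c: "cyclic_type v \<Psi> r I (\<Phi>, U)"
    and \<Psi>': "irreducible_rep v \<Psi>'" and r': "1 \<le> r'" and I': "I' \<in> rep_isos v (twist v (int (orbit_card v \<Psi>')) \<Psi>') \<Psi>'"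
  shows "(equiv_class v (deligne_tensor (segment v r') (cycle v \<Psi>' I')) :: ('f, 'k, 'v) deligne set) = equiv_class v (\<Phi>, U) \<longleftrightarrow>
    (r', nu_orbit v \<Psi>') = (r, nu_orbit v \<Psi>)"
proof -
  note q = indecomposable_pre_rep[OF ind]
  interpret P: vector_space "smul \<Phi>" by (rule q(4))
  define E where "E = seg_rep (orbit_card v \<Psi>) \<Psi>"
  define C where "C = cycle_op (orbit_card v \<Psi>) I"
  define E' where "E' = seg_rep (orbit_card v \<Psi>') \<Psi>'"
  define C' where "C' = cycle_op (orbit_card v \<Psi>') I'"
  have \<Psi>: "irreducible_rep v \<Psi>" "r \<ge> 1" "I \<in> rep_isos v (twist v (int (orbit_card v \<Psi>)) \<Psi>) \<Psi>"
    and i: "deligne_iso v (\<Phi>, U) (seg_rep r E, seg_op r C)"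
    using c unfolding cyclic_type_iff E_def C_def by auto
  have sp: "simple_pair E C" unfolding E_def C_def by (rule simple_pair_cycle[OF \<Psi>(1,3)])
  have sp': "simple_pair E' C'" unfolding E'_def C'_def by (rule simple_pair_cycle[OF \<Psi>' I'])
  note p = simple_pairD[OF sp] and p' = simple_pairD[OF sp']
  obtain A T where AT: "deligne_tensor (segment v r') (E', C') = (A, T)" by (metis surj_pair)
  have cyc: "deligne_tensor (segment v r') (cycle v \<Psi>' I') = (A, T)" unfolding cycle_eq E'_def[symmetric] C'_def[symmetric] by (rule AT)
  define s :: "('f, 'k, nat \<Rightarrow> 'k) deligne" where "s = segment v r'"
  have "A = tensor_rep (fst s) E'" using AT unfolding s_def[symmetric] by (cases s) auto
  then have vs: "vector_space (smul A)" using vector_space_tensor by (simp add: tensor_rep_def)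
  interpret A: vector_space "smul A" by (rule vs)
  have j: "deligne_iso v (seg_rep r' E', seg_op r' C') (A, T)" using seg_iso_tensor[OF p'(1,3) r'] AT by simp
  show ?thesis unfolding cyc
  proof
    assume "(equiv_class v (A, T) :: ('f, 'k, 'v) deligne set) = equiv_class v (\<Phi>, U)"
    moreover have "(\<Phi>, U) \<in> equiv_class v (\<Phi>, U)" unfolding equiv_class_def using deligne_equiv_refl[OF ind ss] by blast
    ultimately have "(\<Phi>, U) \<in> equiv_class v (A, T)" by simp
    then obtain d where "deligne_iso v (\<Phi>, U) (A, \<lambda>x. smul A d (T x))" by (auto simp: equiv_class_def)
    then have 1: "rep_iso v \<Phi> A" by (auto simp: rep_iso_def)
    have 2: "rep_iso v \<Phi> (seg_rep r E)" using i by (auto simp: rep_iso_def)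
    have 3: "rep_iso v (seg_rep r' E') A" using j by (auto simp: rep_iso_def)
    have "rep_iso v (seg_rep r E) (seg_rep r' E')"
      by (rule rep_iso_trans[OF rep_iso_sym[OF q(2) 2] rep_iso_trans[OF 1 rep_iso_sym[OF pre_rep_seg_rep[OF p'(1)] 3]]])
    then have "nu_orbit v \<Psi> = nu_orbit v \<Psi>' \<and> r = r'"
      unfolding E_def E'_def by (rule nu_orbit_length_unique[OF \<Psi>(1,2) \<Psi>'])
    then show "(r', nu_orbit v \<Psi>') = (r, nu_orbit v \<Psi>)" by simp
  next
    assume e: "(r', nu_orbit v \<Psi>') = (r, nu_orbit v \<Psi>)"
    then have rr: "r' = r" and oo: "nu_orbit v \<Psi> = nu_orbit v \<Psi>'" by auto
    obtain t f where f: "t \<noteq> 0" "f \<in> rep_isos v E E'" "\<And>x. x \<in> vecs E \<Longrightarrow> f (C x) = smul E' t (C' (f x))"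
      using cycle_iso_of_nu_orbit_eq[OF \<Psi>(1,3) \<Psi>' I' oo] unfolding E_def E'_def C_def C'_def by blast
    have 1: "deligne_iso v (seg_rep r E, seg_op r C) (seg_rep r E', \<lambda>x. smul (seg_rep r E') t (seg_op r C' x))"
      by (rule seg_iso_scaled[OF p(1,3) p'(1,3) \<Psi>(2) f(1,2)]) (rule f(3))
    have 2: "deligne_iso v (seg_rep r E', \<lambda>x. smul (seg_rep r E') t (seg_op r C' x)) (A, \<lambda>x. smul A t (T x))"
      by (rule deligne_iso_scale[OF lin_maps_closed[OF seg_op_lin_maps[OF p'(1,3) \<Psi>(2)]] j[unfolded rr]])
    have 3: "deligne_iso v (\<Phi>, U) (A, \<lambda>x. smul A t (T x))"
      by (rule deligne_iso_trans[OF i deligne_iso_trans[OF 1 2]])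
    have "indecomposable v (A, \<lambda>x. smul A t (T x))" by (rule indecomposable_transfer[OF ind 3 vs])
    \<comment> \<open>Transport yields indecomposability for the rescaled operator; scaling back by
      the inverse of \<open>t\<close> reaches \<open>T\<close> itself.\<close>
    then have "indecomposable v (A, \<lambda>x. smul A (inverse t) (smul A t (T x)))"
      by (rule indecomposable_scale) (use f(1) in simp)
    then have indA: "indecomposable v (A, T)" using f(1) by simp
    obtain g where g: "g \<in> rep_isos v \<Phi> A" using 3 by auto
    have "semisimple_rep v A" by (rule semisimple_rep_transfer[OF ss g vs])
    then have "deligne_equiv v (A, T) (\<Phi>, U)" unfolding deligne_equiv.simps weil_semisimple.simps
      using indA ind ss f(1) 3 by blast
    then show "(equiv_class v (A, T) :: ('f, 'k, 'v) deligne set) = equiv_class v (\<Phi>, U)" by (rule equiv_class_eq)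
  qed
qed

end

text \<open>Existence provides \<Psi> in the ambient type of \<open>D\<close>, whereas the remaining
  clauses compare representations in the independent types \<open>'w\<close> and \<open>'u\<close>.
  The last clause is an equivalence over all admissible \<Psi>', r', I': one direction says that the
  class depends on r and the orbit only, the other that it determines them.\<close>

theorem theorem1:
  fixes v :: "'f::field \<Rightarrow> int"
    and D :: "('f, 'l::prime_card mod_ring alg_closure, 'v::ab_group_add) deligne"
  assumes "nonarch_local_field v"
    and "CARD('l) \<noteq> residue_char v"
    and "indecomposable v D"
    and "weil_semisimple v D"
  shows
    "(\<exists>(\<Psi> :: ('f, 'l mod_ring alg_closure, 'v) weil_rep) r.
        nilpotent_type v \<Psi> r D \<or> (\<exists>I. cyclic_type v \<Psi> r I D)) \<and>
     (\<forall>(\<Psi> :: ('f, 'l mod_ring alg_closure, 'w::ab_group_add) weil_rep) r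
       (\<Psi>' :: ('f, 'l mod_ring alg_closure, 'u::ab_group_add) weil_rep) r' I.
        \<not> (nilpotent_type v \<Psi> r D \<and> cyclic_type v \<Psi>' r' I D)) \<and>
     (\<forall>(\<Psi> :: ('f, 'l mod_ring alg_closure, 'w) weil_rep) r.
        nilpotent_type v \<Psi> r D \<or> (\<exists>I. cyclic_type v \<Psi> r I D) \<longrightarrow>
        (deligne_irreducible v D \<longleftrightarrow> r = 1)) \<and>
     (\<forall>(\<Psi> :: ('f, 'l mod_ring alg_closure, 'w) weil_rep) r. nilpotent_type v \<Psi> r D \<longrightarrow>
        (iso_class v D :: ('f, 'l mod_ring alg_closure, 'u) deligne set) = equiv_class v D \<and>
        (\<forall>(\<Psi>' :: ('f, 'l mod_ring alg_closure, 'u) weil_rep) r'.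
           nilpotent_type v \<Psi>' r' D \<longrightarrow> rep_iso v \<Psi> \<Psi>' \<and> r = r')) \<and>
     (\<forall>(\<Psi> :: ('f, 'l mod_ring alg_closure, 'w) weil_rep) r I. cyclic_type v \<Psi> r I D \<longrightarrow>
        (\<forall>(\<Psi>' :: ('f, 'l mod_ring alg_closure, 'w) weil_rep) r' I'.
           irreducible_rep v \<Psi>' \<and> 1 \<le> r' \<and>
           I' \<in> rep_isos v (twist v (int (orbit_card v \<Psi>')) \<Psi>') \<Psi>' \<longrightarrow>
           ((equiv_class v (deligne_tensor (segment v r') (cycle v \<Psi>' I')) ::
               ('f, 'l mod_ring alg_closure, 'v) deligne set) = equiv_class v D \<longleftrightarrow>
            (r', nu_orbit v \<Psi>') = (r, nu_orbit v \<Psi>))))"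
proof -
  interpret weil_coeffs v "TYPE('l mod_ring alg_closure)"
    using assms(1,2) prime_card[where 'a = 'l]
    by (simp add: weil_coeffs_def weil_coeffs_axioms_def CHAR_mod_ring)
  obtain \<Phi> U where D: "D = (\<Phi>, U)" by (metis surj_pair)
  have ind: "indecomposable v (\<Phi>, U)" and ss: "semisimple_rep v \<Phi>" using assms(3,4) by (auto simp: D)
  note d = indecomposable_pre_rep(1)[OF ind]
  have irr: "deligne_irreducible v (\<Phi>, U) \<longleftrightarrow> r = 1"
    if t: "nilpotent_type v \<Psi> r (\<Phi>, U) \<or> (\<exists>I. cyclic_type v \<Psi> r I (\<Phi>, U))"
    for \<Psi> :: "('f, 'l mod_ring alg_closure, 'w) weil_rep" and r
    using t
  proof
    assume "nilpotent_type v \<Psi> r (\<Phi>, U)"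
    then show ?thesis unfolding nilpotent_type_iff
      using deligne_irreducible_iff_length[OF d simple_pair_zero] by blast
  next
    assume "\<exists>I. cyclic_type v \<Psi> r I (\<Phi>, U)"
    then show ?thesis unfolding cyclic_type_iff
      using deligne_irreducible_iff_length[OF d simple_pair_cycle] by blast
  qed
  show ?thesis unfolding D
  proof (intro conjI allI impI)
    show "\<exists>(\<Psi> :: ('f, 'l mod_ring alg_closure, 'v) weil_rep) r.
        nilpotent_type v \<Psi> r (\<Phi>, U) \<or> (\<exists>I. cyclic_type v \<Psi> r I (\<Phi>, U))" by (rule type_exists[OF ind ss])
  next
    fix \<Psi> :: "('f, 'l mod_ring alg_closure, 'w) weil_rep" and r :: nat
      and \<Psi>' :: "('f, 'l mod_ring alg_closure, 'u) weil_rep" and r' :: nat and I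
    show "\<not> (nilpotent_type v \<Psi> r (\<Phi>, U) \<and> cyclic_type v \<Psi>' r' I (\<Phi>, U))" using not_both_types[OF ind] by blast
  next
    fix \<Psi> :: "('f, 'l mod_ring alg_closure, 'w) weil_rep" and r :: nat
    assume "nilpotent_type v \<Psi> r (\<Phi>, U) \<or> (\<exists>I. cyclic_type v \<Psi> r I (\<Phi>, U))"
    then show "deligne_irreducible v (\<Phi>, U) \<longleftrightarrow> r = 1" by (rule irr)
  next
    fix \<Psi> :: "('f, 'l mod_ring alg_closure, 'w) weil_rep" and r :: nat
    assume n: "nilpotent_type v \<Psi> r (\<Phi>, U)"
    show "(iso_class v (\<Phi>, U) :: ('f, 'l mod_ring alg_closure, 'u) deligne set) = equiv_class v (\<Phi>, U)"
      by (rule iso_class_eq_equiv_class[OF ind ss n])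
    fix \<Psi>' :: "('f, 'l mod_ring alg_closure, 'u) weil_rep" and r' :: nat
    assume n': "nilpotent_type v \<Psi>' r' (\<Phi>, U)"
    show "rep_iso v \<Psi> \<Psi>'" and "r = r'" using nilpotent_type_unique[OF ind n n'] by blast+
  next
    fix \<Psi> :: "('f, 'l mod_ring alg_closure, 'w) weil_rep" and r :: nat and I
    assume c: "cyclic_type v \<Psi> r I (\<Phi>, U)"
    fix \<Psi>' :: "('f, 'l mod_ring alg_closure, 'w) weil_rep" and r' :: nat and I'
    assume h: "irreducible_rep v \<Psi>' \<and> 1 \<le> r' \<and> I' \<in> rep_isos v (twist v (int (orbit_card v \<Psi>')) \<Psi>') \<Psi>'"
    show "(equiv_class v (deligne_tensor (segment v r') (cycle v \<Psi>' I')) ::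
        ('f, 'l mod_ring alg_closure, 'v) deligne set) = equiv_class v (\<Phi>, U) \<longleftrightarrow>
        (r', nu_orbit v \<Psi>') = (r, nu_orbit v \<Psi>)"
      by (rule cyclic_type_equiv_class[OF ind ss c]) (use h in simp_all)
  qed
qed

end
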